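(* Suppose that $\alpha\in\mathbb{R}$ is such that $$\lim_{t\uparrow T} I_{X^{(\alpha)}}(t)=\infty$$ and $$\lim_{t\uparrow T}\frac{b(t)}{\sigma(t)^2}\exp\left\{2\alpha\int_0^t b(w)\,\mathrm{d}w\right\}=C\in\mathbb{R}\setminus\{0\}.$$ Then $$\sqrt{I_{X^{(\alpha)}}(t)}\,\Big(\widehat{\alpha}_t^{(X^{(\alpha)})}-\alpha\Big)\ \longrightarrow\ \frac{\operatorname{sign}(C)}{\sqrt{2}}\,\frac{\int_0^1 W_s\,\mathrm{d}W_s}{\int_0^1 (W_s)^2\,\mathrm{d}s}\qquad\text{in distribution as } t\uparrow T,$$ where $\operatorname{sign}$ denotes the signum function and $(W_s)_{s\in[0,1]}$ is a standard Wiener process.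
   Context: Let $T\in(0,\infty]$ be fixed. Let $b:[0,T)\to\mathbb{R}$ and $\sigma:[0,T)\to\mathbb{R}$ be continuous functions such that $\sigma(t)>0$ for all $t\in[0,T)$, and there exists $t_0\in(0,T)$ with $b(t)\neq0$ for all $t\in[t_0,T)$. Let $(B_t)_{t\in[0,T)}$ be a standard Wiener process on a filtered probability space $(\Omega,\mathcal{F},(\mathcal{F}_t)_{t\in[0,T)},\mathsf{P})$ constructed with the help of $B$, satisfying the usual conditions, with $\mathcal{F}=\sigma\big(\bigcup_{t\in[0,T)}\mathcal{F}_t\big)$. For $\alpha\in\mathbb{R}$, let $(X_t^{(\alpha)})_{t\in[0,T)}$ be the unique strong solution of $$\mathrm{d}X_t^{(\alpha)}=\alpha b(t)X_t^{(\alpha)}\,\mathrm{d}t+\sigma(t)\,\mathrm{d}B_t,\quad t\in[0,T),\qquad X_0^{(\alpha)}=0,$$ that is, $X_t^{(\alpha)}=\int_0^t\sigma(s)\exp\{\alpha\int_s^t b(u)\,\mathrm{d}u\}\,\mathrm{d}B_s$. The maximum likelihood estimator (MLE) $\widehat{\alpha}_t^{(X^{(\alpha)})}$ of $\alpha$ based on $(X_s^{(\alpha)})_{s\in[0,t]}$ is the maximizer over $\theta\in\mathbb{R}$ of the log-likelihood $\theta\int_0^t\frac{b(s)X_s^{(\alpha)}}{\sigma(s)^2}\,\mathrm{d}X_s^{(\alpha)}-\frac{\theta^2}{2}\int_0^t\frac{b(s)^2(X_s^{(\alpha)})^2}{\sigma(s)^2}\,\mathrm{d}s$; for $t\in[t_0,T)$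 it exists $\mathsf{P}$-almost surely, is unique, and is given by $$\widehat{\alpha}_t^{(X^{(\alpha)})}=\frac{\int_0^t\frac{b(s)X_s^{(\alpha)}}{\sigma(s)^2}\,\mathrm{d}X_s^{(\alpha)}}{\int_0^t\frac{b(s)^2(X_s^{(\alpha)})^2}{\sigma(s)^2}\,\mathrm{d}s},\quad\text{so that}\quad \widehat{\alpha}_t^{(X^{(\alpha)})}-\alpha=\frac{\int_0^t\frac{b(s)X_s^{(\alpha)}}{\sigma(s)}\,\mathrm{d}B_s}{\int_0^t\frac{b(s)^2(X_s^{(\alpha)})^2}{\sigma(s)^2}\,\mathrm{d}s}.$$ The Fisher information for $\alpha$ contained in $(X_s^{(\alpha)})_{s\in[0,t]}$ is $$I_{X^{(\alpha)}}(t)=\int_0^t\frac{b(s)^2\,\mathsf{E}(X_s^{(\alpha)})^2}{\sigma(s)^2}\,\mathrm{d}s,\qquad \mathsf{E}(X_s^{(\alpha)})^2=\int_0^s\sigma(u)^2\exp\Big\{2\alpha\int_u^s b(v)\,\mathrm{d}v\Big\}\,\mathrm{d}u .$$ *)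

theory Defs
  imports "HOL-Probability.Probability"
begin

text \<open>Real time approaching a possibly infinite horizon from below.\<close>

definition time_interval :: "ereal \<Rightarrow> real set" where
  "time_interval T = {t. 0 \<le> t \<and> ereal t < T}"

definition up_to :: "ereal \<Rightarrow> real filter" where
  "up_to T = filtercomap ereal (at_left T)"

lemma up_to_ereal: "up_to (ereal r) = at_left r"
  unfolding up_to_def at_left_ereal
  by (auto simp: filter_eq_iff eventually_filtercomap eventually_filtermap elim: eventually_mono
      intro!: exI[of _ "\<lambda>x. _ (real_of_ereal x)"])

lemma up_to_PInf: "up_to \<infinity> = at_top"
  unfolding up_to_def at_left_PInf
  by (auto simp: filter_eq_iff eventually_filtercomap eventually_filtermap elim: eventually_mono
      intro!: exI[of _ "\<lambda>x. _ (real_of_ereal x)"])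

text \<open>
  Convergence of random variables.  Measurability is part of both notions, because
  \<^const>\<open>measure\<close> and \<^const>\<open>distr\<close> give meaningless values on non-measurable arguments.
  Convergence in distribution along an arbitrary filter generalises \<^const>\<open>weak_conv_m\<close>,
  which is restricted to sequences.
\<close>

definition tendsto_in_prob ::
    "'a measure \<Rightarrow> ('i \<Rightarrow> 'a \<Rightarrow> real) \<Rightarrow> ('a \<Rightarrow> real) \<Rightarrow> 'i filter \<Rightarrow> bool" where
  "tendsto_in_prob M Y Z G \<longleftrightarrow>
     (\<forall>\<^sub>F i in G. Y i \<in> borel_measurable M) \<and> Z \<in> borel_measurable M \<and>
     (\<forall>\<epsilon>>0. ((\<lambda>i. measure M {\<omega> \<in> space M. \<bar>Y i \<omega> - Z \<omega>\<bar> > \<epsilon>}) \<longlongrightarrow> 0) G)"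

definition weak_conv_filter :: "('i \<Rightarrow> real measure) \<Rightarrow> real measure \<Rightarrow> 'i filter \<Rightarrow> bool" where
  "weak_conv_filter \<mu> \<nu> G \<longleftrightarrow>
     (\<forall>x. isCont (cdf \<nu>) x \<longrightarrow> ((\<lambda>i. cdf (\<mu> i) x) \<longlongrightarrow> cdf \<nu> x) G)"

lemma weak_conv_filter_sequentially: "weak_conv_filter \<mu> \<nu> sequentially \<longleftrightarrow> weak_conv_m \<mu> \<nu>"
  by (simp add: weak_conv_filter_def weak_conv_m_def weak_conv_def)

definition tendsto_in_distr ::
    "'a measure \<Rightarrow> ('i \<Rightarrow> 'a \<Rightarrow> real) \<Rightarrow> 'b measure \<Rightarrow> ('b \<Rightarrow> real) \<Rightarrow> 'i filter \<Rightarrow> bool" where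
  "tendsto_in_distr M Y N Z G \<longleftrightarrow>
     (\<forall>\<^sub>F i in G. Y i \<in> borel_measurable M) \<and> Z \<in> borel_measurable N \<and>
     weak_conv_filter (\<lambda>i. distr M borel (Y i)) (distr N borel Z) G"

definition wiener_process :: "'a measure \<Rightarrow> real set \<Rightarrow> (real \<Rightarrow> 'a \<Rightarrow> real) \<Rightarrow> bool" where
  "wiener_process M I B \<longleftrightarrow>
     prob_space M \<and>
     (\<forall>t\<in>I. B t \<in> borel_measurable M) \<and>
     (AE \<omega> in M. B 0 \<omega> = 0) \<and>
     (\<forall>\<omega>\<in>space M. continuous_on I (\<lambda>t. B t \<omega>)) \<and>
     (\<forall>s\<in>I. \<forall>t\<in>I. s < t \<longrightarrow>
        distributed M lborel (\<lambda>\<omega>. B t \<omega> - B s \<omega>) (normal_density 0 (sqrt (t - s)))) \<and>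
     (\<forall>(n::nat) \<tau>. (\<forall>i\<le>n. \<tau> i \<in> I) \<and> (\<forall>i<n. \<tau> i < \<tau> (Suc i)) \<longrightarrow>
        prob_space.indep_vars M (\<lambda>_. borel) (\<lambda>i \<omega>. B (\<tau> (Suc i)) \<omega> - B (\<tau> i) \<omega>) {..<n})"

text \<open>
  Sigma-algebras are represented by measures of which only the measurable sets matter.
  The augmented filtration is formally indexed by all reals, but only the times in \<open>I\<close> are used.
\<close>

definition augmented_filtration ::
    "'a measure \<Rightarrow> real set \<Rightarrow> (real \<Rightarrow> 'a \<Rightarrow> real) \<Rightarrow> real \<Rightarrow> 'a measure" where
  "augmented_filtration M I B t =
     sigma (space M)
       ({B u -` A \<inter> space M |u A. u \<in> I \<and> u \<le> t \<and> A \<in> sets borel} \<union> null_sets M)"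

definition usual_conditions :: "'a measure \<Rightarrow> real set \<Rightarrow> (real \<Rightarrow> 'a measure) \<Rightarrow> bool" where
  "usual_conditions M I F \<longleftrightarrow>
     complete_measure M \<and>
     (\<forall>t\<in>I. null_sets M \<subseteq> sets (F t)) \<and>
     (\<forall>t\<in>I. sets (F t) = (\<Inter>s\<in>{s \<in> I. t < s}. sets (F s)))"

definition wiener_filtered_space ::
    "'a measure \<Rightarrow> real set \<Rightarrow> (real \<Rightarrow> 'a measure) \<Rightarrow> (real \<Rightarrow> 'a \<Rightarrow> real) \<Rightarrow> bool" where
  "wiener_filtered_space M I F B \<longleftrightarrow>
     wiener_process M I B \<and>
     F = augmented_filtration M I B \<and>
     usual_conditions M I F \<and>
     sets M = sigma_sets (space M) (\<Union>t\<in>I. sets (F t))"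

definition progressive :: "(real \<Rightarrow> 'a measure) \<Rightarrow> real \<Rightarrow> (real \<Rightarrow> 'a \<Rightarrow> real) \<Rightarrow> bool" where
  "progressive F t H \<longleftrightarrow>
     (\<forall>s\<in>{0..t}. (\<lambda>(u, \<omega>). H u \<omega>) \<in> borel_measurable (restrict_space borel {0..s} \<Otimes>\<^sub>M F s))"

text \<open>
  The triple \<open>(n, \<tau>, \<xi>)\<close> encodes the simple process
  \<open>\<Sum>i<n. \<xi> i * indicator {\<tau> i<..\<tau> (Suc i)}\<close> on \<open>[0, t]\<close>.
\<close>

definition is_simple ::
    "(real \<Rightarrow> 'a measure) \<Rightarrow> real \<Rightarrow> nat \<Rightarrow> (nat \<Rightarrow> real) \<Rightarrow> (nat \<Rightarrow> 'a \<Rightarrow> real) \<Rightarrow> bool" where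
  "is_simple F t n \<tau> \<xi> \<longleftrightarrow>
     \<tau> 0 = 0 \<and> \<tau> n = t \<and> (\<forall>i<n. \<tau> i \<le> \<tau> (Suc i)) \<and>
     (\<forall>i<n. \<xi> i \<in> borel_measurable (F (\<tau> i)) \<and> (\<exists>K. \<forall>\<omega>\<in>space (F (\<tau> i)). \<bar>\<xi> i \<omega>\<bar> \<le> K))"

definition simple_process ::
    "nat \<Rightarrow> (nat \<Rightarrow> real) \<Rightarrow> (nat \<Rightarrow> 'a \<Rightarrow> real) \<Rightarrow> real \<Rightarrow> 'a \<Rightarrow> real" where
  "simple_process n \<tau> \<xi> s \<omega> = (\<Sum>i<n. \<xi> i \<omega> * indicator {\<tau> i<..\<tau> (Suc i)} s)"

definition simple_integral ::
    "(real \<Rightarrow> 'a \<Rightarrow> real) \<Rightarrow> nat \<Rightarrow> (nat \<Rightarrow> real) \<Rightarrow> (nat \<Rightarrow> 'a \<Rightarrow> real) \<Rightarrow> 'a \<Rightarrow> real" where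
  "simple_integral B n \<tau> \<xi> \<omega> = (\<Sum>i<n. \<xi> i \<omega> * (B (\<tau> (Suc i)) \<omega> - B (\<tau> i) \<omega>))"

text \<open>
  \<open>has_ito_integral M F B H t Y\<close> says that the random variable \<open>Y\<close> is a version of the Ito
  integral of \<open>H\<close> with respect to the Wiener process \<open>B\<close> over \<open>[0, t]\<close>, for progressively
  measurable \<open>H\<close> with almost surely square integrable paths: the limit in probability of the
  integrals of simple processes that approximate \<open>H\<close> in \<open>L\<^sup>2[0, t]\<close>, in probability.
  The Ito integral is only determined almost surely, hence a relation.
\<close>

definition has_ito_integral ::
    "'a measure \<Rightarrow> (real \<Rightarrow> 'a measure) \<Rightarrow> (real \<Rightarrow> 'a \<Rightarrow> real) \<Rightarrow>
     (real \<Rightarrow> 'a \<Rightarrow> real) \<Rightarrow> real \<Rightarrow> ('a \<Rightarrow> real) \<Rightarrow> bool" where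
  "has_ito_integral M F B H t Y \<longleftrightarrow>
     progressive F t H \<and>
     (AE \<omega> in M. set_integrable lborel {0..t} (\<lambda>s. (H s \<omega>)\<^sup>2)) \<and>
     (\<exists>(n :: nat \<Rightarrow> nat) \<tau> \<xi>.
        (\<forall>k. is_simple F t (n k) (\<tau> k) (\<xi> k)) \<and>
        tendsto_in_prob M
          (\<lambda>k \<omega>. LBINT s:{0..t}. (simple_process (n k) (\<tau> k) (\<xi> k) s \<omega> - H s \<omega>)\<^sup>2)
          (\<lambda>_. 0) sequentially \<and>
        tendsto_in_prob M (\<lambda>k. simple_integral B (n k) (\<tau> k) (\<xi> k)) Y sequentially)"

text \<open>\<open>ito_process M F B I \<mu> \<nu> X\<close> renders \<open>dX = \<mu> dt + \<nu> dB\<close> on \<open>I\<close>.\<close>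

definition ito_process ::
    "'a measure \<Rightarrow> (real \<Rightarrow> 'a measure) \<Rightarrow> (real \<Rightarrow> 'a \<Rightarrow> real) \<Rightarrow> real set \<Rightarrow>
     (real \<Rightarrow> 'a \<Rightarrow> real) \<Rightarrow> (real \<Rightarrow> 'a \<Rightarrow> real) \<Rightarrow> (real \<Rightarrow> 'a \<Rightarrow> real) \<Rightarrow> bool" where
  "ito_process M F B I \<mu> \<nu> X \<longleftrightarrow>
     (\<forall>t\<in>I. X t \<in> borel_measurable (F t)) \<and>
     (\<forall>\<omega>\<in>space M. continuous_on I (\<lambda>t. X t \<omega>)) \<and>
     (\<forall>t\<in>I. progressive F t \<mu> \<and>
        (AE \<omega> in M. set_integrable lborel {0..t} (\<lambda>s. \<mu> s \<omega>)) \<and>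
        has_ito_integral M F B \<nu> t (\<lambda>\<omega>. X t \<omega> - X 0 \<omega> - (LBINT s:{0..t}. \<mu> s \<omega>)))"

text \<open>
  \<open>Y\<close> is a version of the integral of \<open>H\<close> over \<open>[0, t]\<close> with respect to the Ito process \<open>X\<close>
  with \<open>dX = \<mu> dt + \<nu> dB\<close>, that is, of the integral of \<open>H \<mu> dt + H \<nu> dB\<close>.
\<close>

definition has_ito_process_integral ::
    "'a measure \<Rightarrow> (real \<Rightarrow> 'a measure) \<Rightarrow> (real \<Rightarrow> 'a \<Rightarrow> real) \<Rightarrow>
     (real \<Rightarrow> 'a \<Rightarrow> real) \<Rightarrow> (real \<Rightarrow> 'a \<Rightarrow> real) \<Rightarrow> (real \<Rightarrow> 'a \<Rightarrow> real) \<Rightarrow>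
     (real \<Rightarrow> 'a \<Rightarrow> real) \<Rightarrow> real \<Rightarrow> ('a \<Rightarrow> real) \<Rightarrow> bool" where
  "has_ito_process_integral M F B \<mu> \<nu> X H t Y \<longleftrightarrow>
     ito_process M F B {0..t} \<mu> \<nu> X \<and>
     (AE \<omega> in M. set_integrable lborel {0..t} (\<lambda>s. H s \<omega> * \<mu> s \<omega>)) \<and>
     has_ito_integral M F B (\<lambda>s \<omega>. H s \<omega> * \<nu> s \<omega>) t
       (\<lambda>\<omega>. Y \<omega> - (LBINT s:{0..t}. H s \<omega> * \<mu> s \<omega>))"

text \<open>
  Solutions are adapted to \<open>F\<close>, so they are strong solutions when \<open>F\<close> is the augmented filtration
  of the driving Wiener process \<open>B\<close>.
\<close>

definition sde_solution ::
    "'a measure \<Rightarrow> (real \<Rightarrow> 'a measure) \<Rightarrow> (real \<Rightarrow> 'a \<Rightarrow> real) \<Rightarrow> real set \<Rightarrow>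
     (real \<Rightarrow> real \<Rightarrow> real) \<Rightarrow> (real \<Rightarrow> real \<Rightarrow> real) \<Rightarrow> real \<Rightarrow> (real \<Rightarrow> 'a \<Rightarrow> real) \<Rightarrow> bool" where
  "sde_solution M F B I drift diffusion x0 X \<longleftrightarrow>
     (AE \<omega> in M. X 0 \<omega> = x0) \<and>
     ito_process M F B I (\<lambda>t \<omega>. drift t (X t \<omega>)) (\<lambda>t \<omega>. diffusion t (X t \<omega>)) X"

text \<open>
  Log-likelihood of the drift parameter in \<open>dX = \<theta> b X dt + \<sigma> dB\<close>; \<open>S t\<close> is a version of the
  stochastic integral of \<open>b X / \<sigma>\<^sup>2\<close> with respect to \<open>X\<close> over \<open>[0, t]\<close>.
\<close>

definition log_likelihood ::
    "(real \<Rightarrow> real) \<Rightarrow> (real \<Rightarrow> real) \<Rightarrow> (real \<Rightarrow> 'a \<Rightarrow> real) \<Rightarrow> (real \<Rightarrow> 'a \<Rightarrow> real) \<Rightarrow>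
     real \<Rightarrow> 'a \<Rightarrow> real \<Rightarrow> real" where
  "log_likelihood b \<sigma> X S t \<omega> \<theta> =
     \<theta> * S t \<omega> - \<theta>\<^sup>2 / 2 * (LBINT s:{0..t}. (b s)\<^sup>2 * (X s \<omega>)\<^sup>2 / (\<sigma> s)\<^sup>2)"

definition is_mle ::
    "'a measure \<Rightarrow> (real \<Rightarrow> real) \<Rightarrow> (real \<Rightarrow> real) \<Rightarrow> (real \<Rightarrow> 'a \<Rightarrow> real) \<Rightarrow>
     (real \<Rightarrow> 'a \<Rightarrow> real) \<Rightarrow> real \<Rightarrow> ('a \<Rightarrow> real) \<Rightarrow> bool" where
  "is_mle M b \<sigma> X S t \<alpha>hat \<longleftrightarrow>
     (AE \<omega> in M. is_arg_max (log_likelihood b \<sigma> X S t \<omega>) (\<lambda>_. True) (\<alpha>hat \<omega>))"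

definition fisher_information ::
    "'a measure \<Rightarrow> (real \<Rightarrow> real) \<Rightarrow> (real \<Rightarrow> real) \<Rightarrow> (real \<Rightarrow> 'a \<Rightarrow> real) \<Rightarrow> real \<Rightarrow> real" where
  "fisher_information M b \<sigma> X t =
     (LBINT s:{0..t}. (b s)\<^sup>2 * (\<integral>\<omega>. (X s \<omega>)\<^sup>2 \<partial>M) / (\<sigma> s)\<^sup>2)"

end

theory Submission
  imports Defs
begin

text \<open>
  Write \<open>\<beta>(t) = \<integral>\<^sub>0\<^sup>t b\<close> and \<open>e = exp (- \<alpha> \<beta>)\<close>. The integrating factor turns the solution into a Wiener
  integral: \<open>Z = e X\<close> satisfies \<open>dZ = g dB\<close> with the deterministic function \<open>g = \<sigma> e\<close>
  (\<open>ornstein_uhlenbeck_wiener_integral\<close>). It is a Gaussian martingale with variance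
  \<open>v(t) = \<integral>\<^sub>0\<^sup>t g\<^sup>2\<close>. With \<open>c = b exp (2 \<alpha> \<beta>) / \<sigma>\<^sup>2\<close>, the function that converges to \<open>C\<close>, the score
  \<open>N\<close>, the observed information \<open>A\<close> and the Fisher information \<open>\<I>\<close> become
  \<open>N(t) = \<integral> c Z dZ\<close>, \<open>A(t) = \<integral> c\<^sup>2 Z\<^sup>2 dv\<close> and \<open>\<I>(t) = \<integral> c\<^sup>2 v dv\<close>, and the estimation error is \<open>N / A\<close>.

  As \<open>c\<close> is bounded, \<open>\<I> \<le> K v\<^sup>2\<close>, so \<open>v\<close> tends to infinity with \<open>\<I>\<close>. Averages with respect to
  \<open>v dv\<close> then only see the limit of \<open>c\<close> (\<open>weighted_average_tendsto\<close>). Hence \<open>\<I> \<sim> C\<^sup>2 v\<^sup>2 / 2\<close>, and up to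
  errors that are small in probability compared with \<open>v\<close> and \<open>v\<^sup>2\<close> respectively, \<open>c\<close> may be replaced by \<open>C\<close>
  in \<open>N\<close> and \<open>A\<close> (\<open>numerator_tail\<close>, \<open>denominator_tail\<close>). By Ito's formula \<open>\<integral> Z dZ = (Z\<^sup>2 - v) / 2\<close>
  (\<open>ito_square\<close>).

  For fixed \<open>t\<close>, running \<open>Z / sqrt (v(t))\<close> along the inverse of the clock \<open>v / v(t)\<close> gives a Wiener process
  on the unit interval (\<open>time_changed_wiener_integral\<close>). So the pair
  \<open>(Z(t)\<^sup>2 / v(t), \<integral> Z\<^sup>2 dv / v(t)\<^sup>2)\<close> enters only through functionals whose law is, for every \<open>t\<close>, that of the same
  functional of \<open>(W(1)\<^sup>2, \<integral>\<^sub>0\<^sup>1 W\<^sup>2)\<close> (\<open>quadratic_functional_law\<close>), and \<open>\<integral> W dW = (W(1)\<^sup>2 - 1) / 2\<close>.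
  Quotients are avoided: since \<open>A\<close> is positive, \<open>sqrt \<I> N / A \<le> x\<close> holds iff
  \<open>sqrt \<I> N - x A \<le> 0\<close>, and convergence of the probability of the latter event only involves linear combinations
  (\<open>normalized_score_tendsto\<close>, \<open>wiener_ratio_level\<close>).

  The stochastic integrals enter through one inequality. A simple integrand can be stopped before
  its energy exceeds a given level, and the stopped integral has a small second moment
  (\<open>stopped_simple_integral\<close>). This makes the closure of the simple integrals in probability a
  well-behaved relation \<open>ito_lim\<close>: it is linear, single-valued, closed under limits, and satisfies a tail
  bound and a second moment bound.
\<close>

section \<open>Independence of Brownian increments from the augmented past\<close>

lemma (in prob_space) indep_set_mono:
  "indep_set A B \<Longrightarrow> A' \<subseteq> A \<Longrightarrow> B' \<subseteq> B \<Longrightarrow> indep_set A' B'"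
  unfolding indep_sets2_eq by blast

lemma (in prob_space) prob_le_union:
  assumes "A \<subseteq> A1 \<union> A2" "A1 \<in> sets M" "A2 \<in> sets M"
  shows "prob A \<le> prob A1 + prob A2"
  using finite_measure_mono[OF assms(1)] measure_Un_le[OF assms(2,3)] assms(2,3)
  by fastforce

lemma (in prob_space) prob_le_union3:
  assumes "A \<subseteq> A1 \<union> A2 \<union> A3" "A1 \<in> sets M" "A2 \<in> sets M" "A3 \<in> sets M"
  shows "prob A \<le> prob A1 + prob A2 + prob A3"
  using prob_le_union[OF assms(1)] prob_le_union[of "A1 \<union> A2" A1 A2] assms(2-4) by fastforce

text \<open>
  The index set is any interval that starts at 0. One locale thus covers the driving process on
  the half-open, possibly infinite, horizon and the Wiener process on the unit interval in the limit.
\<close>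

locale brownian = prob_space M for M :: "'a measure" +
  fixes I :: "real set" and B :: "real \<Rightarrow> 'a \<Rightarrow> real"
  assumes wiener: "wiener_process M I B"
    and zero_in: "0 \<in> I"
    and nonneg: "\<And>t. t \<in> I \<Longrightarrow> 0 \<le> t"
    and down_closed: "\<And>s t. t \<in> I \<Longrightarrow> 0 \<le> s \<Longrightarrow> s \<le> t \<Longrightarrow> s \<in> I"
begin

abbreviation F :: "real \<Rightarrow> 'a measure" where
  "F \<equiv> augmented_filtration M I B"

lemma B_measurable [measurable]: "t \<in> I \<Longrightarrow> B t \<in> borel_measurable M"
  using wiener by (simp add: wiener_process_def)

lemma increment_measurable [measurable]:
  "s \<in> I \<Longrightarrow> t \<in> I \<Longrightarrow> (\<lambda>\<omega>. B t \<omega> - B s \<omega>) \<in> borel_measurable M"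
  by measurable

lemma B_0: "AE \<omega> in M. B 0 \<omega> = 0"
  using wiener by (simp add: wiener_process_def)

lemma B_continuous: "\<omega> \<in> space M \<Longrightarrow> continuous_on I (\<lambda>t. B t \<omega>)"
  using wiener by (simp add: wiener_process_def)

lemma increment_normal:
  "s \<in> I \<Longrightarrow> t \<in> I \<Longrightarrow> s < t \<Longrightarrow>
     distributed M lborel (\<lambda>\<omega>. B t \<omega> - B s \<omega>) (normal_density 0 (sqrt (t - s)))"
  using wiener by (simp add: wiener_process_def)

lemma increments_indep:
  "(\<And>i. i \<le> n \<Longrightarrow> \<tau> i \<in> I) \<Longrightarrow> (\<And>i. i < n \<Longrightarrow> \<tau> i < \<tau> (Suc i)) \<Longrightarrow>
     indep_vars (\<lambda>_. borel) (\<lambda>i \<omega>. B (\<tau> (Suc i)) \<omega> - B (\<tau> i) \<omega>) {..<n}"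
  using wiener by (simp add: wiener_process_def)

lemma F_generator_subset:
  "{B u -` A \<inter> space M |u A. u \<in> I \<and> u \<le> t \<and> A \<in> sets borel} \<union> null_sets M \<subseteq> sets M"
  by (auto intro!: measurable_sets B_measurable)

lemma F_generator_Pow:
  "{B u -` A \<inter> space M |u A. u \<in> I \<and> u \<le> t \<and> A \<in> sets borel} \<union> null_sets M \<subseteq> Pow (space M)"
  using F_generator_subset sets.sets_into_space by blast

lemma space_F [simp]: "space (F t) = space M"
  unfolding augmented_filtration_def using F_generator_Pow by (intro space_measure_of) blast

lemma sets_F: "sets (F t) = sigma_sets (space M)
    ({B u -` A \<inter> space M |u A. u \<in> I \<and> u \<le> t \<and> A \<in> sets borel} \<union> null_sets M)"
  unfolding augmented_filtration_def using F_generator_Pow by (intro sets_measure_of) blast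

lemma sets_F_subset: "sets (F t) \<subseteq> sets M"
  unfolding sets_F using F_generator_subset by (intro sets.sigma_sets_subset) blast

lemma subalgebra_F: "subalgebra M (F t)"
  by (simp add: subalgebra_def sets_F_subset)

lemma sets_F_mono: "s \<le> t \<Longrightarrow> sets (F s) \<subseteq> sets (F t)"
  unfolding sets_F by (intro sigma_sets_mono') (auto intro: order_trans)

lemma measurable_F_mono: "\<xi> \<in> borel_measurable (F s) \<Longrightarrow> s \<le> t \<Longrightarrow> \<xi> \<in> borel_measurable (F t)"
  using sets_F_mono[of s t] by (auto simp: measurable_def)

lemma measurable_F_M: "\<xi> \<in> borel_measurable (F s) \<Longrightarrow> \<xi> \<in> borel_measurable M"
  using measurable_from_subalg[OF subalgebra_F] by blast

lemma B_measurable_F: "u \<in> I \<Longrightarrow> u \<le> t \<Longrightarrow> B u \<in> borel_measurable (F t)"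
proof (rule measurableI)
  fix A :: "real set" assume "u \<in> I" "u \<le> t" "A \<in> sets borel"
  then show "B u -` A \<inter> space (F t) \<in> sets (F t)"
    by (subst sets_F, intro sigma_sets.Basic) auto
qed simp

text \<open>
  The generators of the augmented sigma-algebra are not closed under intersection, and a null set
  need not depend on finitely many times. The events that agree almost surely with a finite
  cylinder form a \<open>\<pi>\<close>-system that contains both kinds of generators.
\<close>

definition past_cylinders :: "real \<Rightarrow> 'a set set" where
  "past_cylinders s = {A \<in> sets M. \<exists>U E. finite U \<and> U \<subseteq> I \<inter> {..s} \<and> (\<forall>u\<in>U. E u \<in> sets borel) \<and>
      (AE \<omega> in M. \<omega> \<in> A \<longleftrightarrow> (\<forall>u\<in>U. B u \<omega> \<in> E u))}"

lemma Int_stable_past_cylinders: "Int_stable (past_cylinders s)"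
proof (rule Int_stableI)
  fix A A' assume "A \<in> past_cylinders s" "A' \<in> past_cylinders s"
  then obtain U E U' E' where U: "finite U" "U \<subseteq> I \<inter> {..s}" "\<forall>u\<in>U. E u \<in> sets borel"
      "AE \<omega> in M. \<omega> \<in> A \<longleftrightarrow> (\<forall>u\<in>U. B u \<omega> \<in> E u)"
    and U': "finite U'" "U' \<subseteq> I \<inter> {..s}" "\<forall>u\<in>U'. E' u \<in> sets borel"
      "AE \<omega> in M. \<omega> \<in> A' \<longleftrightarrow> (\<forall>u\<in>U'. B u \<omega> \<in> E' u)"
    and A: "A \<in> sets M" "A' \<in> sets M"
    unfolding past_cylinders_def by blast
  define E'' where "E'' u = (if u \<in> U then E u else UNIV) \<inter> (if u \<in> U' then E' u else UNIV)" for u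
  have "AE \<omega> in M. \<omega> \<in> A \<inter> A' \<longleftrightarrow> (\<forall>u\<in>U \<union> U'. B u \<omega> \<in> E'' u)"
    using U(4) U'(4) by eventually_elim (auto simp: E''_def split: if_splits)
  moreover have "\<forall>u\<in>U \<union> U'. E'' u \<in> sets borel"
    using U(3) U'(3) by (auto simp: E''_def)
  ultimately show "A \<inter> A' \<in> past_cylinders s"
    unfolding past_cylinders_def using U(1,2) U'(1,2) A
    by (auto intro!: exI[of _ "U \<union> U'"] exI[of _ E''])
qed

lemma F_subset_past_cylinders:
  assumes "s \<in> I"
  shows "sets (F s) \<subseteq> sigma_sets (space M) (past_cylinders s)"
  unfolding sets_F
proof (rule sigma_sets_mono', rule subsetI)
  fix A assume "A \<in> {B u -` A \<inter> space M |u A. u \<in> I \<and> u \<le> s \<and> A \<in> sets borel} \<union> null_sets M"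
  then consider u E where "u \<in> I" "u \<le> s" "E \<in> sets borel" "A = B u -` E \<inter> space M"
    | "A \<in> null_sets M" by blast
  then show "A \<in> past_cylinders s"
  proof cases
    case 1
    have "A \<in> sets M"
      unfolding 1 by (rule measurable_sets[OF B_measurable]) (use 1 in auto)
    moreover have "AE \<omega> in M. \<omega> \<in> A \<longleftrightarrow> (\<forall>u\<in>{u}. B u \<omega> \<in> E)"
      by (rule AE_I2) (simp add: 1)
    ultimately show ?thesis
      unfolding past_cylinders_def using 1
      by (auto intro!: exI[of _ "{u}"] exI[of _ "\<lambda>_. E"])
  next
    case 2
    have "AE \<omega> in M. \<omega> \<in> A \<longleftrightarrow> (\<forall>u\<in>{0}. B u \<omega> \<in> {})"
      using AE_not_in[OF 2] by eventually_elim simp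
    then show ?thesis
      unfolding past_cylinders_def using 2 zero_in nonneg[OF assms]
      by (auto intro!: exI[of _ "{0}"] exI[of _ "\<lambda>_. {}"] simp: null_sets_def)
  qed
qed

text \<open>
  Since \<open>B 0 = 0\<close> almost surely, the values of \<open>B\<close> at finitely many times up to \<open>s\<close> are partial sums of
  increments over a partition of \<open>[0, s]\<close>. A cylinder event is therefore an event of these
  increments, which are independent of the increment from \<open>s\<close> to \<open>t\<close>.
\<close>

lemma prob_past_cylinder_increment:
  assumes s: "s \<in> I" and t: "t \<in> I" and st: "s < t"
    and A: "A \<in> past_cylinders s" and E: "E \<in> sets borel"
  shows "prob (A \<inter> ((\<lambda>\<omega>. B t \<omega> - B s \<omega>) -` E \<inter> space M))
       = prob A * prob ((\<lambda>\<omega>. B t \<omega> - B s \<omega>) -` E \<inter> space M)"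
proof -
  from A obtain U G where U: "finite U" "U \<subseteq> I \<inter> {..s}" "\<forall>u\<in>U. G u \<in> sets borel"
      "AE \<omega> in M. \<omega> \<in> A \<longleftrightarrow> (\<forall>u\<in>U. B u \<omega> \<in> G u)" and A': "A \<in> sets M"
    unfolding past_cylinders_def by blast
  define P where "P = sorted_list_of_set (insert 0 (insert s U))"
  have P: "set P = insert 0 (insert s U)" "sorted_wrt (<) P" "P \<noteq> []"
    using U(1) strict_sorted_list_of_set[of "insert 0 (insert s U)"]
    unfolding P_def by (auto simp del: sorted_list_of_set_insert_remove)
  have PI: "u \<in> set P \<Longrightarrow> u \<in> I \<and> 0 \<le> u \<and> u \<le> s" for u
    using U(2) s zero_in nonneg P(1) by auto
  define m where "m = length P - 1"
  have lenP: "length P = Suc m" using P(3) by (simp add: m_def)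
  define \<tau> where "\<tau> i = (if i \<le> m then P ! i else t)" for i
  have \<tau>_I: "\<tau> i \<in> I" for i
    using PI t lenP by (auto simp: \<tau>_def)
  have mono: "i < j \<Longrightarrow> j \<le> m \<Longrightarrow> \<tau> i < \<tau> j" for i j
    using P(2) lenP by (auto simp: \<tau>_def sorted_wrt_iff_nth_less)
  have \<tau>_0: "\<tau> 0 = 0"
  proof -
    obtain i where i: "i \<le> m" "P ! i = 0"
      using P(1) lenP by (metis in_set_conv_nth insertI1 less_Suc_eq_le)
    then show ?thesis using mono[of 0 i] PI[of "P ! 0"] lenP by (cases i) (auto simp: \<tau>_def)
  qed
  have \<tau>_m: "\<tau> m = s"
  proof -
    obtain i where i: "i \<le> m" "P ! i = s"
      using P(1) lenP by (metis in_set_conv_nth insertI1 insertCI less_Suc_eq_le)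
    then show ?thesis using mono[of i m] PI[of "P ! m"] lenP
      by (cases "i = m") (auto simp: \<tau>_def)
  qed
  have \<tau>_Suc_m: "\<tau> (Suc m) = t" by (simp add: \<tau>_def)
  have incr: "\<tau> i < \<tau> (Suc i)" if "i < Suc m" for i
    using that mono[of i "Suc i"] \<tau>_m st \<tau>_Suc_m by (cases "i = m") auto
  define D where "D i \<omega> = B (\<tau> (Suc i)) \<omega> - B (\<tau> i) \<omega>" for i \<omega>
  have ind: "indep_vars (\<lambda>_. borel) D {..<Suc m}"
    unfolding D_def using \<tau>_I incr by (intro increments_indep) auto
  have Dm: "D m = (\<lambda>\<omega>. B t \<omega> - B s \<omega>)"
    by (simp add: D_def \<tau>_m \<tau>_Suc_m fun_eq_iff)
  obtain k where k: "\<And>u. u \<in> U \<Longrightarrow> k u \<le> m \<and> \<tau> (k u) = u"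
  proof -
    have "\<exists>i. i \<le> m \<and> \<tau> i = u" if "u \<in> U" for u
    proof -
      have "u \<in> set P" using that P(1) by simp
      then obtain i where "i < length P" "P ! i = u" by (auto simp: in_set_conv_nth)
      then show ?thesis using lenP by (auto simp: \<tau>_def intro!: exI[of _ i])
    qed
    then show ?thesis using that by metis
  qed
  let ?D = "\<lambda>\<omega>. restrict (\<lambda>i. D i \<omega>) {..<m}"
  let ?Q = "PiM {..<m} (\<lambda>_. borel :: real measure)"
  define S where "S = {x \<in> space ?Q. \<forall>u\<in>U. (\<Sum>i<k u. x i) \<in> G u}"
  have sum_meas: "(\<lambda>x. \<Sum>i<k u. x i) \<in> borel_measurable ?Q" if "u \<in> U" for u
    by (rule borel_measurable_sum, rule measurable_component_singleton) (use k[OF that] in auto)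
  have S: "S \<in> sets ?Q"
  proof -
    have "{x \<in> space ?Q. (\<Sum>i<k u. x i) \<in> G u} \<in> sets ?Q" if "u \<in> U" for u
      using measurable_sets[OF sum_meas[OF that], of "G u"] U(3) that
      by (simp add: vimage_def Int_def conj_commute)
    then show ?thesis unfolding S_def using U(1) by (intro sets.sets_Collect_finite_All) auto
  qed
  have D_meas: "D i \<in> borel_measurable M" for i
    unfolding D_def using \<tau>_I by measurable
  have D_vec: "?D \<in> M \<rightarrow>\<^sub>M ?Q"
    using D_meas by (intro measurable_restrict) auto
  let ?R = "PiM {m} (\<lambda>_. borel :: real measure)" and ?Dm = "\<lambda>\<omega>. restrict (\<lambda>i. D i \<omega>) {m}"
  have iv: "indep_var ?Q ?D ?R ?Dm"
    by (rule indep_var_restrict[OF ind]) auto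
  define E' where "E' = (\<lambda>x. x m) -` E \<inter> space ?R"
  have E': "E' \<in> sets ?R"
    unfolding E'_def
    by (rule measurable_sets[OF measurable_component_singleton[of m "{m}" "\<lambda>_. borel"] E]) simp
  have E'_eq: "?Dm -` E' \<inter> space M = D m -` E \<inter> space M"
    by (auto simp: E'_def space_PiM)
  have S_AE: "AE \<omega> in M. \<omega> \<in> A \<longleftrightarrow> \<omega> \<in> ?D -` S \<inter> space M"
    using U(4) B_0 AE_space
  proof eventually_elim
    case (elim \<omega>)
    have "(\<Sum>i<k u. ?D \<omega> i) = B u \<omega>" if "u \<in> U" for u
    proof -
      have "(\<Sum>i<k u. ?D \<omega> i) = (\<Sum>i<k u. D i \<omega>)"
        using k[OF that] by (intro sum.cong) auto
      also have "\<dots> = B (\<tau> (k u)) \<omega> - B (\<tau> 0) \<omega>"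
        unfolding D_def by (rule sum_lessThan_telescope)
      finally show ?thesis using k[OF that] elim(2) \<tau>_0 by simp
    qed
    then show ?case
      using elim(1,3) measurable_space[OF D_vec elim(3)] by (auto simp: S_def)
  qed
  have "prob (A \<inter> (D m -` E \<inter> space M)) = prob ((?D -` S \<inter> space M) \<inter> (D m -` E \<inter> space M))"
  proof (rule measure_eq_AE)
    show "AE \<omega> in M. \<omega> \<in> A \<inter> (D m -` E \<inter> space M) \<longleftrightarrow>
        \<omega> \<in> (?D -` S \<inter> space M) \<inter> (D m -` E \<inter> space M)"
      using S_AE by eventually_elim auto
  qed (use A' S E D_vec D_meas in \<open>auto intro!: measurable_sets\<close>)
  also have "\<dots> = prob ((\<lambda>\<omega>. (?D \<omega>, ?Dm \<omega>)) -` (S \<times> E') \<inter> space M)"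
    unfolding E'_eq[symmetric] by (rule arg_cong[where f = prob]) auto
  also have "\<dots> = prob (?D -` S \<inter> space M) * prob (D m -` E \<inter> space M)"
    unfolding E'_eq[symmetric] by (rule indep_varD[OF iv S E'])
  also have "prob (?D -` S \<inter> space M) = prob A"
    by (rule measure_eq_AE) (use S_AE A' S D_vec in \<open>auto intro!: measurable_sets elim: eventually_mono\<close>)
  finally show ?thesis unfolding Dm .
qed

text \<open>
  \<^const>\<open>prob_space.indep_var\<close> requires two variables with values in the same type. The function
  \<open>p\<close> makes the lemma applicable to complex functions of the increment.
\<close>

lemma increment_indep_var:
  assumes s: "s \<in> I" and t: "t \<in> I" and st: "s \<le> t"
    and \<xi>: "\<xi> \<in> F s \<rightarrow>\<^sub>M N" and p: "p \<in> borel \<rightarrow>\<^sub>M N'"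
  shows "indep_var N \<xi> N' (\<lambda>\<omega>. p (B t \<omega> - B s \<omega>))"
proof -
  let ?D = "{(\<lambda>\<omega>. B t \<omega> - B s \<omega>) -` E \<inter> space M |E. E \<in> sets borel}"
  have "prob (a \<inter> b) = prob a * prob b" if ab: "a \<in> past_cylinders s" "b \<in> ?D" for a b
  proof (cases "s = t")
    case True
    obtain E where "b = (\<lambda>\<omega>. B t \<omega> - B s \<omega>) -` E \<inter> space M" using ab(2) by blast
    with True have "b = {} \<or> b = space M" by (cases "0 \<in> E") auto
    moreover have "a \<subseteq> space M"
      using ab(1) sets.sets_into_space by (auto simp: past_cylinders_def)
    ultimately show ?thesis by (auto simp: prob_space Int_absorb2)
  next
    case False
    then show ?thesis using ab prob_past_cylinder_increment[OF s t] st by auto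
  qed
  then have "indep_set (past_cylinders s) ?D"
    unfolding indep_sets2_eq using s t
    by (auto simp: past_cylinders_def intro!: measurable_sets)
  moreover have "Int_stable ?D"
  proof (rule Int_stableI)
    fix a b assume "a \<in> ?D" "b \<in> ?D"
    then obtain E E' where "E \<in> sets borel" "E' \<in> sets borel"
      "a = (\<lambda>\<omega>. B t \<omega> - B s \<omega>) -` E \<inter> space M" "b = (\<lambda>\<omega>. B t \<omega> - B s \<omega>) -` E' \<inter> space M" by blast
    then show "a \<inter> b \<in> ?D" by (auto intro!: exI[of _ "E \<inter> E'"])
  qed
  ultimately have ind: "indep_set (sigma_sets (space M) (past_cylinders s)) (sigma_sets (space M) ?D)"
    by (intro indep_set_sigma_sets Int_stable_past_cylinders)
  have "sigma_sets (space M) {\<xi> -` A \<inter> space M |A. A \<in> sets N} \<subseteq> sets (F s)"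
    using sets.sigma_sets_subset[of "{\<xi> -` A \<inter> space M |A. A \<in> sets N}" "F s"]
      measurable_sets[OF \<xi>] by (auto simp del: sets.sigma_sets_eq)
  moreover have "sigma_sets (space M) {(\<lambda>\<omega>. p (B t \<omega> - B s \<omega>)) -` A \<inter> space M |A. A \<in> sets N'}
      \<subseteq> sigma_sets (space M) ?D"
  proof (rule sigma_sets_mono', safe)
    fix A assume "A \<in> sets N'"
    then show "\<exists>E. (\<lambda>\<omega>. p (B t \<omega> - B s \<omega>)) -` A \<inter> space M = (\<lambda>\<omega>. B t \<omega> - B s \<omega>) -` E \<inter> space M
        \<and> E \<in> sets borel"
      using measurable_sets[OF p] by (intro exI[of _ "p -` A"]) auto
  qed
  ultimately have "indep_set (sigma_sets (space M) {\<xi> -` A \<inter> space M |A. A \<in> sets N})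
      (sigma_sets (space M) {(\<lambda>\<omega>. p (B t \<omega> - B s \<omega>)) -` A \<inter> space M |A. A \<in> sets N'})"
    using F_subset_past_cylinders[OF s] by (intro indep_set_mono[OF ind]) auto
  moreover have "\<xi> \<in> M \<rightarrow>\<^sub>M N" by (rule measurable_from_subalg[OF subalgebra_F \<xi>])
  moreover have "(\<lambda>\<omega>. p (B t \<omega> - B s \<omega>)) \<in> M \<rightarrow>\<^sub>M N'"
    by (rule measurable_compose[OF increment_measurable[OF s t] p])
  ultimately show ?thesis
    unfolding indep_var_eq by simp
qed


section \<open>Second moments of simple stochastic integrals\<close>

lemma increment_power_integrable:
  assumes "s \<in> I" "t \<in> I" "s \<le> t"
  shows "integrable M (\<lambda>\<omega>. (B t \<omega> - B s \<omega>) ^ k)"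
proof (cases "s = t")
  case False
  then have d: "distributed M lborel (\<lambda>\<omega>. B t \<omega> - B s \<omega>) (normal_density 0 (sqrt (t - s)))"
    using assms increment_normal by simp
  have "integrable lborel (\<lambda>x. normal_density 0 (sqrt (t - s)) x * (x - 0) ^ k)"
    using False assms by (intro integrable_normal_moment) auto
  then show ?thesis
    by (subst distributed_integrable[OF d, of "\<lambda>x. x ^ k", symmetric]) auto
qed auto

lemma increment_moments:
  assumes "s \<in> I" "t \<in> I" "s \<le> t"
  shows "expectation (\<lambda>\<omega>. B t \<omega> - B s \<omega>) = 0"
    and "expectation (\<lambda>\<omega>. (B t \<omega> - B s \<omega>)\<^sup>2) = t - s"
    and "expectation (\<lambda>\<omega>. (B t \<omega> - B s \<omega>) ^ 4) = 3 * (t - s)\<^sup>2"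
proof -
  have *: "expectation (\<lambda>\<omega>. B t \<omega> - B s \<omega>) = 0 \<and>
      expectation (\<lambda>\<omega>. (B t \<omega> - B s \<omega>)\<^sup>2) = t - s \<and>
      expectation (\<lambda>\<omega>. (B t \<omega> - B s \<omega>) ^ 4) = 3 * (t - s)\<^sup>2"
  proof (cases "s = t")
    case False
    then have d: "distributed M lborel (\<lambda>\<omega>. B t \<omega> - B s \<omega>) (normal_density 0 (sqrt (t - s)))"
      and pos: "0 < sqrt (t - s)"
      using assms increment_normal by auto
    have *: "expectation (\<lambda>\<omega>. (B t \<omega> - B s \<omega>) ^ k)
        = (\<integral>x. normal_density 0 (sqrt (t - s)) x * (x - 0) ^ k \<partial>lborel)" for k
      by (subst distributed_integral[OF d, of "\<lambda>x. x ^ k", symmetric]) auto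
    show ?thesis
      using *[of 1] *[of 2] *[of 4] pos assms False
        integral_normal_moment_odd[OF pos, of 0 0]
        integral_normal_moment_even[OF pos, of 0 1] integral_normal_moment_even[OF pos, of 0 2]
      by (simp add: fact_numeral power_divide field_simps power4_eq_xxxx power2_eq_square)
  qed auto
  then show "expectation (\<lambda>\<omega>. B t \<omega> - B s \<omega>) = 0"
    and "expectation (\<lambda>\<omega>. (B t \<omega> - B s \<omega>)\<^sup>2) = t - s"
    and "expectation (\<lambda>\<omega>. (B t \<omega> - B s \<omega>) ^ 4) = 3 * (t - s)\<^sup>2"
    by auto
qed

text \<open>
  Orthogonality: in the square of the sum every mixed term has a factor \<open>D j\<close> that has mean zero and
  is independent of all other factors. The functions \<open>q i\<close> allow for the increments themselves
  as well as for their compensated squares, which appear in Ito's formula.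
\<close>

lemma martingale_transform_second_moment:
  fixes \<tau> :: "nat \<Rightarrow> real" and \<xi> :: "nat \<Rightarrow> 'a \<Rightarrow> real" and q :: "nat \<Rightarrow> real \<Rightarrow> real"
  defines "D \<equiv> \<lambda>i \<omega>. q i (B (\<tau> (Suc i)) \<omega> - B (\<tau> i) \<omega>)"
  assumes \<tau>_I: "\<And>i. i \<le> n \<Longrightarrow> \<tau> i \<in> I" and \<tau>_mono: "\<And>i. i < n \<Longrightarrow> \<tau> i \<le> \<tau> (Suc i)"
    and \<xi>: "\<And>i. i < n \<Longrightarrow> \<xi> i \<in> borel_measurable (F (\<tau> i))"
    and K: "\<And>i \<omega>. i < n \<Longrightarrow> \<omega> \<in> space M \<Longrightarrow> \<bar>\<xi> i \<omega>\<bar> \<le> K i"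
    and q: "\<And>i. q i \<in> borel_measurable borel"
    and D2: "\<And>i. i < n \<Longrightarrow> integrable M (\<lambda>\<omega>. (D i \<omega>)\<^sup>2)"
    and D1: "\<And>i. i < n \<Longrightarrow> expectation (D i) = 0"
  shows "integrable M (\<lambda>\<omega>. (\<Sum>i<n. \<xi> i \<omega> * D i \<omega>)\<^sup>2) \<and>
    expectation (\<lambda>\<omega>. (\<Sum>i<n. \<xi> i \<omega> * D i \<omega>)\<^sup>2)
      = (\<Sum>i<n. expectation (\<lambda>\<omega>. (\<xi> i \<omega>)\<^sup>2) * expectation (\<lambda>\<omega>. (D i \<omega>)\<^sup>2)) \<and>
    (\<lambda>\<omega>. \<Sum>i<n. \<xi> i \<omega> * D i \<omega>) \<in> borel_measurable (F (\<tau> n))"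
  using \<tau>_I \<tau>_mono \<xi> K D2 D1
proof (induction n)
  case 0
  then show ?case by simp
next
  case (Suc n)
  let ?S = "\<lambda>\<omega>. \<Sum>i<n. \<xi> i \<omega> * D i \<omega>"
  have IH: "integrable M (\<lambda>\<omega>. (?S \<omega>)\<^sup>2)"
      "expectation (\<lambda>\<omega>. (?S \<omega>)\<^sup>2) = (\<Sum>i<n. expectation (\<lambda>\<omega>. (\<xi> i \<omega>)\<^sup>2) * expectation (\<lambda>\<omega>. (D i \<omega>)\<^sup>2))"
      "?S \<in> borel_measurable (F (\<tau> n))"
    using Suc by auto
  have n: "\<tau> n \<in> I" "\<tau> (Suc n) \<in> I" "\<tau> n \<le> \<tau> (Suc n)" using Suc.prems(1,2) by auto
  have \<xi>n: "\<xi> n \<in> borel_measurable (F (\<tau> n))" and Kn: "\<And>\<omega>. \<omega> \<in> space M \<Longrightarrow> \<bar>\<xi> n \<omega>\<bar> \<le> K n"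
    using Suc.prems by auto
  have \<xi>M [measurable]: "\<xi> n \<in> borel_measurable M" by (rule measurable_F_M[OF \<xi>n])
  have SM [measurable]: "?S \<in> borel_measurable M" by (rule measurable_F_M[OF IH(3)])
  have Dn: "D n \<in> borel_measurable (F (\<tau> (Suc n)))"
  proof -
    have "(\<lambda>\<omega>. B (\<tau> (Suc n)) \<omega> - B (\<tau> n) \<omega>) \<in> borel_measurable (F (\<tau> (Suc n)))"
      using n by (intro borel_measurable_diff B_measurable_F) auto
    then show ?thesis unfolding D_def by (rule measurable_compose[OF _ q])
  qed
  have DM [measurable]: "D n \<in> borel_measurable M" by (rule measurable_F_M[OF Dn])
  have ind: "indep_var borel Z borel (\<lambda>\<omega>. p (D n \<omega>))"
    if "Z \<in> borel_measurable (F (\<tau> n))" "p \<in> borel_measurable borel"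
    for Z :: "'a \<Rightarrow> real" and p :: "real \<Rightarrow> real"
    using increment_indep_var[OF n that(1) measurable_compose[OF q that(2)]]
    by (simp add: D_def)
  have S1: "integrable M ?S"
    by (rule square_integrable_imp_integrable[OF SM IH(1)])
  have S\<xi>: "integrable M (\<lambda>\<omega>. ?S \<omega> * \<xi> n \<omega>)"
  proof (rule Bochner_Integration.integrable_bound)
    show "integrable M (\<lambda>\<omega>. K n * ?S \<omega>)" using S1 by simp
    show "AE \<omega> in M. norm (?S \<omega> * \<xi> n \<omega>) \<le> norm (K n * ?S \<omega>)"
      using AE_space
    proof eventually_elim
      case (elim \<omega>)
      then have "\<bar>\<xi> n \<omega>\<bar> \<le> \<bar>K n\<bar>" using Kn[of \<omega>] by simp
      then show ?case by (simp add: abs_mult mult.commute mult_right_mono)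
    qed
  qed measurable
  have D1n: "integrable M (D n)"
    by (rule square_integrable_imp_integrable) (use Suc.prems in auto)
  have S\<xi>F: "(\<lambda>\<omega>. ?S \<omega> * \<xi> n \<omega>) \<in> borel_measurable (F (\<tau> n))"
    using IH(3) \<xi>n by (rule borel_measurable_times)
  have cross: "integrable M (\<lambda>\<omega>. (?S \<omega> * \<xi> n \<omega>) * D n \<omega>)"
      "expectation (\<lambda>\<omega>. (?S \<omega> * \<xi> n \<omega>) * D n \<omega>) = 0"
    using indep_var_integrable[OF ind[OF S\<xi>F, of "\<lambda>x. x"] S\<xi>]
      indep_var_lebesgue_integral[OF ind[OF S\<xi>F, of "\<lambda>x. x"] S\<xi>] D1n Suc.prems(6)[of n]
    by auto
  have \<xi>2: "integrable M (\<lambda>\<omega>. (\<xi> n \<omega>)\<^sup>2)"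
  proof (rule integrable_const_bound)
    show "AE \<omega> in M. norm ((\<xi> n \<omega>)\<^sup>2) \<le> (K n)\<^sup>2"
      using AE_space
    proof eventually_elim
      case (elim \<omega>)
      then have "\<bar>\<xi> n \<omega>\<bar>\<^sup>2 \<le> (K n)\<^sup>2" using Kn[of \<omega>] by (intro power_mono) auto
      then show ?case by simp
    qed
  qed measurable
  have \<xi>2F: "(\<lambda>\<omega>. (\<xi> n \<omega>)\<^sup>2) \<in> borel_measurable (F (\<tau> n))"
    using \<xi>n by (rule borel_measurable_power)
  have sq: "integrable M (\<lambda>\<omega>. (\<xi> n \<omega>)\<^sup>2 * (D n \<omega>)\<^sup>2)"
      "expectation (\<lambda>\<omega>. (\<xi> n \<omega>)\<^sup>2 * (D n \<omega>)\<^sup>2)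
        = expectation (\<lambda>\<omega>. (\<xi> n \<omega>)\<^sup>2) * expectation (\<lambda>\<omega>. (D n \<omega>)\<^sup>2)"
    using indep_var_integrable[OF ind[OF \<xi>2F, of "\<lambda>x. x\<^sup>2"] \<xi>2]
      indep_var_lebesgue_integral[OF ind[OF \<xi>2F, of "\<lambda>x. x\<^sup>2"] \<xi>2] Suc.prems(5)[of n]
    by auto
  have eq: "(\<Sum>i<Suc n. \<xi> i \<omega> * D i \<omega>)\<^sup>2
      = (?S \<omega>)\<^sup>2 + 2 * ((?S \<omega> * \<xi> n \<omega>) * D n \<omega>) + (\<xi> n \<omega>)\<^sup>2 * (D n \<omega>)\<^sup>2" for \<omega>
    by (simp add: power2_eq_square algebra_simps)
  have "(\<lambda>\<omega>. ?S \<omega> + \<xi> n \<omega> * D n \<omega>) \<in> borel_measurable (F (\<tau> (Suc n)))"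
    using measurable_F_mono[OF IH(3) n(3)] measurable_F_mono[OF \<xi>n n(3)] Dn
    by (intro borel_measurable_add borel_measurable_times)
  then show ?case
    unfolding eq using IH(1,2) cross sq by simp
qed

lemma is_simple_times:
  assumes "is_simple F t n \<tau> \<xi>" "t \<in> I"
  shows "i \<le> j \<Longrightarrow> j \<le> n \<Longrightarrow> \<tau> i \<le> \<tau> j" and "i \<le> n \<Longrightarrow> 0 \<le> \<tau> i \<and> \<tau> i \<le> t \<and> \<tau> i \<in> I"
proof -
  have step: "i < n \<Longrightarrow> \<tau> i \<le> \<tau> (Suc i)" for i using assms(1) by (simp add: is_simple_def)
  have mono: "i \<le> j \<Longrightarrow> j \<le> n \<Longrightarrow> \<tau> i \<le> \<tau> j" for i j
  proof (induction j rule: dec_induct)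
    case (step k)
    then show ?case using \<open>\<And>i. i < n \<Longrightarrow> \<tau> i \<le> \<tau> (Suc i)\<close>[of k] by auto
  qed simp
  then show "i \<le> j \<Longrightarrow> j \<le> n \<Longrightarrow> \<tau> i \<le> \<tau> j" .
  show "0 \<le> \<tau> i \<and> \<tau> i \<le> t \<and> \<tau> i \<in> I" if "i \<le> n"
    using mono[of 0 i] mono[of i n] that assms down_closed[OF assms(2), of "\<tau> i"]
    by (auto simp: is_simple_def)
qed

text \<open>
  The energy that is spent up to and including the \<open>i\<close>-th interval is known at the left end of that
  interval. Switching the coefficients off as soon as this energy would exceed \<open>\<delta>\<close> thus
  keeps them adapted, and gives a martingale transform with second moment at most \<open>\<delta>\<close>.
\<close>

lemma stopped_simple_integral:
  assumes simple: "is_simple F t n \<tau> \<xi>" and t: "t \<in> I" and \<delta>: "0 \<le> \<delta>"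
  obtains Z where "Z \<in> borel_measurable M" "(\<integral>\<^sup>+\<omega>. ennreal ((Z \<omega>)\<^sup>2) \<partial>M) \<le> ennreal \<delta>"
    "\<And>\<omega>. \<omega> \<in> space M \<Longrightarrow> (\<Sum>i<n. (\<xi> i \<omega>)\<^sup>2 * (\<tau> (Suc i) - \<tau> i)) \<le> \<delta> \<Longrightarrow>
       simple_integral B n \<tau> \<xi> \<omega> = Z \<omega>"
proof -
  note tm = is_simple_times[OF simple t]
  have \<xi>: "\<xi> i \<in> borel_measurable (F (\<tau> i))" if "i < n" for i
    using simple that by (simp add: is_simple_def)
  have "\<forall>i<n. \<exists>K. \<forall>\<omega>\<in>space M. \<bar>\<xi> i \<omega>\<bar> \<le> K"
    using simple by (simp add: is_simple_def)
  then obtain K where K: "\<And>i \<omega>. i < n \<Longrightarrow> \<omega> \<in> space M \<Longrightarrow> \<bar>\<xi> i \<omega>\<bar> \<le> K i" by metis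
  \<comment> \<open>the sum includes the \<open>i\<close>-th interval itself, so that the total never exceeds \<open>\<delta>\<close>\<close>
  define A where "A i \<omega> = (\<Sum>j<Suc i. (\<xi> j \<omega>)\<^sup>2 * (\<tau> (Suc j) - \<tau> j))" for i \<omega>
  define \<zeta> where "\<zeta> i \<omega> = (if A i \<omega> \<le> \<delta> then \<xi> i \<omega> else 0)" for i \<omega>
  let ?Z = "\<lambda>\<omega>. \<Sum>i<n. \<zeta> i \<omega> * (B (\<tau> (Suc i)) \<omega> - B (\<tau> i) \<omega>)"
  have AF: "A i \<in> borel_measurable (F (\<tau> i))" if "i < n" for i
    unfolding A_def
  proof (intro borel_measurable_sum borel_measurable_times borel_measurable_power)
    fix j assume "j \<in> {..<Suc i}"
    then show "\<xi> j \<in> borel_measurable (F (\<tau> i))"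
      using that by (intro measurable_F_mono[OF \<xi>[of j]] tm) auto
  qed simp
  have \<zeta>F: "\<zeta> i \<in> borel_measurable (F (\<tau> i))" if "i < n" for i
    unfolding \<zeta>_def using AF[OF that] \<xi>[OF that] by measurable
  have \<zeta>K: "\<bar>\<zeta> i \<omega>\<bar> \<le> K i" if "i < n" "\<omega> \<in> space M" for i \<omega>
    using K[OF that] by (auto simp: \<zeta>_def)
  have inc: "\<tau> i \<in> I" "\<tau> (Suc i) \<in> I" "\<tau> i \<le> \<tau> (Suc i)" if "i < n" for i
    using tm(1)[of i "Suc i"] tm(2)[of i] tm(2)[of "Suc i"] that by auto
  have *: "integrable M (\<lambda>\<omega>. (?Z \<omega>)\<^sup>2) \<and>
    expectation (\<lambda>\<omega>. (?Z \<omega>)\<^sup>2)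
      = (\<Sum>i<n. expectation (\<lambda>\<omega>. (\<zeta> i \<omega>)\<^sup>2) * expectation (\<lambda>\<omega>. (B (\<tau> (Suc i)) \<omega> - B (\<tau> i) \<omega>)\<^sup>2)) \<and>
    ?Z \<in> borel_measurable (F (\<tau> n))"
    by (rule martingale_transform_second_moment[where K = K and q = "\<lambda>_ x. x"])
       (use tm inc \<zeta>F \<zeta>K increment_power_integrable increment_moments in auto)
  have \<zeta>2: "integrable M (\<lambda>\<omega>. (\<zeta> i \<omega>)\<^sup>2)" if "i < n" for i
  proof (rule integrable_const_bound)
    show "AE \<omega> in M. norm ((\<zeta> i \<omega>)\<^sup>2) \<le> (K i)\<^sup>2"
      using AE_space
    proof eventually_elim
      case (elim \<omega>)
      then have "\<bar>\<zeta> i \<omega>\<bar>\<^sup>2 \<le> (K i)\<^sup>2" using \<zeta>K[OF that] by (intro power_mono) auto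
      then show ?case by simp
    qed
    show "(\<lambda>\<omega>. (\<zeta> i \<omega>)\<^sup>2) \<in> borel_measurable M"
      using measurable_F_M[OF \<zeta>F[OF that]] by measurable
  qed
  have bound: "(\<Sum>i<m. (\<zeta> i \<omega>)\<^sup>2 * (\<tau> (Suc i) - \<tau> i)) \<le> \<delta>" if "m \<le> n" for m \<omega>
    using that
  proof (induction m)
    case (Suc m)
    show ?case
    proof (cases "A m \<omega> \<le> \<delta>")
      case True
      have "(\<Sum>i<Suc m. (\<zeta> i \<omega>)\<^sup>2 * (\<tau> (Suc i) - \<tau> i)) \<le> A m \<omega>"
        unfolding A_def using inc(3) Suc.prems by (intro sum_mono) (auto simp: \<zeta>_def)
      then show ?thesis using True by simp
    next
      case False
      then show ?thesis using Suc by (simp add: \<zeta>_def)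
    qed
  qed (use \<delta> in simp)
  have "expectation (\<lambda>\<omega>. (?Z \<omega>)\<^sup>2) = (\<Sum>i<n. expectation (\<lambda>\<omega>. (\<zeta> i \<omega>)\<^sup>2 * (\<tau> (Suc i) - \<tau> i)))"
    using * inc by (auto intro!: sum.cong simp: increment_moments)
  also have "\<dots> = expectation (\<lambda>\<omega>. \<Sum>i<n. (\<zeta> i \<omega>)\<^sup>2 * (\<tau> (Suc i) - \<tau> i))"
    using \<zeta>2 by (intro Bochner_Integration.integral_sum[symmetric]) auto
  also have "\<dots> \<le> expectation (\<lambda>\<omega>. \<delta>)"
    using \<zeta>2 bound[of n] by (intro integral_mono) auto
  finally have E: "expectation (\<lambda>\<omega>. (?Z \<omega>)\<^sup>2) \<le> \<delta>" by (simp add: prob_space)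
  show ?thesis
  proof (rule that)
    show "?Z \<in> borel_measurable M" using * measurable_F_M by blast
    show "(\<integral>\<^sup>+\<omega>. ennreal ((?Z \<omega>)\<^sup>2) \<partial>M) \<le> ennreal \<delta>"
      using E * by (subst nn_integral_eq_integral) (auto intro: ennreal_leI)
    fix \<omega> assume le: "(\<Sum>i<n. (\<xi> i \<omega>)\<^sup>2 * (\<tau> (Suc i) - \<tau> i)) \<le> \<delta>"
    have "A i \<omega> \<le> \<delta>" if "i < n" for i
    proof -
      have "A i \<omega> \<le> (\<Sum>i<n. (\<xi> i \<omega>)\<^sup>2 * (\<tau> (Suc i) - \<tau> i))"
        unfolding A_def using that inc(3) by (intro sum_mono2) auto
      then show ?thesis using le by simp
    qed
    then show "simple_integral B n \<tau> \<xi> \<omega> = ?Z \<omega>"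
      by (auto simp: simple_integral_def \<zeta>_def)
  qed
qed

end

lemma simple_process_eq:
  assumes mono: "\<And>i. i < n \<Longrightarrow> \<tau> i \<le> \<tau> (Suc i)" and i: "i < n" "\<tau> i < s" "s \<le> \<tau> (Suc i)"
  shows "simple_process n \<tau> \<xi> s \<omega> = \<xi> i \<omega>"
proof -
  have m: "i \<le> j \<Longrightarrow> j \<le> n \<Longrightarrow> \<tau> i \<le> \<tau> j" for i j
  proof (induction j rule: dec_induct)
    case (step k)
    then show ?case using mono[of k] by auto
  qed simp
  have "simple_process n \<tau> \<xi> s \<omega> = (\<Sum>j\<in>{i}. \<xi> j \<omega> * indicator {\<tau> j<..\<tau> (Suc j)} s)"
    unfolding simple_process_def
  proof (rule sum.mono_neutral_right)
    show "\<forall>j\<in>{..<n} - {i}. \<xi> j \<omega> * indicator {\<tau> j<..\<tau> (Suc j)} s = 0"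
    proof
      fix j assume j: "j \<in> {..<n} - {i}"
      then have "j < i \<or> i < j" by auto
      then have "s \<notin> {\<tau> j<..\<tau> (Suc j)}"
        using m[of "Suc j" i] m[of "Suc i" j] j i by auto
      then show "\<xi> j \<omega> * indicator {\<tau> j<..\<tau> (Suc j)} s = 0" by simp
    qed
  qed (use i in auto)
  then show ?thesis using i by simp
qed

lemma interval_of_partition:
  fixes \<tau> :: "nat \<Rightarrow> real"
  assumes "\<tau> 0 < s" "s \<le> \<tau> n"
  obtains i where "i < n" "\<tau> i < s" "s \<le> \<tau> (Suc i)"
  using assms
proof (induction n arbitrary: thesis)
  case (Suc n)
  show ?case
  proof (cases "s \<le> \<tau> n")
    case True
    then show ?thesis using Suc.IH Suc.prems by (metis less_Suc_eq)
  next
    case False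
    then show ?thesis using Suc.prems by (metis lessI not_less)
  qed
qed auto

lemma simple_process_power2:
  assumes mono: "\<And>i. i < n \<Longrightarrow> \<tau> i \<le> \<tau> (Suc i)"
  shows "(simple_process n \<tau> \<xi> s \<omega>)\<^sup>2 = simple_process n \<tau> (\<lambda>i \<omega>. (\<xi> i \<omega>)\<^sup>2) s \<omega>"
proof (cases "\<exists>i<n. \<tau> i < s \<and> s \<le> \<tau> (Suc i)")
  case True
  then obtain i where "i < n" "\<tau> i < s" "s \<le> \<tau> (Suc i)" by blast
  then show ?thesis by (simp add: simple_process_eq[where \<tau> = \<tau>, OF mono])
next
  case False
  then have "simple_process n \<tau> \<zeta> s \<omega> = 0" for \<zeta> :: "nat \<Rightarrow> 'a \<Rightarrow> real"
    unfolding simple_process_def by (intro sum.neutral) (auto simp: indicator_def)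
  then show ?thesis by simp
qed

text \<open>
  The squared norm of a path in \<open>L\<^sup>2[0, t]\<close>. As an extended nonnegative integral it makes sense
  for every measurable path, so that no integrability conditions have to be carried along.
\<close>

definition energy :: "real \<Rightarrow> (real \<Rightarrow> 'a \<Rightarrow> real) \<Rightarrow> 'a \<Rightarrow> ennreal" where
  "energy t H \<omega> = (\<integral>\<^sup>+s\<in>{0..t}. ennreal ((H s \<omega>)\<^sup>2) \<partial>lborel)"

lemma energy_le_of_bound:
  assumes t: "0 \<le> t" and c: "0 \<le> c" and le: "\<And>u. 0 < u \<Longrightarrow> u \<le> t \<Longrightarrow> \<bar>H u \<omega>\<bar> \<le> c"
  shows "energy t H \<omega> \<le> ennreal (c\<^sup>2 * t)"
proof -
  have "energy t H \<omega> \<le> (\<integral>\<^sup>+s. ennreal (c\<^sup>2) * indicator {0..t} s \<partial>lborel)"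
    unfolding energy_def
  proof (rule nn_integral_mono_AE)
    show "AE s in lborel. ennreal ((H s \<omega>)\<^sup>2) * indicator {0..t} s \<le> ennreal (c\<^sup>2) * indicator {0..t} s"
      using AE_lborel_singleton[of "0::real"]
    proof eventually_elim
      case (elim s)
      show ?case
      proof (cases "s \<in> {0..t}")
        case True
        then have "\<bar>H s \<omega>\<bar>\<^sup>2 \<le> c\<^sup>2" using elim by (intro power_mono le) auto
        then show ?thesis by (auto simp: indicator_def intro!: ennreal_leI)
      qed simp
    qed
  qed
  also have "\<dots> = ennreal (c\<^sup>2 * t)"
    using t by (subst nn_integral_cmult) (auto simp: ennreal_mult')
  finally show ?thesis .
qed

lemma energy_at_0: "energy 0 H \<omega> = 0"
proof -
  have "energy 0 H \<omega> = (\<integral>\<^sup>+s. 0 \<partial>(lborel :: real measure))"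
    unfolding energy_def
  proof (rule nn_integral_cong_AE)
    show "AE s in lborel. ennreal ((H s \<omega>)\<^sup>2) * indicator {0..0} s = 0"
      using AE_lborel_singleton[of "0::real"] by eventually_elim auto
  qed
  then show ?thesis by simp
qed

context brownian
begin

lemma energy_simple_process:
  assumes simple: "is_simple F t n \<tau> \<xi>" and t: "t \<in> I"
  shows "energy t (simple_process n \<tau> \<xi>) \<omega> = ennreal (\<Sum>i<n. (\<xi> i \<omega>)\<^sup>2 * (\<tau> (Suc i) - \<tau> i))"
proof -
  note tm = is_simple_times[OF simple t]
  have mono: "i < n \<Longrightarrow> \<tau> i \<le> \<tau> (Suc i)" for i using simple by (simp add: is_simple_def)
  have "energy t (simple_process n \<tau> \<xi>) \<omega>
      = (\<integral>\<^sup>+s. (\<Sum>i<n. ennreal ((\<xi> i \<omega>)\<^sup>2) * indicator {\<tau> i<..\<tau> (Suc i)} s) \<partial>lborel)"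
    unfolding energy_def
  proof (rule nn_integral_cong)
    fix s :: real
    have "ennreal ((simple_process n \<tau> \<xi> s \<omega>)\<^sup>2) * indicator {0..t} s
        = ennreal (\<Sum>i<n. (\<xi> i \<omega>)\<^sup>2 * indicator {\<tau> i<..\<tau> (Suc i)} s * indicator {0..t} s)"
      by (subst simple_process_power2, erule mono) (auto simp: simple_process_def indicator_def)
    also have "\<dots> = ennreal (\<Sum>i<n. (\<xi> i \<omega>)\<^sup>2 * indicator {\<tau> i<..\<tau> (Suc i)} s)"
    proof (rule arg_cong[where f = ennreal], rule sum.cong)
      fix i assume "i \<in> {..<n}"
      then show "(\<xi> i \<omega>)\<^sup>2 * indicator {\<tau> i<..\<tau> (Suc i)} s * indicator {0..t} s
          = (\<xi> i \<omega>)\<^sup>2 * indicator {\<tau> i<..\<tau> (Suc i)} s"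
        using tm(2)[of i] tm(2)[of "Suc i"] by (auto simp: indicator_def)
    qed simp
    also have "\<dots> = (\<Sum>i<n. ennreal ((\<xi> i \<omega>)\<^sup>2) * indicator {\<tau> i<..\<tau> (Suc i)} s)"
      by (subst sum_ennreal[symmetric]) (auto intro!: sum.cong simp: ennreal_mult' ennreal_indicator)
    finally show "ennreal ((simple_process n \<tau> \<xi> s \<omega>)\<^sup>2) * indicator {0..t} s
        = (\<Sum>i<n. ennreal ((\<xi> i \<omega>)\<^sup>2) * indicator {\<tau> i<..\<tau> (Suc i)} s)" .
  qed
  also have "\<dots> = (\<Sum>i<n. ennreal ((\<xi> i \<omega>)\<^sup>2 * (\<tau> (Suc i) - \<tau> i)))"
    by (subst nn_integral_sum) (auto intro!: sum.cong simp: nn_integral_cmult mono ennreal_mult')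
  also have "\<dots> = ennreal (\<Sum>i<n. (\<xi> i \<omega>)\<^sup>2 * (\<tau> (Suc i) - \<tau> i))"
    using mono by (intro sum_ennreal) auto
  finally show ?thesis .
qed


section \<open>Sums of simple processes\<close>

text \<open>
  A simple process is left-continuous and constant between its partition points, so its value on an
  interval of a finer partition is its value at the right end. Its integral does not change because the
  increments of \<open>B\<close> telescope.
\<close>

lemma refine_simple:
  fixes \<rho> :: "nat \<Rightarrow> real"
  assumes simple: "is_simple F t n \<tau> \<xi>" and t: "t \<in> I"
    and \<rho>0: "\<rho> 0 = 0" and \<rho>m: "\<rho> m = t"
    and \<rho>: "\<And>i j. i < j \<Longrightarrow> j \<le> m \<Longrightarrow> \<rho> i < \<rho> j" and sub: "\<tau> ` {..n} \<subseteq> \<rho> ` {..m}"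
  defines "\<zeta> \<equiv> \<lambda>i \<omega>. simple_process n \<tau> \<xi> (\<rho> (Suc i)) \<omega>"
  shows "is_simple F t m \<rho> \<zeta>"
    and "simple_process m \<rho> \<zeta> s \<omega> = simple_process n \<tau> \<xi> s \<omega>"
    and "simple_integral B m \<rho> \<zeta> \<omega> = simple_integral B n \<tau> \<xi> \<omega>"
proof -
  note tm = is_simple_times[OF simple t]
  have step: "\<And>i. i < m \<Longrightarrow> \<rho> i \<le> \<rho> (Suc i)" using \<rho> by (simp add: less_imp_le)
  have gap: "\<tau> j \<le> \<rho> i \<or> \<rho> (Suc i) \<le> \<tau> j" if "i < m" "j \<le> n" for i j
  proof -
    obtain k where k: "k \<le> m" "\<tau> j = \<rho> k" using sub \<open>j \<le> n\<close> by auto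
    show ?thesis
    proof (cases "k \<le> i")
      case True
      then show ?thesis using k \<rho>[of k i] that by (cases "k = i") auto
    next
      case False
      then show ?thesis using k \<rho>[of "Suc i" k] that by (cases "k = Suc i") auto
    qed
  qed
  have \<xi>: "\<xi> i \<in> borel_measurable (F (\<tau> i))" if "i < n" for i
    using simple that by (simp add: is_simple_def)
  have "\<forall>i<n. \<exists>K. \<forall>\<omega>\<in>space M. \<bar>\<xi> i \<omega>\<bar> \<le> K"
    using simple by (simp add: is_simple_def)
  then obtain K where K: "\<And>i \<omega>. i < n \<Longrightarrow> \<omega> \<in> space M \<Longrightarrow> \<bar>\<xi> i \<omega>\<bar> \<le> K i" by metis
  have \<zeta>F: "\<zeta> i \<in> borel_measurable (F (\<rho> i))" if i: "i < m" for i
    unfolding \<zeta>_def simple_process_def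
  proof (rule borel_measurable_sum)
    fix j assume j: "j \<in> {..<n}"
    show "(\<lambda>\<omega>. \<xi> j \<omega> * indicator {\<tau> j<..\<tau> (Suc j)} (\<rho> (Suc i))) \<in> borel_measurable (F (\<rho> i))"
    proof (cases "\<tau> j < \<rho> (Suc i)")
      case True
      then have "\<tau> j \<le> \<rho> i" using gap[OF i, of j] j by auto
      then show ?thesis
        using measurable_F_mono[OF \<xi>[of j]] j by (intro borel_measurable_times) auto
    qed simp
  qed
  have \<zeta>K: "\<exists>K'. \<forall>\<omega>\<in>space M. \<bar>\<zeta> i \<omega>\<bar> \<le> K'" for i
  proof (intro exI[of _ "\<Sum>j<n. K j"] ballI)
    fix \<omega> assume \<omega>: "\<omega> \<in> space M"
    have "\<bar>\<zeta> i \<omega>\<bar> \<le> (\<Sum>j<n. \<bar>\<xi> j \<omega> * indicator {\<tau> j<..\<tau> (Suc j)} (\<rho> (Suc i))\<bar>)"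
      unfolding \<zeta>_def simple_process_def by (rule sum_abs)
    also have "\<dots> \<le> (\<Sum>j<n. K j)"
      using K[OF _ \<omega>] by (intro sum_mono) (auto simp: indicator_def intro: order_trans[OF abs_ge_zero])
    finally show "\<bar>\<zeta> i \<omega>\<bar> \<le> (\<Sum>j<n. K j)" .
  qed
  show "is_simple F t m \<rho> \<zeta>"
    unfolding is_simple_def using \<rho>0 \<rho>m step \<zeta>F \<zeta>K by auto
  show "simple_process m \<rho> \<zeta> s \<omega> = simple_process n \<tau> \<xi> s \<omega>"
  proof (cases "0 < s \<and> s \<le> t")
    case True
    then obtain i where i: "i < m" "\<rho> i < s" "s \<le> \<rho> (Suc i)"
      using interval_of_partition[of \<rho> s m] \<rho>0 \<rho>m by auto
    have "simple_process m \<rho> \<zeta> s \<omega> = \<zeta> i \<omega>"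
      by (rule simple_process_eq) (use i step in auto)
    also have "\<dots> = simple_process n \<tau> \<xi> s \<omega>"
      unfolding \<zeta>_def simple_process_def
    proof (rule sum.cong)
      fix j assume j: "j \<in> {..<n}"
      then have "\<tau> j < \<rho> (Suc i) \<longleftrightarrow> \<tau> j < s" "\<rho> (Suc i) \<le> \<tau> (Suc j) \<longleftrightarrow> s \<le> \<tau> (Suc j)"
        using gap[OF i(1), of j] gap[OF i(1), of "Suc j"] i by auto
      then show "\<xi> j \<omega> * indicator {\<tau> j<..\<tau> (Suc j)} (\<rho> (Suc i))
          = \<xi> j \<omega> * indicator {\<tau> j<..\<tau> (Suc j)} s"
        by (auto simp: indicator_def)
    qed simp
    finally show ?thesis .
  next
    case False
    have "\<xi> j \<omega> * indicator {\<tau> j<..\<tau> (Suc j)} s = 0" if "j < n" for j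
      using tm(2)[of j] tm(2)[of "Suc j"] that False by (auto simp: indicator_def)
    moreover have "\<zeta> i \<omega> * indicator {\<rho> i<..\<rho> (Suc i)} s = 0" if "i < m" for i
      using \<rho>[of 0 i] \<rho>[of "Suc i" m] that False \<rho>0 \<rho>m
      by (cases "i = 0"; cases "Suc i = m") (auto simp: indicator_def)
    ultimately show ?thesis
      unfolding simple_process_def by (metis (no_types, lifting) lessThan_iff sum.neutral)
  qed
  show "simple_integral B m \<rho> \<zeta> \<omega> = simple_integral B n \<tau> \<xi> \<omega>"
  proof -
    let ?D = "\<lambda>i. B (\<rho> (Suc i)) \<omega> - B (\<rho> i) \<omega>"
    have "simple_integral B m \<rho> \<zeta> \<omega>
        = (\<Sum>j<n. \<xi> j \<omega> * (\<Sum>i<m. indicator {\<tau> j<..\<tau> (Suc j)} (\<rho> (Suc i)) * ?D i))"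
      unfolding simple_integral_def \<zeta>_def simple_process_def
      by (simp only: sum_distrib_left sum_distrib_right mult.assoc) (rule sum.swap)
    also have "\<dots> = (\<Sum>j<n. \<xi> j \<omega> * (B (\<tau> (Suc j)) \<omega> - B (\<tau> j) \<omega>))"
    proof (intro sum.cong refl, rule arg_cong2[where f = "(*)"])
      fix j assume j: "j \<in> {..<n}"
      then have "\<tau> j \<in> \<rho> ` {..m}" "\<tau> (Suc j) \<in> \<rho> ` {..m}" using sub by auto
      then obtain a b where ab: "a \<le> m" "b \<le> m" "\<tau> j = \<rho> a" "\<tau> (Suc j) = \<rho> b" by auto
      have le_iff: "\<rho> k \<le> \<rho> l \<longleftrightarrow> k \<le> l" if "k \<le> m" "l \<le> m" for k l
        using \<rho>[of k l] \<rho>[of l k] that by (metis linorder_not_less nless_le order.strict_implies_order)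
      have "a \<le> b" using le_iff ab tm(1)[of j "Suc j"] j by auto
      have "(\<Sum>i<m. indicator {\<tau> j<..\<tau> (Suc j)} (\<rho> (Suc i)) * ?D i) = (\<Sum>i\<in>{a..<b}. ?D i)"
      proof (rule sum.mono_neutral_cong_right)
        show "\<forall>i\<in>{..<m} - {a..<b}. indicator {\<tau> j<..\<tau> (Suc j)} (\<rho> (Suc i)) * ?D i = 0"
          using ab le_iff by (auto simp: indicator_def not_less[symmetric] simp del: not_less)
        fix i assume "i \<in> {a..<b}"
        then have "\<rho> a < \<rho> (Suc i)" "\<rho> (Suc i) \<le> \<rho> b"
          using ab le_iff[of "Suc i" b] \<rho>[of a "Suc i"] by auto
        then show "indicator {\<tau> j<..\<tau> (Suc j)} (\<rho> (Suc i)) * ?D i = ?D i"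
          using ab by simp
      qed (use ab in auto)
      also have "\<dots> = B (\<rho> b) \<omega> - B (\<rho> a) \<omega>"
        using \<open>a \<le> b\<close> by (rule sum_Suc_diff')
      finally show "(\<Sum>i<m. indicator {\<tau> j<..\<tau> (Suc j)} (\<rho> (Suc i)) * ?D i)
          = B (\<tau> (Suc j)) \<omega> - B (\<tau> j) \<omega>"
        using ab by simp
    qed simp
    finally show ?thesis by (simp add: simple_integral_def)
  qed
qed

lemma add_simple:
  assumes 1: "is_simple F t n \<tau> \<xi>" and 2: "is_simple F t n' \<tau>' \<xi>'" and t: "t \<in> I"
  obtains m \<rho> \<zeta> where "is_simple F t m \<rho> \<zeta>"
    "\<And>s \<omega>. simple_process m \<rho> \<zeta> s \<omega> = simple_process n \<tau> \<xi> s \<omega> + simple_process n' \<tau>' \<xi>' s \<omega>"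
    "\<And>\<omega>. simple_integral B m \<rho> \<zeta> \<omega> = simple_integral B n \<tau> \<xi> \<omega> + simple_integral B n' \<tau>' \<xi>' \<omega>"
proof -
  define P where "P = \<tau> ` {..n} \<union> \<tau>' ` {..n'}"
  define L where "L = sorted_list_of_set P"
  have L: "set L = P" "sorted_wrt (<) L"
    unfolding L_def using strict_sorted_list_of_set[of P] by (auto simp: P_def)
  have P: "0 \<in> P" "t \<in> P" "\<And>x. x \<in> P \<Longrightarrow> 0 \<le> x \<and> x \<le> t"
  proof -
    show "0 \<in> P" using 1 unfolding P_def is_simple_def by (metis UnI1 atMost_iff image_eqI le0)
    show "t \<in> P" using 1 unfolding P_def is_simple_def by (metis UnI1 atMost_iff image_eqI le_refl)
    show "\<And>x. x \<in> P \<Longrightarrow> 0 \<le> x \<and> x \<le> t"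
      using is_simple_times(2)[OF 1 t] is_simple_times(2)[OF 2 t] by (auto simp: P_def)
  qed
  define m where "m = length L - 1"
  have lenL: "length L = Suc m" using L(1) P(1) by (cases L) (auto simp: m_def)
  define \<rho> where "\<rho> i = L ! i" for i
  have mono: "i < j \<Longrightarrow> j \<le> m \<Longrightarrow> \<rho> i < \<rho> j" for i j
    using L(2) lenL by (auto simp: \<rho>_def sorted_wrt_iff_nth_less)
  have img: "\<rho> ` {..m} = P"
    using L(1) lenL by (auto simp: \<rho>_def set_conv_nth less_Suc_eq_le)
  have "\<rho> 0 = 0"
  proof -
    obtain i where i: "i \<le> m" "\<rho> i = 0" using img P(1) by (metis atMost_iff imageE)
    have "\<rho> 0 \<in> P" using img by auto
    then show ?thesis using mono[of 0 i] P(3)[of "\<rho> 0"] i by (cases "i = 0") auto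
  qed
  have "\<rho> m = t"
  proof -
    obtain i where i: "i \<le> m" "\<rho> i = t" using img P(2) by (metis atMost_iff imageE)
    have "\<rho> m \<in> P" using img by auto
    then show ?thesis using mono[of i m] P(3)[of "\<rho> m"] i by (cases "i = m") auto
  qed
  note r1 = refine_simple[OF 1 t \<open>\<rho> 0 = 0\<close> \<open>\<rho> m = t\<close> mono]
  note r2 = refine_simple[OF 2 t \<open>\<rho> 0 = 0\<close> \<open>\<rho> m = t\<close> mono]
  let ?\<zeta>1 = "\<lambda>i \<omega>. simple_process n \<tau> \<xi> (\<rho> (Suc i)) \<omega>"
  let ?\<zeta>2 = "\<lambda>i \<omega>. simple_process n' \<tau>' \<xi>' (\<rho> (Suc i)) \<omega>"
  have s1: "\<tau> ` {..n} \<subseteq> \<rho> ` {..m}" and s2: "\<tau>' ` {..n'} \<subseteq> \<rho> ` {..m}"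
    unfolding img by (auto simp: P_def)
  have i1: "is_simple F t m \<rho> ?\<zeta>1" and i2: "is_simple F t m \<rho> ?\<zeta>2"
    using r1(1)[OF _ _ s1] r2(1)[OF _ _ s2] by auto
  show ?thesis
  proof (rule that)
    show "is_simple F t m \<rho> (\<lambda>i \<omega>. ?\<zeta>1 i \<omega> + ?\<zeta>2 i \<omega>)"
      unfolding is_simple_def
    proof (intro conjI allI impI)
      fix i assume i: "i < m"
      show "(\<lambda>\<omega>. ?\<zeta>1 i \<omega> + ?\<zeta>2 i \<omega>) \<in> borel_measurable (F (\<rho> i))"
        using i1 i2 i unfolding is_simple_def by (intro borel_measurable_add) auto
      obtain K1 K2 where "\<forall>\<omega>\<in>space M. \<bar>?\<zeta>1 i \<omega>\<bar> \<le> K1" "\<forall>\<omega>\<in>space M. \<bar>?\<zeta>2 i \<omega>\<bar> \<le> K2"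
        using i1 i2 i unfolding is_simple_def space_F by blast
      then have "\<forall>\<omega>\<in>space M. \<bar>?\<zeta>1 i \<omega> + ?\<zeta>2 i \<omega>\<bar> \<le> K1 + K2"
        by (smt (verit) abs_triangle_ineq)
      then show "\<exists>K. \<forall>\<omega>\<in>space (F (\<rho> i)). \<bar>?\<zeta>1 i \<omega> + ?\<zeta>2 i \<omega>\<bar> \<le> K" unfolding space_F by blast
    qed (use i1 in \<open>auto simp: is_simple_def\<close>)
    fix s \<omega>
    have "simple_process m \<rho> (\<lambda>i \<omega>. ?\<zeta>1 i \<omega> + ?\<zeta>2 i \<omega>) s \<omega>
        = simple_process m \<rho> ?\<zeta>1 s \<omega> + simple_process m \<rho> ?\<zeta>2 s \<omega>"
      by (simp add: simple_process_def distrib_right sum.distrib)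
    then show "simple_process m \<rho> (\<lambda>i \<omega>. ?\<zeta>1 i \<omega> + ?\<zeta>2 i \<omega>) s \<omega>
        = simple_process n \<tau> \<xi> s \<omega> + simple_process n' \<tau>' \<xi>' s \<omega>"
      using r1(2)[OF _ _ s1, of s \<omega>] r2(2)[OF _ _ s2, of s \<omega>] by simp
    have "simple_integral B m \<rho> (\<lambda>i \<omega>. ?\<zeta>1 i \<omega> + ?\<zeta>2 i \<omega>) \<omega>
        = simple_integral B m \<rho> ?\<zeta>1 \<omega> + simple_integral B m \<rho> ?\<zeta>2 \<omega>"
      by (simp add: simple_integral_def distrib_right sum.distrib)
    then show "simple_integral B m \<rho> (\<lambda>i \<omega>. ?\<zeta>1 i \<omega> + ?\<zeta>2 i \<omega>) \<omega>
        = simple_integral B n \<tau> \<xi> \<omega> + simple_integral B n' \<tau>' \<xi>' \<omega>"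
      using r1(3)[OF _ _ s1, of \<omega>] r2(3)[OF _ _ s2, of \<omega>] by simp
  qed
qed

section \<open>Joint measurability and energy\<close>

definition jointly_measurable :: "real \<Rightarrow> (real \<Rightarrow> 'a \<Rightarrow> real) \<Rightarrow> bool" where
  "jointly_measurable t H \<longleftrightarrow>
     (\<lambda>(\<omega>, s). indicator {0..t} s * H s \<omega>) \<in> borel_measurable (M \<Otimes>\<^sub>M lborel)"

lemma jointly_measurable_arith:
  assumes "jointly_measurable t H" "jointly_measurable t G"
  shows "jointly_measurable t (\<lambda>s \<omega>. H s \<omega> + G s \<omega>)"
    and "jointly_measurable t (\<lambda>s \<omega>. H s \<omega> - G s \<omega>)"
    and "jointly_measurable t (\<lambda>s \<omega>. H s \<omega> * G s \<omega>)"
    and "jointly_measurable t (\<lambda>s \<omega>. a * H s \<omega>)"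
proof -
  let ?h = "\<lambda>H. \<lambda>(\<omega>, s). indicator {0..t} s * H s \<omega> :: real"
  have 1: "?h H \<in> borel_measurable (M \<Otimes>\<^sub>M lborel)" and 2: "?h G \<in> borel_measurable (M \<Otimes>\<^sub>M lborel)"
    using assms by (auto simp: jointly_measurable_def)
  have "?h (\<lambda>s \<omega>. H s \<omega> + G s \<omega>) = (\<lambda>x. ?h H x + ?h G x)"
    "?h (\<lambda>s \<omega>. H s \<omega> - G s \<omega>) = (\<lambda>x. ?h H x - ?h G x)"
    "?h (\<lambda>s \<omega>. H s \<omega> * G s \<omega>) = (\<lambda>x. ?h H x * ?h G x)"
    "?h (\<lambda>s \<omega>. a * H s \<omega>) = (\<lambda>x. a * ?h H x)"
    by (auto simp: fun_eq_iff indicator_def)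
  then show "jointly_measurable t (\<lambda>s \<omega>. H s \<omega> + G s \<omega>)"
    and "jointly_measurable t (\<lambda>s \<omega>. H s \<omega> - G s \<omega>)"
    and "jointly_measurable t (\<lambda>s \<omega>. H s \<omega> * G s \<omega>)"
    and "jointly_measurable t (\<lambda>s \<omega>. a * H s \<omega>)"
    unfolding jointly_measurable_def using 1 2 by auto
qed

lemma jointly_measurable_cong:
  assumes "jointly_measurable t H" "\<And>s \<omega>. 0 \<le> s \<Longrightarrow> s \<le> t \<Longrightarrow> \<omega> \<in> space M \<Longrightarrow> H s \<omega> = G s \<omega>"
  shows "jointly_measurable t G"
  using assms(1) unfolding jointly_measurable_def
  by (rule measurable_cong[THEN iffD1, rotated])
     (auto simp: space_pair_measure indicator_def assms(2))

lemma jointly_measurable_simple: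
  assumes "is_simple F t n \<tau> \<xi>"
  shows "jointly_measurable t (simple_process n \<tau> \<xi>)"
proof -
  have [measurable]: "\<xi> i \<in> borel_measurable M" if "i \<in> {..<n}" for i
    using assms that measurable_F_M by (auto simp: is_simple_def)
  show ?thesis
    unfolding jointly_measurable_def simple_process_def by measurable
qed

lemma path_measurable:
  assumes "jointly_measurable t H" "\<omega> \<in> space M"
  shows "(\<lambda>s. indicator {0..t} s * H s \<omega>) \<in> borel_measurable borel"
  using measurable_compose[OF measurable_Pair1'[OF assms(2)] assms(1)[unfolded jointly_measurable_def]]
  by simp

lemma energy_alt: "energy t H \<omega> = (\<integral>\<^sup>+s. ennreal ((indicator {0..t} s * H s \<omega>)\<^sup>2) \<partial>lborel)"
  unfolding energy_def by (intro nn_integral_cong) (auto simp: indicator_def)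

lemma energy_measurable [measurable]:
  assumes "jointly_measurable t H"
  shows "energy t H \<in> borel_measurable M"
proof -
  have "(\<lambda>(\<omega>, s). ennreal ((indicator {0..t} s * H s \<omega>)\<^sup>2)) \<in> borel_measurable (M \<Otimes>\<^sub>M lborel)"
    using assms unfolding jointly_measurable_def split_def by measurable
  then show ?thesis
    unfolding energy_alt[abs_def] by (rule lborel.borel_measurable_nn_integral)
qed

lemma energy_add_le:
  assumes "jointly_measurable t H" "jointly_measurable t G" "\<omega> \<in> space M"
  shows "energy t (\<lambda>s \<omega>. H s \<omega> + G s \<omega>) \<omega> \<le> 2 * energy t H \<omega> + 2 * energy t G \<omega>"
proof -
  note [measurable] = path_measurable[OF assms(1,3)] path_measurable[OF assms(2,3)]
  have "energy t (\<lambda>s \<omega>. H s \<omega> + G s \<omega>) \<omega>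
      \<le> (\<integral>\<^sup>+s. (2 * ennreal ((indicator {0..t} s * H s \<omega>)\<^sup>2)
              + 2 * ennreal ((indicator {0..t} s * G s \<omega>)\<^sup>2)) \<partial>lborel)"
    unfolding energy_alt
  proof (rule nn_integral_mono)
    fix s
    define a b where "a = indicator {0..t} s * H s \<omega>" and "b = indicator {0..t} s * G s \<omega>"
    have "(indicator {0..t} s * (H s \<omega> + G s \<omega>))\<^sup>2 = (a + b)\<^sup>2"
      by (simp add: a_def b_def algebra_simps)
    also have "\<dots> \<le> 2 * a\<^sup>2 + 2 * b\<^sup>2"
      using sum_squares_bound[of a b] by (simp add: power2_sum)
    finally have "ennreal ((indicator {0..t} s * (H s \<omega> + G s \<omega>))\<^sup>2) \<le> ennreal (2 * a\<^sup>2 + 2 * b\<^sup>2)"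
      by (rule ennreal_leI)
    also have "\<dots> = 2 * ennreal (a\<^sup>2) + 2 * ennreal (b\<^sup>2)"
      by (simp add: ennreal_plus ennreal_mult')
    finally show "ennreal ((indicator {0..t} s * (H s \<omega> + G s \<omega>))\<^sup>2)
      \<le> 2 * ennreal ((indicator {0..t} s * H s \<omega>)\<^sup>2) + 2 * ennreal ((indicator {0..t} s * G s \<omega>)\<^sup>2)"
      unfolding a_def b_def .
  qed
  also have "\<dots> = 2 * energy t H \<omega> + 2 * energy t G \<omega>"
    unfolding energy_alt by (simp add: nn_integral_add nn_integral_cmult)
  finally show ?thesis .
qed

lemma energy_scale:
  assumes "jointly_measurable t H" "\<omega> \<in> space M"
  shows "energy t (\<lambda>s \<omega>. a * H s \<omega>) \<omega> = ennreal (a\<^sup>2) * energy t H \<omega>"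
proof -
  note [measurable] = path_measurable[OF assms]
  have "(indicator {0..t} s * (a * H s \<omega>))\<^sup>2 = a\<^sup>2 * (indicator {0..t} s * H s \<omega>)\<^sup>2" for s
    by (simp add: power_mult_distrib)
  then show ?thesis
    unfolding energy_alt by (simp only: ennreal_mult' zero_le_power2) (simp add: nn_integral_cmult)
qed

lemma energy_cong:
  "(\<And>s. 0 \<le> s \<Longrightarrow> s \<le> t \<Longrightarrow> H s \<omega> = G s \<omega>) \<Longrightarrow> energy t H \<omega> = energy t G \<omega>"
  unfolding energy_def by (intro nn_integral_cong) (auto simp: indicator_def)

end

section \<open>Ito integrals as limits in probability\<close>

lemma ennreal_quadruple: "0 \<le> x \<Longrightarrow> 2 * ennreal x + 2 * ennreal x = ennreal (4 * x)"
  by (simp add: ennreal_mult' flip: distrib_right)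

context brownian
begin

text \<open>
  Integrands are compared in \<open>L\<^sup>2[0, t]\<close> and integrals as random variables, both in probability and with one
  common \<open>\<epsilon>\<close>. This turns limits into applications of a triangle inequality.
\<close>

definition ito_close ::
    "real \<Rightarrow> real \<Rightarrow> (real \<Rightarrow> 'a \<Rightarrow> real) \<Rightarrow> ('a \<Rightarrow> real) \<Rightarrow> (real \<Rightarrow> 'a \<Rightarrow> real) \<Rightarrow> ('a \<Rightarrow> real) \<Rightarrow> bool" where
  "ito_close \<epsilon> t H Y H' Y' \<longleftrightarrow>
     prob {\<omega> \<in> space M. ennreal \<epsilon> < energy t (\<lambda>s \<omega>. H s \<omega> - H' s \<omega>) \<omega>} \<le> \<epsilon> \<and>
     prob {\<omega> \<in> space M. \<epsilon> < \<bar>Y \<omega> - Y' \<omega>\<bar>} \<le> \<epsilon>"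

text \<open>
  The closure of the pairs of a simple process and its integral. The simple processes are
  dense by definition, so that uniqueness, linearity and all bounds reduce to statements about finite sums.
\<close>

definition ito_lim :: "(real \<Rightarrow> 'a \<Rightarrow> real) \<Rightarrow> real \<Rightarrow> ('a \<Rightarrow> real) \<Rightarrow> bool" where
  "ito_lim H t Y \<longleftrightarrow> t \<in> I \<and> jointly_measurable t H \<and> Y \<in> borel_measurable M \<and>
     (\<forall>\<epsilon>>0. \<exists>n \<tau> \<xi>. is_simple F t n \<tau> \<xi> \<and>
        ito_close \<epsilon> t (simple_process n \<tau> \<xi>) (simple_integral B n \<tau> \<xi>) H Y)"

lemma simple_integral_measurable:
  assumes "is_simple F t n \<tau> \<xi>" "t \<in> I"
  shows "simple_integral B n \<tau> \<xi> \<in> borel_measurable M"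
  unfolding simple_integral_def
proof (rule borel_measurable_sum)
  fix i assume i: "i \<in> {..<n}"
  then have "\<xi> i \<in> borel_measurable (F (\<tau> i))" "\<tau> i \<in> I" "\<tau> (Suc i) \<in> I"
    using assms(1) is_simple_times(2)[OF assms] by (auto simp: is_simple_def)
  moreover from this have [measurable]: "\<xi> i \<in> borel_measurable M" by (intro measurable_F_M)
  ultimately show "(\<lambda>\<omega>. \<xi> i \<omega> * (B (\<tau> (Suc i)) \<omega> - B (\<tau> i) \<omega>)) \<in> borel_measurable M" by measurable
qed

lemma ito_lim_jm: "ito_lim H t Y \<Longrightarrow> jointly_measurable t H"
  and ito_lim_measurable: "ito_lim H t Y \<Longrightarrow> Y \<in> borel_measurable M"
  and ito_lim_time: "ito_lim H t Y \<Longrightarrow> t \<in> I"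
  by (auto simp: ito_lim_def)

lemma ito_lim_simple_bounded:
  assumes "is_simple F t n \<tau> \<xi>" "t \<in> I"
  shows "ito_lim (simple_process n \<tau> \<xi>) t (simple_integral B n \<tau> \<xi>)"
  unfolding ito_lim_def
  using assms jointly_measurable_simple[OF assms(1)] simple_integral_measurable[OF assms]
  by (auto intro!: exI[of _ n] exI[of _ \<tau>] exI[of _ \<xi>] simp: energy_def ito_close_def)

text \<open>
  The constant 4 comes from \<open>(x + y)\<^sup>2 \<le> 2 x\<^sup>2 + 2 y\<^sup>2\<close>. If the two given differences share a middle term, this is the
  triangle inequality; for two unrelated approximations it is compatibility with sums.
\<close>

lemma ito_close_sum:
  assumes jm: "jointly_measurable t (\<lambda>s \<omega>. H1 s \<omega> - G1 s \<omega>)" "jointly_measurable t (\<lambda>s \<omega>. H2 s \<omega> - G2 s \<omega>)"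
    and [measurable]: "Y1 \<in> borel_measurable M" "Z1 \<in> borel_measurable M"
      "Y2 \<in> borel_measurable M" "Z2 \<in> borel_measurable M"
    and close: "ito_close (\<epsilon> / 4) t H1 Y1 G1 Z1" "ito_close (\<epsilon> / 4) t H2 Y2 G2 Z2"
    and H: "\<And>s \<omega>. H s \<omega> - G s \<omega> = (H1 s \<omega> - G1 s \<omega>) + (H2 s \<omega> - G2 s \<omega>)"
    and Y: "\<And>\<omega>. Y \<omega> - Z \<omega> = (Y1 \<omega> - Z1 \<omega>) + (Y2 \<omega> - Z2 \<omega>)"
    and \<epsilon>: "0 < \<epsilon>"
  shows "ito_close \<epsilon> t H Y G Z"
proof -
  let ?E = "\<lambda>H G. energy t (\<lambda>s \<omega>. H s \<omega> - G s \<omega>)"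
  note [measurable] = energy_measurable[OF jm(1)] energy_measurable[OF jm(2)]
  have "prob {\<omega> \<in> space M. ennreal \<epsilon> < ?E H G \<omega>}
      \<le> prob {\<omega> \<in> space M. ennreal (\<epsilon> / 4) < ?E H1 G1 \<omega>} + prob {\<omega> \<in> space M. ennreal (\<epsilon> / 4) < ?E H2 G2 \<omega>}"
  proof (rule prob_le_union)
    show "{\<omega> \<in> space M. ennreal \<epsilon> < ?E H G \<omega>}
      \<subseteq> {\<omega> \<in> space M. ennreal (\<epsilon> / 4) < ?E H1 G1 \<omega>} \<union> {\<omega> \<in> space M. ennreal (\<epsilon> / 4) < ?E H2 G2 \<omega>}"
    proof (rule subsetI, rule ccontr)
      fix \<omega> assume *: "\<omega> \<in> {\<omega> \<in> space M. ennreal \<epsilon> < ?E H G \<omega>}"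
        "\<omega> \<notin> {\<omega> \<in> space M. ennreal (\<epsilon> / 4) < ?E H1 G1 \<omega>} \<union> {\<omega> \<in> space M. ennreal (\<epsilon> / 4) < ?E H2 G2 \<omega>}"
      then have \<omega>: "\<omega> \<in> space M" by simp
      have "?E H G \<omega> \<le> 2 * ?E H1 G1 \<omega> + 2 * ?E H2 G2 \<omega>"
        unfolding H by (rule energy_add_le[OF jm \<omega>])
      also have "\<dots> \<le> 2 * ennreal (\<epsilon> / 4) + 2 * ennreal (\<epsilon> / 4)"
        using * by (intro add_mono mult_left_mono) auto
      also have "\<dots> = ennreal \<epsilon>"
        using \<epsilon> ennreal_quadruple[of "\<epsilon> / 4"] by simp
      finally show False using * by (simp add: not_le[symmetric])
    qed
  qed measurable
  moreover have "prob {\<omega> \<in> space M. \<epsilon> < \<bar>Y \<omega> - Z \<omega>\<bar>}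
      \<le> prob {\<omega> \<in> space M. \<epsilon> / 4 < \<bar>Y1 \<omega> - Z1 \<omega>\<bar>} + prob {\<omega> \<in> space M. \<epsilon> / 4 < \<bar>Y2 \<omega> - Z2 \<omega>\<bar>}"
  proof (rule prob_le_union)
    show "{\<omega> \<in> space M. \<epsilon> < \<bar>Y \<omega> - Z \<omega>\<bar>}
      \<subseteq> {\<omega> \<in> space M. \<epsilon> / 4 < \<bar>Y1 \<omega> - Z1 \<omega>\<bar>} \<union> {\<omega> \<in> space M. \<epsilon> / 4 < \<bar>Y2 \<omega> - Z2 \<omega>\<bar>}"
      unfolding Y using \<epsilon> by (auto simp: abs_if split: if_splits)
  qed measurable
  ultimately show ?thesis using close \<epsilon> unfolding ito_close_def by linarith
qed

lemma ito_lim_approx: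
  assumes "ito_lim H t Y" "0 < \<epsilon>"
  obtains n \<tau> \<xi> where "is_simple F t n \<tau> \<xi>"
    "ito_close \<epsilon> t (simple_process n \<tau> \<xi>) (simple_integral B n \<tau> \<xi>) H Y"
  using assms unfolding ito_lim_def by blast

lemma ito_lim_closure:
  assumes t: "t \<in> I" and H: "jointly_measurable t H" and Y: "Y \<in> borel_measurable M"
    and approx: "\<And>\<epsilon>. 0 < \<epsilon> \<Longrightarrow> \<exists>H' Y'. ito_lim H' t Y' \<and> ito_close \<epsilon> t H' Y' H Y"
  shows "ito_lim H t Y"
  unfolding ito_lim_def
proof (intro conjI allI impI)
  fix \<epsilon> :: real assume \<epsilon>: "0 < \<epsilon>"
  then have \<epsilon>4: "0 < \<epsilon> / 4" by simp
  then obtain H' Y' where 1: "ito_lim H' t Y'" "ito_close (\<epsilon> / 4) t H' Y' H Y"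
    using approx by blast
  obtain n \<tau> \<xi> where 2: "is_simple F t n \<tau> \<xi>"
      "ito_close (\<epsilon> / 4) t (simple_process n \<tau> \<xi>) (simple_integral B n \<tau> \<xi>) H' Y'"
    by (rule ito_lim_approx[OF 1(1) \<epsilon>4])
  note H' = ito_lim_jm[OF 1(1)]
  have "ito_close \<epsilon> t (simple_process n \<tau> \<xi>) (simple_integral B n \<tau> \<xi>) H Y"
    by (rule ito_close_sum[OF jointly_measurable_arith(2)[OF jointly_measurable_simple[OF 2(1)] H']
          jointly_measurable_arith(2)[OF H' H] simple_integral_measurable[OF 2(1) t]
          ito_lim_measurable[OF 1(1)] ito_lim_measurable[OF 1(1)] Y 2(2) 1(2) _ _ \<epsilon>]) auto
  then show "\<exists>n \<tau> \<xi>. is_simple F t n \<tau> \<xi> \<and>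
      ito_close \<epsilon> t (simple_process n \<tau> \<xi>) (simple_integral B n \<tau> \<xi>) H Y"
    using 2(1) by blast
qed (use t H Y in auto)

lemma ito_lim_cong:
  assumes 1: "ito_lim H t Y" and H': "jointly_measurable t H'" and Y': "Y' \<in> borel_measurable M"
    and eq: "\<And>\<omega>. \<omega> \<in> space M \<Longrightarrow> energy t (\<lambda>s \<omega>. H s \<omega> - H' s \<omega>) \<omega> = 0"
    and Y: "AE \<omega> in M. Y \<omega> = Y' \<omega>"
  shows "ito_lim H' t Y'"
proof (rule ito_lim_closure[OF ito_lim_time[OF 1] H' Y'])
  fix \<epsilon> :: real assume \<epsilon>: "0 < \<epsilon>"
  note [measurable] = Y' ito_lim_measurable[OF 1]
  have "prob {\<omega> \<in> space M. ennreal \<epsilon> < energy t (\<lambda>s \<omega>. H s \<omega> - H' s \<omega>) \<omega>} = prob {}"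
    using eq by (intro arg_cong[where f = prob]) auto
  moreover have "prob {\<omega> \<in> space M. \<epsilon> < \<bar>Y \<omega> - Y' \<omega>\<bar>} = prob {}"
    using Y \<epsilon> by (intro measure_eq_AE) (auto elim!: eventually_mono)
  ultimately show "\<exists>H'' Y''. ito_lim H'' t Y'' \<and> ito_close \<epsilon> t H'' Y'' H' Y'"
    unfolding ito_close_def using 1 \<epsilon> by (intro exI[of _ H] exI[of _ Y]) auto
qed

lemma ito_lim_cong':
  assumes "ito_lim H t Y" "\<And>s \<omega>. 0 \<le> s \<Longrightarrow> s \<le> t \<Longrightarrow> \<omega> \<in> space M \<Longrightarrow> H s \<omega> = H' s \<omega>"
    "Y' \<in> borel_measurable M" "AE \<omega> in M. Y \<omega> = Y' \<omega>"
  shows "ito_lim H' t Y'"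
proof (rule ito_lim_cong[OF assms(1)])
  show "jointly_measurable t H'"
    by (rule jointly_measurable_cong[OF ito_lim_jm[OF assms(1)]]) (use assms(2) in auto)
  fix \<omega> assume "\<omega> \<in> space M"
  then have "energy t (\<lambda>s \<omega>. H s \<omega> - H' s \<omega>) \<omega> = energy t (\<lambda>s \<omega>. 0) \<omega>"
    using assms(2) by (intro energy_cong) auto
  then show "energy t (\<lambda>s \<omega>. H s \<omega> - H' s \<omega>) \<omega> = 0" by (simp add: energy_def)
qed (use assms in auto)

lemma ito_lim_add:
  assumes 1: "ito_lim H t Y" and 2: "ito_lim H' t Y'"
  shows "ito_lim (\<lambda>s \<omega>. H s \<omega> + H' s \<omega>) t (\<lambda>\<omega>. Y \<omega> + Y' \<omega>)"
  unfolding ito_lim_def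
proof (intro conjI allI impI)
  note t = ito_lim_time[OF 1]
  note H = ito_lim_jm[OF 1] ito_lim_jm[OF 2]
    and [measurable] = ito_lim_measurable[OF 1] ito_lim_measurable[OF 2]
  show "t \<in> I" by (rule t)
  show "jointly_measurable t (\<lambda>s \<omega>. H s \<omega> + H' s \<omega>)" using H by (rule jointly_measurable_arith)
  show "(\<lambda>\<omega>. Y \<omega> + Y' \<omega>) \<in> borel_measurable M" by measurable
  fix \<epsilon> :: real assume \<epsilon>: "0 < \<epsilon>"
  then have \<epsilon>4: "0 < \<epsilon> / 4" by simp
  obtain n \<tau> \<xi> where s1: "is_simple F t n \<tau> \<xi>"
      "ito_close (\<epsilon> / 4) t (simple_process n \<tau> \<xi>) (simple_integral B n \<tau> \<xi>) H Y"
    by (rule ito_lim_approx[OF 1 \<epsilon>4])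
  obtain n' \<tau>' \<xi>' where s2: "is_simple F t n' \<tau>' \<xi>'"
      "ito_close (\<epsilon> / 4) t (simple_process n' \<tau>' \<xi>') (simple_integral B n' \<tau>' \<xi>') H' Y'"
    by (rule ito_lim_approx[OF 2 \<epsilon>4])
  obtain m \<rho> \<zeta> where s: "is_simple F t m \<rho> \<zeta>"
    "\<And>s \<omega>. simple_process m \<rho> \<zeta> s \<omega> = simple_process n \<tau> \<xi> s \<omega> + simple_process n' \<tau>' \<xi>' s \<omega>"
    "\<And>\<omega>. simple_integral B m \<rho> \<zeta> \<omega> = simple_integral B n \<tau> \<xi> \<omega> + simple_integral B n' \<tau>' \<xi>' \<omega>"
    by (rule add_simple[OF s1(1) s2(1) t]) blast
  have "ito_close \<epsilon> t (simple_process m \<rho> \<zeta>) (simple_integral B m \<rho> \<zeta>)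
      (\<lambda>s \<omega>. H s \<omega> + H' s \<omega>) (\<lambda>\<omega>. Y \<omega> + Y' \<omega>)"
    by (rule ito_close_sum[OF jointly_measurable_arith(2)[OF jointly_measurable_simple[OF s1(1)] H(1)]
          jointly_measurable_arith(2)[OF jointly_measurable_simple[OF s2(1)] H(2)]
          simple_integral_measurable[OF s1(1) t] ito_lim_measurable[OF 1]
          simple_integral_measurable[OF s2(1) t] ito_lim_measurable[OF 2] s1(2) s2(2) _ _ \<epsilon>]) (auto simp: s)
  then show "\<exists>n \<tau> \<xi>. is_simple F t n \<tau> \<xi> \<and>
      ito_close \<epsilon> t (simple_process n \<tau> \<xi>) (simple_integral B n \<tau> \<xi>)
        (\<lambda>s \<omega>. H s \<omega> + H' s \<omega>) (\<lambda>\<omega>. Y \<omega> + Y' \<omega>)"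
    using s(1) by blast
qed

lemma ito_lim_scale:
  assumes 1: "ito_lim H t Y"
  shows "ito_lim (\<lambda>s \<omega>. c * H s \<omega>) t (\<lambda>\<omega>. c * Y \<omega>)"
  unfolding ito_lim_def
proof (intro conjI allI impI)
  note t = ito_lim_time[OF 1] and H = ito_lim_jm[OF 1] and [measurable] = ito_lim_measurable[OF 1]
  show "t \<in> I" by (rule t)
  show "jointly_measurable t (\<lambda>s \<omega>. c * H s \<omega>)" by (rule jointly_measurable_arith(4)[OF H H])
  show "(\<lambda>\<omega>. c * Y \<omega>) \<in> borel_measurable M" by measurable
  fix \<epsilon> :: real assume \<epsilon>: "0 < \<epsilon>"
  define \<delta> where "\<delta> = \<epsilon> / (1 + \<bar>c\<bar>)\<^sup>2"
  have \<delta>: "0 < \<delta>" using \<epsilon> by (auto simp: \<delta>_def intro!: divide_pos_pos)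
  have c1: "1 \<le> (1 + \<bar>c\<bar>)\<^sup>2" by (simp add: power2_eq_square algebra_simps)
  have c2: "c\<^sup>2 \<le> (1 + \<bar>c\<bar>)\<^sup>2" and c3: "\<bar>c\<bar> \<le> (1 + \<bar>c\<bar>)\<^sup>2"
    by (simp_all add: power2_eq_square algebra_simps)
  have \<epsilon>_eq: "\<epsilon> = (1 + \<bar>c\<bar>)\<^sup>2 * \<delta>" using c1 by (auto simp: \<delta>_def)
  have b: "\<delta> \<le> \<epsilon>" "c\<^sup>2 * \<delta> \<le> \<epsilon>" "\<bar>c\<bar> * \<delta> \<le> \<epsilon>"
    using mult_right_mono[OF c1, of \<delta>] mult_right_mono[OF c2, of \<delta>] mult_right_mono[OF c3, of \<delta>] \<delta>
    by (auto simp: \<epsilon>_eq)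
  obtain n \<tau> \<xi> where s: "is_simple F t n \<tau> \<xi>"
      "ito_close \<delta> t (simple_process n \<tau> \<xi>) (simple_integral B n \<tau> \<xi>) H Y"
    by (rule ito_lim_approx[OF 1 \<delta>])
  let ?\<xi> = "\<lambda>i \<omega>. c * \<xi> i \<omega>"
  have P: "simple_process n \<tau> ?\<xi> u \<omega> = c * simple_process n \<tau> \<xi> u \<omega>" for u \<omega>
    by (simp only: simple_process_def sum_distrib_left mult.assoc)
  have S: "simple_integral B n \<tau> ?\<xi> \<omega> = c * simple_integral B n \<tau> \<xi> \<omega>" for \<omega>
    by (simp add: simple_integral_def sum_distrib_left mult.assoc)
  have "is_simple F t n \<tau> ?\<xi>"
    unfolding is_simple_def
  proof (intro conjI allI impI)
    fix i assume i: "i < n"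
    show "?\<xi> i \<in> borel_measurable (F (\<tau> i))"
      using s(1) i by (auto simp: is_simple_def)
    obtain K where "\<forall>\<omega>\<in>space M. \<bar>\<xi> i \<omega>\<bar> \<le> K"
      using s(1) i unfolding is_simple_def space_F by blast
    then have "\<forall>\<omega>\<in>space M. \<bar>?\<xi> i \<omega>\<bar> \<le> \<bar>c\<bar> * K"
      by (auto simp: abs_mult intro: mult_left_mono)
    then show "\<exists>K. \<forall>\<omega>\<in>space (F (\<tau> i)). \<bar>?\<xi> i \<omega>\<bar> \<le> K" unfolding space_F by blast
  qed (use s in \<open>auto simp: is_simple_def\<close>)
  moreover note jm = jointly_measurable_arith(2)[OF jointly_measurable_simple[OF s(1)] H]
  note [measurable] = energy_measurable[OF jm] simple_integral_measurable[OF s(1) t]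
  have "prob {\<omega> \<in> space M. ennreal \<epsilon> < energy t (\<lambda>s \<omega>. simple_process n \<tau> ?\<xi> s \<omega> - c * H s \<omega>) \<omega>}
      \<le> prob {\<omega> \<in> space M. ennreal \<delta> < energy t (\<lambda>s \<omega>. simple_process n \<tau> \<xi> s \<omega> - H s \<omega>) \<omega>}"
  proof (rule finite_measure_mono, safe)
    fix \<omega> assume \<omega>: "\<omega> \<in> space M"
      "ennreal \<epsilon> < energy t (\<lambda>s \<omega>. simple_process n \<tau> ?\<xi> s \<omega> - c * H s \<omega>) \<omega>"
    show "ennreal \<delta> < energy t (\<lambda>s \<omega>. simple_process n \<tau> \<xi> s \<omega> - H s \<omega>) \<omega>"
    proof (rule ccontr)
      assume "\<not> ennreal \<delta> < energy t (\<lambda>s \<omega>. simple_process n \<tau> \<xi> s \<omega> - H s \<omega>) \<omega>"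
      then have "energy t (\<lambda>s \<omega>. c * (simple_process n \<tau> \<xi> s \<omega> - H s \<omega>)) \<omega> \<le> ennreal (c\<^sup>2) * ennreal \<delta>"
        unfolding energy_scale[OF jm \<omega>(1)] by (intro mult_left_mono) auto
      also have "\<dots> = ennreal (c\<^sup>2 * \<delta>)" using \<delta> by (simp add: ennreal_mult')
      also have "\<dots> \<le> ennreal \<epsilon>" using b by (intro ennreal_leI)
      finally show False using \<omega>(2) unfolding P by (simp add: right_diff_distrib not_le[symmetric])
    qed
  qed measurable
  moreover have "prob {\<omega> \<in> space M. \<epsilon> < \<bar>simple_integral B n \<tau> ?\<xi> \<omega> - c * Y \<omega>\<bar>}
      \<le> prob {\<omega> \<in> space M. \<delta> < \<bar>simple_integral B n \<tau> \<xi> \<omega> - Y \<omega>\<bar>}"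
  proof (rule finite_measure_mono, safe)
    fix \<omega> assume \<omega>: "\<epsilon> < \<bar>simple_integral B n \<tau> ?\<xi> \<omega> - c * Y \<omega>\<bar>"
    show "\<delta> < \<bar>simple_integral B n \<tau> \<xi> \<omega> - Y \<omega>\<bar>"
    proof (rule ccontr)
      assume "\<not> \<delta> < \<bar>simple_integral B n \<tau> \<xi> \<omega> - Y \<omega>\<bar>"
      then have "\<bar>c\<bar> * \<bar>simple_integral B n \<tau> \<xi> \<omega> - Y \<omega>\<bar> \<le> \<bar>c\<bar> * \<delta>"
        by (intro mult_left_mono) auto
      then show False using \<omega> b unfolding S
        by (simp add: right_diff_distrib[symmetric] abs_mult del: right_diff_distrib)
    qed
  qed measurable
  ultimately show "\<exists>n \<tau> \<xi>. is_simple F t n \<tau> \<xi> \<and>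
      ito_close \<epsilon> t (simple_process n \<tau> \<xi>) (simple_integral B n \<tau> \<xi>) (\<lambda>s \<omega>. c * H s \<omega>) (\<lambda>\<omega>. c * Y \<omega>)"
    unfolding ito_close_def
    using s b by (intro exI[of _ n] exI[of _ \<tau>] exI[of _ ?\<xi>]) (auto simp: ito_close_def)
qed

lemma ito_lim_diff:
  assumes "ito_lim H t Y" "ito_lim H' t Y'"
  shows "ito_lim (\<lambda>s \<omega>. H s \<omega> - H' s \<omega>) t (\<lambda>\<omega>. Y \<omega> - Y' \<omega>)"
  using ito_lim_add[OF assms(1) ito_lim_scale[OF assms(2), of "-1"]] by simp

lemma ito_lim_sum:
  assumes t: "t \<in> I" and "\<And>i. i < (k::nat) \<Longrightarrow> ito_lim (H i) t (Y i)"
  shows "ito_lim (\<lambda>s \<omega>. \<Sum>i<k. H i s \<omega>) t (\<lambda>\<omega>. \<Sum>i<k. Y i \<omega>)"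
  using assms(2)
proof (induction k)
  case 0
  have "is_simple F t 1 (\<lambda>i. if i = 0 then 0 else t) (\<lambda>_ _. 0)"
    using nonneg[OF t] by (auto simp: is_simple_def)
  from ito_lim_simple_bounded[OF this t] show ?case
    by (simp add: simple_process_def[abs_def] simple_integral_def[abs_def])
next
  case (Suc k)
  then show ?case using ito_lim_add[OF Suc.IH, of "H k" "Y k"] by simp
qed

text \<open>
  The stopping argument survives the passage to the limit: where \<open>H\<close> has energy at most \<open>\<delta>\<close>, a good simple
  approximation has energy at most \<open>4 \<delta>\<close>.
\<close>

lemma ito_lim_stopped:
  assumes 1: "ito_lim H t Y" and \<delta>: "0 < \<delta>" and \<epsilon>: "0 < \<epsilon>"
  obtains Z where "Z \<in> borel_measurable M" "(\<integral>\<^sup>+\<omega>. ennreal ((Z \<omega>)\<^sup>2) \<partial>M) \<le> ennreal (4 * \<delta>)"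
    "prob {\<omega> \<in> space M. energy t H \<omega> \<le> ennreal \<delta> \<and> \<epsilon> < \<bar>Z \<omega> - Y \<omega>\<bar>} \<le> \<epsilon>"
proof -
  define \<eta> where "\<eta> = min (\<epsilon> / 2) \<delta>"
  have \<eta>: "0 < \<eta>" "\<eta> \<le> \<epsilon> / 2" "\<eta> \<le> \<delta>" using \<delta> \<epsilon> by (auto simp: \<eta>_def)
  note t = ito_lim_time[OF 1] and H = ito_lim_jm[OF 1] and [measurable] = ito_lim_measurable[OF 1]
  obtain n \<tau> \<xi> where s: "is_simple F t n \<tau> \<xi>"
      "ito_close \<eta> t (simple_process n \<tau> \<xi>) (simple_integral B n \<tau> \<xi>) H Y"
    by (rule ito_lim_approx[OF 1 \<eta>(1)])
  obtain Z where Z: "Z \<in> borel_measurable M" "(\<integral>\<^sup>+\<omega>. ennreal ((Z \<omega>)\<^sup>2) \<partial>M) \<le> ennreal (4 * \<delta>)"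
    "\<And>\<omega>. \<omega> \<in> space M \<Longrightarrow> (\<Sum>i<n. (\<xi> i \<omega>)\<^sup>2 * (\<tau> (Suc i) - \<tau> i)) \<le> 4 * \<delta> \<Longrightarrow>
       simple_integral B n \<tau> \<xi> \<omega> = Z \<omega>"
    by (rule stopped_simple_integral[OF s(1) t, of "4 * \<delta>"]) (use \<delta> in auto)
  note jm = jointly_measurable_arith(2)[OF jointly_measurable_simple[OF s(1)] H]
  note [measurable] = energy_measurable[OF jm] simple_integral_measurable[OF s(1) t]
    energy_measurable[OF H] Z(1)
  have "prob {\<omega> \<in> space M. energy t H \<omega> \<le> ennreal \<delta> \<and> \<epsilon> < \<bar>Z \<omega> - Y \<omega>\<bar>}
      \<le> prob {\<omega> \<in> space M. ennreal \<eta> < energy t (\<lambda>s \<omega>. simple_process n \<tau> \<xi> s \<omega> - H s \<omega>) \<omega>}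
        + prob {\<omega> \<in> space M. \<eta> < \<bar>simple_integral B n \<tau> \<xi> \<omega> - Y \<omega>\<bar>}"
  proof (rule prob_le_union)
    show "{\<omega> \<in> space M. energy t H \<omega> \<le> ennreal \<delta> \<and> \<epsilon> < \<bar>Z \<omega> - Y \<omega>\<bar>}
      \<subseteq> {\<omega> \<in> space M. ennreal \<eta> < energy t (\<lambda>s \<omega>. simple_process n \<tau> \<xi> s \<omega> - H s \<omega>) \<omega>}
        \<union> {\<omega> \<in> space M. \<eta> < \<bar>simple_integral B n \<tau> \<xi> \<omega> - Y \<omega>\<bar>}"
    proof safe
      fix \<omega> assume \<omega>: "\<omega> \<in> space M" "energy t H \<omega> \<le> ennreal \<delta>" "\<epsilon> < \<bar>Z \<omega> - Y \<omega>\<bar>"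
        "\<not> \<eta> < \<bar>simple_integral B n \<tau> \<xi> \<omega> - Y \<omega>\<bar>"
      show "ennreal \<eta> < energy t (\<lambda>s \<omega>. simple_process n \<tau> \<xi> s \<omega> - H s \<omega>) \<omega>"
      proof (rule ccontr)
        assume a: "\<not> ennreal \<eta> < energy t (\<lambda>s \<omega>. simple_process n \<tau> \<xi> s \<omega> - H s \<omega>) \<omega>"
        have "energy t (simple_process n \<tau> \<xi>) \<omega>
            \<le> 2 * energy t (\<lambda>s \<omega>. simple_process n \<tau> \<xi> s \<omega> - H s \<omega>) \<omega> + 2 * energy t H \<omega>"
          using energy_add_le[OF jm H \<omega>(1)] by simp
        also have "\<dots> \<le> 2 * ennreal \<delta> + 2 * ennreal \<delta>"
          using \<omega> a \<eta>(3) by (intro add_mono mult_left_mono) (auto simp: not_less intro: order_trans ennreal_leI)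
        also have "\<dots> = ennreal (4 * \<delta>)"
          using \<delta> ennreal_quadruple[of \<delta>] by simp
        finally have "(\<Sum>i<n. (\<xi> i \<omega>)\<^sup>2 * (\<tau> (Suc i) - \<tau> i)) \<le> 4 * \<delta>"
          unfolding energy_simple_process[OF s(1) t] using \<delta> by (subst (asm) ennreal_le_iff) auto
        then have "simple_integral B n \<tau> \<xi> \<omega> = Z \<omega>" using Z(3) \<omega>(1) by blast
        then show False using \<omega> \<eta> by auto
      qed
    qed
  qed measurable
  then show ?thesis using that[OF Z(1,2)] s \<eta> unfolding ito_close_def by auto
qed

lemma prob_second_moment_le:
  assumes [measurable]: "Z \<in> borel_measurable M"
    and Z: "(\<integral>\<^sup>+\<omega>. ennreal ((Z \<omega>)\<^sup>2) \<partial>M) \<le> ennreal c" and c: "0 \<le> c" and \<epsilon>: "0 < \<epsilon>"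
  shows "prob {\<omega> \<in> space M. \<epsilon> \<le> \<bar>Z \<omega>\<bar>} \<le> c / \<epsilon>\<^sup>2"
proof -
  have "ennreal (\<epsilon>\<^sup>2) * emeasure M {\<omega> \<in> space M. \<epsilon> \<le> \<bar>Z \<omega>\<bar>}
      = (\<integral>\<^sup>+\<omega>. ennreal (\<epsilon>\<^sup>2) * indicator {\<omega> \<in> space M. \<epsilon> \<le> \<bar>Z \<omega>\<bar>} \<omega> \<partial>M)"
    by (subst nn_integral_cmult_indicator) auto
  also have "\<dots> \<le> (\<integral>\<^sup>+\<omega>. ennreal ((Z \<omega>)\<^sup>2) \<partial>M)"
  proof (rule nn_integral_mono)
    fix \<omega>
    show "ennreal (\<epsilon>\<^sup>2) * indicator {\<omega> \<in> space M. \<epsilon> \<le> \<bar>Z \<omega>\<bar>} \<omega> \<le> ennreal ((Z \<omega>)\<^sup>2)"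
      using \<epsilon> power_mono[of \<epsilon> "\<bar>Z \<omega>\<bar>" 2] by (auto simp: indicator_def intro!: ennreal_leI)
  qed
  finally have "ennreal (\<epsilon>\<^sup>2 * prob {\<omega> \<in> space M. \<epsilon> \<le> \<bar>Z \<omega>\<bar>}) \<le> ennreal c"
    using order_trans[OF _ Z] by (simp add: emeasure_eq_measure ennreal_mult')
  then show ?thesis using \<epsilon> c by (simp add: field_simps)
qed

text \<open>
  A form of Lenglart's inequality; it is Chebyshev's inequality for the stopped approximations.
\<close>

lemma ito_lim_tail_bound:
  assumes 1: "ito_lim H t Y" and \<delta>: "0 < \<delta>" and \<epsilon>: "0 < \<epsilon>"
  shows "prob {\<omega> \<in> space M. \<epsilon> < \<bar>Y \<omega>\<bar>}
    \<le> prob {\<omega> \<in> space M. ennreal \<delta> < energy t H \<omega>} + 16 * \<delta> / \<epsilon>\<^sup>2"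
proof (rule field_le_epsilon)
  fix \<eta>' :: real assume "0 < \<eta>'"
  define \<eta> where "\<eta> = min \<eta>' (\<epsilon> / 2)"
  have \<eta>: "0 < \<eta>" "\<eta> \<le> \<eta>'" "\<eta> \<le> \<epsilon> / 2" using \<open>0 < \<eta>'\<close> \<epsilon> by (auto simp: \<eta>_def)
  obtain Z where Z: "Z \<in> borel_measurable M" "(\<integral>\<^sup>+\<omega>. ennreal ((Z \<omega>)\<^sup>2) \<partial>M) \<le> ennreal (4 * \<delta>)"
    "prob {\<omega> \<in> space M. energy t H \<omega> \<le> ennreal \<delta> \<and> \<eta> < \<bar>Z \<omega> - Y \<omega>\<bar>} \<le> \<eta>"
    by (rule ito_lim_stopped[OF 1 \<delta> \<eta>(1)])
  note [measurable] = Z(1) ito_lim_measurable[OF 1] energy_measurable[OF ito_lim_jm[OF 1]]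
  have "prob {\<omega> \<in> space M. \<epsilon> < \<bar>Y \<omega>\<bar>} \<le> prob {\<omega> \<in> space M. ennreal \<delta> < energy t H \<omega>}
      + prob {\<omega> \<in> space M. energy t H \<omega> \<le> ennreal \<delta> \<and> \<eta> < \<bar>Z \<omega> - Y \<omega>\<bar>}
      + prob {\<omega> \<in> space M. \<epsilon> / 2 \<le> \<bar>Z \<omega>\<bar>}"
    by (rule prob_le_union3) (use \<eta> in \<open>auto simp: not_less\<close>)
  moreover have "prob {\<omega> \<in> space M. \<epsilon> / 2 \<le> \<bar>Z \<omega>\<bar>} \<le> (4 * \<delta>) / (\<epsilon> / 2)\<^sup>2"
    using \<delta> \<epsilon> by (intro prob_second_moment_le Z) auto
  moreover have "(4 * \<delta>) / (\<epsilon> / 2)\<^sup>2 = 16 * \<delta> / \<epsilon>\<^sup>2" by (simp add: power_divide)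
  ultimately show "prob {\<omega> \<in> space M. \<epsilon> < \<bar>Y \<omega>\<bar>}
      \<le> prob {\<omega> \<in> space M. ennreal \<delta> < energy t H \<omega>} + 16 * \<delta> / \<epsilon>\<^sup>2 + \<eta>'"
    using Z(3) \<eta> by linarith
qed

text \<open>
  Approximations with errors \<open>2\<^sup>-\<^sup>k\<close> converge almost surely by the Borel--Cantelli lemma, so that Fatou's lemma
  applies to their second moments.
\<close>

lemma ito_lim_L2_bound:
  assumes 1: "ito_lim H t Y" and \<delta>: "0 < \<delta>"
    and H: "AE \<omega> in M. energy t H \<omega> \<le> ennreal \<delta>"
  shows "(\<integral>\<^sup>+\<omega>. ennreal ((Y \<omega>)\<^sup>2) \<partial>M) \<le> ennreal (4 * \<delta>)"
proof -
  define Q where "Q Z k \<longleftrightarrow> Z \<in> borel_measurable M \<and> (\<integral>\<^sup>+\<omega>. ennreal ((Z \<omega>)\<^sup>2) \<partial>M) \<le> ennreal (4 * \<delta>) \<and>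
    prob {\<omega> \<in> space M. energy t H \<omega> \<le> ennreal \<delta> \<and> (1/2) ^ k < \<bar>Z \<omega> - Y \<omega>\<bar>} \<le> (1/2) ^ k"
    for Z and k :: nat
  have "\<exists>Z. Q Z k" for k
    unfolding Q_def by (rule ito_lim_stopped[OF 1 \<delta>, of "(1/2) ^ k"]) (simp, intro exI conjI)
  then obtain Z where Q: "\<And>k. Q (Z k) k" by metis
  then have Z: "\<And>k. Z k \<in> borel_measurable M"
    "\<And>k. (\<integral>\<^sup>+\<omega>. ennreal ((Z k \<omega>)\<^sup>2) \<partial>M) \<le> ennreal (4 * \<delta>)"
    "\<And>k::nat. prob {\<omega> \<in> space M. energy t H \<omega> \<le> ennreal \<delta> \<and> (1/2) ^ k < \<bar>Z k \<omega> - Y \<omega>\<bar>} \<le> (1/2) ^ k"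
    by (auto simp: Q_def)
  note [measurable] = Z(1) ito_lim_measurable[OF 1] energy_measurable[OF ito_lim_jm[OF 1]]
  let ?A = "\<lambda>k::nat. {\<omega> \<in> space M. energy t H \<omega> \<le> ennreal \<delta> \<and> (1/2) ^ k < \<bar>Z k \<omega> - Y \<omega>\<bar>}"
  have "AE \<omega> in M. eventually (\<lambda>k. \<omega> \<in> space M - ?A k) sequentially"
  proof (rule borel_cantelli_AE1)
    show "summable (\<lambda>k. prob (?A k))"
      by (rule summable_comparison_test'[where g = "\<lambda>k. (1/2) ^ k" and N = 0])
         (use Z(3) in \<open>auto simp: summable_geometric\<close>)
  qed (auto simp: emeasure_eq_measure less_top[symmetric])
  then have conv: "AE \<omega> in M. (\<lambda>k. Z k \<omega>) \<longlonglongrightarrow> Y \<omega>"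
    using H
  proof eventually_elim
    case (elim \<omega>)
    have "(\<lambda>k. Z k \<omega> - Y \<omega>) \<longlonglongrightarrow> 0"
    proof (rule Lim_null_comparison)
      show "\<forall>\<^sub>F k in sequentially. norm (Z k \<omega> - Y \<omega>) \<le> (1/2) ^ k"
        using elim(1) by eventually_elim (use elim(2) in auto)
      show "(\<lambda>k. (1/2::real) ^ k) \<longlonglongrightarrow> 0" by (simp add: LIMSEQ_power_zero)
    qed
    then show ?case by (simp add: LIM_zero_iff)
  qed
  have "(\<integral>\<^sup>+\<omega>. ennreal ((Y \<omega>)\<^sup>2) \<partial>M) = (\<integral>\<^sup>+\<omega>. liminf (\<lambda>k. ennreal ((Z k \<omega>)\<^sup>2)) \<partial>M)"
  proof (rule nn_integral_cong_AE)
    show "AE \<omega> in M. ennreal ((Y \<omega>)\<^sup>2) = liminf (\<lambda>k. ennreal ((Z k \<omega>)\<^sup>2))"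
      using conv
    proof eventually_elim
      case (elim \<omega>)
      then have "(\<lambda>k. ennreal ((Z k \<omega>)\<^sup>2)) \<longlonglongrightarrow> ennreal ((Y \<omega>)\<^sup>2)"
        by (intro tendsto_ennrealI tendsto_power)
      then show ?case by (metis lim_imp_Liminf sequentially_bot)
    qed
  qed
  also have "\<dots> \<le> liminf (\<lambda>k. \<integral>\<^sup>+\<omega>. ennreal ((Z k \<omega>)\<^sup>2) \<partial>M)"
    by (rule nn_integral_liminf) measurable
  also have "\<dots> \<le> ennreal (4 * \<delta>)"
    using Z(2) Liminf_mono[of "\<lambda>k. \<integral>\<^sup>+\<omega>. ennreal ((Z k \<omega>)\<^sup>2) \<partial>M" "\<lambda>_. ennreal (4 * \<delta>)" sequentially]
    by (simp add: Liminf_const)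
  finally show ?thesis .
qed

lemma ito_lim_zero:
  assumes 1: "ito_lim H t Y" and H: "AE \<omega> in M. energy t H \<omega> = 0"
  shows "AE \<omega> in M. Y \<omega> = 0"
proof -
  note [measurable] = ito_lim_measurable[OF 1]
  have "(\<integral>\<^sup>+\<omega>. ennreal ((Y \<omega>)\<^sup>2) \<partial>M) \<le> 0"
  proof (rule ennreal_le_epsilon)
    fix e :: real assume "0 < e"
    moreover have "AE \<omega> in M. energy t H \<omega> \<le> ennreal (e / 4)"
      using H by eventually_elim simp
    ultimately show "(\<integral>\<^sup>+\<omega>. ennreal ((Y \<omega>)\<^sup>2) \<partial>M) \<le> 0 + ennreal e"
      using ito_lim_L2_bound[OF 1, of "e / 4"] by simp
  qed
  then have "(\<integral>\<^sup>+\<omega>. ennreal ((Y \<omega>)\<^sup>2) \<partial>M) = 0" by simp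
  then show ?thesis by (subst (asm) nn_integral_0_iff_AE) auto
qed

lemma ito_lim_unique:
  assumes "ito_lim H t Y" "ito_lim H t Y'"
  shows "AE \<omega> in M. Y \<omega> = Y' \<omega>"
  using ito_lim_zero[OF ito_lim_diff[OF assms]] by (simp add: energy_def)


lemma ito_lim_extend:
  assumes 1: "ito_lim H s Y" and t: "t \<in> I" and st: "s \<le> t"
  shows "ito_lim (\<lambda>u \<omega>. indicator {..s} u * H u \<omega>) t Y"
  unfolding ito_lim_def
proof (intro conjI allI impI t ito_lim_measurable[OF 1])
  note s = ito_lim_time[OF 1]
  have "(\<lambda>(\<omega>, u). indicator {0..t} u * (indicator {..s} u * H u \<omega>) :: real)
      = (\<lambda>(\<omega>, u). indicator {0..s} u * H u \<omega>)"
    using st by (auto simp: fun_eq_iff indicator_def)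
  then show "jointly_measurable t (\<lambda>u \<omega>. indicator {..s} u * H u \<omega>)"
    using ito_lim_jm[OF 1] unfolding jointly_measurable_def by simp
  fix \<epsilon> :: real assume "0 < \<epsilon>"
  then obtain n \<tau> \<xi> where a: "is_simple F s n \<tau> \<xi>"
      "ito_close \<epsilon> s (simple_process n \<tau> \<xi>) (simple_integral B n \<tau> \<xi>) H Y"
    by (rule ito_lim_approx[OF 1])
  define \<tau>' where "\<tau>' i = (if i \<le> n then \<tau> i else t)" for i
  define \<xi>' where "\<xi>' i = (if i < n then \<xi> i else (\<lambda>_. 0))" for i
  have P: "simple_process (Suc n) \<tau>' \<xi>' u \<omega> = simple_process n \<tau> \<xi> u \<omega>" for u \<omega>
    by (simp add: simple_process_def \<tau>'_def \<xi>'_def)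
  have S: "simple_integral B (Suc n) \<tau>' \<xi>' \<omega> = simple_integral B n \<tau> \<xi> \<omega>" for \<omega>
    by (simp add: simple_integral_def \<tau>'_def \<xi>'_def)
  have zero: "simple_process n \<tau> \<xi> u \<omega> = 0" if "s < u" for u \<omega>
    unfolding simple_process_def
  proof (intro sum.neutral ballI)
    fix x assume "x \<in> {..<n}"
    then have "\<tau> (Suc x) < u" using is_simple_times(2)[OF a(1) s, of "Suc x"] that by simp
    then show "\<xi> x \<omega> * indicator {\<tau> x<..\<tau> (Suc x)} u = 0" by simp
  qed
  have E: "energy t (\<lambda>u \<omega>. simple_process (Suc n) \<tau>' \<xi>' u \<omega> - indicator {..s} u * H u \<omega>) \<omega>
      = energy s (\<lambda>u \<omega>. simple_process n \<tau> \<xi> u \<omega> - H u \<omega>) \<omega>" for \<omega>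
    unfolding energy_def P using zero st
    by (intro nn_integral_cong) (auto simp: indicator_def not_le)
  have "is_simple F t (Suc n) \<tau>' \<xi>'"
    using a(1) st is_simple_times[OF a(1) s]
    unfolding is_simple_def \<tau>'_def \<xi>'_def by (auto simp: less_Suc_eq)
  then show "\<exists>n \<tau> \<xi>. is_simple F t n \<tau> \<xi> \<and>
      ito_close \<epsilon> t (simple_process n \<tau> \<xi>) (simple_integral B n \<tau> \<xi>) (\<lambda>u \<omega>. indicator {..s} u * H u \<omega>) Y"
    using a unfolding ito_close_def by (intro exI[of _ "Suc n"] exI[of _ \<tau>'] exI[of _ \<xi>']) (simp add: E S)
qed

text \<open>
  The coefficients may be unbounded here, in contrast to \<^const>\<open>is_simple\<close>, since they agree with their
  truncations outside an event of small probability.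
\<close>

lemma ito_lim_simple:
  assumes t: "t \<in> I" and \<tau>0: "\<tau> 0 = 0" and \<tau>n: "\<tau> n = t"
    and mono: "\<And>i. i < n \<Longrightarrow> \<tau> i \<le> \<tau> (Suc i)"
    and \<xi>: "\<And>i. i < n \<Longrightarrow> \<xi> i \<in> borel_measurable (F (\<tau> i))"
  shows "ito_lim (simple_process n \<tau> \<xi>) t (simple_integral B n \<tau> \<xi>)"
proof (rule ito_lim_closure[OF t])
  define \<zeta> where "\<zeta> k i \<omega> = max (- real k) (min (real k) (\<xi> i \<omega>))" for k :: nat and i \<omega>
  have \<zeta>: "is_simple F t n \<tau> (\<zeta> k)" for k
    unfolding is_simple_def
  proof (intro conjI allI impI)
    fix i assume "i < n"
    note [measurable] = \<xi>[OF this]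
    show "\<zeta> k i \<in> borel_measurable (F (\<tau> i))" unfolding \<zeta>_def by measurable
    show "\<exists>K. \<forall>\<omega>\<in>space (F (\<tau> i)). \<bar>\<zeta> k i \<omega>\<bar> \<le> K" by (rule exI[of _ "real k"]) (auto simp: \<zeta>_def)
  qed (use \<tau>0 \<tau>n mono in auto)
  have \<xi>M [measurable]: "\<xi> i \<in> borel_measurable M" if "i \<in> {..<n}" for i
    using \<xi>[of i] that by (auto intro: measurable_F_M)
  show "jointly_measurable t (simple_process n \<tau> \<xi>)"
    unfolding jointly_measurable_def simple_process_def by measurable
  show "simple_integral B n \<tau> \<xi> \<in> borel_measurable M"
    unfolding simple_integral_def
  proof (rule borel_measurable_sum)
    fix i assume i: "i \<in> {..<n}"
    then have "\<tau> i \<in> I" "\<tau> (Suc i) \<in> I"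
      using is_simple_times(2)[OF \<zeta>[of 0] t] by auto
    then show "(\<lambda>\<omega>. \<xi> i \<omega> * (B (\<tau> (Suc i)) \<omega> - B (\<tau> i) \<omega>)) \<in> borel_measurable M" using i by measurable
  qed
  fix \<epsilon> :: real assume \<epsilon>: "0 < \<epsilon>"
  define A where "A k = {\<omega> \<in> space M. \<exists>i\<in>{..<n}. real k < \<bar>\<xi> i \<omega>\<bar>}" for k :: nat
  have A [measurable]: "A k \<in> sets M" for k unfolding A_def by measurable
  have "decseq A"
    unfolding A_def decseq_def by (auto intro!: bexI intro: le_less_trans[OF of_nat_mono])
  moreover have "(\<Inter>k. A k) = {}"
  proof -
    have "\<exists>k. \<omega> \<notin> A k" for \<omega>
    proof -
      obtain k where "(\<Sum>i<n. \<bar>\<xi> i \<omega>\<bar>) \<le> real k" using real_arch_simple by blast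
      then have "\<bar>\<xi> i \<omega>\<bar> \<le> real k" if "i < n" for i
        using member_le_sum[of i "{..<n}" "\<lambda>i. \<bar>\<xi> i \<omega>\<bar>"] that by force
      then show ?thesis by (intro exI[of _ k]) (auto simp: A_def not_less)
    qed
    then show ?thesis by auto
  qed
  moreover have "range A \<subseteq> sets M" using A by blast
  ultimately have "(\<lambda>k. prob (A k)) \<longlonglongrightarrow> prob {}"
    using finite_Lim_measure_decseq[of A] by simp
  then have "\<forall>\<^sub>F k in sequentially. prob (A k) < \<epsilon>"
    using \<epsilon> by (auto dest: order_tendstoD)
  then obtain k where k: "prob (A k) < \<epsilon>" using eventually_happens by force
  have eq: "\<zeta> k i \<omega> = \<xi> i \<omega>" if "\<omega> \<in> space M" "\<omega> \<notin> A k" "i < n" for i \<omega>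
    using that by (force simp: A_def \<zeta>_def)
  have eqP: "simple_process n \<tau> (\<zeta> k) s \<omega> = simple_process n \<tau> \<xi> s \<omega>"
    and eqS: "simple_integral B n \<tau> (\<zeta> k) \<omega> = simple_integral B n \<tau> \<xi> \<omega>"
    if "\<omega> \<in> space M" "\<omega> \<notin> A k" for \<omega> s
    unfolding simple_process_def simple_integral_def using eq[OF that] by auto
  have "prob {\<omega> \<in> space M. ennreal \<epsilon> < energy t (\<lambda>s \<omega>. simple_process n \<tau> (\<zeta> k) s \<omega> - simple_process n \<tau> \<xi> s \<omega>) \<omega>}
      \<le> prob (A k)"
  proof (rule finite_measure_mono, safe)
    fix \<omega> assume \<omega>: "\<omega> \<in> space M"
      "ennreal \<epsilon> < energy t (\<lambda>s \<omega>. simple_process n \<tau> (\<zeta> k) s \<omega> - simple_process n \<tau> \<xi> s \<omega>) \<omega>"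
    show "\<omega> \<in> A k"
    proof (rule ccontr)
      assume "\<omega> \<notin> A k"
      then have "energy t (\<lambda>s \<omega>. simple_process n \<tau> (\<zeta> k) s \<omega> - simple_process n \<tau> \<xi> s \<omega>) \<omega> = 0"
        using eqP[OF \<omega>(1)] by (simp add: energy_def)
      then show False using \<omega>(2) by simp
    qed
  qed (rule A)
  moreover have "prob {\<omega> \<in> space M. \<epsilon> < \<bar>simple_integral B n \<tau> (\<zeta> k) \<omega> - simple_integral B n \<tau> \<xi> \<omega>\<bar>}
      \<le> prob (A k)"
    by (rule finite_measure_mono) (use \<epsilon> eqS in fastforce)+
  ultimately show "\<exists>H' Y'. ito_lim H' t Y' \<and>
      ito_close \<epsilon> t H' Y' (simple_process n \<tau> \<xi>) (simple_integral B n \<tau> \<xi>)"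
    unfolding ito_close_def using ito_lim_simple_bounded[OF \<zeta>[of k] t] k
    by (intro exI[of _ "simple_process n \<tau> (\<zeta> k)"] exI[of _ "simple_integral B n \<tau> (\<zeta> k)"]) auto
qed

lemma progressive_jointly_measurable:
  assumes "progressive F t H" "0 \<le> t"
  shows "jointly_measurable t H"
proof -
  have H: "(\<lambda>(u, \<omega>). H u \<omega>) \<in> borel_measurable (restrict_space borel {0..t} \<Otimes>\<^sub>M F t)"
    using assms by (auto simp: progressive_def)
  define c where "c s = max 0 (min t s)" for s :: real
  have "c \<in> lborel \<rightarrow>\<^sub>M restrict_space borel {0..t}"
    using assms(2) unfolding c_def by (intro measurable_restrict_space2) auto
  then have "(\<lambda>(\<omega>, s). (c s, \<omega>)) \<in> M \<Otimes>\<^sub>M lborel \<rightarrow>\<^sub>M restrict_space borel {0..t} \<Otimes>\<^sub>M F t"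
    using measurable_from_subalg[OF subalgebra_F measurable_ident[of "F t"]]
    by (auto intro!: measurable_Pair measurable_compose[OF measurable_snd] measurable_compose[OF measurable_fst]
        simp: split_def id_def)
  from measurable_compose[OF this H]
  have [measurable]: "(\<lambda>(\<omega>, s). H (c s) \<omega>) \<in> borel_measurable (M \<Otimes>\<^sub>M lborel)"
    by (simp add: split_def)
  have "(\<lambda>(\<omega>, s). indicator {0..t} s * H s \<omega>) = (\<lambda>(\<omega>, s). indicator {0..t} s * H (c s) \<omega>)"
    by (auto simp: fun_eq_iff indicator_def c_def)
  also have "\<dots> \<in> borel_measurable (M \<Otimes>\<^sub>M lborel)"
    unfolding split_def
  proof (rule borel_measurable_times)
    show "(\<lambda>x. H (c (snd x)) (fst x)) \<in> borel_measurable (M \<Otimes>\<^sub>M lborel)"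
      using \<open>(\<lambda>(\<omega>, s). H (c s) \<omega>) \<in> borel_measurable (M \<Otimes>\<^sub>M lborel)\<close> by (simp add: split_def)
  qed measurable
  finally show ?thesis unfolding jointly_measurable_def .
qed

text \<open>
  The integral over \<open>[0, t]\<close> in \<^const>\<open>has_ito_integral\<close> is a Bochner integral, which is 0 by convention if the integrand
  is not integrable. It equals the energy almost surely, where the paths of \<open>H\<close> are square integrable.
\<close>

lemma has_ito_integral_imp_ito_lim:
  assumes 1: "has_ito_integral M F B H t Y" and t: "t \<in> I"
  shows "ito_lim H t Y"
proof -
  have jm: "jointly_measurable t H"
    using 1 nonneg[OF t] by (intro progressive_jointly_measurable) (auto simp: has_ito_integral_def)
  have sq: "AE \<omega> in M. set_integrable lborel {0..t} (\<lambda>s. (H s \<omega>)\<^sup>2)"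
    using 1 by (simp add: has_ito_integral_def)
  obtain n :: "nat \<Rightarrow> nat" and \<tau> \<xi> where s: "\<And>k. is_simple F t (n k) (\<tau> k) (\<xi> k)"
    and c1: "tendsto_in_prob M
          (\<lambda>k \<omega>. LBINT s:{0..t}. (simple_process (n k) (\<tau> k) (\<xi> k) s \<omega> - H s \<omega>)\<^sup>2)
          (\<lambda>_. 0) sequentially"
    and c2: "tendsto_in_prob M (\<lambda>k. simple_integral B (n k) (\<tau> k) (\<xi> k)) Y sequentially"
    using 1 unfolding has_ito_integral_def by blast
  let ?L = "\<lambda>k \<omega>. LBINT s:{0..t}. (simple_process (n k) (\<tau> k) (\<xi> k) s \<omega> - H s \<omega>)\<^sup>2"
  let ?E = "\<lambda>k. energy t (\<lambda>s \<omega>. simple_process (n k) (\<tau> k) (\<xi> k) s \<omega> - H s \<omega>)"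
  have Y: "Y \<in> borel_measurable M" using c2 by (simp add: tendsto_in_prob_def)
  have jk: "jointly_measurable t (\<lambda>s \<omega>. simple_process (n k) (\<tau> k) (\<xi> k) s \<omega> - H s \<omega>)" for k
    by (intro jointly_measurable_arith jointly_measurable_simple s jm)
  have eq: "AE \<omega> in M. ?E k \<omega> \<le> ennreal (?L k \<omega>)" for k
    using sq AE_space
  proof eventually_elim
    case (elim \<omega>)
    let ?D = "\<lambda>s. simple_process (n k) (\<tau> k) (\<xi> k) s \<omega> - H s \<omega>"
    have 2: "2 * energy t (simple_process (n k) (\<tau> k) (\<xi> k)) \<omega> + 2 * energy t H \<omega> < \<infinity>"
    proof -
      have "energy t H \<omega> = (\<integral>\<^sup>+s. ennreal (norm (indicator {0..t} s *\<^sub>R (H s \<omega>)\<^sup>2)) \<partial>lborel)"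
        unfolding energy_def by (intro nn_integral_cong) (auto simp: indicator_def)
      then have "energy t H \<omega> < \<infinity>"
        using elim(1) unfolding set_integrable_def integrable_iff_bounded by simp
      then show ?thesis
        unfolding energy_simple_process[OF s t] by (simp add: ennreal_mult_less_top)
    qed
    have "?E k \<omega> \<le> 2 * energy t (simple_process (n k) (\<tau> k) (\<xi> k)) \<omega> + 2 * energy t H \<omega>"
      using energy_add_le[OF jointly_measurable_simple[OF s] jointly_measurable_arith(4)[OF jm jm, of "-1"] elim(2), of k]
        energy_scale[OF jm elim(2), of "-1"] by simp
    then have fin: "?E k \<omega> < \<infinity>" using 2 by (rule le_less_trans)
    have m: "(\<lambda>s. indicator {0..t} s * ?D s) \<in> borel_measurable lborel"
      using path_measurable[OF jk elim(2), of k] by simp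
    have m2: "(\<lambda>s. indicator {0..t} s *\<^sub>R (?D s)\<^sup>2) \<in> borel_measurable lborel"
    proof -
      have "(\<lambda>s. indicator {0..t} s *\<^sub>R (?D s)\<^sup>2) = (\<lambda>s. (indicator {0..t} s * ?D s)\<^sup>2)"
        by (auto simp: fun_eq_iff indicator_def)
      then show ?thesis using borel_measurable_power[OF m, of 2] by simp
    qed
    have E: "?E k \<omega> = (\<integral>\<^sup>+s. ennreal (indicator {0..t} s *\<^sub>R (?D s)\<^sup>2) \<partial>lborel)"
      unfolding energy_def by (intro nn_integral_cong) (auto simp: indicator_def)
    have int: "integrable lborel (\<lambda>s. indicator {0..t} s *\<^sub>R (?D s)\<^sup>2)"
      using m2 fin unfolding integrable_iff_bounded E by simp
    then show ?case
      unfolding E set_lebesgue_integral_def by (subst nn_integral_eq_integral) auto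
  qed
  show ?thesis
    unfolding ito_lim_def
  proof (intro conjI allI impI t jm Y)
    fix \<epsilon> :: real assume \<epsilon>: "0 < \<epsilon>"
    have "\<forall>\<^sub>F k in sequentially. measure M {\<omega> \<in> space M. \<bar>?L k \<omega> - 0\<bar> > \<epsilon>} < \<epsilon>"
      "\<forall>\<^sub>F k in sequentially. ?L k \<in> borel_measurable M"
      "\<forall>\<^sub>F k in sequentially. measure M {\<omega> \<in> space M. \<bar>simple_integral B (n k) (\<tau> k) (\<xi> k) \<omega> - Y \<omega>\<bar> > \<epsilon>} < \<epsilon>"
      using c1 c2 \<epsilon> unfolding tendsto_in_prob_def by (auto intro!: order_tendstoD)
    then have "\<forall>\<^sub>F k in sequentially. measure M {\<omega> \<in> space M. \<bar>?L k \<omega> - 0\<bar> > \<epsilon>} < \<epsilon> \<and>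
      ?L k \<in> borel_measurable M \<and>
      measure M {\<omega> \<in> space M. \<bar>simple_integral B (n k) (\<tau> k) (\<xi> k) \<omega> - Y \<omega>\<bar> > \<epsilon>} < \<epsilon>"
      by eventually_elim simp
    then obtain k where k: "measure M {\<omega> \<in> space M. \<bar>?L k \<omega> - 0\<bar> > \<epsilon>} < \<epsilon>"
      "?L k \<in> borel_measurable M"
      "measure M {\<omega> \<in> space M. \<bar>simple_integral B (n k) (\<tau> k) (\<xi> k) \<omega> - Y \<omega>\<bar> > \<epsilon>} < \<epsilon>"
      using eventually_happens by force
    note [measurable] = energy_measurable[OF jk[of k]] k(2)
    have "prob {\<omega> \<in> space M. ennreal \<epsilon> < ?E k \<omega>} \<le> prob {\<omega> \<in> space M. \<bar>?L k \<omega> - 0\<bar> > \<epsilon>}"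
    proof (rule finite_measure_mono_AE)
      show "AE \<omega> in M. \<omega> \<in> {\<omega> \<in> space M. ennreal \<epsilon> < ?E k \<omega>} \<longrightarrow> \<omega> \<in> {\<omega> \<in> space M. \<bar>?L k \<omega> - 0\<bar> > \<epsilon>}"
        using eq[of k]
      proof eventually_elim
        case (elim \<omega>)
        show ?case
        proof
          assume "\<omega> \<in> {\<omega> \<in> space M. ennreal \<epsilon> < ?E k \<omega>}"
          then have "\<omega> \<in> space M" "ennreal \<epsilon> < ennreal (?L k \<omega>)"
            using elim by (auto intro: less_le_trans)
          then show "\<omega> \<in> {\<omega> \<in> space M. \<bar>?L k \<omega> - 0\<bar> > \<epsilon>}"
            using \<epsilon> by (auto simp: ennreal_less_iff)
        qed
      qed
    qed measurable
    then show "\<exists>n \<tau> \<xi>. is_simple F t n \<tau> \<xi> \<and>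
        ito_close \<epsilon> t (simple_process n \<tau> \<xi>) (simple_integral B n \<tau> \<xi>) H Y"
      unfolding ito_close_def
      using k s by (intro exI[of _ "n k"] exI[of _ "\<tau> k"] exI[of _ "\<xi> k"]) auto
  qed
qed

end

section \<open>Uniform grids and Riemann sums\<close>

definition grid :: "real \<Rightarrow> real \<Rightarrow> nat \<Rightarrow> nat \<Rightarrow> real" where
  "grid a b n i = a + (b - a) * real i / real n"

lemma grid_0 [simp]: "grid a b n 0 = a"
  by (simp add: grid_def)

lemma grid_n: "0 < n \<Longrightarrow> grid a b n n = b"
  by (simp add: grid_def)

lemma grid_mono: "a \<le> b \<Longrightarrow> i \<le> j \<Longrightarrow> grid a b n i \<le> grid a b n j"
  by (auto simp: grid_def intro!: divide_right_mono mult_left_mono)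

lemma grid_bounds: "a \<le> b \<Longrightarrow> i \<le> n \<Longrightarrow> 0 < n \<Longrightarrow> a \<le> grid a b n i \<and> grid a b n i \<le> b"
  using grid_mono[of a b 0 i n] grid_mono[of a b i n n] by (simp add: grid_n)

lemma grid_step: "grid a b n (Suc i) - grid a b n i = (b - a) / real n"
  by (simp add: grid_def field_simps diff_divide_distrib[symmetric])

lemma uniform_grid:
  fixes f :: "real \<Rightarrow> real"
  assumes f: "continuous_on {a..b} f" and ab: "a \<le> b" and \<epsilon>: "0 < \<epsilon>"
  obtains N where "0 < N" "\<And>n i u w. N \<le> n \<Longrightarrow> i < n \<Longrightarrow> u \<in> {grid a b n i..grid a b n (Suc i)} \<Longrightarrow>
    w \<in> {grid a b n i..grid a b n (Suc i)} \<Longrightarrow> \<bar>f u - f w\<bar> \<le> \<epsilon>"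
proof -
  have "uniformly_continuous_on {a..b} f"
    by (rule compact_uniformly_continuous[OF f]) simp
  then obtain d where d: "0 < d" "\<And>x y. x \<in> {a..b} \<Longrightarrow> y \<in> {a..b} \<Longrightarrow> dist y x < d \<Longrightarrow> dist (f y) (f x) < \<epsilon>"
    unfolding uniformly_continuous_on_def using \<epsilon> by metis
  obtain N :: nat where N: "(b - a) / d < real N" using reals_Archimedean2 by blast
  show ?thesis
  proof (rule that[of "Suc N"])
    fix n i u w assume *: "Suc N \<le> n" "i < n" "u \<in> {grid a b n i..grid a b n (Suc i)}"
      "w \<in> {grid a b n i..grid a b n (Suc i)}"
    have n: "(b - a) / d < real n" "0 < n" using N * by auto
    then have "(b - a) / real n < d" using d by (simp add: field_simps)
    moreover have "dist u w \<le> (b - a) / real n"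
      using * grid_step[of a b n i] by (auto simp: dist_real_def abs_if)
    moreover have "u \<in> {a..b}" "w \<in> {a..b}"
      using * grid_bounds[OF ab, of i n] grid_bounds[OF ab, of "Suc i" n] n by auto
    ultimately show "\<bar>f u - f w\<bar> \<le> \<epsilon>" using d(2)[of w u] by (auto simp: dist_real_def)
  qed simp
qed

lemma riemann_sum_error:
  fixes f :: "real \<Rightarrow> real" and \<tau> :: "nat \<Rightarrow> real"
  assumes "\<And>i. i < n \<Longrightarrow> \<tau> i \<le> \<tau> (Suc i)" "continuous_on {\<tau> 0..\<tau> n} f"
    "\<And>i u. i < n \<Longrightarrow> u \<in> {\<tau> i..\<tau> (Suc i)} \<Longrightarrow> \<bar>f u - c i\<bar> \<le> \<epsilon>"
  shows "\<bar>(\<Sum>i<n. c i * (\<tau> (Suc i) - \<tau> i)) - integral {\<tau> 0..\<tau> n} f\<bar> \<le> \<epsilon> * (\<tau> n - \<tau> 0) \<and> \<tau> 0 \<le> \<tau> n"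
  using assms
proof (induction n)
  case (Suc n)
  have le: "\<tau> n \<le> \<tau> (Suc n)" using Suc.prems(1) by simp
  have 0: "\<tau> 0 \<le> \<tau> n"
    using Suc.prems(1) by (induction n) (auto intro: order_trans)
  have IH: "\<bar>(\<Sum>i<n. c i * (\<tau> (Suc i) - \<tau> i)) - integral {\<tau> 0..\<tau> n} f\<bar> \<le> \<epsilon> * (\<tau> n - \<tau> 0)"
    using Suc.IH Suc.prems le continuous_on_subset[OF Suc.prems(2), of "{\<tau> 0..\<tau> n}"] by auto
  have cn: "continuous_on {\<tau> n..\<tau> (Suc n)} f"
    by (rule continuous_on_subset[OF Suc.prems(2)]) (use 0 in auto)
  have split: "integral {\<tau> 0..\<tau> n} f + integral {\<tau> n..\<tau> (Suc n)} f = integral {\<tau> 0..\<tau> (Suc n)} f"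
    using 0 le Suc.prems(2)
    by (intro Henstock_Kurzweil_Integration.integral_combine integrable_continuous_real)
  have "integral {\<tau> n..\<tau> (Suc n)} f - c n * (\<tau> (Suc n) - \<tau> n) = integral {\<tau> n..\<tau> (Suc n)} (\<lambda>u. f u - c n)"
    using le cn by (subst Henstock_Kurzweil_Integration.integral_diff) (auto intro: integrable_continuous_real)
  also have "norm \<dots> \<le> \<epsilon> * (\<tau> (Suc n) - \<tau> n)"
    by (rule integral_bound[OF le]) (use cn Suc.prems(3)[of n] in \<open>auto intro!: continuous_intros\<close>)
  finally have "\<bar>c n * (\<tau> (Suc n) - \<tau> n) - integral {\<tau> n..\<tau> (Suc n)} f\<bar> \<le> \<epsilon> * (\<tau> (Suc n) - \<tau> n)"
    by (simp add: abs_minus_commute)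
  with IH show ?case
    unfolding split[symmetric] using 0 le by (auto simp: algebra_simps abs_if split: if_splits)
qed simp

lemma riemann_sum_tendsto:
  fixes f :: "real \<Rightarrow> real"
  assumes f: "continuous_on {a..b} f" and ab: "a \<le> b"
  shows "(\<lambda>n. \<Sum>i<n. f (grid a b n i) * (grid a b n (Suc i) - grid a b n i)) \<longlonglongrightarrow> integral {a..b} f"
    and "(\<lambda>n. \<Sum>i<n. f (grid a b n (Suc i)) * (grid a b n (Suc i) - grid a b n i)) \<longlonglongrightarrow> integral {a..b} f"
proof -
  have *: "(\<lambda>n. \<Sum>i<n. f (p n i) * (grid a b n (Suc i) - grid a b n i)) \<longlonglongrightarrow> integral {a..b} f"
    if p: "\<And>n i. p n i \<in> {grid a b n i..grid a b n (Suc i)}" for p :: "nat \<Rightarrow> nat \<Rightarrow> real"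
  proof (rule LIMSEQ_I)
    fix r :: real assume r: "0 < r"
    define \<epsilon> where "\<epsilon> = r / (2 * (b - a + 1))"
    have "a * r \<le> b * r" using ab r by simp
    then have "a * r < b * r + r * 2" using r by linarith
    then have \<epsilon>: "0 < \<epsilon>" "\<epsilon> * (b - a) < r"
      using ab r by (auto simp: \<epsilon>_def field_simps)
    obtain N where N: "0 < N" "\<And>n i u w. N \<le> n \<Longrightarrow> i < n \<Longrightarrow> u \<in> {grid a b n i..grid a b n (Suc i)} \<Longrightarrow>
      w \<in> {grid a b n i..grid a b n (Suc i)} \<Longrightarrow> \<bar>f u - f w\<bar> \<le> \<epsilon>"
      using uniform_grid[OF f ab \<epsilon>(1)] by blast
    have "norm ((\<Sum>i<n. f (p n i) * (grid a b n (Suc i) - grid a b n i)) - integral {a..b} f) < r"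
      if n: "N \<le> n" for n
    proof -
      have e: "grid a b n n = b" using N n by (intro grid_n) auto
      have "\<bar>(\<Sum>i<n. f (p n i) * (grid a b n (Suc i) - grid a b n i)) - integral {grid a b n 0..grid a b n n} f\<bar>
          \<le> \<epsilon> * (grid a b n n - grid a b n 0) \<and> grid a b n 0 \<le> grid a b n n"
        by (rule riemann_sum_error) (use f ab grid_mono[of a b] N(2)[OF n] p e in auto)
      then show ?thesis using \<epsilon>(2) e by simp
    qed
    then show "\<exists>no. \<forall>n\<ge>no. norm ((\<Sum>i<n. f (p n i) * (grid a b n (Suc i) - grid a b n i)) - integral {a..b} f) < r"
      by blast
  qed
  show "(\<lambda>n. \<Sum>i<n. f (grid a b n i) * (grid a b n (Suc i) - grid a b n i)) \<longlonglongrightarrow> integral {a..b} f"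
    by (rule *) (use grid_mono[OF ab] in auto)
  show "(\<lambda>n. \<Sum>i<n. f (grid a b n (Suc i)) * (grid a b n (Suc i) - grid a b n i)) \<longlonglongrightarrow> integral {a..b} f"
    by (rule *) (use grid_mono[OF ab] in auto)
qed

lemma energy_simple_diff_le:
  assumes \<tau>0: "\<tau> 0 = 0" and \<tau>n: "\<tau> n = t" and mono: "\<And>i. i < n \<Longrightarrow> \<tau> i \<le> \<tau> (Suc i)"
    and t: "0 \<le> t" and \<epsilon>: "0 \<le> \<epsilon>"
    and le: "\<And>i u. i < n \<Longrightarrow> \<tau> i < u \<Longrightarrow> u \<le> \<tau> (Suc i) \<Longrightarrow> \<bar>\<xi> i \<omega> - H u \<omega>\<bar> \<le> \<epsilon>"
  shows "energy t (\<lambda>s \<omega>. simple_process n \<tau> \<xi> s \<omega> - H s \<omega>) \<omega> \<le> ennreal (\<epsilon>\<^sup>2 * t)"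
proof (rule energy_le_of_bound[OF t \<epsilon>])
  fix u assume "0 < u" "u \<le> t"
  then obtain i where i: "i < n" "\<tau> i < u" "u \<le> \<tau> (Suc i)"
    using interval_of_partition[of \<tau> u n] \<tau>0 \<tau>n by auto
  then have "simple_process n \<tau> \<xi> u \<omega> = \<xi> i \<omega>"
    using mono by (intro simple_process_eq) auto
  then show "\<bar>simple_process n \<tau> \<xi> u \<omega> - H u \<omega>\<bar> \<le> \<epsilon>" using le[OF i] by simp
qed

section \<open>Characteristic functions and normal laws\<close>

text \<open>
  Under the law conditioned on \<open>A\<close>, the variable \<open>Z\<close> has the characteristic function of \<open>N\<close>, and hence the law
  \<open>N\<close>. Used for all \<open>A\<close> in a sigma-algebra, this gives the law of \<open>Z\<close> and independence of the sigma-algebra at the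
  same time.
\<close>

lemma (in prob_space) law_and_indep_of_char:
  assumes A: "A \<in> sets M" and Z [measurable]: "Z \<in> borel_measurable M" and N: "real_distribution N"
    and char: "\<And>l. (LINT \<omega>|M. indicator A \<omega> *\<^sub>R iexp (l * Z \<omega>)) = of_real (prob A) * char N l"
    and E: "E \<in> sets borel"
  shows "prob (A \<inter> (Z -` E \<inter> space M)) = prob A * measure N E"
proof (cases "prob A = 0")
  case True
  have "prob (A \<inter> (Z -` E \<inter> space M)) \<le> prob A"
    using A by (intro finite_measure_mono) auto
  then have "prob (A \<inter> (Z -` E \<inter> space M)) = 0"
    using True measure_nonneg[of M "A \<inter> (Z -` E \<inter> space M)"] by linarith
  then show ?thesis using True by simp
next
  case False
  let ?U = "uniform_measure M A"
  have pos: "0 < prob A" using False by (simp add: zero_less_measure_iff)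
  interpret U: prob_space ?U
    using pos by (intro prob_space_uniform_measure) (auto simp: emeasure_eq_measure)
  have ZU: "Z \<in> borel_measurable ?U" by simp
  interpret D: real_distribution "distr ?U borel Z"
    using ZU by (rule U.real_distribution_distr)
  have U: "?U = density M (\<lambda>\<omega>. ennreal (indicator A \<omega> / prob A))"
    unfolding uniform_measure_def
  proof (rule density_cong)
    show "AE \<omega> in M. indicator A \<omega> / emeasure M A = ennreal (indicator A \<omega> / prob A)"
      using pos by (intro AE_I2) (simp add: emeasure_eq_measure divide_ennreal[symmetric] ennreal_indicator)
  qed (use A in measurable)
  have "char (distr ?U borel Z) = char N"
  proof
    fix l
    have "char (distr ?U borel Z) l = (LINT \<omega>|?U. iexp (l * Z \<omega>))"
      unfolding char_def by (subst integral_distr) (auto simp: ZU)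
    also have "\<dots> = (LINT \<omega>|M. (indicator A \<omega> / prob A) *\<^sub>R iexp (l * Z \<omega>))"
      unfolding U using A pos by (intro integral_density) auto
    also have "\<dots> = (LINT \<omega>|M. (1 / prob A) *\<^sub>R (indicator A \<omega> *\<^sub>R iexp (l * Z \<omega>)))"
      by (intro Bochner_Integration.integral_cong) auto
    also have "\<dots> = (1 / prob A) *\<^sub>R (of_real (prob A) * char N l)"
      unfolding char[symmetric] by (rule integral_scaleR_right)
    also have "\<dots> = char N l" using pos by (simp add: scaleR_conv_of_real)
    finally show "char (distr ?U borel Z) l = char N l" .
  qed
  then have "distr ?U borel Z = N"
    by (intro Levy_uniqueness N D.real_distribution_axioms)
  then have "measure N E = measure ?U (Z -` E \<inter> space M)"
    using E ZU by (metis measure_distr space_uniform_measure)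
  also have "\<dots> = prob (A \<inter> (Z -` E \<inter> space M)) / prob A"
    using A E by (intro measure_uniform_measure) (use pos in \<open>auto simp: emeasure_eq_measure\<close>)
  finally show ?thesis using pos by simp
qed

lemma (in prob_space) normal_characteristic:
  assumes \<sigma>: "0 < \<sigma>" and X: "distributed M lborel X (normal_density 0 \<sigma>)"
  shows "(LINT \<omega>|M. iexp (x * X \<omega>)) = complex_of_real (exp (- x\<^sup>2 * \<sigma>\<^sup>2 / 2))"
proof -
  have [measurable]: "X \<in> borel_measurable M" using distributed_measurable[OF X] by simp
  have d: "distributed M lborel (\<lambda>\<omega>. X \<omega> / \<sigma>) std_normal_density"
    using X normal_standard_normal_convert[OF \<sigma>, of X 0] by simp
  have "(LINT \<omega>|M. iexp (x * X \<omega>)) = (LINT \<omega>|M. iexp ((x * \<sigma>) * (X \<omega> / \<sigma>)))"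
    using \<sigma> by (intro Bochner_Integration.integral_cong) auto
  also have "\<dots> = (LINT y|distr M lborel (\<lambda>\<omega>. X \<omega> / \<sigma>). iexp ((x * \<sigma>) * y))"
    by (subst integral_distr) auto
  also have "\<dots> = char std_normal_distribution (x * \<sigma>)"
    unfolding char_def using distributed_distr_eq_density[OF d] by simp
  also have "\<dots> = complex_of_real (exp (- x\<^sup>2 * \<sigma>\<^sup>2 / 2))"
    using \<sigma> by (simp add: char_std_normal_distribution power_mult_distrib)
  finally show ?thesis .
qed

lemma char_normal_distribution:
  assumes "0 < \<sigma>"
  shows "real_distribution (density lborel (normal_density 0 \<sigma>))"
    and "char (density lborel (normal_density 0 \<sigma>)) l = complex_of_real (exp (- l\<^sup>2 * \<sigma>\<^sup>2 / 2))"
proof -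
  interpret N: prob_space "density lborel (normal_density 0 \<sigma>)"
    by (rule prob_space_normal_density[OF assms])
  show "real_distribution (density lborel (normal_density 0 \<sigma>))"
    by unfold_locales simp_all
  have "distributed (density lborel (normal_density 0 \<sigma>)) lborel (\<lambda>x. x) (normal_density 0 \<sigma>)"
    unfolding distributed_def by (auto intro!: distr_id2)
  from N.normal_characteristic[OF assms this, of l]
  show "char (density lborel (normal_density 0 \<sigma>)) l = complex_of_real (exp (- l\<^sup>2 * \<sigma>\<^sup>2 / 2))"
    by (simp add: char_def)
qed

text \<open>
  This follows from \<open>\<bar>exp (i x) - exp (i y)\<bar> \<le> \<bar>x - y\<bar>\<close> and \<open>(E D)\<^sup>2 \<le> E (D\<^sup>2)\<close>.
\<close>

lemma (in prob_space) char_L2_close: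
  assumes [measurable]: "A \<in> sets M" "Z \<in> borel_measurable M" "Z' \<in> borel_measurable M"
    and c: "0 \<le> c" and le: "(\<integral>\<^sup>+\<omega>. ennreal ((Z \<omega> - Z' \<omega>)\<^sup>2) \<partial>M) \<le> ennreal (c\<^sup>2)"
  shows "cmod ((LINT \<omega>|M. indicator A \<omega> *\<^sub>R iexp (l * Z \<omega>)) - (LINT \<omega>|M. indicator A \<omega> *\<^sub>R iexp (l * Z' \<omega>)))
    \<le> \<bar>l\<bar> * c"
proof -
  let ?D = "\<lambda>\<omega>. \<bar>Z \<omega> - Z' \<omega>\<bar>"
  have le': "(\<integral>\<^sup>+\<omega>. ennreal ((?D \<omega>)\<^sup>2) \<partial>M) \<le> ennreal (c\<^sup>2)" using le by simp
  have i2: "integrable M (\<lambda>\<omega>. (?D \<omega>)\<^sup>2)"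
  proof (rule integrableI_nonneg)
    show "(\<integral>\<^sup>+\<omega>. ennreal ((?D \<omega>)\<^sup>2) \<partial>M) < \<infinity>"
      using le' by (rule le_less_trans) simp
  qed auto
  have E2: "expectation (\<lambda>\<omega>. (?D \<omega>)\<^sup>2) \<le> c\<^sup>2"
    using le' i2 by (subst (asm) nn_integral_eq_integral) auto
  have i1: "integrable M ?D"
    by (rule square_integrable_imp_integrable[OF _ i2]) measurable
  have "(expectation ?D)\<^sup>2 \<le> expectation (\<lambda>\<omega>. (?D \<omega>)\<^sup>2)"
    using variance_eq[OF i1 i2] variance_positive[of ?D] by linarith
  then have E1: "expectation ?D \<le> c"
    using E2 c by (meson order_trans power2_le_imp_le)
  have int: "integrable M (\<lambda>\<omega>. indicator A \<omega> *\<^sub>R iexp (l * X \<omega>))"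
    if [measurable]: "X \<in> borel_measurable M" for X
  proof (rule integrable_const_bound[where B = 1])
    show "AE \<omega> in M. cmod (indicator A \<omega> *\<^sub>R iexp (l * X \<omega>)) \<le> 1"
      by (rule AE_I2) (simp add: indicator_def)
    show "(\<lambda>\<omega>. indicator A \<omega> *\<^sub>R iexp (l * X \<omega>)) \<in> borel_measurable M"
      by (intro borel_measurable_scaleR borel_measurable_indicator) measurable
  qed
  have diff: "cmod (iexp x - iexp y) \<le> \<bar>x - y\<bar>" for x y :: real
  proof -
    have "iexp x - iexp y = iexp y * (iexp (x - y) - 1)"
      by (simp add: algebra_simps exp_add[symmetric])
    then have "cmod (iexp x - iexp y) = cmod (iexp (x - y) - 1)" by (simp add: norm_mult)
    also have "\<dots> \<le> \<bar>x - y\<bar>" using iexp_approx1[of "x - y" 0] by simp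
    finally show ?thesis .
  qed
  have "(LINT \<omega>|M. indicator A \<omega> *\<^sub>R iexp (l * Z \<omega>)) - (LINT \<omega>|M. indicator A \<omega> *\<^sub>R iexp (l * Z' \<omega>))
      = (LINT \<omega>|M. indicator A \<omega> *\<^sub>R iexp (l * Z \<omega>) - indicator A \<omega> *\<^sub>R iexp (l * Z' \<omega>))"
    by (rule Bochner_Integration.integral_diff[symmetric]; rule int; measurable)
  also have "cmod \<dots> \<le> (LINT \<omega>|M. cmod (indicator A \<omega> *\<^sub>R iexp (l * Z \<omega>) - indicator A \<omega> *\<^sub>R iexp (l * Z' \<omega>)))"
    by (rule integral_norm_bound)
  also have "\<dots> \<le> (LINT \<omega>|M. \<bar>l\<bar> * ?D \<omega>)"
  proof (rule integral_mono)
    fix \<omega>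
    have "cmod (iexp (l * Z \<omega>) - iexp (l * Z' \<omega>)) \<le> \<bar>l\<bar> * ?D \<omega>"
      using diff[of "l * Z \<omega>" "l * Z' \<omega>"] by (simp add: abs_mult[symmetric] algebra_simps)
    then show "cmod (indicator A \<omega> *\<^sub>R iexp (l * Z \<omega>) - indicator A \<omega> *\<^sub>R iexp (l * Z' \<omega>)) \<le> \<bar>l\<bar> * ?D \<omega>"
      by (auto simp: indicator_def)
  qed (intro integrable_norm Bochner_Integration.integrable_diff int assms; fail | use i1 in simp)+
  also have "\<dots> \<le> \<bar>l\<bar> * c" using E1 by (simp add: mult_left_mono)
  finally show ?thesis .
qed

section \<open>Wiener integrals have independent normal increments\<close>

context brownian
begin

lemma increment_char:
  assumes "s \<in> I" "t \<in> I" "s \<le> t"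
  shows "(LINT \<omega>|M. iexp (x * (B t \<omega> - B s \<omega>))) = complex_of_real (exp (- x\<^sup>2 * (t - s) / 2))"
proof (cases "s = t")
  case True
  then show ?thesis by (simp add: prob_space)
next
  case False
  then show ?thesis
    using assms increment_normal[of s t] normal_characteristic[of "sqrt (t - s)" "\<lambda>\<omega>. B t \<omega> - B s \<omega>" x]
    by simp
qed

text \<open>
  The increments are split off one at a time, starting with the last one: all other factors are measurable at the left end of
  its interval, and thus independent of it.
\<close>

lemma char_deterministic_sum:
  fixes \<tau> :: "nat \<Rightarrow> real"
  assumes "\<And>i. i \<le> n \<Longrightarrow> \<tau> i \<in> I" "\<And>i. i < n \<Longrightarrow> \<tau> i \<le> \<tau> (Suc i)" and A: "A \<in> sets (F (\<tau> 0))"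
  shows "(LINT \<omega>|M. indicator A \<omega> *\<^sub>R iexp (l * (\<Sum>i<n. x i * (B (\<tau> (Suc i)) \<omega> - B (\<tau> i) \<omega>))))
    = of_real (prob A) * complex_of_real (exp (- l\<^sup>2 * (\<Sum>i<n. (x i)\<^sup>2 * (\<tau> (Suc i) - \<tau> i)) / 2)) \<and>
    (\<lambda>\<omega>. \<Sum>i<n. x i * (B (\<tau> (Suc i)) \<omega> - B (\<tau> i) \<omega>)) \<in> borel_measurable (F (\<tau> n)) \<and> \<tau> 0 \<le> \<tau> n"
  using assms(1,2)
proof (induction n)
  case 0
  have "A \<in> sets M" using A sets_F_subset by blast
  then have "(LINT \<omega>|M. indicator A \<omega> *\<^sub>R (1::complex)) = complex_of_real (prob A)"
    by (subst integral_scaleR_left) (auto simp: scaleR_conv_of_real emeasure_eq_measure)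
  then show ?case by simp
next
  case (Suc n)
  let ?S = "\<lambda>\<omega>. \<Sum>i<n. x i * (B (\<tau> (Suc i)) \<omega> - B (\<tau> i) \<omega>)"
  let ?Z = "\<lambda>\<omega>. indicator A \<omega> *\<^sub>R iexp (l * ?S \<omega>)"
  let ?W = "\<lambda>\<omega>. iexp ((l * x n) * (B (\<tau> (Suc n)) \<omega> - B (\<tau> n) \<omega>))"
  have IH: "(LINT \<omega>|M. ?Z \<omega>)
      = of_real (prob A) * complex_of_real (exp (- l\<^sup>2 * (\<Sum>i<n. (x i)\<^sup>2 * (\<tau> (Suc i) - \<tau> i)) / 2))"
    "?S \<in> borel_measurable (F (\<tau> n))" "\<tau> 0 \<le> \<tau> n"
    using Suc by auto
  have n: "\<tau> n \<in> I" "\<tau> (Suc n) \<in> I" "\<tau> n \<le> \<tau> (Suc n)" using Suc.prems by auto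
  have An: "A \<in> sets (F (\<tau> n))" using A sets_F_mono[OF IH(3)] by blast
  note [measurable] = IH(2) An
  have ZF: "?Z \<in> borel_measurable (F (\<tau> n))" by measurable
  have ZM [measurable]: "?Z \<in> borel_measurable M" by (rule measurable_F_M[OF ZF])
  have "indep_var borel ?Z borel ?W"
    by (rule increment_indep_var[OF n ZF]) measurable
  moreover have "integrable M ?Z"
    by (rule integrable_const_bound[where B = 1, OF _ ZM]) (auto simp: indicator_def)
  moreover have "integrable M ?W"
    by (rule integrable_const_bound[where B = 1]) (use n in auto)
  ultimately have "(LINT \<omega>|M. ?Z \<omega> * ?W \<omega>) = (LINT \<omega>|M. ?Z \<omega>) * (LINT \<omega>|M. ?W \<omega>)"
    by (rule indep_var_lebesgue_integral)
  also have "(LINT \<omega>|M. ?Z \<omega> * ?W \<omega>)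
      = (LINT \<omega>|M. indicator A \<omega> *\<^sub>R iexp (l * (\<Sum>i<Suc n. x i * (B (\<tau> (Suc i)) \<omega> - B (\<tau> i) \<omega>))))"
    by (intro Bochner_Integration.integral_cong)
       (simp_all add: exp_add[symmetric] ring_distribs mult.assoc)
  also have "(LINT \<omega>|M. ?Z \<omega>) * (LINT \<omega>|M. ?W \<omega>)
      = of_real (prob A) * complex_of_real (exp (- l\<^sup>2 * (\<Sum>i<n. (x i)\<^sup>2 * (\<tau> (Suc i) - \<tau> i)) / 2)
          * exp (- (l * x n)\<^sup>2 * (\<tau> (Suc n) - \<tau> n) / 2))"
    unfolding IH(1) increment_char[OF n] by simp
  also have "exp (- l\<^sup>2 * (\<Sum>i<n. (x i)\<^sup>2 * (\<tau> (Suc i) - \<tau> i)) / 2)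
          * exp (- (l * x n)\<^sup>2 * (\<tau> (Suc n) - \<tau> n) / 2)
      = exp (- l\<^sup>2 * (\<Sum>i<Suc n. (x i)\<^sup>2 * (\<tau> (Suc i) - \<tau> i)) / 2)"
    by (simp add: exp_add[symmetric] power_mult_distrib field_simps)
  finally have 1: "(LINT \<omega>|M. indicator A \<omega> *\<^sub>R iexp (l * (\<Sum>i<Suc n. x i * (B (\<tau> (Suc i)) \<omega> - B (\<tau> i) \<omega>))))
      = of_real (prob A) * complex_of_real (exp (- l\<^sup>2 * (\<Sum>i<Suc n. (x i)\<^sup>2 * (\<tau> (Suc i) - \<tau> i)) / 2))" .
  have "(\<lambda>\<omega>. ?S \<omega> + x n * (B (\<tau> (Suc n)) \<omega> - B (\<tau> n) \<omega>)) \<in> borel_measurable (F (\<tau> (Suc n)))"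
    using measurable_F_mono[OF IH(2) n(3)] n
    by (intro borel_measurable_add borel_measurable_times borel_measurable_diff B_measurable_F) auto
  then show ?case using 1 IH(3) n(3) by simp
qed


text \<open>
  \<open>Y - Y'\<close> is the integral of \<open>g\<close> over \<open>(s, t]\<close>, hence an \<open>L\<^sup>2\<close>-limit of sums with
  deterministic coefficients, for which the formula is known.
\<close>

lemma wiener_integral_increment_char:
  assumes g: "continuous_on {0..t} g" and t: "t \<in> I" and s: "0 \<le> s" "s \<le> t"
    and Y: "ito_lim (\<lambda>u _. g u) t Y" and Y': "ito_lim (\<lambda>u _. g u) s Y'"
    and A: "A \<in> sets (F s)"
  shows "(LINT \<omega>|M. indicator A \<omega> *\<^sub>R iexp (l * (Y \<omega> - Y' \<omega>)))
    = of_real (prob A) * complex_of_real (exp (- l\<^sup>2 * integral {s..t} (\<lambda>u. (g u)\<^sup>2) / 2))"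
proof -
  note [measurable] = ito_lim_measurable[OF Y] ito_lim_measurable[OF Y']
  have A' [measurable]: "A \<in> sets M" using A sets_F_subset by blast
  have gs: "continuous_on {s..t} g" by (rule continuous_on_subset[OF g]) (use s in auto)
  have grid_I: "grid s t n i \<in> I \<and> s \<le> grid s t n i \<and> grid s t n i \<le> t" if "i \<le> n" "0 < n" for n i
    using grid_bounds[OF s(2) that] s down_closed[OF t, of "grid s t n i"] by auto
  define G where "G n \<omega> = (\<Sum>i<n. g (grid s t n i) * (B (grid s t n (Suc i)) \<omega> - B (grid s t n i) \<omega>))"
    for n \<omega>
  let ?D = "\<lambda>\<omega>. Y \<omega> - Y' \<omega>"
  let ?H = "\<lambda>u (\<omega>::'a). g u - indicator {..s} u * g u"
  have D: "ito_lim ?H t ?D"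
    by (rule ito_lim_diff[OF Y ito_lim_extend[OF Y' t s(2)]])
  have close: "G n \<in> borel_measurable M \<and> (\<integral>\<^sup>+\<omega>. ennreal ((G n \<omega> - ?D \<omega>)\<^sup>2) \<partial>M) \<le> ennreal (4 * (\<epsilon>\<^sup>2 * (t + 1)))"
    if n: "0 < n" and \<epsilon>: "0 < \<epsilon>" and unif: "\<And>i u w. i < n \<Longrightarrow> u \<in> {grid s t n i..grid s t n (Suc i)} \<Longrightarrow>
      w \<in> {grid s t n i..grid s t n (Suc i)} \<Longrightarrow> \<bar>g u - g w\<bar> \<le> \<epsilon>" for n \<epsilon>
  proof -
    \<comment> \<open>partitions start at 0, so the grid on \<open>[s, t]\<close> is preceded by \<open>[0, s]\<close> with coefficient 0\<close>
    define \<rho> where "\<rho> i = (case i of 0 \<Rightarrow> 0 | Suc j \<Rightarrow> grid s t n j)" for i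
    define \<xi> where "\<xi> i = (\<lambda>_::'a. case i of 0 \<Rightarrow> 0 | Suc j \<Rightarrow> g (grid s t n j))" for i
    have mono: "\<rho> i \<le> \<rho> (Suc i)" if "i < Suc n" for i
      using grid_mono[OF s(2), of _ "Suc _"] s by (cases i) (auto simp: \<rho>_def)
    have "ito_lim (simple_process (Suc n) \<rho> \<xi>) t (simple_integral B (Suc n) \<rho> \<xi>)"
      by (rule ito_lim_simple[OF t]) (use n mono in \<open>auto simp: \<rho>_def \<xi>_def grid_n\<close>)
    moreover have "simple_integral B (Suc n) \<rho> \<xi> = G n"
      by (simp add: fun_eq_iff simple_integral_def G_def \<rho>_def \<xi>_def sum.lessThan_Suc_shift del: sum.lessThan_Suc)
    ultimately have S: "ito_lim (simple_process (Suc n) \<rho> \<xi>) t (G n)" by simp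
    have "energy t (\<lambda>u \<omega>. simple_process (Suc n) \<rho> \<xi> u \<omega> - ?H u \<omega>) \<omega> \<le> ennreal (\<epsilon>\<^sup>2 * t)" for \<omega>
    proof (rule energy_simple_diff_le)
      fix i u assume *: "i < Suc n" "\<rho> i < u" "u \<le> \<rho> (Suc i)"
      show "\<bar>\<xi> i \<omega> - ?H u \<omega>\<bar> \<le> \<epsilon>"
      proof (cases i)
        case 0
        then show ?thesis using * \<epsilon> by (simp add: \<xi>_def \<rho>_def)
      next
        case (Suc j)
        then have "grid s t n j < u" "u \<le> grid s t n (Suc j)" "j < n" using * by (auto simp: \<rho>_def)
        moreover from this have "s < u" using grid_I[of j n] by auto
        ultimately show ?thesis using unif[of j "grid s t n j" u] Suc by (simp add: \<xi>_def)
      qed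
    qed (use n mono s \<epsilon> in \<open>auto simp: \<rho>_def grid_n\<close>)
    also have "ennreal (\<epsilon>\<^sup>2 * t) \<le> ennreal (\<epsilon>\<^sup>2 * (t + 1))"
      using s by (intro ennreal_leI mult_left_mono) auto
    finally have "AE \<omega> in M. energy t (\<lambda>u \<omega>. simple_process (Suc n) \<rho> \<xi> u \<omega> - ?H u \<omega>) \<omega> \<le> ennreal (\<epsilon>\<^sup>2 * (t + 1))"
      by simp
    then show ?thesis
      using ito_lim_L2_bound[OF ito_lim_diff[OF S D], of "\<epsilon>\<^sup>2 * (t + 1)"] \<epsilon> s ito_lim_measurable[OF S]
      by (auto intro!: mult_pos_pos)
  qed
  have "(\<lambda>n. LINT \<omega>|M. indicator A \<omega> *\<^sub>R iexp (l * G n \<omega>)) \<longlonglongrightarrow> (LINT \<omega>|M. indicator A \<omega> *\<^sub>R iexp (l * ?D \<omega>))"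
  proof (rule LIMSEQ_I)
    fix r :: real assume r: "0 < r"
    define \<epsilon> where "\<epsilon> = r / (2 * (\<bar>l\<bar> + 1) * sqrt (t + 1))"
    have t1: "0 < sqrt (t + 1)" using s by simp
    have \<epsilon>: "0 < \<epsilon>" using r t1 by (simp add: \<epsilon>_def)
    have cancel: "2 * (r / (2 * a * q)) * q = r / a" if "q \<noteq> 0" for a q :: real
      using that by simp
    have "\<bar>l\<bar> * (2 * \<epsilon> * sqrt (t + 1)) = r * (\<bar>l\<bar> / (\<bar>l\<bar> + 1))"
      unfolding \<epsilon>_def using t1 by (subst cancel) auto
    also have "\<dots> < r" using r by (simp add: field_simps)
    finally have lt: "\<bar>l\<bar> * (2 * \<epsilon> * sqrt (t + 1)) < r" .
    obtain N where N: "0 < N" "\<And>n i u w. N \<le> n \<Longrightarrow> i < n \<Longrightarrow> u \<in> {grid s t n i..grid s t n (Suc i)} \<Longrightarrow>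
      w \<in> {grid s t n i..grid s t n (Suc i)} \<Longrightarrow> \<bar>g u - g w\<bar> \<le> \<epsilon>"
      using uniform_grid[OF gs s(2) \<epsilon>] by blast
    have "norm ((LINT \<omega>|M. indicator A \<omega> *\<^sub>R iexp (l * G n \<omega>)) - (LINT \<omega>|M. indicator A \<omega> *\<^sub>R iexp (l * ?D \<omega>))) < r"
      if n: "N \<le> n" for n
    proof -
      have c: "G n \<in> borel_measurable M \<and> (\<integral>\<^sup>+\<omega>. ennreal ((G n \<omega> - ?D \<omega>)\<^sup>2) \<partial>M) \<le> ennreal (4 * (\<epsilon>\<^sup>2 * (t + 1)))"
        by (rule close) (use N n \<epsilon> in auto)
      have "4 * (\<epsilon>\<^sup>2 * (t + 1)) = (2 * \<epsilon> * sqrt (t + 1))\<^sup>2"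
        using s by (simp add: power_mult_distrib)
      then have "norm ((LINT \<omega>|M. indicator A \<omega> *\<^sub>R iexp (l * G n \<omega>)) - (LINT \<omega>|M. indicator A \<omega> *\<^sub>R iexp (l * ?D \<omega>)))
          \<le> \<bar>l\<bar> * (2 * \<epsilon> * sqrt (t + 1))"
        using c \<epsilon> t1 by (intro char_L2_close) auto
      then show ?thesis using lt by simp
    qed
    then show "\<exists>no. \<forall>n\<ge>no. norm ((LINT \<omega>|M. indicator A \<omega> *\<^sub>R iexp (l * G n \<omega>)) - (LINT \<omega>|M. indicator A \<omega> *\<^sub>R iexp (l * ?D \<omega>))) < r"
      by blast
  qed
  moreover have "(\<lambda>n. LINT \<omega>|M. indicator A \<omega> *\<^sub>R iexp (l * G n \<omega>))
      \<longlonglongrightarrow> of_real (prob A) * complex_of_real (exp (- l\<^sup>2 * integral {s..t} (\<lambda>u. (g u)\<^sup>2) / 2))"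
  proof (rule Lim_transform_eventually)
    have "continuous_on {s..t} (\<lambda>u. (g u)\<^sup>2)" using gs by (intro continuous_intros)
    from riemann_sum_tendsto(1)[OF this s(2)]
    show "(\<lambda>n. complex_of_real (prob A) * complex_of_real (exp (- l\<^sup>2 *
        (\<Sum>i<n. (g (grid s t n i))\<^sup>2 * (grid s t n (Suc i) - grid s t n i)) / 2)))
      \<longlonglongrightarrow> of_real (prob A) * complex_of_real (exp (- l\<^sup>2 * integral {s..t} (\<lambda>u. (g u)\<^sup>2) / 2))"
      by (intro tendsto_intros) simp_all
    show "\<forall>\<^sub>F n in sequentially. complex_of_real (prob A) * complex_of_real (exp (- l\<^sup>2 *
        (\<Sum>i<n. (g (grid s t n i))\<^sup>2 * (grid s t n (Suc i) - grid s t n i)) / 2))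
      = (LINT \<omega>|M. indicator A \<omega> *\<^sub>R iexp (l * G n \<omega>))"
      using eventually_gt_at_top[of 0]
    proof eventually_elim
      case (elim n)
      show ?case
        unfolding G_def
        using char_deterministic_sum[of n "grid s t n" A l "\<lambda>i. g (grid s t n i)"] grid_I[OF _ elim]
          grid_mono[OF s(2), of _ "Suc _" n] A
        by auto
    qed
  qed
  ultimately show ?thesis by (rule LIMSEQ_unique)
qed

lemma wiener_integral_increment_law:
  assumes g: "continuous_on {0..t} g" and t: "t \<in> I" and s: "0 \<le> s" "s \<le> t"
    and Y: "ito_lim (\<lambda>u _. g u) t Y" and Y': "ito_lim (\<lambda>u _. g u) s Y'"
    and \<sigma>: "0 < \<sigma>" "\<sigma>\<^sup>2 = integral {s..t} (\<lambda>u. (g u)\<^sup>2)"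
  shows "distributed M lborel (\<lambda>\<omega>. Y \<omega> - Y' \<omega>) (normal_density 0 \<sigma>)"
    and "\<And>A E. A \<in> sets (F s) \<Longrightarrow> E \<in> sets borel \<Longrightarrow>
      prob (A \<inter> ((\<lambda>\<omega>. Y \<omega> - Y' \<omega>) -` E \<inter> space M))
        = prob A * prob ((\<lambda>\<omega>. Y \<omega> - Y' \<omega>) -` E \<inter> space M)"
proof -
  note [measurable] = ito_lim_measurable[OF Y] ito_lim_measurable[OF Y']
  let ?N = "density lborel (normal_density 0 \<sigma>)" and ?D = "\<lambda>\<omega>. Y \<omega> - Y' \<omega>"
  have *: "prob (A \<inter> (?D -` E \<inter> space M)) = prob A * measure ?N E"
    if A: "A \<in> sets (F s)" and E: "E \<in> sets borel" for A E
  proof (rule law_and_indep_of_char[OF _ _ char_normal_distribution(1)[OF \<sigma>(1)] _ E])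
    show "A \<in> sets M" using A sets_F_subset by blast
    show "(LINT \<omega>|M. indicator A \<omega> *\<^sub>R iexp (l * ?D \<omega>)) = of_real (prob A) * char ?N l" for l
      unfolding char_normal_distribution(2)[OF \<sigma>(1)] \<sigma>(2)
      by (rule wiener_integral_increment_char[OF g t s Y Y' A])
  qed measurable
  have law: "prob (?D -` E \<inter> space M) = measure ?N E" if "E \<in> sets borel" for E
  proof -
    have "space M \<in> sets (F s)" using sets.top[of "F s"] by simp
    from *[OF this that] show ?thesis by (simp add: prob_space Int_absorb1)
  qed
  show "prob (A \<inter> (?D -` E \<inter> space M)) = prob A * prob (?D -` E \<inter> space M)"
    if "A \<in> sets (F s)" "E \<in> sets borel" for A E
    using *[OF that] law[OF that(2)] by simp
  interpret N: real_distribution ?N by (rule char_normal_distribution(1)[OF \<sigma>(1)])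
  have "distr M lborel ?D = ?N"
  proof (rule measure_eqI)
    fix E assume "E \<in> sets (distr M lborel ?D)"
    then have E: "E \<in> sets borel" by simp
    then show "emeasure (distr M lborel ?D) E = emeasure ?N E"
      using law[OF E] by (subst emeasure_distr) (auto simp: emeasure_eq_measure N.emeasure_eq_measure)
  qed simp
  then show "distributed M lborel ?D (normal_density 0 \<sigma>)"
    unfolding distributed_def by auto
qed

text \<open>
  The joint probability of events \<open>D j \<in> A j\<close> factorises by splitting off the last event, which is independent of the
  past that contains the others.
\<close>

lemma indep_vars_of_sequential_indep:
  fixes D :: "nat \<Rightarrow> 'a \<Rightarrow> real" and \<rho> :: "nat \<Rightarrow> real"
  assumes mono: "\<And>i. i < n \<Longrightarrow> \<rho> i \<le> \<rho> (Suc i)"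
    and D: "\<And>i. i < n \<Longrightarrow> D i \<in> borel_measurable (F (\<rho> (Suc i)))"
    and indep: "\<And>i A E. i < n \<Longrightarrow> A \<in> sets (F (\<rho> i)) \<Longrightarrow> E \<in> sets borel \<Longrightarrow>
      prob (A \<inter> (D i -` E \<inter> space M)) = prob A * prob (D i -` E \<inter> space M)"
  shows "indep_vars (\<lambda>_. borel) D {..<n}"
proof (cases "n = 0")
  case True
  then show ?thesis by (simp add: indep_vars_def indep_sets_def)
next
  case False
  have DM: "D i \<in> borel_measurable M" if "i < n" for i
    using D[OF that] by (rule measurable_F_M)
  have "(\<forall>A\<in>(\<Pi> i\<in>{..<n}. sets (borel :: real measure)).
      prob (\<Inter>j\<in>{..<n}. D j -` A j \<inter> space M) = (\<Prod>j\<in>{..<n}. prob (D j -` A j \<inter> space M)))"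
  proof
    fix A assume A: "A \<in> (\<Pi> i\<in>{..<n}. sets (borel :: real measure))"
    define Q where "Q k = space M \<inter> (\<Inter>j\<in>{..<k}. D j -` A j \<inter> space M)" for k
    have "Q k \<in> sets (F (\<rho> k)) \<and> prob (Q k) = (\<Prod>j\<in>{..<k}. prob (D j -` A j \<inter> space M))" if "k \<le> n" for k
      using that
    proof (induction k)
      case 0
      then show ?case using sets.top[of "F (\<rho> 0)"] by (simp add: Q_def prob_space)
    next
      case (Suc k)
      then have k: "k < n" and IH: "Q k \<in> sets (F (\<rho> k))"
        "prob (Q k) = (\<Prod>j\<in>{..<k}. prob (D j -` A j \<inter> space M))" by auto
      have Ak: "A k \<in> sets borel" using A k by auto
      have eq: "Q (Suc k) = Q k \<inter> (D k -` A k \<inter> space M)"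
        by (auto simp: Q_def lessThan_Suc)
      have "D k -` A k \<inter> space M \<in> sets (F (\<rho> (Suc k)))"
        using measurable_sets[OF D[OF k] Ak] by simp
      then show ?case
        unfolding eq using IH indep[OF k IH(1) Ak] sets_F_mono[OF mono[OF k]] by auto
    qed
    from this[of n] have "prob (Q n) = (\<Prod>j\<in>{..<n}. prob (D j -` A j \<inter> space M))" by simp
    moreover have "Q n = (\<Inter>j\<in>{..<n}. D j -` A j \<inter> space M)"
      using False by (auto simp: Q_def)
    ultimately show "prob (\<Inter>j\<in>{..<n}. D j -` A j \<inter> space M) = (\<Prod>j\<in>{..<n}. prob (D j -` A j \<inter> space M))"
      by simp
  qed
  then show ?thesis
    using False DM
    by (subst indep_vars_finite[where E = "\<lambda>_. sets borel"])
       (auto simp: sets.sigma_sets_eq[of borel, simplified] Int_stable_def)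
qed


section \<open>Change of clock to the unit interval\<close>

text \<open>
  As \<open>g\<close> is positive, the clock \<open>v\<close> is strictly increasing and has a continuous inverse. Along the inverse clock,
  the variance of the increments grows linearly in time, while independence, normality and continuity of paths
  carry over from \<open>Z\<close>.
\<close>

lemma time_changed_wiener_integral:
  fixes g :: "real \<Rightarrow> real" and Z :: "real \<Rightarrow> 'a \<Rightarrow> real"
  defines "v \<equiv> \<lambda>s. integral {0..s} (\<lambda>u. (g u)\<^sup>2)"
  assumes t: "t \<in> I" "0 < t" and g: "continuous_on {0..t} g" and g_pos: "\<And>u. u \<in> {0..t} \<Longrightarrow> 0 < g u"
    and Z: "\<And>s. s \<in> {0..t} \<Longrightarrow> ito_lim (\<lambda>u _. g u) s (Z s)"
    and Z_adapted: "\<And>s. s \<in> {0..t} \<Longrightarrow> Z s \<in> borel_measurable (F s)"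
    and Z_cont: "\<And>\<omega>. \<omega> \<in> space M \<Longrightarrow> continuous_on {0..t} (\<lambda>s. Z s \<omega>)"
  obtains \<kappa> where "\<And>r. r \<in> {0..1} \<Longrightarrow> \<kappa> r \<in> {0..t}" "\<And>s. s \<in> {0..t} \<Longrightarrow> \<kappa> (v s / v t) = s"
    "0 < v t" "wiener_process M {0..1} (\<lambda>r \<omega>. Z (\<kappa> r) \<omega> / sqrt (v t))"
proof -
  have g2: "continuous_on {0..t} (\<lambda>u. (g u)\<^sup>2)" using g by (intro continuous_intros)
  have v_diff: "v b - v a = integral {a..b} (\<lambda>u. (g u)\<^sup>2)" if "0 \<le> a" "a \<le> b" "b \<le> t" for a b
  proof -
    have "integral {0..a} (\<lambda>u. (g u)\<^sup>2) + integral {a..b} (\<lambda>u. (g u)\<^sup>2) = integral {0..b} (\<lambda>u. (g u)\<^sup>2)"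
      using that continuous_on_subset[OF g2]
      by (intro Henstock_Kurzweil_Integration.integral_combine integrable_continuous_real) auto
    then show ?thesis by (simp add: v_def)
  qed
  have v0: "v 0 = 0" by (simp add: v_def)
  have v_pos: "v a < v b" if "0 \<le> a" "a < b" "b \<le> t" for a b
  proof -
    have c: "continuous_on {a..b} (\<lambda>u. (g u)\<^sup>2)" by (rule continuous_on_subset[OF g2]) (use that in auto)
    have "\<exists>x\<in>{a..b}. \<forall>y\<in>{a..b}. (g x)\<^sup>2 \<le> (g y)\<^sup>2"
      by (rule continuous_attains_inf[OF _ _ c]) (use that in auto)
    then obtain x where x: "x \<in> {a..b}" "\<And>y. y \<in> {a..b} \<Longrightarrow> (g x)\<^sup>2 \<le> (g y)\<^sup>2"
      by blast
    have "0 < (g x)\<^sup>2 * (b - a)" using g_pos[of x] x(1) that by simp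
    also have "\<dots> = integral {a..b} (\<lambda>_. (g x)\<^sup>2)" using that by simp
    also have "\<dots> \<le> integral {a..b} (\<lambda>u. (g u)\<^sup>2)"
      using x c by (intro integral_le integrable_continuous_real) auto
    finally show ?thesis using v_diff[of a b] that by simp
  qed
  have v_cont: "continuous_on {0..t} v"
    unfolding v_def using integrable_continuous_real[OF g2] by (rule indefinite_integral_continuous_1)
  have vt: "0 < v t" using v_pos[of 0 t] v0 t by simp
  have v_inj: "inj_on v {0..t}"
    using v_pos by (intro linorder_inj_onI') force
  have img: "v ` {0..t} = {0..v t}"
  proof
    have "v s \<le> v t \<and> 0 \<le> v s" if "s \<in> {0..t}" for s
      using v_pos[of 0 s] v_pos[of s t] v0 that by (cases "s = 0"; cases "s = t") (auto simp: vt[THEN less_imp_le])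
    then show "v ` {0..t} \<subseteq> {0..v t}" by auto
    show "{0..v t} \<subseteq> v ` {0..t}"
    proof
      fix y assume "y \<in> {0..v t}"
      then show "y \<in> v ` {0..t}"
        using IVT'[of v 0 y t] v_cont v0 t by auto
    qed
  qed
  define w where "w = the_inv_into {0..t} v"
  define \<kappa> where "\<kappa> r = w (r * v t)" for r
  have w_cont: "continuous_on {0..v t} w"
    unfolding w_def img[symmetric]
    by (rule continuous_on_inv[OF v_cont]) (auto simp: the_inv_into_f_f[OF v_inj])
  have w_in: "w y \<in> {0..t}" if "y \<in> {0..v t}" for y
    unfolding w_def by (rule the_inv_into_into[OF v_inj]) (use that img in auto)
  have vw: "v (w y) = y" if "y \<in> {0..v t}" for y
    unfolding w_def by (rule f_the_inv_into_f[OF v_inj]) (use that img in auto)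
  have scale: "r * v t \<in> {0..v t}" if "r \<in> {0..1}" for r
    using that vt by (auto simp: mult_le_cancel_right1)
  have \<kappa>_in: "\<kappa> r \<in> {0..t}" if "r \<in> {0..1}" for r
    unfolding \<kappa>_def using w_in scale that by blast
  have v\<kappa>: "v (\<kappa> r) = r * v t" if "r \<in> {0..1}" for r
    unfolding \<kappa>_def using vw scale that by blast
  have \<kappa>_v: "\<kappa> (v s / v t) = s" if "s \<in> {0..t}" for s
    unfolding \<kappa>_def w_def using vt that by (simp add: the_inv_into_f_f[OF v_inj])
  have \<kappa>_less: "\<kappa> r < \<kappa> r'" if "r \<in> {0..1}" "r' \<in> {0..1}" "r < r'" for r r'
  proof (rule ccontr)
    assume "\<not> \<kappa> r < \<kappa> r'"
    then have "v (\<kappa> r') \<le> v (\<kappa> r)"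
      using v_pos[of "\<kappa> r'" "\<kappa> r"] \<kappa>_in[OF that(1)] \<kappa>_in[OF that(2)] by (cases "\<kappa> r = \<kappa> r'") auto
    then show False using v\<kappa> that vt by (auto simp: mult_le_cancel_right)
  qed
  have \<kappa>_cont: "continuous_on {0..1} \<kappa>"
    unfolding \<kappa>_def by (rule continuous_on_compose2[OF w_cont]) (use scale in \<open>auto intro!: continuous_intros\<close>)
  have \<kappa>_0: "\<kappa> 0 = 0" using \<kappa>_v[of 0] v0 t by simp
  have \<kappa>_I: "\<kappa> r \<in> I" if "r \<in> {0..1}" for r
    using \<kappa>_in[OF that] down_closed[OF t(1)] by auto
  let ?W = "\<lambda>r \<omega>. Z (\<kappa> r) \<omega> / sqrt (v t)"
  have ZM [measurable]: "Z (\<kappa> r) \<in> borel_measurable M" if "r \<in> {0..1}" for r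
    using ito_lim_measurable[OF Z[OF \<kappa>_in[OF that]]] .
  have law: "distributed M lborel (\<lambda>\<omega>. Z (\<kappa> r') \<omega> - Z (\<kappa> r) \<omega>) (normal_density 0 (sqrt (v t) * sqrt (r' - r)))"
    "\<And>A E. A \<in> sets (F (\<kappa> r)) \<Longrightarrow> E \<in> sets borel \<Longrightarrow>
      prob (A \<inter> ((\<lambda>\<omega>. Z (\<kappa> r') \<omega> - Z (\<kappa> r) \<omega>) -` E \<inter> space M))
        = prob A * prob ((\<lambda>\<omega>. Z (\<kappa> r') \<omega> - Z (\<kappa> r) \<omega>) -` E \<inter> space M)"
    if r: "r \<in> {0..1}" "r' \<in> {0..1}" "r < r'" for r r'
  proof -
    have le: "0 \<le> \<kappa> r" "\<kappa> r \<le> \<kappa> r'" "\<kappa> r' \<le> t"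
      using \<kappa>_in[OF r(1)] \<kappa>_in[OF r(2)] \<kappa>_less[OF r] by auto
    have var: "(sqrt (v t) * sqrt (r' - r))\<^sup>2 = integral {\<kappa> r..\<kappa> r'} (\<lambda>u. (g u)\<^sup>2)"
      using v_diff[OF le] v\<kappa>[OF r(1)] v\<kappa>[OF r(2)] vt r(3)
      by (simp add: power_mult_distrib algebra_simps)
    have sd: "0 < sqrt (v t) * sqrt (r' - r)" using vt r by simp
    have gc: "continuous_on {0..\<kappa> r'} g" by (rule continuous_on_subset[OF g]) (use le in auto)
    note * = wiener_integral_increment_law[OF gc \<kappa>_I[OF r(2)] le(1,2) Z[OF \<kappa>_in[OF r(2)]] Z[OF \<kappa>_in[OF r(1)]] sd var]
    show "distributed M lborel (\<lambda>\<omega>. Z (\<kappa> r') \<omega> - Z (\<kappa> r) \<omega>) (normal_density 0 (sqrt (v t) * sqrt (r' - r)))"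
      by (rule *(1))
    show "\<And>A E. A \<in> sets (F (\<kappa> r)) \<Longrightarrow> E \<in> sets borel \<Longrightarrow>
      prob (A \<inter> ((\<lambda>\<omega>. Z (\<kappa> r') \<omega> - Z (\<kappa> r) \<omega>) -` E \<inter> space M))
        = prob A * prob ((\<lambda>\<omega>. Z (\<kappa> r') \<omega> - Z (\<kappa> r) \<omega>) -` E \<inter> space M)"
      by (rule *(2))
  qed
  have "wiener_process M {0..1} ?W"
    unfolding wiener_process_def
  proof (intro conjI ballI allI impI)
    show "prob_space M" by (rule prob_space_axioms)
    show "?W r \<in> borel_measurable M" if "r \<in> {0..1}" for r
      using ZM[OF that] by measurable
    have "AE \<omega> in M. Z 0 \<omega> = 0"
      using ito_lim_zero[OF Z[of 0]] t by (simp add: energy_at_0)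
    then show "AE \<omega> in M. ?W 0 \<omega> = 0" by eventually_elim (simp add: \<kappa>_0)
    show "continuous_on {0..1} (\<lambda>r. ?W r \<omega>)" if "\<omega> \<in> space M" for \<omega>
    proof -
      have "continuous_on {0..1} (\<lambda>r. Z (\<kappa> r) \<omega>)"
        by (rule continuous_on_compose2[OF Z_cont[OF that] \<kappa>_cont]) (use \<kappa>_in in auto)
      then show ?thesis using vt by (intro continuous_intros) auto
    qed
    show "distributed M lborel (\<lambda>\<omega>. ?W r' \<omega> - ?W r \<omega>) (normal_density 0 (sqrt (r' - r)))"
      if "r \<in> {0..1}" "r' \<in> {0..1}" "r < r'" for r r'
    proof -
      have "distributed M lborel (\<lambda>\<omega>. 0 + (1 / sqrt (v t)) * (Z (\<kappa> r') \<omega> - Z (\<kappa> r) \<omega>))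
          (normal_density (0 + (1 / sqrt (v t)) * 0) (\<bar>1 / sqrt (v t)\<bar> * (sqrt (v t) * sqrt (r' - r))))"
        by (rule normal_density_affine[OF law(1)[OF that]]) (use vt that in auto)
      then show ?thesis using vt by (simp add: diff_divide_distrib)
    qed
    fix n :: nat and \<tau> :: "nat \<Rightarrow> real"
    assume \<tau>: "(\<forall>i\<le>n. \<tau> i \<in> {0..1}) \<and> (\<forall>i<n. \<tau> i < \<tau> (Suc i))"
    have "indep_vars (\<lambda>_. borel) (\<lambda>i \<omega>. Z (\<kappa> (\<tau> (Suc i))) \<omega> - Z (\<kappa> (\<tau> i)) \<omega>) {..<n}"
    proof (rule indep_vars_of_sequential_indep[where \<rho> = "\<lambda>i. \<kappa> (\<tau> i)"])
      fix i assume "i < n"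
      then have i: "\<tau> i \<in> {0..1}" "\<tau> (Suc i) \<in> {0..1}" "\<tau> i < \<tau> (Suc i)" using \<tau> by auto
      show le: "\<kappa> (\<tau> i) \<le> \<kappa> (\<tau> (Suc i))" using \<kappa>_less[OF i] by simp
      show "(\<lambda>\<omega>. Z (\<kappa> (\<tau> (Suc i))) \<omega> - Z (\<kappa> (\<tau> i)) \<omega>) \<in> borel_measurable (F (\<kappa> (\<tau> (Suc i))))"
        using Z_adapted[OF \<kappa>_in[OF i(2)]] measurable_F_mono[OF Z_adapted[OF \<kappa>_in[OF i(1)]] le]
        by (rule borel_measurable_diff)
      show "prob (A \<inter> ((\<lambda>\<omega>. Z (\<kappa> (\<tau> (Suc i))) \<omega> - Z (\<kappa> (\<tau> i)) \<omega>) -` E \<inter> space M))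
          = prob A * prob ((\<lambda>\<omega>. Z (\<kappa> (\<tau> (Suc i))) \<omega> - Z (\<kappa> (\<tau> i)) \<omega>) -` E \<inter> space M)"
        if "A \<in> sets (F (\<kappa> (\<tau> i)))" "E \<in> sets borel" for A E
        by (rule law(2)[OF i that])
    qed
    from indep_vars_compose2[OF this, of "\<lambda>_ x. x / sqrt (v t)" "\<lambda>_. borel"]
    show "indep_vars (\<lambda>_. borel) (\<lambda>i \<omega>. ?W (\<tau> (Suc i)) \<omega> - ?W (\<tau> i) \<omega>) {..<n}"
      by (simp add: diff_divide_distrib)
  qed
  then show ?thesis using that[of \<kappa>] \<kappa>_in \<kappa>_v vt by blast
qed

end

section \<open>Uniqueness of the law of quadratic functionals of Wiener processes\<close>

lemma brownian_unit_interval: "wiener_process M {0..1} W \<Longrightarrow> brownian M {0..1} W"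
  unfolding brownian_def brownian_axioms_def by (auto simp: wiener_process_def)

lemma wiener_increments_distr:
  assumes "wiener_process M {0..1} W" "0 < n"
  shows "distr M (PiM {..<n} (\<lambda>_. borel)) (\<lambda>\<omega>. \<lambda>i\<in>{..<n}. W (grid 0 1 n (Suc i)) \<omega> - W (grid 0 1 n i) \<omega>)
    = PiM {..<n} (\<lambda>_. density lborel (normal_density 0 (sqrt (1 / n))))"
proof -
  interpret brownian M "{0..1}" W by (rule brownian_unit_interval[OF assms(1)])
  have g: "grid 0 1 n i \<in> {0..1}" if "i \<le> n" for i
    using grid_bounds[of 0 1 i n] that assms(2) by auto
  have less: "grid 0 1 n i < grid 0 1 n (Suc i)" for i
    using grid_step[of 0 1 n i] assms(2) by (smt (verit) divide_pos_pos of_nat_0_less_iff)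
  let ?D = "\<lambda>i \<omega>. W (grid 0 1 n (Suc i)) \<omega> - W (grid 0 1 n i) \<omega>"
  have "indep_vars (\<lambda>_. borel) ?D {..<n}"
    by (rule increments_indep) (use g less in auto)
  then have "distr M (PiM {..<n} (\<lambda>_. borel)) (\<lambda>\<omega>. \<lambda>i\<in>{..<n}. ?D i \<omega>)
      = PiM {..<n} (\<lambda>i. distr M borel (?D i))"
    using assms(2) g
    by (intro indep_vars_iff_distr_eq_PiM'[THEN iffD1]) (auto intro!: increment_measurable)
  also have "\<dots> = PiM {..<n} (\<lambda>_. density lborel (normal_density 0 (sqrt (1 / n))))"
  proof (rule PiM_cong)
    fix i assume i: "i \<in> {..<n}"
    have "distributed M lborel (?D i) (normal_density 0 (sqrt (grid 0 1 n (Suc i) - grid 0 1 n i)))"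
      using i g less by (intro increment_normal) auto
    then have "distr M lborel (?D i) = density lborel (normal_density 0 (sqrt (1 / n)))"
      by (simp add: grid_step distributed_def)
    moreover have "distr M borel (?D i) = distr M lborel (?D i)"
      by (rule distr_cong) auto
    ultimately show "distr M borel (?D i) = density lborel (normal_density 0 (sqrt (1 / n)))"
      by simp
  qed simp
  finally show ?thesis .
qed

lemma wiener_quadratic_functional_measurable:
  assumes "wiener_process M {0..1} W"
  shows "(\<lambda>\<omega>. a * (W 1 \<omega>)\<^sup>2 + y * integral {0..1} (\<lambda>s. (W s \<omega>)\<^sup>2)) \<in> borel_measurable M"
    and "\<omega> \<in> space M \<Longrightarrow>
      (\<lambda>n. a * (W 1 \<omega>)\<^sup>2 + y * (\<Sum>i<n. (W (grid 0 1 n (Suc i)) \<omega>)\<^sup>2 * (grid 0 1 n (Suc i) - grid 0 1 n i)))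
        \<longlonglongrightarrow> a * (W 1 \<omega>)\<^sup>2 + y * integral {0..1} (\<lambda>s. (W s \<omega>)\<^sup>2)"
    and "0 < n \<Longrightarrow> (\<lambda>\<omega>. a * (W 1 \<omega>)\<^sup>2 + y * (\<Sum>i<n. (W (grid 0 1 n (Suc i)) \<omega>)\<^sup>2 * (grid 0 1 n (Suc i) - grid 0 1 n i)))
      \<in> borel_measurable M"
proof -
  interpret brownian M "{0..1}" W by (rule brownian_unit_interval[OF assms(1)])
  show m: "(\<lambda>\<omega>. a * (W 1 \<omega>)\<^sup>2 + y * (\<Sum>i<n. (W (grid 0 1 n (Suc i)) \<omega>)\<^sup>2 * (grid 0 1 n (Suc i) - grid 0 1 n i)))
      \<in> borel_measurable M" if "0 < n" for n
  proof -
    have [measurable]: "W (grid 0 1 n (Suc i)) \<in> borel_measurable M" if "i \<in> {..<n}" for i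
      using that \<open>0 < n\<close> grid_bounds[of 0 1 "Suc i" n] by (intro B_measurable) auto
    have [measurable]: "W 1 \<in> borel_measurable M" by (rule B_measurable) simp
    show ?thesis by measurable
  qed
  show l: "(\<lambda>n. a * (W 1 \<omega>)\<^sup>2 + y * (\<Sum>i<n. (W (grid 0 1 n (Suc i)) \<omega>)\<^sup>2 * (grid 0 1 n (Suc i) - grid 0 1 n i)))
        \<longlonglongrightarrow> a * (W 1 \<omega>)\<^sup>2 + y * integral {0..1} (\<lambda>s. (W s \<omega>)\<^sup>2)" if "\<omega> \<in> space M" for \<omega>
    by (intro tendsto_intros riemann_sum_tendsto(2)[of 0 1 "\<lambda>s. (W s \<omega>)\<^sup>2"] continuous_intros B_continuous that) simp
  show "(\<lambda>\<omega>. a * (W 1 \<omega>)\<^sup>2 + y * integral {0..1} (\<lambda>s. (W s \<omega>)\<^sup>2)) \<in> borel_measurable M"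
    by (rule borel_measurable_LIMSEQ_real[OF LIMSEQ_Suc[OF l] m]) auto
qed

text \<open>
  Replacing the time integral by Riemann sums gives a function of the increments over a uniform grid, whose joint law is the same
  for all Wiener processes. The characteristic functions converge as the mesh tends to 0.
\<close>

lemma wiener_quadratic_functional_law:
  assumes 1: "wiener_process M {0..1} W" and 2: "wiener_process N {0..1} V"
  shows "distr M borel (\<lambda>\<omega>. a * (W 1 \<omega>)\<^sup>2 + y * integral {0..1} (\<lambda>s. (W s \<omega>)\<^sup>2))
    = distr N borel (\<lambda>\<omega>. a * (V 1 \<omega>)\<^sup>2 + y * integral {0..1} (\<lambda>s. (V s \<omega>)\<^sup>2))"
proof -
  define \<Psi> where "\<Psi> n x = a * (\<Sum>j<n. x j)\<^sup>2 + y * (\<Sum>i<n. (\<Sum>j<Suc i. x j)\<^sup>2 * (1 / real n))"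
    for n :: nat and x :: "nat \<Rightarrow> real"
  let ?P = "\<lambda>n::nat. PiM {..<n} (\<lambda>_. density lborel (normal_density 0 (sqrt (1 / real n))))"
  have \<Psi>: "\<Psi> n \<in> borel_measurable (PiM {..<n} (\<lambda>_. borel))" for n
  proof -
    have [measurable]: "(\<lambda>x. \<Sum>j<k. x j) \<in> borel_measurable (PiM {..<n} (\<lambda>_. borel :: real measure))"
      if "k \<le> n" for k
      by (rule borel_measurable_sum, rule measurable_component_singleton) (use that in auto)
    have "(\<lambda>x. \<Sum>j<Suc i. x j) \<in> borel_measurable (PiM {..<n} (\<lambda>_. borel :: real measure))"
      if "i \<in> {..<n}" for i
      by (rule borel_measurable_sum, rule measurable_component_singleton) (use that in auto)
    then show ?thesis unfolding \<Psi>_def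
      by (intro borel_measurable_add borel_measurable_times borel_measurable_power borel_measurable_sum)
         (auto intro!: borel_measurable_sum measurable_component_singleton)
  qed
  have lim: "(\<lambda>n. LINT x|?P n. iexp (l * \<Psi> n x))
      \<longlonglongrightarrow> char (distr M borel (\<lambda>\<omega>. a * (W 1 \<omega>)\<^sup>2 + y * integral {0..1} (\<lambda>s. (W s \<omega>)\<^sup>2))) l"
    if W: "wiener_process M {0..1} W" for M :: "'c measure" and W l
  proof -
    interpret brownian M "{0..1}" W by (rule brownian_unit_interval[OF W])
    let ?Q = "\<lambda>n \<omega>. a * (W 1 \<omega>)\<^sup>2 + y * (\<Sum>i<n. (W (grid 0 1 n (Suc i)) \<omega>)\<^sup>2 * (grid 0 1 n (Suc i) - grid 0 1 n i))"
    let ?L = "\<lambda>\<omega>. a * (W 1 \<omega>)\<^sup>2 + y * integral {0..1} (\<lambda>s. (W s \<omega>)\<^sup>2)"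
    note meas = wiener_quadratic_functional_measurable[OF W, where a = a and y = y]
    have eq: "(LINT x|?P n. iexp (l * \<Psi> n x)) = (LINT \<omega>|M. iexp (l * ?Q n \<omega>))" if n: "0 < n" for n
    proof -
      let ?D = "\<lambda>\<omega>. \<lambda>i\<in>{..<n}. W (grid 0 1 n (Suc i)) \<omega> - W (grid 0 1 n i) \<omega>"
      have D: "?D \<in> M \<rightarrow>\<^sub>M PiM {..<n} (\<lambda>_. borel)"
        using n grid_bounds[of 0 1 _ n] by (intro measurable_restrict increment_measurable) auto
      have "(LINT x|?P n. iexp (l * \<Psi> n x)) = (LINT \<omega>|M. iexp (l * \<Psi> n (?D \<omega>)))"
        unfolding wiener_increments_distr[OF W n, symmetric]
        using \<Psi>[of n] by (intro integral_distr[OF D]) measurable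
      also have "\<dots> = (LINT \<omega>|M. iexp (l * ?Q n \<omega>))"
      proof (rule integral_cong_AE)
        show "(\<lambda>\<omega>. iexp (l * \<Psi> n (?D \<omega>))) \<in> borel_measurable M"
          using measurable_compose[OF D \<Psi>] by measurable
        show "(\<lambda>\<omega>. iexp (l * ?Q n \<omega>)) \<in> borel_measurable M"
          using meas(3)[OF n] by measurable
        show "AE \<omega> in M. iexp (l * \<Psi> n (?D \<omega>)) = iexp (l * ?Q n \<omega>)"
          using B_0
        proof eventually_elim
          case (elim \<omega>)
          have s: "(\<Sum>j<k. ?D \<omega> j) = W (grid 0 1 n k) \<omega>" if "k \<le> n" for k
          proof -
            have "(\<Sum>j<k. ?D \<omega> j) = (\<Sum>j<k. W (grid 0 1 n (Suc j)) \<omega> - W (grid 0 1 n j) \<omega>)"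
              using that by (intro sum.cong) auto
            also have "\<dots> = W (grid 0 1 n k) \<omega> - W (grid 0 1 n 0) \<omega>"
              by (rule sum_lessThan_telescope)
            finally show ?thesis using elim by simp
          qed
          have "\<Psi> n (?D \<omega>) = ?Q n \<omega>"
            unfolding \<Psi>_def using s[of n] s[of "Suc _"] n
            by (auto simp: grid_n grid_step simp del: sum.lessThan_Suc intro!: arg_cong2[where f = "(+)"] sum.cong)
          then show ?case by simp
        qed
      qed
      finally show ?thesis .
    qed
    have "(\<lambda>n. LINT \<omega>|M. iexp (l * ?Q (Suc n) \<omega>)) \<longlonglongrightarrow> (LINT \<omega>|M. iexp (l * ?L \<omega>))"
    proof (rule integral_dominated_convergence[where w = "\<lambda>_. 1"])
      show "AE \<omega> in M. (\<lambda>n. iexp (l * ?Q (Suc n) \<omega>)) \<longlonglongrightarrow> iexp (l * ?L \<omega>)"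
        using AE_space
      proof eventually_elim
        case (elim \<omega>)
        show ?case by (intro tendsto_intros LIMSEQ_Suc[OF meas(2)[OF elim]])
      qed
      show "(\<lambda>\<omega>. iexp (l * ?L \<omega>)) \<in> borel_measurable M" using meas(1) by measurable
      show "(\<lambda>\<omega>. iexp (l * ?Q (Suc n) \<omega>)) \<in> borel_measurable M" for n
        using meas(3)[of "Suc n"] by measurable
    qed auto
    then have "(\<lambda>n. LINT x|?P (Suc n). iexp (l * \<Psi> (Suc n) x)) \<longlonglongrightarrow> (LINT \<omega>|M. iexp (l * ?L \<omega>))"
      by (simp only: eq[OF zero_less_Suc])
    then have "(\<lambda>n. LINT x|?P n. iexp (l * \<Psi> n x)) \<longlonglongrightarrow> (LINT \<omega>|M. iexp (l * ?L \<omega>))"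
      by (rule LIMSEQ_imp_Suc)
    also have "(LINT \<omega>|M. iexp (l * ?L \<omega>)) = char (distr M borel ?L) l"
      unfolding char_def using meas(1) by (subst integral_distr) auto
    finally show ?thesis .
  qed
  interpret M: prob_space M using 1 by (simp add: wiener_process_def)
  interpret N: prob_space N using 2 by (simp add: wiener_process_def)
  show ?thesis
  proof (rule Levy_uniqueness)
    show "real_distribution (distr M borel (\<lambda>\<omega>. a * (W 1 \<omega>)\<^sup>2 + y * integral {0..1} (\<lambda>s. (W s \<omega>)\<^sup>2)))"
      by (rule M.real_distribution_distr[OF wiener_quadratic_functional_measurable(1)[OF 1]])
    show "real_distribution (distr N borel (\<lambda>\<omega>. a * (V 1 \<omega>)\<^sup>2 + y * integral {0..1} (\<lambda>s. (V s \<omega>)\<^sup>2)))"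
      by (rule N.real_distribution_distr[OF wiener_quadratic_functional_measurable(1)[OF 2]])
    show "char (distr M borel (\<lambda>\<omega>. a * (W 1 \<omega>)\<^sup>2 + y * integral {0..1} (\<lambda>s. (W s \<omega>)\<^sup>2)))
      = char (distr N borel (\<lambda>\<omega>. a * (V 1 \<omega>)\<^sup>2 + y * integral {0..1} (\<lambda>s. (V s \<omega>)\<^sup>2)))"
      by (rule ext, rule LIMSEQ_unique[OF lim[OF 1] lim[OF 2]])
  qed
qed

section \<open>Ito formula for the square of a Wiener integral\<close>

lemma sum_martingale_square:
  fixes a :: "nat \<Rightarrow> real"
  shows "(\<Sum>i<n. (\<Sum>j<i. a j) * a i) = ((\<Sum>i<n. a i)\<^sup>2 - (\<Sum>i<n. (a i)\<^sup>2)) / 2"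
  by (induction n) (simp_all add: power2_eq_square algebra_simps add_divide_distrib)

lemma square_sum3_le: "(a + b + c)\<^sup>2 \<le> 3 * a\<^sup>2 + 3 * b\<^sup>2 + 3 * (c::real)\<^sup>2"
proof -
  have "3 * a\<^sup>2 + 3 * b\<^sup>2 + 3 * c\<^sup>2 - (a + b + c)\<^sup>2 = (a - b)\<^sup>2 + (b - c)\<^sup>2 + (a - c)\<^sup>2"
    by (simp add: power2_eq_square algebra_simps)
  then show ?thesis using zero_le_power2[of "a - b"] zero_le_power2[of "b - c"] zero_le_power2[of "a - c"]
    by linarith
qed

lemma (in prob_space) prob_Markov:
  assumes X [measurable]: "X \<in> borel_measurable M" and le: "(\<integral>\<^sup>+\<omega>. X \<omega> \<partial>M) \<le> ennreal c"
    and c: "0 \<le> c" and \<epsilon>: "0 < \<epsilon>"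
  shows "prob {\<omega> \<in> space M. ennreal \<epsilon> < X \<omega>} \<le> c / \<epsilon>"
proof -
  have "ennreal \<epsilon> * emeasure M {\<omega> \<in> space M. ennreal \<epsilon> < X \<omega>}
      = (\<integral>\<^sup>+\<omega>. ennreal \<epsilon> * indicator {\<omega> \<in> space M. ennreal \<epsilon> < X \<omega>} \<omega> \<partial>M)"
    by (subst nn_integral_cmult_indicator) auto
  also have "\<dots> \<le> (\<integral>\<^sup>+\<omega>. X \<omega> \<partial>M)"
    by (intro nn_integral_mono) (auto simp: indicator_def)
  finally have "ennreal (\<epsilon> * prob {\<omega> \<in> space M. ennreal \<epsilon> < X \<omega>}) \<le> ennreal c"
    using order_trans[OF _ le] \<epsilon> by (simp add: emeasure_eq_measure ennreal_mult')
  then show ?thesis using \<epsilon> c by (simp add: field_simps)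
qed

lemma (in prob_space) AE_tendsto_imp_prob:
  fixes Y :: "nat \<Rightarrow> 'a \<Rightarrow> real"
  assumes Y [measurable]: "\<And>n. Y n \<in> borel_measurable M"
    and lim: "AE \<omega> in M. (\<lambda>n. Y n \<omega>) \<longlonglongrightarrow> 0" and \<epsilon>: "0 < \<epsilon>"
  shows "(\<lambda>n. prob {\<omega> \<in> space M. \<epsilon> < \<bar>Y n \<omega>\<bar>}) \<longlonglongrightarrow> 0"
proof -
  let ?A = "\<lambda>n. {\<omega> \<in> space M. \<epsilon> < \<bar>Y n \<omega>\<bar>}"
  have "(\<lambda>n. LINT \<omega>|M. indicator (?A n) \<omega> :: real) \<longlonglongrightarrow> (LINT \<omega>|M. 0)"
  proof (rule integral_dominated_convergence[where w = "\<lambda>_. 1"])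
    show "AE \<omega> in M. (\<lambda>n. indicator (?A n) \<omega> :: real) \<longlonglongrightarrow> 0"
      using lim
    proof eventually_elim
      case (elim \<omega>)
      then have "\<forall>\<^sub>F n in sequentially. \<bar>Y n \<omega>\<bar> < \<epsilon>"
        using \<epsilon> by (auto simp: tendsto_iff dist_real_def)
      then have "\<forall>\<^sub>F n in sequentially. (0::real) = indicator (?A n) \<omega>"
        by eventually_elim auto
      then show ?case by (rule Lim_transform_eventually[OF tendsto_const])
    qed
  qed (auto simp: indicator_def)
  then show ?thesis by simp
qed

context brownian
begin

lemma jointly_measurable_continuous:
  assumes t: "0 \<le> t" and H: "\<And>s. s \<in> {0..t} \<Longrightarrow> H s \<in> borel_measurable M"
    and cont: "\<And>\<omega>. \<omega> \<in> space M \<Longrightarrow> continuous_on {0..t} (\<lambda>s. H s \<omega>)"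
  shows "jointly_measurable t H"
  unfolding jointly_measurable_def split_def
proof (rule borel_measurable_LIMSEQ_real)
  let ?f = "\<lambda>n x. indicator {0} (snd x) * H 0 (fst x)
    + simple_process (Suc n) (grid 0 t (Suc n)) (\<lambda>i. H (grid 0 t (Suc n) i)) (snd x) (fst x)"
  show "?f n \<in> borel_measurable (M \<Otimes>\<^sub>M lborel)" for n
  proof -
    have [measurable]: "H 0 \<in> borel_measurable M" using H t by simp
    have [measurable]: "H (grid 0 t (Suc n) i) \<in> borel_measurable M" if "i \<in> {..<Suc n}" for i
      using grid_bounds[OF t, of i "Suc n"] that by (intro H) auto
    show ?thesis unfolding simple_process_def by measurable
  qed
  fix x assume "x \<in> space (M \<Otimes>\<^sub>M (lborel :: real measure))"
  then obtain \<omega> s where x: "x = (\<omega>, s)" "\<omega> \<in> space M" by (auto simp: space_pair_measure)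
  have zero: "simple_process (Suc n) (grid 0 t (Suc n)) \<zeta> s \<omega> = 0" if "s \<notin> {0<..t}" for n \<zeta>
    unfolding simple_process_def
  proof (intro sum.neutral ballI)
    fix i assume "i \<in> {..<Suc n}"
    then have "0 \<le> grid 0 t (Suc n) i" "grid 0 t (Suc n) (Suc i) \<le> t"
      using grid_bounds[OF t, of i "Suc n"] grid_bounds[OF t, of "Suc i" "Suc n"] by auto
    then show "\<zeta> i \<omega> * indicator {grid 0 t (Suc n) i<..grid 0 t (Suc n) (Suc i)} s = 0"
      using that by (auto simp: indicator_def)
  qed
  show "(\<lambda>n. ?f n x) \<longlonglongrightarrow> indicator {0..t} (snd x) * H (snd x) (fst x)"
  proof (cases "s \<in> {0<..t}")
    case False
    then show ?thesis using zero[OF False] t by (auto simp: x indicator_def)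
  next
    case True
    show ?thesis
    proof (rule LIMSEQ_I)
      fix r :: real assume r: "0 < r"
      then have r2: "0 < r / 2" by simp
      obtain N where N: "\<And>n i u w. N \<le> n \<Longrightarrow> i < n \<Longrightarrow> u \<in> {grid 0 t n i..grid 0 t n (Suc i)} \<Longrightarrow>
        w \<in> {grid 0 t n i..grid 0 t n (Suc i)} \<Longrightarrow> \<bar>H u \<omega> - H w \<omega>\<bar> \<le> r / 2"
        by (rule uniform_grid[OF cont[OF x(2)] t r2]) blast
      have "norm (?f n x - indicator {0..t} (snd x) * H (snd x) (fst x)) < r" if n: "N \<le> n" for n
      proof -
        obtain i where i: "i < Suc n" "grid 0 t (Suc n) i < s" "s \<le> grid 0 t (Suc n) (Suc i)"
          using interval_of_partition[of "grid 0 t (Suc n)" s "Suc n"] True by (auto simp: grid_n)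
        have "simple_process (Suc n) (grid 0 t (Suc n)) (\<lambda>i. H (grid 0 t (Suc n) i)) s \<omega> = H (grid 0 t (Suc n) i) \<omega>"
          by (rule simple_process_eq) (use i grid_mono[OF t] in auto)
        moreover have "\<bar>H (grid 0 t (Suc n) i) \<omega> - H s \<omega>\<bar> \<le> r / 2"
          by (rule N[of "Suc n" i]) (use i n in auto)
        ultimately show ?thesis using True r by (simp add: x)
      qed
      then show "\<exists>no. \<forall>n\<ge>no. norm (?f n x - indicator {0..t} (snd x) * H (snd x) (fst x)) < r" by blast
    qed
  qed
qed

lemma continuous_bounded:
  assumes "continuous_on {a..b} (f :: real \<Rightarrow> real)"
  obtains K where "1 \<le> K" "\<And>u. u \<in> {a..b} \<Longrightarrow> \<bar>f u\<bar> \<le> K"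
proof -
  have "bounded (f ` {a..b})"
    by (intro compact_imp_bounded compact_continuous_image assms) simp
  then obtain K where "\<forall>u\<in>{a..b}. \<bar>f u\<bar> \<le> K" by (auto simp: bounded_iff)
  then show ?thesis using that[of "max 1 K"] by (meson le_max_iff_disj max.cobounded1)
qed

text \<open>
  Ito's formula for the square of a Wiener integral. The approximating coefficients are \<open>g(\<tau> i) G i\<close>, where
  \<open>G\<close> is the Riemann sum of \<open>Z\<close> on the same grid: then the simple integral equals
  \<open>(G\<^sup>2 - Q) / 2\<close> exactly, where \<open>Q\<close> is the sum of the squared increments of \<open>G\<close>. It remains to see that \<open>G\<close> is
  close to \<open>Z\<close>, which follows from uniform continuity of \<open>g\<close>, and that \<open>Q\<close> is close to its mean,
  for which the fourth moment of the increments of \<open>B\<close> suffices.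
\<close>

lemma ito_square:
  fixes g :: "real \<Rightarrow> real"
  assumes t: "t \<in> I" "0 < t" and g: "continuous_on {0..t} g"
    and Z: "\<And>s. s \<in> {0..t} \<Longrightarrow> ito_lim (\<lambda>u _. g u) s (Z s)" and Zjm: "jointly_measurable t Z"
  shows "ito_lim (\<lambda>s \<omega>. g s * Z s \<omega>) t (\<lambda>\<omega>. ((Z t \<omega>)\<^sup>2 - integral {0..t} (\<lambda>u. (g u)\<^sup>2)) / 2)"
proof (rule ito_lim_closure[OF t(1)])
  have tI: "s \<in> I" if "s \<in> {0..t}" for s using down_closed[OF t(1)] that by auto
  have Zm [measurable]: "Z s \<in> borel_measurable M" if "s \<in> {0..t}" for s
    using ito_lim_measurable[OF Z[OF that]] .
  show jm: "jointly_measurable t (\<lambda>s \<omega>. g s * Z s \<omega>)"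
    using ito_lim_jm[OF Z[of t]] Zjm t by (intro jointly_measurable_arith) auto
  have Zt [measurable]: "Z t \<in> borel_measurable M" using t by simp
  show "(\<lambda>\<omega>. ((Z t \<omega>)\<^sup>2 - integral {0..t} (\<lambda>u. (g u)\<^sup>2)) / 2) \<in> borel_measurable M" by measurable
  let ?v = "integral {0..t} (\<lambda>u. (g u)\<^sup>2)"
  obtain K where K: "1 \<le> K" "\<And>u. u \<in> {0..t} \<Longrightarrow> \<bar>g u\<bar> \<le> K" using continuous_bounded[OF g] by blast
  have K2: "(g u)\<^sup>2 \<le> K\<^sup>2" if "u \<in> {0..t}" for u
    using power_mono[OF K(2)[OF that], of 2] by simp
  have Z2: "(\<integral>\<^sup>+\<omega>. ennreal ((Z s \<omega>)\<^sup>2) \<partial>M) \<le> ennreal (4 * (K\<^sup>2 * t))" if s: "s \<in> {0..t}" for s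
  proof (rule ito_lim_L2_bound[OF Z[OF s]])
    show "0 < K\<^sup>2 * t" using K t by simp
    have "energy s (\<lambda>u _. g u) \<omega> \<le> ennreal (K\<^sup>2 * s)" for \<omega> :: 'a
      by (rule energy_le_of_bound) (use K s in auto)
    also have "ennreal (K\<^sup>2 * s) \<le> ennreal (K\<^sup>2 * t)" using s by (intro ennreal_leI mult_left_mono) auto
    finally show "AE \<omega> in M. energy s (\<lambda>u _. g u) \<omega> \<le> ennreal (K\<^sup>2 * t)" by simp
  qed
  fix \<epsilon> :: real assume \<epsilon>: "0 < \<epsilon>"
  \<comment> \<open>If \<open>g\<close> varies by at most \<open>\<eta>\<close> on the intervals of the grid, then \<open>c1 \<eta>\<close> bounds the part of the
    error of the integrand, and \<open>c2 \<eta>\<close> the part of the error of the integral, that does not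
    vanish with the mesh alone.\<close>
  define c1 where "c1 \<eta> = t * (24 * K\<^sup>2 * t * \<eta>\<^sup>2) / \<epsilon>" for \<eta>
  define c2 where "c2 \<eta> = (4 * \<eta>\<^sup>2 * t + 4 * \<eta> * t + 4 * \<eta> * K\<^sup>2 * t) / (2 * \<epsilon> / 3)" for \<eta>
  have "(c1 \<longlongrightarrow> c1 0) (at_right 0)" "(c2 \<longlongrightarrow> c2 0) (at_right 0)"
    unfolding c1_def c2_def using \<epsilon> by (intro tendsto_intros; simp)+
  then have "(c1 \<longlongrightarrow> 0) (at_right 0)" "(c2 \<longlongrightarrow> 0) (at_right 0)" by (auto simp: c1_def c2_def)
  then have "\<forall>\<^sub>F \<eta> in at_right 0. c1 \<eta> < \<epsilon> / 2" "\<forall>\<^sub>F \<eta> in at_right 0. c2 \<eta> < \<epsilon> / 2"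
    by - (rule order_tendstoD(2)[OF _ half_gt_zero[OF \<epsilon>]], assumption)+
  moreover have "\<forall>\<^sub>F \<eta> in at_right (0::real). 0 < \<eta>" by (simp add: eventually_at_right_less)
  ultimately have "\<forall>\<^sub>F \<eta> in at_right 0. c1 \<eta> < \<epsilon> / 2 \<and> c2 \<eta> < \<epsilon> / 2 \<and> 0 < \<eta>"
    by eventually_elim simp
  then obtain \<eta> where \<eta>: "c1 \<eta> < \<epsilon> / 2" "c2 \<eta> < \<epsilon> / 2" "0 < \<eta>"
    using eventually_happens[of _ "at_right (0::real)"] by (auto simp: trivial_limit_at_right_real)
  obtain N where N: "0 < N" "\<And>n i u w. N \<le> n \<Longrightarrow> i < n \<Longrightarrow> u \<in> {grid 0 t n i..grid 0 t n (Suc i)} \<Longrightarrow>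
      w \<in> {grid 0 t n i..grid 0 t n (Suc i)} \<Longrightarrow> \<bar>g u - g w\<bar> \<le> \<eta>"
    using uniform_grid[OF g less_imp_le[OF t(2)] \<eta>(3)] by blast
  have "continuous_on {0..t} (\<lambda>u. (g u)\<^sup>2)" using g by (intro continuous_intros)
  from riemann_sum_tendsto(1)[OF this less_imp_le[OF t(2)]]
  have "\<forall>\<^sub>F n in sequentially. dist (\<Sum>i<n. (g (grid 0 t n i))\<^sup>2 * (grid 0 t n (Suc i) - grid 0 t n i)) ?v < \<epsilon> / 3"
    using \<epsilon> by (intro tendstoD) auto
  moreover have "(\<lambda>n. t * (3 * K ^ 4 * t / real n) / \<epsilon>) \<longlonglongrightarrow> 0"
    "(\<lambda>n. (2 * K ^ 4 * t\<^sup>2 / real n) / (2 * \<epsilon> / 3)\<^sup>2) \<longlonglongrightarrow> 0"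
    using tendsto_mult_right_zero[OF lim_1_over_n, of "t * (3 * K ^ 4 * t) / \<epsilon>"]
      tendsto_mult_right_zero[OF lim_1_over_n, of "(2 * K ^ 4 * t\<^sup>2) / (2 * \<epsilon> / 3)\<^sup>2"]
    by (simp_all add: field_simps)
  then have "\<forall>\<^sub>F n in sequentially. t * (3 * K ^ 4 * t / real n) / \<epsilon> < \<epsilon> / 2"
    "\<forall>\<^sub>F n in sequentially. (2 * K ^ 4 * t\<^sup>2 / real n) / (2 * \<epsilon> / 3)\<^sup>2 < \<epsilon> / 2"
    by - (rule order_tendstoD(2)[OF _ half_gt_zero[OF \<epsilon>]], assumption)+
  ultimately have "\<forall>\<^sub>F n in sequentially. N \<le> n \<and>
      dist (\<Sum>i<n. (g (grid 0 t n i))\<^sup>2 * (grid 0 t n (Suc i) - grid 0 t n i)) ?v < \<epsilon> / 3 \<and>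
      t * (3 * K ^ 4 * t / real n) / \<epsilon> < \<epsilon> / 2 \<and> (2 * K ^ 4 * t\<^sup>2 / real n) / (2 * \<epsilon> / 3)\<^sup>2 < \<epsilon> / 2"
    using eventually_ge_at_top[of N] by eventually_elim simp
  then obtain n where n: "N \<le> n"
      "dist (\<Sum>i<n. (g (grid 0 t n i))\<^sup>2 * (grid 0 t n (Suc i) - grid 0 t n i)) ?v < \<epsilon> / 3"
      "t * (3 * K ^ 4 * t / real n) / \<epsilon> < \<epsilon> / 2" "(2 * K ^ 4 * t\<^sup>2 / real n) / (2 * \<epsilon> / 3)\<^sup>2 < \<epsilon> / 2"
    using eventually_happens by force
  have n0: "0 < n" using N(1) n(1) by simp
  define \<tau> where "\<tau> = grid 0 t n"
  have \<tau>0: "\<tau> 0 = 0" and \<tau>n: "\<tau> n = t" and \<tau>_mono: "\<And>i j. i \<le> j \<Longrightarrow> \<tau> i \<le> \<tau> j"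
    and \<tau>_step: "\<And>i. \<tau> (Suc i) - \<tau> i = t / real n"
    using n0 t by (auto simp: \<tau>_def grid_n grid_mono grid_step)
  have \<tau>_in: "\<tau> i \<in> {0..t}" if "i \<le> n" for i
    using \<tau>_mono[of 0 i] \<tau>_mono[OF that] \<tau>0 \<tau>n by auto
  have \<tau>_I: "\<tau> i \<in> I" if "i \<le> n" for i using tI[OF \<tau>_in[OF that]] .
  have close: "\<bar>g u - g w\<bar> \<le> \<eta>" if "i < n" "u \<in> {\<tau> i..\<tau> (Suc i)}" "w \<in> {\<tau> i..\<tau> (Suc i)}" for i u w
    using N(2)[OF n(1)] that by (auto simp: \<tau>_def)
  define D where "D i \<omega> = B (\<tau> (Suc i)) \<omega> - B (\<tau> i) \<omega>" for i \<omega>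
  define G where "G i \<omega> = (\<Sum>j<i. g (\<tau> j) * D j \<omega>)" for i \<omega>
  have G_F: "G i \<in> borel_measurable (F (\<tau> i))" if "i \<le> n" for i
    unfolding G_def D_def
  proof (intro borel_measurable_sum borel_measurable_times borel_measurable_diff)
    fix j assume "j \<in> {..<i}"
    then show "B (\<tau> (Suc j)) \<in> borel_measurable (F (\<tau> i))" "B (\<tau> j) \<in> borel_measurable (F (\<tau> i))"
      using that by (intro B_measurable_F \<tau>_I \<tau>_mono; simp)+
  qed simp
  have Dm [measurable]: "D i \<in> borel_measurable M" if "i < n" for i
    unfolding D_def using \<tau>_I[of i] \<tau>_I[of "Suc i"] that by (intro increment_measurable) auto
  have Gm [measurable]: "G i \<in> borel_measurable M" if "i \<le> n" for i
    using measurable_F_M[OF G_F[OF that]] .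
  \<comment> \<open>At an intermediate time \<open>s\<close> the last increment is only taken up to \<open>s\<close>: the step function is then
    uniformly close to \<open>g\<close> on all of \<open>[0, s]\<close>.\<close>
  have GZ: "(\<lambda>\<omega>. G i \<omega> + g (\<tau> i) * (B s \<omega> - B (\<tau> i) \<omega>)) \<in> borel_measurable M \<and>
      (\<integral>\<^sup>+\<omega>. ennreal ((G i \<omega> + g (\<tau> i) * (B s \<omega> - B (\<tau> i) \<omega>) - Z s \<omega>)\<^sup>2) \<partial>M) \<le> ennreal (4 * (\<eta>\<^sup>2 * t))"
    if i: "i < n" and s: "\<tau> i \<le> s" "s \<le> \<tau> (Suc i)" for i s
  proof -
    have s0t: "s \<in> {0..t}" using \<tau>_in[of i] \<tau>_in[of "Suc i"] i s by auto
    define \<rho> where "\<rho> j = (if j \<le> i then \<tau> j else s)" for j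
    let ?\<xi> = "\<lambda>j (_::'a). g (\<tau> j)"
    have \<rho>_mono: "\<rho> j \<le> \<rho> (Suc j)" if "j < Suc i" for j
      using that s \<tau>_mono[of j "Suc j"] by (cases "j = i") (auto simp: \<rho>_def)
    have "ito_lim (simple_process (Suc i) \<rho> ?\<xi>) s (simple_integral B (Suc i) \<rho> ?\<xi>)"
      by (rule ito_lim_simple[OF tI[OF s0t]]) (use \<rho>_mono \<tau>0 in \<open>auto simp: \<rho>_def\<close>)
    moreover have "simple_integral B (Suc i) \<rho> ?\<xi> = (\<lambda>\<omega>. G i \<omega> + g (\<tau> i) * (B s \<omega> - B (\<tau> i) \<omega>))"
    proof
      fix \<omega>
      have "(\<Sum>j<i. g (\<tau> j) * (B (\<rho> (Suc j)) \<omega> - B (\<rho> j) \<omega>)) = G i \<omega>"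
        unfolding G_def D_def by (intro sum.cong) (auto simp: \<rho>_def)
      moreover have "\<rho> i = \<tau> i" "\<rho> (Suc i) = s" by (simp_all add: \<rho>_def)
      ultimately show "simple_integral B (Suc i) \<rho> ?\<xi> \<omega> = G i \<omega> + g (\<tau> i) * (B s \<omega> - B (\<tau> i) \<omega>)"
        by (simp add: simple_integral_def)
    qed
    ultimately have S: "ito_lim (simple_process (Suc i) \<rho> ?\<xi>) s (\<lambda>\<omega>. G i \<omega> + g (\<tau> i) * (B s \<omega> - B (\<tau> i) \<omega>))"
      by simp
    have "energy s (\<lambda>u \<omega>. simple_process (Suc i) \<rho> ?\<xi> u \<omega> - g u) \<omega> \<le> ennreal (\<eta>\<^sup>2 * s)" for \<omega>
    proof (rule energy_simple_diff_le)
      fix j u assume "j < Suc i" "\<rho> j < u" "u \<le> \<rho> (Suc j)"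
      then have "\<tau> j \<le> u" "u \<le> \<tau> (Suc j)" "j < n"
        using s i by (cases "j = i"; simp add: \<rho>_def)+
      then show "\<bar>g (\<tau> j) - g u\<bar> \<le> \<eta>" using \<tau>_mono[of j "Suc j"] by (intro close[of j]) auto
    qed (use \<rho>_mono \<tau>0 s0t \<eta> in \<open>auto simp: \<rho>_def\<close>)
    also have "ennreal (\<eta>\<^sup>2 * s) \<le> ennreal (\<eta>\<^sup>2 * t)" using s0t by (intro ennreal_leI mult_left_mono) auto
    finally have "AE \<omega> in M. energy s (\<lambda>u \<omega>. simple_process (Suc i) \<rho> ?\<xi> u \<omega> - g u) \<omega> \<le> ennreal (\<eta>\<^sup>2 * t)"
      by simp
    then show ?thesis
      using ito_lim_L2_bound[OF ito_lim_diff[OF S Z[OF s0t]], of "\<eta>\<^sup>2 * t"] \<eta> t ito_lim_measurable[OF S] by simp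
  qed
  let ?\<xi> = "\<lambda>i \<omega>. g (\<tau> i) * G i \<omega>"
  let ?\<phi> = "simple_process n \<tau> ?\<xi>"
  have \<phi>: "ito_lim ?\<phi> t (simple_integral B n \<tau> ?\<xi>)"
  proof (rule ito_lim_simple[OF t(1) \<tau>0 \<tau>n])
    show "\<tau> i \<le> \<tau> (Suc i)" for i by (rule \<tau>_mono) simp
    show "?\<xi> i \<in> borel_measurable (F (\<tau> i))" if "i < n" for i
      using G_F[of i] that by (intro borel_measurable_times) auto
  qed
  note djm = jointly_measurable_arith(2)[OF ito_lim_jm[OF \<phi>] jm]
  have "prob {\<omega> \<in> space M. ennreal \<epsilon> < energy t (\<lambda>s \<omega>. ?\<phi> s \<omega> - g s * Z s \<omega>) \<omega>}
      \<le> (t * (24 * K\<^sup>2 * t * \<eta>\<^sup>2 + 3 * K ^ 4 * t / real n)) / \<epsilon>"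
  proof (rule prob_Markov[OF energy_measurable[OF djm]])
    let ?C = "24 * K\<^sup>2 * t * \<eta>\<^sup>2 + 3 * K ^ 4 * t / real n"
    have C0: "0 \<le> ?C" using t K by auto
    have "(\<integral>\<^sup>+\<omega>. energy t (\<lambda>s \<omega>. ?\<phi> s \<omega> - g s * Z s \<omega>) \<omega> \<partial>M)
        = (\<integral>\<^sup>+\<omega>. \<integral>\<^sup>+s. ennreal ((indicator {0..t} s * (?\<phi> s \<omega> - g s * Z s \<omega>))\<^sup>2) \<partial>lborel \<partial>M)"
      by (simp only: energy_alt)
    also have "\<dots> = (\<integral>\<^sup>+s. \<integral>\<^sup>+\<omega>. ennreal ((indicator {0..t} s * (?\<phi> s \<omega> - g s * Z s \<omega>))\<^sup>2) \<partial>M \<partial>lborel)"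
    proof -
      interpret P: pair_sigma_finite M "lborel :: real measure" ..
      have "(\<lambda>(\<omega>, s). ennreal ((indicator {0..t} s * (?\<phi> s \<omega> - g s * Z s \<omega>))\<^sup>2)) \<in> borel_measurable (M \<Otimes>\<^sub>M lborel)"
        using djm unfolding jointly_measurable_def split_def by measurable
      then show ?thesis by (rule P.Fubini'[symmetric])
    qed
    also have "\<dots> \<le> (\<integral>\<^sup>+s. ennreal ?C * indicator {0..t} s \<partial>lborel)"
    proof (rule nn_integral_mono_AE)
      show "AE s in lborel. (\<integral>\<^sup>+\<omega>. ennreal ((indicator {0..t} s * (?\<phi> s \<omega> - g s * Z s \<omega>))\<^sup>2) \<partial>M)
          \<le> ennreal ?C * indicator {0..t} s"
        using AE_lborel_singleton[of "0::real"]
      proof eventually_elim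
        case (elim s)
        show ?case
        proof (cases "s \<in> {0..t}")
          case True
          then have "\<tau> 0 < s" "s \<le> \<tau> n" using elim \<tau>0 \<tau>n by auto
          then obtain i where i: "i < n" "\<tau> i < s" "s \<le> \<tau> (Suc i)"
            by (rule interval_of_partition)
          have ti: "\<tau> i \<in> {0..t}" "\<tau> i \<in> I" using \<tau>_in \<tau>_I i by auto
          have sI: "s \<in> I" using tI[OF True] .
          note [measurable] = Zm[OF True] B_measurable[OF sI] B_measurable[OF ti(2)]
          have G' [measurable]: "(\<lambda>\<omega>. G i \<omega> + g (\<tau> i) * (B s \<omega> - B (\<tau> i) \<omega>)) \<in> borel_measurable M"
            using GZ[of i s] i by auto
          let ?a = "\<lambda>\<omega>. ennreal ((Z s \<omega>)\<^sup>2)"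
          let ?b = "\<lambda>\<omega>. ennreal ((G i \<omega> + g (\<tau> i) * (B s \<omega> - B (\<tau> i) \<omega>) - Z s \<omega>)\<^sup>2)"
          let ?c = "\<lambda>\<omega>. ennreal ((B s \<omega> - B (\<tau> i) \<omega>)\<^sup>2)"
          have "(\<integral>\<^sup>+\<omega>. ennreal ((indicator {0..t} s * (?\<phi> s \<omega> - g s * Z s \<omega>))\<^sup>2) \<partial>M)
              \<le> (\<integral>\<^sup>+\<omega>. ennreal (3 * \<eta>\<^sup>2) * ?a \<omega> + ennreal (3 * K\<^sup>2) * ?b \<omega> + ennreal (3 * K ^ 4) * ?c \<omega> \<partial>M)"
          proof (rule nn_integral_mono)
            fix \<omega>
            let ?x = "(g (\<tau> i) - g s) * Z s \<omega>"
              and ?y = "g (\<tau> i) * (G i \<omega> + g (\<tau> i) * (B s \<omega> - B (\<tau> i) \<omega>) - Z s \<omega>)"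
              and ?z = "- ((g (\<tau> i))\<^sup>2 * (B s \<omega> - B (\<tau> i) \<omega>))"
            have "?\<phi> s \<omega> = ?\<xi> i \<omega>"
              by (rule simple_process_eq) (use i \<tau>_mono in auto)
            then have "indicator {0..t} s * (?\<phi> s \<omega> - g s * Z s \<omega>) = ?x + ?y + ?z"
              using True by (simp add: algebra_simps power2_eq_square)
            then have "(indicator {0..t} s * (?\<phi> s \<omega> - g s * Z s \<omega>))\<^sup>2 \<le> 3 * ?x\<^sup>2 + 3 * ?y\<^sup>2 + 3 * ?z\<^sup>2"
              using square_sum3_le[of ?x ?y ?z] by simp
            also have "?x\<^sup>2 \<le> \<eta>\<^sup>2 * (Z s \<omega>)\<^sup>2"
              using power_mono[OF close[of i "\<tau> i" s], of 2] i
              by (simp add: power_mult_distrib mult_right_mono)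
            also have "?y\<^sup>2 \<le> K\<^sup>2 * (G i \<omega> + g (\<tau> i) * (B s \<omega> - B (\<tau> i) \<omega>) - Z s \<omega>)\<^sup>2"
              using mult_right_mono[OF K2[OF ti(1)] zero_le_power2] by (simp only: power_mult_distrib)
            also have "?z\<^sup>2 \<le> K ^ 4 * (B s \<omega> - B (\<tau> i) \<omega>)\<^sup>2"
            proof -
              have "((g (\<tau> i))\<^sup>2)\<^sup>2 \<le> (K\<^sup>2)\<^sup>2" by (rule power_mono[OF K2[OF ti(1)]]) simp
              then have "((g (\<tau> i))\<^sup>2)\<^sup>2 * (B s \<omega> - B (\<tau> i) \<omega>)\<^sup>2 \<le> K ^ 4 * (B s \<omega> - B (\<tau> i) \<omega>)\<^sup>2"
                by (intro mult_right_mono) auto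
              then show ?thesis by (simp add: power_mult_distrib)
            qed
            finally have "(indicator {0..t} s * (?\<phi> s \<omega> - g s * Z s \<omega>))\<^sup>2 \<le> 3 * (\<eta>\<^sup>2 * (Z s \<omega>)\<^sup>2)
                + 3 * (K\<^sup>2 * (G i \<omega> + g (\<tau> i) * (B s \<omega> - B (\<tau> i) \<omega>) - Z s \<omega>)\<^sup>2) + 3 * (K ^ 4 * (B s \<omega> - B (\<tau> i) \<omega>)\<^sup>2)"
              by simp
            then have "ennreal ((indicator {0..t} s * (?\<phi> s \<omega> - g s * Z s \<omega>))\<^sup>2) \<le> ennreal (3 * \<eta>\<^sup>2 * (Z s \<omega>)\<^sup>2
                + 3 * K\<^sup>2 * (G i \<omega> + g (\<tau> i) * (B s \<omega> - B (\<tau> i) \<omega>) - Z s \<omega>)\<^sup>2 + 3 * K ^ 4 * (B s \<omega> - B (\<tau> i) \<omega>)\<^sup>2)"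
              by (intro ennreal_leI) (simp add: mult.assoc)
            also have "\<dots> = ennreal (3 * \<eta>\<^sup>2) * ?a \<omega> + ennreal (3 * K\<^sup>2) * ?b \<omega> + ennreal (3 * K ^ 4) * ?c \<omega>"
              using K by (simp add: ennreal_mult'[symmetric])
            finally show "ennreal ((indicator {0..t} s * (?\<phi> s \<omega> - g s * Z s \<omega>))\<^sup>2)
                \<le> ennreal (3 * \<eta>\<^sup>2) * ?a \<omega> + ennreal (3 * K\<^sup>2) * ?b \<omega> + ennreal (3 * K ^ 4) * ?c \<omega>" .
          qed
          also have "\<dots> = ennreal (3 * \<eta>\<^sup>2) * (\<integral>\<^sup>+\<omega>. ?a \<omega> \<partial>M) + ennreal (3 * K\<^sup>2) * (\<integral>\<^sup>+\<omega>. ?b \<omega> \<partial>M)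
              + ennreal (3 * K ^ 4) * (\<integral>\<^sup>+\<omega>. ?c \<omega> \<partial>M)"
            by (simp add: nn_integral_add nn_integral_cmult)
          also have "\<dots> \<le> ennreal (3 * \<eta>\<^sup>2) * ennreal (4 * (K\<^sup>2 * t)) + ennreal (3 * K\<^sup>2) * ennreal (4 * (\<eta>\<^sup>2 * t))
              + ennreal (3 * K ^ 4) * ennreal (t / real n)"
          proof (intro add_mono mult_left_mono)
            show "(\<integral>\<^sup>+\<omega>. ?a \<omega> \<partial>M) \<le> ennreal (4 * (K\<^sup>2 * t))" by (rule Z2[OF True])
            show "(\<integral>\<^sup>+\<omega>. ?b \<omega> \<partial>M) \<le> ennreal (4 * (\<eta>\<^sup>2 * t))" using GZ[of i s] i by auto
            have "(\<integral>\<^sup>+\<omega>. ?c \<omega> \<partial>M) = ennreal (s - \<tau> i)"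
              using increment_power_integrable[OF ti(2) sI, of 2] increment_moments(2)[OF ti(2) sI] i
              by (subst nn_integral_eq_integral) auto
            also have "\<dots> \<le> ennreal (t / real n)" using \<tau>_step[of i] i by (intro ennreal_leI) simp
            finally show "(\<integral>\<^sup>+\<omega>. ?c \<omega> \<partial>M) \<le> ennreal (t / real n)" .
          qed auto
          also have "\<dots> = ennreal (3 * \<eta>\<^sup>2 * (4 * (K\<^sup>2 * t)) + 3 * K\<^sup>2 * (4 * (\<eta>\<^sup>2 * t)) + 3 * K ^ 4 * (t / real n))"
            using K t by (simp add: ennreal_mult'[symmetric] ennreal_plus[symmetric] del: ennreal_plus)
          also have "\<dots> = ennreal ?C * indicator {0..t} s"
            using True by (simp add: algebra_simps)
          finally show ?thesis .
        qed simp
      qed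
    qed
    also have "\<dots> = ennreal ?C * ennreal t"
      using t by (subst nn_integral_cmult) auto
    also have "\<dots> = ennreal (t * ?C)"
      by (simp only: ennreal_mult'[OF less_imp_le[OF t(2)]] mult.commute)
    finally show "(\<integral>\<^sup>+\<omega>. energy t (\<lambda>s \<omega>. ?\<phi> s \<omega> - g s * Z s \<omega>) \<omega> \<partial>M) \<le> ennreal (t * ?C)" .
    show "0 \<le> t * ?C" using t C0 by simp
  qed (rule \<epsilon>)
  also have "\<dots> = c1 \<eta> + t * (3 * K ^ 4 * t / real n) / \<epsilon>"
    by (simp add: c1_def ring_distribs add_divide_distrib)
  also have "\<dots> \<le> \<epsilon>" using \<eta>(1) n(3) by simp
  finally have P1: "prob {\<omega> \<in> space M. ennreal \<epsilon> < energy t (\<lambda>s \<omega>. ?\<phi> s \<omega> - g s * Z s \<omega>) \<omega>} \<le> \<epsilon>" .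
  let ?Q = "\<lambda>\<omega>. \<Sum>i<n. (g (\<tau> i))\<^sup>2 * ((D i \<omega>)\<^sup>2 - t / real n)"
  have S_eq: "simple_integral B n \<tau> ?\<xi> \<omega> = ((G n \<omega>)\<^sup>2 - (\<Sum>i<n. (g (\<tau> i) * D i \<omega>)\<^sup>2)) / 2" for \<omega>
    unfolding simple_integral_def D_def[symmetric] G_def
    by (subst sum_martingale_square[symmetric]) (auto intro!: sum.cong)
  have GnZ: "(\<integral>\<^sup>+\<omega>. ennreal ((G n \<omega> - Z t \<omega>)\<^sup>2) \<partial>M) \<le> ennreal (4 * (\<eta>\<^sup>2 * t))"
  proof -
    obtain m where m: "n = Suc m" using n0 by (cases n) auto
    have "G n \<omega> = G m \<omega> + g (\<tau> m) * (B t \<omega> - B (\<tau> m) \<omega>)" for \<omega>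
      using \<tau>n unfolding m by (simp add: G_def D_def)
    then show ?thesis using GZ[of m t] m \<tau>n \<tau>_mono[of m n] by simp
  qed
  have P2: "prob {\<omega> \<in> space M. 2 * \<epsilon> / 3 < \<bar>(G n \<omega>)\<^sup>2 - (Z t \<omega>)\<^sup>2\<bar>} \<le> c2 \<eta>"
  proof -
    have "prob {\<omega> \<in> space M. ennreal (2 * \<epsilon> / 3) < ennreal \<bar>(G n \<omega>)\<^sup>2 - (Z t \<omega>)\<^sup>2\<bar>} \<le> c2 \<eta>"
      unfolding c2_def
    proof (rule prob_Markov)
      show "(\<lambda>\<omega>. ennreal \<bar>(G n \<omega>)\<^sup>2 - (Z t \<omega>)\<^sup>2\<bar>) \<in> borel_measurable M"
        using Gm[of n] by measurable
      have "(\<integral>\<^sup>+\<omega>. ennreal \<bar>(G n \<omega>)\<^sup>2 - (Z t \<omega>)\<^sup>2\<bar> \<partial>M)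
          \<le> (\<integral>\<^sup>+\<omega>. ennreal (1 + 1 / \<eta>) * ennreal ((G n \<omega> - Z t \<omega>)\<^sup>2) + ennreal \<eta> * ennreal ((Z t \<omega>)\<^sup>2) \<partial>M)"
      proof (rule nn_integral_mono)
        fix \<omega>
        define x z where "x = G n \<omega> - Z t \<omega>" and "z = Z t \<omega>"
        \<comment> \<open>weighting the mixed term by \<open>\<eta>\<close> compensates for the fact that only \<open>x\<close> is small\<close>
        have eq: "(G n \<omega>)\<^sup>2 - (Z t \<omega>)\<^sup>2 = x\<^sup>2 + 2 * (x * z)"
          by (simp add: x_def z_def power2_eq_square algebra_simps)
        have "0 \<le> (\<bar>x\<bar> - \<eta> * \<bar>z\<bar>)\<^sup>2 / \<eta>" using \<eta>(3) by simp
        also have "\<dots> = x\<^sup>2 / \<eta> - 2 * \<bar>x * z\<bar> + \<eta> * z\<^sup>2"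
        proof -
          have "(a - \<eta> * b)\<^sup>2 / \<eta> = a\<^sup>2 / \<eta> - 2 * (a * b) + \<eta> * b\<^sup>2" for a b
            using \<eta>(3) by (simp add: field_simps power2_eq_square)
          from this[of "\<bar>x\<bar>" "\<bar>z\<bar>"] show ?thesis by (simp add: abs_mult)
        qed
        finally have "2 * \<bar>x * z\<bar> \<le> x\<^sup>2 / \<eta> + \<eta> * z\<^sup>2" by simp
        moreover have "\<bar>x\<^sup>2 + 2 * (x * z)\<bar> \<le> x\<^sup>2 + 2 * \<bar>x * z\<bar>"
          using abs_triangle_ineq[of "x\<^sup>2" "2 * (x * z)"] by (simp add: abs_mult)
        ultimately have "\<bar>(G n \<omega>)\<^sup>2 - (Z t \<omega>)\<^sup>2\<bar> \<le> (1 + 1 / \<eta>) * x\<^sup>2 + \<eta> * z\<^sup>2"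
          unfolding eq by (simp add: ring_distribs)
        then have "ennreal \<bar>(G n \<omega>)\<^sup>2 - (Z t \<omega>)\<^sup>2\<bar> \<le> ennreal ((1 + 1 / \<eta>) * x\<^sup>2 + \<eta> * z\<^sup>2)"
          by (rule ennreal_leI)
        also have "\<dots> = ennreal (1 + 1 / \<eta>) * ennreal (x\<^sup>2) + ennreal \<eta> * ennreal (z\<^sup>2)"
          using \<eta>(3) by (simp add: ennreal_mult'[symmetric] ennreal_plus[symmetric] del: ennreal_plus)
        finally show "ennreal \<bar>(G n \<omega>)\<^sup>2 - (Z t \<omega>)\<^sup>2\<bar>
            \<le> ennreal (1 + 1 / \<eta>) * ennreal ((G n \<omega> - Z t \<omega>)\<^sup>2) + ennreal \<eta> * ennreal ((Z t \<omega>)\<^sup>2)"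
          by (simp add: x_def z_def)
      qed
      also have "\<dots> = ennreal (1 + 1 / \<eta>) * (\<integral>\<^sup>+\<omega>. ennreal ((G n \<omega> - Z t \<omega>)\<^sup>2) \<partial>M)
          + ennreal \<eta> * (\<integral>\<^sup>+\<omega>. ennreal ((Z t \<omega>)\<^sup>2) \<partial>M)"
        using Gm[of n] by (subst nn_integral_add; (subst nn_integral_cmult)?) (auto simp: nn_integral_cmult)
      also have "\<dots> \<le> ennreal (1 + 1 / \<eta>) * ennreal (4 * (\<eta>\<^sup>2 * t)) + ennreal \<eta> * ennreal (4 * (K\<^sup>2 * t))"
        using GnZ Z2[of t] t by (intro add_mono mult_left_mono) auto
      also have "\<dots> = ennreal ((1 + 1 / \<eta>) * (4 * (\<eta>\<^sup>2 * t)) + \<eta> * (4 * (K\<^sup>2 * t)))"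
        using \<eta>(3) t by (simp add: ennreal_mult'[symmetric] ennreal_plus[symmetric] del: ennreal_plus)
      also have "(1 + 1 / \<eta>) * (4 * (\<eta>\<^sup>2 * t)) + \<eta> * (4 * (K\<^sup>2 * t)) = 4 * \<eta>\<^sup>2 * t + 4 * \<eta> * t + 4 * \<eta> * K\<^sup>2 * t"
        using \<eta>(3) by (simp add: field_simps power2_eq_square)
      finally show "(\<integral>\<^sup>+\<omega>. ennreal \<bar>(G n \<omega>)\<^sup>2 - (Z t \<omega>)\<^sup>2\<bar> \<partial>M) \<le> ennreal (4 * \<eta>\<^sup>2 * t + 4 * \<eta> * t + 4 * \<eta> * K\<^sup>2 * t)" .
    qed (use \<eta> t \<epsilon> in auto)
    then show ?thesis using \<epsilon> by (simp add: ennreal_less_iff)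
  qed
  have Q: "integrable M (\<lambda>\<omega>. (?Q \<omega>)\<^sup>2) \<and>
      expectation (\<lambda>\<omega>. (?Q \<omega>)\<^sup>2) = (\<Sum>i<n. expectation (\<lambda>\<omega>. ((g (\<tau> i))\<^sup>2)\<^sup>2) * expectation (\<lambda>\<omega>. ((D i \<omega>)\<^sup>2 - t / real n)\<^sup>2)) \<and>
      ?Q \<in> borel_measurable (F (\<tau> n))"
    and D4: "\<And>i. i < n \<Longrightarrow> expectation (\<lambda>\<omega>. ((D i \<omega>)\<^sup>2 - t / real n)\<^sup>2) = 2 * (t / real n)\<^sup>2"
  proof -
    have D: "integrable M (\<lambda>\<omega>. ((D i \<omega>)\<^sup>2 - t / real n)\<^sup>2)" "expectation (\<lambda>\<omega>. (D i \<omega>)\<^sup>2 - t / real n) = 0"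
      "expectation (\<lambda>\<omega>. ((D i \<omega>)\<^sup>2 - t / real n)\<^sup>2) = 2 * (t / real n)\<^sup>2" if "i < n" for i
    proof -
      have i: "\<tau> i \<in> I" "\<tau> (Suc i) \<in> I" "\<tau> i \<le> \<tau> (Suc i)"
        using \<tau>_I that \<tau>_mono[of i "Suc i"] by auto
      have int: "integrable M (\<lambda>\<omega>. (D i \<omega>) ^ k)" for k
        unfolding D_def by (rule increment_power_integrable[OF i])
      note m = increment_moments[OF i, folded D_def, unfolded \<tau>_step]
      have eq: "((D i \<omega>)\<^sup>2 - t / real n)\<^sup>2 = (D i \<omega>) ^ 4 - 2 * (t / real n) * (D i \<omega>)\<^sup>2 + (t / real n)\<^sup>2" for \<omega>
        by (simp add: power2_diff power_mult[symmetric])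
      show "integrable M (\<lambda>\<omega>. ((D i \<omega>)\<^sup>2 - t / real n)\<^sup>2)" unfolding eq using int by simp
      show "expectation (\<lambda>\<omega>. (D i \<omega>)\<^sup>2 - t / real n) = 0" using int m by (simp add: prob_space)
      show "expectation (\<lambda>\<omega>. ((D i \<omega>)\<^sup>2 - t / real n)\<^sup>2) = 2 * (t / real n)\<^sup>2"
      proof -
        define q where "q = t / real n"
        have "expectation (\<lambda>\<omega>. (D i \<omega>) ^ 4 - 2 * q * (D i \<omega>)\<^sup>2 + q\<^sup>2)
            = expectation (\<lambda>\<omega>. (D i \<omega>) ^ 4) - 2 * q * expectation (\<lambda>\<omega>. (D i \<omega>)\<^sup>2) + q\<^sup>2"
          using int[of 4] int[of 2] by (simp add: prob_space)
        also have "\<dots> = 2 * q\<^sup>2"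
          using m by (simp add: q_def[symmetric] power2_eq_square)
        finally show ?thesis unfolding eq q_def .
      qed
    qed
    show "\<And>i. i < n \<Longrightarrow> expectation (\<lambda>\<omega>. ((D i \<omega>)\<^sup>2 - t / real n)\<^sup>2) = 2 * (t / real n)\<^sup>2" by (rule D(3))
    show "integrable M (\<lambda>\<omega>. (?Q \<omega>)\<^sup>2) \<and>
      expectation (\<lambda>\<omega>. (?Q \<omega>)\<^sup>2) = (\<Sum>i<n. expectation (\<lambda>\<omega>. ((g (\<tau> i))\<^sup>2)\<^sup>2) * expectation (\<lambda>\<omega>. ((D i \<omega>)\<^sup>2 - t / real n)\<^sup>2)) \<and>
      ?Q \<in> borel_measurable (F (\<tau> n))"
      using martingale_transform_second_moment[of n \<tau> "\<lambda>i _. (g (\<tau> i))\<^sup>2" "\<lambda>i. (g (\<tau> i))\<^sup>2" "\<lambda>_ x. x\<^sup>2 - t / real n"]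
        \<tau>_I \<tau>_mono D unfolding D_def by auto
  qed
  have P3: "prob {\<omega> \<in> space M. 2 * \<epsilon> / 3 \<le> \<bar>?Q \<omega>\<bar>} \<le> (2 * K ^ 4 * t\<^sup>2 / real n) / (2 * \<epsilon> / 3)\<^sup>2"
  proof (rule prob_second_moment_le)
    show Qm: "?Q \<in> borel_measurable M" using Q by (blast intro: measurable_F_M)
    have "expectation (\<lambda>\<omega>. (?Q \<omega>)\<^sup>2) = (\<Sum>i<n. ((g (\<tau> i))\<^sup>2)\<^sup>2 * (2 * (t / real n)\<^sup>2))"
      using Q D4 by (auto simp: prob_space intro!: sum.cong)
    also have "\<dots> \<le> (\<Sum>i<n. K ^ 4 * (2 * (t / real n)\<^sup>2))"
    proof (intro sum_mono mult_right_mono)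
      fix i assume "i \<in> {..<n}"
      then have "\<tau> i \<in> {0..t}" using \<tau>_in[of i] by simp
      then have "((g (\<tau> i))\<^sup>2)\<^sup>2 \<le> (K\<^sup>2)\<^sup>2" by (intro power_mono K2) simp_all
      then show "((g (\<tau> i))\<^sup>2)\<^sup>2 \<le> K ^ 4" by simp
    qed simp
    also have "\<dots> = 2 * K ^ 4 * t\<^sup>2 / real n" using n0 by (simp add: field_simps power2_eq_square)
    finally show "(\<integral>\<^sup>+\<omega>. ennreal ((?Q \<omega>)\<^sup>2) \<partial>M) \<le> ennreal (2 * K ^ 4 * t\<^sup>2 / real n)"
      using Q by (subst nn_integral_eq_integral) (auto intro: ennreal_leI)
  qed (use \<epsilon> t in auto)
  let ?Y = "\<lambda>\<omega>. ((Z t \<omega>)\<^sup>2 - ?v) / 2"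
  have "prob {\<omega> \<in> space M. \<epsilon> < \<bar>simple_integral B n \<tau> ?\<xi> \<omega> - ?Y \<omega>\<bar>}
      \<le> prob {\<omega> \<in> space M. 2 * \<epsilon> / 3 < \<bar>(G n \<omega>)\<^sup>2 - (Z t \<omega>)\<^sup>2\<bar>} + prob {\<omega> \<in> space M. 2 * \<epsilon> / 3 \<le> \<bar>?Q \<omega>\<bar>}"
  proof (rule prob_le_union)
    show "{\<omega> \<in> space M. \<epsilon> < \<bar>simple_integral B n \<tau> ?\<xi> \<omega> - ?Y \<omega>\<bar>}
      \<subseteq> {\<omega> \<in> space M. 2 * \<epsilon> / 3 < \<bar>(G n \<omega>)\<^sup>2 - (Z t \<omega>)\<^sup>2\<bar>} \<union> {\<omega> \<in> space M. 2 * \<epsilon> / 3 \<le> \<bar>?Q \<omega>\<bar>}"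
    proof safe
      fix \<omega> assume *: "\<epsilon> < \<bar>simple_integral B n \<tau> ?\<xi> \<omega> - ?Y \<omega>\<bar>" "\<not> 2 * \<epsilon> / 3 \<le> \<bar>?Q \<omega>\<bar>"
      have "?Q \<omega> = (\<Sum>i<n. (g (\<tau> i) * D i \<omega>)\<^sup>2) - (\<Sum>i<n. (g (\<tau> i))\<^sup>2 * (\<tau> (Suc i) - \<tau> i))"
        by (simp add: \<tau>_step right_diff_distrib sum_subtractf power_mult_distrib)
      then show "2 * \<epsilon> / 3 < \<bar>(G n \<omega>)\<^sup>2 - (Z t \<omega>)\<^sup>2\<bar>"
        using * n(2)[folded \<tau>_def] unfolding S_eq dist_real_def by argo
    qed
    show "{\<omega> \<in> space M. 2 * \<epsilon> / 3 < \<bar>(G n \<omega>)\<^sup>2 - (Z t \<omega>)\<^sup>2\<bar>} \<in> sets M" using Gm[of n] by measurable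
    show "{\<omega> \<in> space M. 2 * \<epsilon> / 3 \<le> \<bar>?Q \<omega>\<bar>} \<in> sets M"
    proof -
      have [measurable]: "?Q \<in> borel_measurable M" using Q by (blast intro: measurable_F_M)
      show ?thesis by measurable
    qed
  qed
  also have "\<dots> \<le> \<epsilon>" using P2 P3 \<eta>(2) n(4) by linarith
  finally have "prob {\<omega> \<in> space M. \<epsilon> < \<bar>simple_integral B n \<tau> ?\<xi> \<omega> - ?Y \<omega>\<bar>} \<le> \<epsilon>" .
  then show "\<exists>H' Y'. ito_lim H' t Y' \<and> ito_close \<epsilon> t H' Y' (\<lambda>s \<omega>. g s * Z s \<omega>) ?Y"
    using \<phi> P1 unfolding ito_close_def by blast
qed


section \<open>Integrating factor for the linear equation\<close>

text \<open>
  Formally, \<open>e' = - k e\<close> and \<open>dX = k X dt + \<sigma> dB\<close> give \<open>d(e X) = e \<sigma> dB\<close>. With the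
  martingale part \<open>Y\<close> of \<open>X\<close>, the sums of \<open>e(\<tau> i) (Y(\<tau> (i+1)) - Y(\<tau> i))\<close> are Ito integrals of \<open>\<sigma>\<close> times a step
  function that approximates \<open>e\<close>. They converge to \<open>e X\<close> along every path, because the
  increments of \<open>e X\<close> differ from the terms of the sum only by integrals of \<open>k (X e(\<tau> i) - e X(\<tau> (i+1)))\<close>, which are small
  by uniform continuity.
\<close>

lemma ornstein_uhlenbeck_wiener_integral:
  fixes k \<sigma> e :: "real \<Rightarrow> real"
  assumes t: "t \<in> I" "0 < t"
    and k: "continuous_on {0..t} k" and \<sigma>: "continuous_on {0..t} \<sigma>" and e: "continuous_on {0..t} e"
    and e_diff: "\<And>a b. 0 \<le> a \<Longrightarrow> a \<le> b \<Longrightarrow> b \<le> t \<Longrightarrow> e b - e a = - integral {a..b} (\<lambda>u. k u * e u)"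
    and X_meas: "\<And>s. s \<in> {0..t} \<Longrightarrow> X s \<in> borel_measurable M"
    and X_cont: "\<And>\<omega>. \<omega> \<in> space M \<Longrightarrow> continuous_on {0..t} (\<lambda>s. X s \<omega>)"
    and X_0: "AE \<omega> in M. X 0 \<omega> = 0"
    and X: "\<And>s. s \<in> {0..t} \<Longrightarrow>
      ito_lim (\<lambda>u _. \<sigma> u) s (\<lambda>\<omega>. X s \<omega> - X 0 \<omega> - integral {0..s} (\<lambda>u. k u * X u \<omega>))"
  shows "ito_lim (\<lambda>u _. \<sigma> u * e u) t (\<lambda>\<omega>. e t * X t \<omega>)"
proof (rule ito_lim_closure[OF t(1)])
  have tI: "s \<in> I" if "s \<in> {0..t}" for s using down_closed[OF t(1)] that by auto
  have t0: "0 \<le> t" using t by simp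
  have det: "jointly_measurable t (\<lambda>u _. f u)" if "continuous_on {0..t} f" for f :: "real \<Rightarrow> real"
    using that t by (intro jointly_measurable_continuous) auto
  show jm: "jointly_measurable t (\<lambda>u _. \<sigma> u * e u)"
    using \<sigma> e by (intro det continuous_intros)
  have [measurable]: "X t \<in> borel_measurable M" using X_meas t by simp
  show "(\<lambda>\<omega>. e t * X t \<omega>) \<in> borel_measurable M" by measurable
  define Y where "Y s \<omega> = X s \<omega> - X 0 \<omega> - integral {0..s} (\<lambda>u. k u * X u \<omega>)" for s \<omega>
  have Y: "ito_lim (\<lambda>u _. \<sigma> u) s (Y s)" if "s \<in> {0..t}" for s
    using X[OF that] by (simp add: Y_def[abs_def])
  obtain K where K: "1 \<le> K" "\<And>u. u \<in> {0..t} \<Longrightarrow> \<bar>\<sigma> u\<bar> \<le> K" using continuous_bounded[OF \<sigma>] by blast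
  define \<tau> where "\<tau> n = grid 0 t n" for n
  have \<tau>_in: "\<tau> n i \<in> {0..t}" if "i \<le> n" "0 < n" for n i
    using grid_bounds[OF t0 that] by (simp add: \<tau>_def)
  have \<tau>_mono: "\<tau> n i \<le> \<tau> n (Suc i)" for n i
    unfolding \<tau>_def using t0 by (intro grid_mono) auto
  define H where "H n u (\<omega>::'a) = (\<Sum>i<n. e (\<tau> n i) * (indicator {..\<tau> n (Suc i)} u * \<sigma> u - indicator {..\<tau> n i} u * \<sigma> u))"
    for n u \<omega>
  define V where "V n \<omega> = (\<Sum>i<n. e (\<tau> n i) * (Y (\<tau> n (Suc i)) \<omega> - Y (\<tau> n i) \<omega>))" for n \<omega>
  have HV: "ito_lim (H n) t (V n)" if "0 < n" for n
    unfolding H_def[abs_def] V_def[abs_def]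
  proof (rule ito_lim_sum[OF t(1)])
    fix i assume i: "i < n"
    have "\<tau> n i \<in> {0..t}" "\<tau> n (Suc i) \<in> {0..t}" using \<tau>_in i that by auto
    then show "ito_lim (\<lambda>s \<omega>. e (\<tau> n i) * (indicator {..\<tau> n (Suc i)} s * \<sigma> s - indicator {..\<tau> n i} s * \<sigma> s)) t
        (\<lambda>\<omega>. e (\<tau> n i) * (Y (\<tau> n (Suc i)) \<omega> - Y (\<tau> n i) \<omega>))"
      using t by (intro ito_lim_scale ito_lim_diff ito_lim_extend Y) auto
  qed
  have H_eq: "H n u \<omega> = e (\<tau> n i) * \<sigma> u" if i: "i < n" "\<tau> n i < u" "u \<le> \<tau> n (Suc i)" for n i u \<omega>
  proof -
    have "H n u \<omega> = simple_process n (\<tau> n) (\<lambda>i _. e (\<tau> n i)) u \<omega> * \<sigma> u"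
      unfolding H_def simple_process_def sum_distrib_right
    proof (rule sum.cong)
      fix j
      have "indicator {..\<tau> n (Suc j)} u - indicator {..\<tau> n j} u = (indicator {\<tau> n j<..\<tau> n (Suc j)} u :: real)"
        using \<tau>_mono[of n j] by (auto simp: indicator_def)
      then show "e (\<tau> n j) * (indicator {..\<tau> n (Suc j)} u * \<sigma> u - indicator {..\<tau> n j} u * \<sigma> u)
          = e (\<tau> n j) * indicator {\<tau> n j<..\<tau> n (Suc j)} u * \<sigma> u"
        by (simp add: left_diff_distrib[symmetric] mult.assoc)
    qed simp
    also have "simple_process n (\<tau> n) (\<lambda>i _. e (\<tau> n i)) u \<omega> = e (\<tau> n i)"
      by (rule simple_process_eq) (use i \<tau>_mono in auto)
    finally show ?thesis .
  qed
  have int_k: "(\<lambda>u. k u * X u \<omega>) integrable_on {a..b}" "(\<lambda>u. k u * e u) integrable_on {a..b}"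
    if "\<omega> \<in> space M" "0 \<le> a" "b \<le> t" for \<omega> a b
    using that by (intro integrable_continuous_real continuous_on_mult
        continuous_on_subset[OF k] continuous_on_subset[OF e] continuous_on_subset[OF X_cont]; auto)+
  have path: "(\<lambda>n. V (Suc n) \<omega> - e t * X t \<omega>) \<longlonglongrightarrow> 0" if \<omega>: "\<omega> \<in> space M" "X 0 \<omega> = 0" for \<omega>
  proof (rule LIMSEQ_I)
    fix r :: real assume r: "0 < r"
    note Xc = X_cont[OF \<omega>(1)]
    obtain Kk where Kk: "1 \<le> Kk" "\<And>u. u \<in> {0..t} \<Longrightarrow> \<bar>k u\<bar> \<le> Kk" using continuous_bounded[OF k] by blast
    obtain Ke where Ke: "1 \<le> Ke" "\<And>u. u \<in> {0..t} \<Longrightarrow> \<bar>e u\<bar> \<le> Ke" using continuous_bounded[OF e] by blast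
    obtain Kx where Kx: "1 \<le> Kx" "\<And>u. u \<in> {0..t} \<Longrightarrow> \<bar>X u \<omega>\<bar> \<le> Kx" using continuous_bounded[OF Xc] by blast
    define c where "c = Kk * (Kx + Ke) * t"
    have c: "0 < c" using Kk Kx Ke t by (auto simp: c_def intro!: mult_pos_pos)
    define \<eta> where "\<eta> = r / (2 * c)"
    have \<eta>: "0 < \<eta>" using r c by (simp add: \<eta>_def)
    obtain N1 where N1: "0 < N1" "\<And>n i u w. N1 \<le> n \<Longrightarrow> i < n \<Longrightarrow> u \<in> {grid 0 t n i..grid 0 t n (Suc i)} \<Longrightarrow>
        w \<in> {grid 0 t n i..grid 0 t n (Suc i)} \<Longrightarrow> \<bar>e u - e w\<bar> \<le> \<eta>"
      by (rule uniform_grid[OF e t0 \<eta>]) blast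
    obtain N2 where N2: "0 < N2" "\<And>n i u w. N2 \<le> n \<Longrightarrow> i < n \<Longrightarrow> u \<in> {grid 0 t n i..grid 0 t n (Suc i)} \<Longrightarrow>
        w \<in> {grid 0 t n i..grid 0 t n (Suc i)} \<Longrightarrow> \<bar>X u \<omega> - X w \<omega>\<bar> \<le> \<eta>"
      by (rule uniform_grid[OF Xc t0 \<eta>]) blast
    have "norm (V (Suc m) \<omega> - e t * X t \<omega> - 0) < r" if m: "max N1 N2 \<le> m" for m
    proof -
      define n where "n = Suc m"
      have n: "0 < n" "N1 \<le> n" "N2 \<le> n" using m by (auto simp: n_def)
      let ?\<tau> = "\<tau> n"
      have ti: "0 \<le> ?\<tau> i" "?\<tau> i \<le> ?\<tau> (Suc i)" "?\<tau> (Suc i) \<le> t" if "i < n" for i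
        using \<tau>_in[of i n] \<tau>_in[of "Suc i" n] \<tau>_mono[of n i] that by auto
      let ?f = "\<lambda>i u. k u * (X u \<omega> * e (?\<tau> i) - e u * X (?\<tau> (Suc i)) \<omega>)"
      have piece: "(e (?\<tau> (Suc i)) * X (?\<tau> (Suc i)) \<omega> - e (?\<tau> i) * X (?\<tau> i) \<omega>)
          - e (?\<tau> i) * (Y (?\<tau> (Suc i)) \<omega> - Y (?\<tau> i) \<omega>) = integral {?\<tau> i..?\<tau> (Suc i)} (?f i)"
        if i: "i < n" for i
      proof -
        have "integral {0..?\<tau> i} (\<lambda>u. k u * X u \<omega>) + integral {?\<tau> i..?\<tau> (Suc i)} (\<lambda>u. k u * X u \<omega>)
            = integral {0..?\<tau> (Suc i)} (\<lambda>u. k u * X u \<omega>)"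
          using ti[OF i] \<omega>(1)
          by (intro Henstock_Kurzweil_Integration.integral_combine int_k) auto
        then have dY: "Y (?\<tau> (Suc i)) \<omega> - Y (?\<tau> i) \<omega>
            = X (?\<tau> (Suc i)) \<omega> - X (?\<tau> i) \<omega> - integral {?\<tau> i..?\<tau> (Suc i)} (\<lambda>u. k u * X u \<omega>)"
          by (simp add: Y_def)
        have de: "e (?\<tau> (Suc i)) - e (?\<tau> i) = - integral {?\<tau> i..?\<tau> (Suc i)} (\<lambda>u. k u * e u)"
          using ti[OF i] by (intro e_diff) auto
        have "integral {?\<tau> i..?\<tau> (Suc i)} (?f i)
            = integral {?\<tau> i..?\<tau> (Suc i)} (\<lambda>u. e (?\<tau> i) * (k u * X u \<omega>) - X (?\<tau> (Suc i)) \<omega> * (k u * e u))"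
          by (rule arg_cong[where f = "integral _"]) (auto simp: algebra_simps)
        also have "\<dots> = e (?\<tau> i) * integral {?\<tau> i..?\<tau> (Suc i)} (\<lambda>u. k u * X u \<omega>)
            - X (?\<tau> (Suc i)) \<omega> * integral {?\<tau> i..?\<tau> (Suc i)} (\<lambda>u. k u * e u)"
          using int_k[OF \<omega>(1) ti(1)[OF i] ti(3)[OF i]]
          by (subst Henstock_Kurzweil_Integration.integral_diff)
             (auto intro!: integrable_on_mult_right)
        finally have f: "integral {?\<tau> i..?\<tau> (Suc i)} (?f i)
            = e (?\<tau> i) * integral {?\<tau> i..?\<tau> (Suc i)} (\<lambda>u. k u * X u \<omega>)
              - X (?\<tau> (Suc i)) \<omega> * integral {?\<tau> i..?\<tau> (Suc i)} (\<lambda>u. k u * e u)" .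
        have e': "e (?\<tau> (Suc i)) = e (?\<tau> i) - integral {?\<tau> i..?\<tau> (Suc i)} (\<lambda>u. k u * e u)"
          using de by simp
        show ?thesis unfolding dY f e' by (simp add: ring_distribs)
      qed
      have bound: "\<bar>integral {?\<tau> i..?\<tau> (Suc i)} (?f i)\<bar> \<le> Kk * (Kx + Ke) * \<eta> * (t / real n)" if i: "i < n" for i
      proof -
        have "norm (integral {?\<tau> i..?\<tau> (Suc i)} (?f i)) \<le> Kk * (Kx + Ke) * \<eta> * (?\<tau> (Suc i) - ?\<tau> i)"
        proof (rule integral_bound[OF ti(2)[OF i]])
          show "continuous_on {?\<tau> i..?\<tau> (Suc i)} (?f i)"
            using ti[OF i] by (intro continuous_intros continuous_on_subset[OF k] continuous_on_subset[OF e]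
                continuous_on_subset[OF Xc]) auto
          show "\<And>u. u \<in> {?\<tau> i..?\<tau> (Suc i)} \<Longrightarrow> norm (?f i u) \<le> Kk * (Kx + Ke) * \<eta>"
          proof -
            fix u assume u: "u \<in> {?\<tau> i..?\<tau> (Suc i)}"
            have u0t: "u \<in> {0..t}" using u ti[OF i] by auto
            have "X u \<omega> * e (?\<tau> i) - e u * X (?\<tau> (Suc i)) \<omega>
                = X u \<omega> * (e (?\<tau> i) - e u) + e u * (X u \<omega> - X (?\<tau> (Suc i)) \<omega>)"
              by (simp add: algebra_simps)
            also have "\<bar>\<dots>\<bar> \<le> \<bar>X u \<omega>\<bar> * \<bar>e (?\<tau> i) - e u\<bar> + \<bar>e u\<bar> * \<bar>X u \<omega> - X (?\<tau> (Suc i)) \<omega>\<bar>"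
              by (rule order_trans[OF abs_triangle_ineq]) (simp add: abs_mult)
            also have "\<dots> \<le> Kx * \<eta> + Ke * \<eta>"
              using Kx(2)[OF u0t] Ke(2)[OF u0t] N1(2)[OF n(2) i, of "?\<tau> i" u] N2(2)[OF n(3) i, of u "?\<tau> (Suc i)"]
                u \<tau>_mono[of n i] Kx(1) Ke(1)
              by (intro add_mono mult_mono) (auto simp: \<tau>_def)
            finally have "\<bar>X u \<omega> * e (?\<tau> i) - e u * X (?\<tau> (Suc i)) \<omega>\<bar> \<le> (Kx + Ke) * \<eta>"
              by (simp add: ring_distribs)
            then have "\<bar>k u\<bar> * \<bar>X u \<omega> * e (?\<tau> i) - e u * X (?\<tau> (Suc i)) \<omega>\<bar> \<le> Kk * ((Kx + Ke) * \<eta>)"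
              using Kk(2)[OF u0t] Kk(1) by (intro mult_mono) auto
            then show "norm (?f i u) \<le> Kk * (Kx + Ke) * \<eta>" by (simp add: abs_mult mult.assoc)
          qed
        qed
        then show ?thesis by (simp add: \<tau>_def grid_step)
      qed
      have "e t * X t \<omega> - V n \<omega> = (\<Sum>i<n. e (?\<tau> (Suc i)) * X (?\<tau> (Suc i)) \<omega> - e (?\<tau> i) * X (?\<tau> i) \<omega>) - V n \<omega>"
        using \<omega>(2) n(1) by (subst sum_lessThan_telescope) (simp add: \<tau>_def grid_n)
      also have "\<dots> = (\<Sum>i<n. integral {?\<tau> i..?\<tau> (Suc i)} (?f i))"
        unfolding V_def sum_subtractf[symmetric] by (intro sum.cong piece) auto
      finally have "\<bar>e t * X t \<omega> - V n \<omega>\<bar> \<le> (\<Sum>i<n. \<bar>integral {?\<tau> i..?\<tau> (Suc i)} (?f i)\<bar>)"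
        by (simp add: sum_abs)
      also have "\<dots> \<le> (\<Sum>i<n. Kk * (Kx + Ke) * \<eta> * (t / real n))"
        by (intro sum_mono bound) auto
      also have "\<dots> = c * \<eta>" using n(1) by (simp add: c_def)
      also have "\<dots> < r" using r c by (simp add: \<eta>_def)
      finally show ?thesis by (simp add: n_def abs_minus_commute)
    qed
    then show "\<exists>no. \<forall>m\<ge>no. norm (V (Suc m) \<omega> - e t * X t \<omega> - 0) < r" by blast
  qed
  have Vm: "(\<lambda>\<omega>. V (Suc n) \<omega> - e t * X t \<omega>) \<in> borel_measurable M" for n
    using ito_lim_measurable[OF HV[of "Suc n"]] by measurable
  have AE: "AE \<omega> in M. (\<lambda>n. V (Suc n) \<omega> - e t * X t \<omega>) \<longlonglongrightarrow> 0"
    using X_0 AE_space by eventually_elim (rule path)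
  fix \<epsilon> :: real assume \<epsilon>: "0 < \<epsilon>"
  have ev: "\<forall>\<^sub>F n in sequentially. prob {\<omega> \<in> space M. \<epsilon> < \<bar>V (Suc n) \<omega> - e t * X t \<omega>\<bar>} < \<epsilon>"
    using order_tendstoD(2)[OF AE_tendsto_imp_prob[OF Vm AE \<epsilon>] \<epsilon>] .
  define \<eta> where "\<eta> = min 1 (\<epsilon> / (K\<^sup>2 * t))"
  have \<eta>: "0 < \<eta>" "\<eta> \<le> 1" "\<eta> \<le> \<epsilon> / (K\<^sup>2 * t)" using \<epsilon> K t by (auto simp: \<eta>_def)
  obtain N where N: "0 < N" "\<And>n i u w. N \<le> n \<Longrightarrow> i < n \<Longrightarrow> u \<in> {grid 0 t n i..grid 0 t n (Suc i)} \<Longrightarrow>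
      w \<in> {grid 0 t n i..grid 0 t n (Suc i)} \<Longrightarrow> \<bar>e u - e w\<bar> \<le> \<eta>"
    by (rule uniform_grid[OF e t0 \<eta>(1)]) blast
  from ev have "\<forall>\<^sub>F n in sequentially. prob {\<omega> \<in> space M. \<epsilon> < \<bar>V (Suc n) \<omega> - e t * X t \<omega>\<bar>} < \<epsilon> \<and> N \<le> n"
    using eventually_ge_at_top[of N] by eventually_elim simp
  then obtain m where m: "prob {\<omega> \<in> space M. \<epsilon> < \<bar>V (Suc m) \<omega> - e t * X t \<omega>\<bar>} < \<epsilon>" "N \<le> m"
    using eventually_happens by force
  have E: "energy t (\<lambda>u \<omega>. H (Suc m) u \<omega> - \<sigma> u * e u) \<omega> \<le> ennreal \<epsilon>" for \<omega>
  proof -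
    have "energy t (\<lambda>u \<omega>. H (Suc m) u \<omega> - \<sigma> u * e u) \<omega> \<le> ennreal ((K * \<eta>)\<^sup>2 * t)"
    proof (rule energy_le_of_bound[OF t0])
      fix u assume u: "0 < u" "u \<le> t"
      then obtain i where i: "i < Suc m" "\<tau> (Suc m) i < u" "u \<le> \<tau> (Suc m) (Suc i)"
        using interval_of_partition[of "\<tau> (Suc m)" u "Suc m"] by (auto simp: \<tau>_def grid_n)
      have "H (Suc m) u \<omega> - \<sigma> u * e u = \<sigma> u * (e (\<tau> (Suc m) i) - e u)"
        unfolding H_eq[OF i] by (simp add: algebra_simps)
      also have "\<bar>\<dots>\<bar> \<le> K * \<eta>"
        unfolding abs_mult using K u \<eta> N(2)[of "Suc m" i "\<tau> (Suc m) i" u] i m(2)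
        by (intro mult_mono) (auto simp: \<tau>_def)
      finally show "\<bar>H (Suc m) u \<omega> - \<sigma> u * e u\<bar> \<le> K * \<eta>" .
    qed (use K \<eta> in auto)
    also have "(K * \<eta>)\<^sup>2 * t \<le> \<epsilon>"
    proof -
      have "\<eta>\<^sup>2 \<le> \<eta>" using \<eta> by (simp add: power2_eq_square mult_left_le)
      then have "\<eta>\<^sup>2 \<le> \<epsilon> / (K\<^sup>2 * t)" using \<eta>(3) by simp
      then have "(K\<^sup>2 * t) * \<eta>\<^sup>2 \<le> \<epsilon>" using K t by (simp add: field_simps)
      then show ?thesis by (simp add: power_mult_distrib mult_ac)
    qed
    finally show ?thesis by (simp add: ennreal_leI)
  qed
  have "prob {\<omega> \<in> space M. ennreal \<epsilon> < energy t (\<lambda>u \<omega>. H (Suc m) u \<omega> - \<sigma> u * e u) \<omega>} = prob {}"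
    using E by (intro arg_cong[where f = prob]) (auto simp: not_less[symmetric])
  then show "\<exists>H' Y'. ito_lim H' t Y' \<and> ito_close \<epsilon> t H' Y' (\<lambda>u _. \<sigma> u * e u) (\<lambda>\<omega>. e t * X t \<omega>)"
    unfolding ito_close_def
    using HV[of "Suc m"] m \<epsilon> by (intro exI[of _ "H (Suc m)"] exI[of _ "V (Suc m)"]) auto
qed

end

section \<open>Gaussian martingales with a deterministic clock\<close>

lemma (in prob_space) normal_AE_neq_0:
  assumes D: "distributed M lborel D (normal_density 0 \<sigma>)"
  shows "AE \<omega> in M. D \<omega> \<noteq> 0"
proof -
  have "AE x in lborel. x \<noteq> (0::real)" by (rule AE_lborel_singleton)
  then have "AE x in density lborel (normal_density 0 \<sigma>). x \<noteq> 0"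
    by (subst AE_density) (auto elim: eventually_mono)
  moreover have "distr M lborel D = density lborel (normal_density 0 \<sigma>)"
    using D by (simp add: distributed_def)
  ultimately have "AE x in distr M lborel D. x \<noteq> 0" by metis
  then show ?thesis
    by (rule AE_distrD[rotated]) (use D in \<open>auto simp: distributed_def\<close>)
qed

lemma (in prob_space) normal_second_moment:
  assumes D: "distributed M lborel D (normal_density 0 \<sigma>)" and \<sigma>: "0 < \<sigma>"
  shows "integrable M (\<lambda>\<omega>. (D \<omega>)\<^sup>2)" and "expectation (\<lambda>\<omega>. (D \<omega>)\<^sup>2) = \<sigma>\<^sup>2"
proof -
  have "integrable lborel (\<lambda>x. normal_density 0 \<sigma> x * (x - 0) ^ 2)"
    by (rule integrable_normal_moment[OF \<sigma>])
  then show "integrable M (\<lambda>\<omega>. (D \<omega>)\<^sup>2)"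
    by (subst distributed_integrable[OF D, of "\<lambda>x. x\<^sup>2", symmetric]) auto
  have "expectation (\<lambda>\<omega>. (D \<omega>)\<^sup>2) = (\<integral>x. normal_density 0 \<sigma> x * (x - 0)\<^sup>2 \<partial>lborel)"
    by (subst distributed_integral[OF D, of "\<lambda>x. x\<^sup>2", symmetric]) auto
  then show "expectation (\<lambda>\<omega>. (D \<omega>)\<^sup>2) = \<sigma>\<^sup>2"
    using integral_normal_moment_even[OF \<sigma>, of 0 1] \<sigma> by simp
qed

lemma nn_integral_continuous_interval:
  fixes f :: "real \<Rightarrow> real"
  assumes f: "continuous_on {a..b} f" and nn: "\<And>s. s \<in> {a..b} \<Longrightarrow> 0 \<le> f s"
  shows "(\<integral>\<^sup>+s\<in>{a..b}. ennreal (f s) \<partial>lborel) = ennreal (integral {a..b} f)"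
proof -
  have si: "set_integrable lborel {a..b} f" by (rule borel_integrable_atLeastAtMost'[OF f])
  have "(\<integral>\<^sup>+s\<in>{a..b}. ennreal (f s) \<partial>lborel) = (\<integral>\<^sup>+s. ennreal (indicator {a..b} s *\<^sub>R f s) \<partial>lborel)"
    by (intro nn_integral_cong) (auto simp: indicator_def)
  also have "\<dots> = ennreal (LBINT s. indicator {a..b} s *\<^sub>R f s)"
    using si nn by (intro nn_integral_eq_integral) (auto simp: set_integrable_def indicator_def)
  also have "(LBINT s. indicator {a..b} s *\<^sub>R f s) = integral {a..b} f"
    using set_borel_integral_eq_integral(2)[OF si] by (simp add: set_lebesgue_integral_def)
  finally show ?thesis .
qed

lemma LBINT_continuous_interval:
  "continuous_on {a..b} (f :: real \<Rightarrow> real) \<Longrightarrow> (LBINT s:{a..b}. f s) = integral {a..b} f"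
  by (intro set_borel_integral_eq_integral(2) borel_integrable_atLeastAtMost')

text \<open>
  These facts describe the limit variable: its numerator is a function of \<open>W 1\<close>, and its denominator does not
  vanish, since \<open>W 1\<close> is almost surely nonzero and the paths are continuous.
\<close>

lemma wiener_ito_self:
  assumes W: "wiener_process N {0..1} W"
    and J: "has_ito_integral N (augmented_filtration N {0..1} W) W W 1 J"
  shows "AE \<omega> in N. J \<omega> = ((W 1 \<omega>)\<^sup>2 - 1) / 2"
    and "AE \<omega> in N. 0 < integral {0..1} (\<lambda>s. (W s \<omega>)\<^sup>2)"
proof -
  interpret brownian N "{0..1}" W by (rule brownian_unit_interval[OF W])
  have W1: "ito_lim (\<lambda>u _. 1) s (W s)" if s: "s \<in> {0..1}" for s
  proof -
    let ?\<tau> = "\<lambda>i::nat. if i = 0 then 0 else s"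
    have "ito_lim (simple_process 1 ?\<tau> (\<lambda>_ _. 1)) s (simple_integral W 1 ?\<tau> (\<lambda>_ _. 1))"
      by (rule ito_lim_simple) (use s in auto)
    then show ?thesis
    proof (rule ito_lim_cong)
      show "jointly_measurable s (\<lambda>u _. 1)"
        using s by (intro jointly_measurable_continuous) (auto intro!: continuous_intros)
      show "W s \<in> borel_measurable N" using s by (rule B_measurable)
      show "AE \<omega> in N. simple_integral W 1 ?\<tau> (\<lambda>_ _. 1) \<omega> = W s \<omega>"
        using B_0 by eventually_elim (simp add: simple_integral_def)
      fix \<omega>
      have "energy s (\<lambda>u \<omega>. simple_process 1 ?\<tau> (\<lambda>_ _. 1) u \<omega> - 1) \<omega> \<le> ennreal (0\<^sup>2 * s)"
        by (rule energy_le_of_bound) (use s in \<open>auto simp: simple_process_def\<close>)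
      then show "energy s (\<lambda>u \<omega>. simple_process 1 ?\<tau> (\<lambda>_ _. 1) u \<omega> - 1) \<omega> = 0" by simp
    qed
  qed
  have jm: "jointly_measurable 1 W"
    by (intro jointly_measurable_continuous B_measurable B_continuous) auto
  have "ito_lim (\<lambda>s \<omega>. 1 * W s \<omega>) 1 (\<lambda>\<omega>. ((W 1 \<omega>)\<^sup>2 - integral {0..1::real} (\<lambda>u. 1\<^sup>2)) / 2)"
    by (rule ito_square[of 1 "\<lambda>_. 1" W]) (use W1 jm in \<open>auto intro!: continuous_intros\<close>)
  then have sq: "ito_lim W 1 (\<lambda>\<omega>. ((W 1 \<omega>)\<^sup>2 - 1) / 2)" by simp
  have "ito_lim W 1 J"
    by (rule has_ito_integral_imp_ito_lim[OF J]) simp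
  from ito_lim_unique[OF this sq] show "AE \<omega> in N. J \<omega> = ((W 1 \<omega>)\<^sup>2 - 1) / 2" .
  have "distributed N lborel (\<lambda>\<omega>. W 1 \<omega> - W 0 \<omega>) (normal_density 0 (sqrt (1 - 0)))"
    by (rule increment_normal) auto
  from normal_AE_neq_0[OF this] B_0 AE_space
  show "AE \<omega> in N. 0 < integral {0..1} (\<lambda>s. (W s \<omega>)\<^sup>2)"
  proof eventually_elim
    case (elim \<omega>)
    have c: "continuous_on {0..1} (\<lambda>s. (W s \<omega>)\<^sup>2)" by (intro continuous_intros B_continuous elim)
    have "integral {0..1} (\<lambda>s. (W s \<omega>)\<^sup>2) \<noteq> 0"
      using integral_eq_0_iff[OF c] elim by (auto intro!: bexI[of _ 1])
    moreover have "0 \<le> integral {0..1} (\<lambda>s. (W s \<omega>)\<^sup>2)"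
      using c by (intro integral_nonneg integrable_continuous_real) auto
    ultimately show ?case by simp
  qed
qed

locale gaussian_martingale = brownian M I B for M :: "'a measure" and I B +
  fixes g :: "real \<Rightarrow> real" and Z :: "real \<Rightarrow> 'a \<Rightarrow> real"
  assumes g_cont: "continuous_on I g" and g_pos: "\<And>u. u \<in> I \<Longrightarrow> 0 < g u"
    and Z_integral: "\<And>s. s \<in> I \<Longrightarrow> ito_lim (\<lambda>u _. g u) s (Z s)"
    and Z_adapted: "\<And>s. s \<in> I \<Longrightarrow> Z s \<in> borel_measurable (F s)"
    and Z_cont: "\<And>\<omega>. \<omega> \<in> space M \<Longrightarrow> continuous_on I (\<lambda>s. Z s \<omega>)"
begin

definition v :: "real \<Rightarrow> real" where
  "v s = integral {0..s} (\<lambda>u. (g u)\<^sup>2)"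

lemma interval_subset: "t \<in> I \<Longrightarrow> {0..t} \<subseteq> I"
  using down_closed by auto

lemma g_cont': "t \<in> I \<Longrightarrow> continuous_on {0..t} g"
  by (rule continuous_on_subset[OF g_cont interval_subset])

lemma Z_cont': "t \<in> I \<Longrightarrow> \<omega> \<in> space M \<Longrightarrow> continuous_on {0..t} (\<lambda>s. Z s \<omega>)"
  by (rule continuous_on_subset[OF Z_cont interval_subset])

lemma Z_measurable [measurable]: "s \<in> I \<Longrightarrow> Z s \<in> borel_measurable M"
  using Z_adapted by (rule measurable_F_M)

lemma v_0: "v 0 = 0"
  by (simp add: v_def)

lemma v_pos: "t \<in> I \<Longrightarrow> 0 < t \<Longrightarrow> 0 < v t"
proof -
  assume t: "t \<in> I" "0 < t"
  have c: "continuous_on {0..t} (\<lambda>u. (g u)\<^sup>2)" using g_cont'[OF t(1)] by (intro continuous_intros)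
  have "integral {0..t} (\<lambda>u. (g u)\<^sup>2) \<noteq> 0"
    using integral_eq_0_iff[OF c] t g_pos[of t] by (auto intro!: bexI[of _ t])
  moreover have "0 \<le> integral {0..t} (\<lambda>u. (g u)\<^sup>2)"
    using c by (intro integral_nonneg integrable_continuous_real) auto
  ultimately show ?thesis by (simp add: v_def)
qed

lemma v_nonneg: "t \<in> I \<Longrightarrow> 0 \<le> v t"
  using v_pos[of t] v_0 nonneg[of t] by (cases "t = 0") auto

lemma v_deriv: "t \<in> I \<Longrightarrow> s \<in> {0..t} \<Longrightarrow> (v has_real_derivative (g s)\<^sup>2) (at s within {0..t})"
  unfolding v_def using g_cont'[of t]
  by (intro integral_has_real_derivative continuous_intros) auto

lemma v_cont: "t \<in> I \<Longrightarrow> continuous_on {0..t} v"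
  using v_deriv by (intro DERIV_continuous_on) auto

lemma jointly_measurable_Z:
  assumes t: "t \<in> I" and h: "continuous_on {0..t} h"
  shows "jointly_measurable t (\<lambda>s \<omega>. h s * Z s \<omega>)"
  using interval_subset[OF t] nonneg[OF t] h Z_cont'[OF t]
  by (intro jointly_measurable_continuous borel_measurable_times continuous_on_mult) auto

lemma Z_0: "AE \<omega> in M. Z 0 \<omega> = 0"
  using ito_lim_zero[OF Z_integral[OF zero_in]] by (simp add: energy_at_0)

lemma Z_normal:
  assumes t: "t \<in> I" "0 < t"
  shows "distributed M lborel (\<lambda>\<omega>. Z t \<omega> - Z 0 \<omega>) (normal_density 0 (sqrt (v t)))"
proof (rule wiener_integral_increment_law(1)[OF g_cont'[OF t(1)] t(1) _ _ Z_integral[OF t(1)] Z_integral[OF zero_in]])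
  show "(sqrt (v t))\<^sup>2 = integral {0..t} (\<lambda>u. (g u)\<^sup>2)"
    using v_nonneg[OF t(1)] by (simp add: v_def)
qed (use t v_pos in auto)

lemma Z_second_moment:
  assumes t: "t \<in> I"
  shows "integrable M (\<lambda>\<omega>. (Z t \<omega>)\<^sup>2)" and "expectation (\<lambda>\<omega>. (Z t \<omega>)\<^sup>2) = v t"
proof -
  have "integrable M (\<lambda>\<omega>. (Z t \<omega>)\<^sup>2) \<and> expectation (\<lambda>\<omega>. (Z t \<omega>)\<^sup>2) = v t"
  proof (cases "t = 0")
    case True
    have AE: "AE \<omega> in M. (Z t \<omega>)\<^sup>2 = 0" using Z_0 by eventually_elim (simp add: True)
    have "integrable M (\<lambda>\<omega>. (Z t \<omega>)\<^sup>2) \<longleftrightarrow> integrable M (\<lambda>\<omega>. 0 :: real)"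
      using t AE by (intro integrable_cong_AE) auto
    moreover have "expectation (\<lambda>\<omega>. (Z t \<omega>)\<^sup>2) = expectation (\<lambda>\<omega>. 0 :: real)"
      using t AE by (intro integral_cong_AE) auto
    ultimately show ?thesis using True v_0 by simp
  next
    case False
    then have t0: "0 < t" using nonneg[OF t] by simp
    have AE: "AE \<omega> in M. (Z t \<omega>)\<^sup>2 = (Z t \<omega> - Z 0 \<omega>)\<^sup>2" using Z_0 by eventually_elim simp
    note m = normal_second_moment[OF Z_normal[OF t t0]]
    have "integrable M (\<lambda>\<omega>. (Z t \<omega>)\<^sup>2) \<longleftrightarrow> integrable M (\<lambda>\<omega>. (Z t \<omega> - Z 0 \<omega>)\<^sup>2)"
      using t zero_in AE by (intro integrable_cong_AE) auto
    moreover have "expectation (\<lambda>\<omega>. (Z t \<omega>)\<^sup>2) = expectation (\<lambda>\<omega>. (Z t \<omega> - Z 0 \<omega>)\<^sup>2)"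
      using t zero_in AE by (intro integral_cong_AE) auto
    ultimately show ?thesis using m v_pos[OF t t0] by simp
  qed
  then show "integrable M (\<lambda>\<omega>. (Z t \<omega>)\<^sup>2)" and "expectation (\<lambda>\<omega>. (Z t \<omega>)\<^sup>2) = v t" by auto
qed

lemma Z_neq_0:
  assumes t: "t \<in> I" "0 < t"
  shows "AE \<omega> in M. Z t \<omega> \<noteq> 0"
  using normal_AE_neq_0[OF Z_normal[OF t]] Z_0 by eventually_elim simp

text \<open>
  Tonelli's theorem together with \<open>E (Z s)\<^sup>2 = v s\<close>.
\<close>

lemma expected_energy:
  assumes t: "t \<in> I" and h: "continuous_on {0..t} h"
  shows "(\<integral>\<^sup>+\<omega>. energy t (\<lambda>s \<omega>. h s * Z s \<omega>) \<omega> \<partial>M) = ennreal (integral {0..t} (\<lambda>s. (h s)\<^sup>2 * v s))"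
proof -
  interpret P: pair_sigma_finite M "lborel :: real measure" ..
  have jm: "(\<lambda>(\<omega>, s). ennreal ((indicator {0..t} s * (h s * Z s \<omega>))\<^sup>2)) \<in> borel_measurable (M \<Otimes>\<^sub>M lborel)"
    using jointly_measurable_Z[OF t h] unfolding jointly_measurable_def split_def by measurable
  have "(\<integral>\<^sup>+\<omega>. energy t (\<lambda>s \<omega>. h s * Z s \<omega>) \<omega> \<partial>M)
      = (\<integral>\<^sup>+\<omega>. \<integral>\<^sup>+s. ennreal ((indicator {0..t} s * (h s * Z s \<omega>))\<^sup>2) \<partial>lborel \<partial>M)"
    by (simp only: energy_alt)
  also have "\<dots> = (\<integral>\<^sup>+s. \<integral>\<^sup>+\<omega>. ennreal ((indicator {0..t} s * (h s * Z s \<omega>))\<^sup>2) \<partial>M \<partial>lborel)"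
    by (rule P.Fubini'[OF jm, symmetric])
  also have "\<dots> = (\<integral>\<^sup>+s\<in>{0..t}. ennreal ((h s)\<^sup>2 * v s) \<partial>lborel)"
  proof (rule nn_integral_cong)
    fix s :: real
    show "(\<integral>\<^sup>+\<omega>. ennreal ((indicator {0..t} s * (h s * Z s \<omega>))\<^sup>2) \<partial>M) = ennreal ((h s)\<^sup>2 * v s) * indicator {0..t} s"
    proof (cases "s \<in> {0..t}")
      case True
      then have s: "s \<in> I" using interval_subset[OF t] by auto
      have "(\<integral>\<^sup>+\<omega>. ennreal ((h s * Z s \<omega>)\<^sup>2) \<partial>M) = ennreal (expectation (\<lambda>\<omega>. (h s * Z s \<omega>)\<^sup>2))"
        using Z_second_moment[OF s] by (intro nn_integral_eq_integral) (auto simp: power_mult_distrib)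
      also have "expectation (\<lambda>\<omega>. (h s * Z s \<omega>)\<^sup>2) = (h s)\<^sup>2 * v s"
        using Z_second_moment[OF s] by (simp add: power_mult_distrib)
      finally show ?thesis using True by simp
    qed simp
  qed
  also have "\<dots> = ennreal (integral {0..t} (\<lambda>s. (h s)\<^sup>2 * v s))"
  proof (rule nn_integral_continuous_interval)
    show "continuous_on {0..t} (\<lambda>s. (h s)\<^sup>2 * v s)" using h v_cont[OF t] by (intro continuous_intros)
    show "0 \<le> (h s)\<^sup>2 * v s" if "s \<in> {0..t}" for s
      using v_nonneg[of s] interval_subset[OF t] that by auto
  qed
  finally show ?thesis .
qed

text \<open>
  By Ito's formula, \<open>N - C (Z\<^sup>2 - v) / 2\<close> is the Ito integral of \<open>(c - C) g Z\<close>. The tail bound for Ito integrals and Markov's inequality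
  for the energy apply.
\<close>

lemma numerator_tail:
  assumes t: "t \<in> I" "0 < t" and c: "continuous_on {0..t} c"
    and N: "ito_lim (\<lambda>s \<omega>. c s * (g s * Z s \<omega>)) t N" and \<delta>: "0 < \<delta>" and \<epsilon>: "0 < \<epsilon>"
  shows "prob {\<omega> \<in> space M. \<epsilon> < \<bar>N \<omega> / v t - C * ((Z t \<omega>)\<^sup>2 / v t - 1) / 2\<bar>}
    \<le> (integral {0..t} (\<lambda>s. (c s - C)\<^sup>2 * v s * (g s)\<^sup>2) / (v t)\<^sup>2) / \<delta> + 16 * \<delta> / \<epsilon>\<^sup>2"
proof -
  have vt: "0 < v t" by (rule v_pos[OF t])
  have g: "continuous_on {0..t} g" by (rule g_cont'[OF t(1)])
  have "jointly_measurable t (\<lambda>s \<omega>. 1 * Z s \<omega>)" by (rule jointly_measurable_Z[OF t(1)]) simp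
  then have sq: "ito_lim (\<lambda>s \<omega>. g s * Z s \<omega>) t (\<lambda>\<omega>. ((Z t \<omega>)\<^sup>2 - v t) / 2)"
    unfolding v_def using interval_subset[OF t(1)] by (intro ito_square t g Z_integral) auto
  let ?h = "\<lambda>s. (c s - C) * g s"
  let ?Y = "\<lambda>\<omega>. N \<omega> - C * (((Z t \<omega>)\<^sup>2 - v t) / 2)"
  have "ito_lim (\<lambda>s \<omega>. c s * (g s * Z s \<omega>) - C * (g s * Z s \<omega>)) t ?Y"
    by (rule ito_lim_diff[OF N ito_lim_scale[OF sq]])
  moreover have "(\<lambda>s \<omega>. c s * (g s * Z s \<omega>) - C * (g s * Z s \<omega>)) = (\<lambda>s \<omega>. ?h s * Z s \<omega>)"
    by (simp add: fun_eq_iff algebra_simps)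
  ultimately have Y: "ito_lim (\<lambda>s \<omega>. ?h s * Z s \<omega>) t ?Y" by simp
  have hc: "continuous_on {0..t} ?h" using c g by (intro continuous_intros)
  let ?R = "integral {0..t} (\<lambda>s. (c s - C)\<^sup>2 * v s * (g s)\<^sup>2)"
  have Req: "integral {0..t} (\<lambda>s. (?h s)\<^sup>2 * v s) = ?R"
    by (rule arg_cong[where f = "integral _"]) (auto simp: power_mult_distrib)
  have R0: "0 \<le> ?R"
    using c g v_cont[OF t(1)] v_nonneg interval_subset[OF t(1)]
    by (intro integral_nonneg integrable_continuous_real continuous_intros) auto
  have 1: "{\<omega> \<in> space M. \<epsilon> < \<bar>N \<omega> / v t - C * ((Z t \<omega>)\<^sup>2 / v t - 1) / 2\<bar>} = {\<omega> \<in> space M. \<epsilon> * v t < \<bar>?Y \<omega>\<bar>}"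
  proof (intro Collect_cong conj_cong refl)
    fix \<omega>
    have "?Y \<omega> = (N \<omega> / v t - C * ((Z t \<omega>)\<^sup>2 / v t - 1) / 2) * v t"
      using vt by (simp add: field_simps)
    then show "\<epsilon> < \<bar>N \<omega> / v t - C * ((Z t \<omega>)\<^sup>2 / v t - 1) / 2\<bar> \<longleftrightarrow> \<epsilon> * v t < \<bar>?Y \<omega>\<bar>"
      using vt by (simp add: abs_mult)
  qed
  have 2: "prob {\<omega> \<in> space M. \<epsilon> * v t < \<bar>?Y \<omega>\<bar>}
      \<le> prob {\<omega> \<in> space M. ennreal (\<delta> * (v t)\<^sup>2) < energy t (\<lambda>s \<omega>. ?h s * Z s \<omega>) \<omega>}
      + 16 * (\<delta> * (v t)\<^sup>2) / (\<epsilon> * v t)\<^sup>2"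
    using vt \<delta> \<epsilon> by (intro ito_lim_tail_bound[OF Y]) auto
  have 3: "16 * (\<delta> * (v t)\<^sup>2) / (\<epsilon> * v t)\<^sup>2 = 16 * \<delta> / \<epsilon>\<^sup>2"
    using vt by (simp add: power_mult_distrib)
  have 4: "prob {\<omega> \<in> space M. ennreal (\<delta> * (v t)\<^sup>2) < energy t (\<lambda>s \<omega>. ?h s * Z s \<omega>) \<omega>} \<le> ?R / (\<delta> * (v t)\<^sup>2)"
    by (rule prob_Markov)
       (use energy_measurable[OF jointly_measurable_Z[OF t(1) hc]] expected_energy[OF t(1) hc] R0 vt \<delta> Req in auto)
  have 5: "?R / (\<delta> * (v t)\<^sup>2) = (?R / (v t)\<^sup>2) / \<delta>" by (simp add: mult.commute)
  show ?thesis unfolding 1 using 2 4 unfolding 3 5 by linarith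
qed

text \<open>
  The absolute difference is at most the energy of \<open>sqrt \<bar>c\<^sup>2 - C\<^sup>2\<bar> g Z\<close>, whose expectation is known. The factor \<open>x\<close> stays
  inside the event, so that \<open>x = 0\<close> is not a special case.
\<close>

lemma denominator_tail:
  assumes t: "t \<in> I" "0 < t" and c: "continuous_on {0..t} c" and \<epsilon>: "0 < \<epsilon>"
  shows "prob {\<omega> \<in> space M. \<epsilon> < \<bar>x * (integral {0..t} (\<lambda>s. (c s)\<^sup>2 * (g s * Z s \<omega>)\<^sup>2) / (v t)\<^sup>2
      - C\<^sup>2 * (integral {0..t} (\<lambda>s. (g s * Z s \<omega>)\<^sup>2) / (v t)\<^sup>2))\<bar>}
    \<le> \<bar>x\<bar> * (integral {0..t} (\<lambda>s. \<bar>(c s)\<^sup>2 - C\<^sup>2\<bar> * v s * (g s)\<^sup>2) / (v t)\<^sup>2) / \<epsilon>"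
proof -
  have vt: "0 < v t" by (rule v_pos[OF t])
  have g: "continuous_on {0..t} g" by (rule g_cont'[OF t(1)])
  let ?h = "\<lambda>s. sqrt \<bar>(c s)\<^sup>2 - C\<^sup>2\<bar> * g s"
  let ?R = "integral {0..t} (\<lambda>s. \<bar>(c s)\<^sup>2 - C\<^sup>2\<bar> * v s * (g s)\<^sup>2)"
  have hc: "continuous_on {0..t} ?h" using c g by (intro continuous_intros)
  have Req: "integral {0..t} (\<lambda>s. (?h s)\<^sup>2 * v s) = ?R"
    by (rule arg_cong[where f = "integral _"]) (auto simp: power_mult_distrib)
  have R0: "0 \<le> ?R"
    using c g v_cont[OF t(1)] v_nonneg interval_subset[OF t(1)]
    by (intro integral_nonneg integrable_continuous_real continuous_intros) auto
  let ?D = "\<lambda>\<omega>. x * (integral {0..t} (\<lambda>s. (c s)\<^sup>2 * (g s * Z s \<omega>)\<^sup>2) / (v t)\<^sup>2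
      - C\<^sup>2 * (integral {0..t} (\<lambda>s. (g s * Z s \<omega>)\<^sup>2) / (v t)\<^sup>2))"
  let ?E = "\<lambda>\<omega>. ennreal (\<bar>x\<bar> / (v t)\<^sup>2) * energy t (\<lambda>s \<omega>. ?h s * Z s \<omega>) \<omega>"
  have Em [measurable]: "energy t (\<lambda>s \<omega>. ?h s * Z s \<omega>) \<in> borel_measurable M"
    by (rule energy_measurable[OF jointly_measurable_Z[OF t(1) hc]])
  have le: "ennreal \<bar>?D \<omega>\<bar> \<le> ?E \<omega>" if \<omega>: "\<omega> \<in> space M" for \<omega>
  proof -
    have Zc: "continuous_on {0..t} (\<lambda>s. Z s \<omega>)" by (rule Z_cont'[OF t(1) \<omega>])
    have e: "energy t (\<lambda>s \<omega>. ?h s * Z s \<omega>) \<omega> = ennreal (integral {0..t} (\<lambda>s. \<bar>(c s)\<^sup>2 - C\<^sup>2\<bar> * (g s * Z s \<omega>)\<^sup>2))"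
    proof -
      have "energy t (\<lambda>s \<omega>. ?h s * Z s \<omega>) \<omega> = ennreal (integral {0..t} (\<lambda>s. (?h s * Z s \<omega>)\<^sup>2))"
        unfolding energy_def
        by (rule nn_integral_continuous_interval[OF continuous_on_power[OF continuous_on_mult[OF hc Zc]]]) simp
      also have "integral {0..t} (\<lambda>s. (?h s * Z s \<omega>)\<^sup>2) = integral {0..t} (\<lambda>s. \<bar>(c s)\<^sup>2 - C\<^sup>2\<bar> * (g s * Z s \<omega>)\<^sup>2)"
        by (rule arg_cong[where f = "integral _"]) (auto simp: power_mult_distrib)
      finally show ?thesis .
    qed
    have "integral {0..t} (\<lambda>s. (c s)\<^sup>2 * (g s * Z s \<omega>)\<^sup>2) - C\<^sup>2 * integral {0..t} (\<lambda>s. (g s * Z s \<omega>)\<^sup>2)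
        = integral {0..t} (\<lambda>s. (c s)\<^sup>2 * (g s * Z s \<omega>)\<^sup>2 - C\<^sup>2 * (g s * Z s \<omega>)\<^sup>2)"
      using c g Zc by (subst Henstock_Kurzweil_Integration.integral_diff)
        (auto intro!: integrable_continuous_real continuous_intros)
    also have "norm \<dots> \<le> integral {0..t} (\<lambda>s. \<bar>(c s)\<^sup>2 - C\<^sup>2\<bar> * (g s * Z s \<omega>)\<^sup>2)"
      using c g Zc by (intro integral_norm_bound_integral integrable_continuous_real continuous_intros)
        (auto simp: abs_mult left_diff_distrib[symmetric])
    finally have "\<bar>integral {0..t} (\<lambda>s. (c s)\<^sup>2 * (g s * Z s \<omega>)\<^sup>2) - C\<^sup>2 * integral {0..t} (\<lambda>s. (g s * Z s \<omega>)\<^sup>2)\<bar>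
        \<le> integral {0..t} (\<lambda>s. \<bar>(c s)\<^sup>2 - C\<^sup>2\<bar> * (g s * Z s \<omega>)\<^sup>2)" by simp
    then have b: "\<bar>x\<bar> / (v t)\<^sup>2 * \<bar>integral {0..t} (\<lambda>s. (c s)\<^sup>2 * (g s * Z s \<omega>)\<^sup>2) - C\<^sup>2 * integral {0..t} (\<lambda>s. (g s * Z s \<omega>)\<^sup>2)\<bar>
        \<le> \<bar>x\<bar> / (v t)\<^sup>2 * integral {0..t} (\<lambda>s. \<bar>(c s)\<^sup>2 - C\<^sup>2\<bar> * (g s * Z s \<omega>)\<^sup>2)"
      by (intro mult_left_mono) auto
    have "?D \<omega> = x / (v t)\<^sup>2 * (integral {0..t} (\<lambda>s. (c s)\<^sup>2 * (g s * Z s \<omega>)\<^sup>2) - C\<^sup>2 * integral {0..t} (\<lambda>s. (g s * Z s \<omega>)\<^sup>2))"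
      by (simp add: diff_divide_distrib right_diff_distrib)
    then have "\<bar>?D \<omega>\<bar> = \<bar>x\<bar> / (v t)\<^sup>2 * \<bar>integral {0..t} (\<lambda>s. (c s)\<^sup>2 * (g s * Z s \<omega>)\<^sup>2) - C\<^sup>2 * integral {0..t} (\<lambda>s. (g s * Z s \<omega>)\<^sup>2)\<bar>"
      by (simp add: abs_mult abs_divide)
    with b have "ennreal \<bar>?D \<omega>\<bar> \<le> ennreal (\<bar>x\<bar> / (v t)\<^sup>2 * integral {0..t} (\<lambda>s. \<bar>(c s)\<^sup>2 - C\<^sup>2\<bar> * (g s * Z s \<omega>)\<^sup>2))"
      by (intro ennreal_leI) simp
    also have "\<dots> = ?E \<omega>"
      unfolding e by (rule ennreal_mult') simp
    finally show ?thesis .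
  qed
  have "prob {\<omega> \<in> space M. \<epsilon> < \<bar>?D \<omega>\<bar>} \<le> prob {\<omega> \<in> space M. ennreal \<epsilon> < ?E \<omega>}"
  proof (rule finite_measure_mono)
    show "{\<omega> \<in> space M. \<epsilon> < \<bar>?D \<omega>\<bar>} \<subseteq> {\<omega> \<in> space M. ennreal \<epsilon> < ?E \<omega>}"
      using \<epsilon> by (auto intro!: less_le_trans[OF _ le] simp: ennreal_less_iff simp del: ennreal_le_iff)
  qed measurable
  also have "\<dots> \<le> (\<bar>x\<bar> / (v t)\<^sup>2 * ?R) / \<epsilon>"
  proof (rule prob_Markov)
    show "(\<integral>\<^sup>+\<omega>. ?E \<omega> \<partial>M) \<le> ennreal (\<bar>x\<bar> / (v t)\<^sup>2 * ?R)"
      unfolding ennreal_mult'[OF divide_nonneg_nonneg[OF abs_ge_zero zero_le_power2]]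
      using expected_energy[OF t(1) hc] Req by (simp add: nn_integral_cmult)
  qed (use R0 \<epsilon> in auto)
  finally show ?thesis by simp
qed

lemma square_tail:
  assumes t: "t \<in> I" "0 < t" and \<epsilon>: "0 < \<epsilon>"
  shows "prob {\<omega> \<in> space M. \<epsilon> < \<bar>a * ((Z t \<omega>)\<^sup>2 / v t - 1)\<bar>} \<le> 2 * \<bar>a\<bar> / \<epsilon>"
proof -
  have vt: "0 < v t" by (rule v_pos[OF t])
  note [measurable] = Z_measurable[OF t(1)]
  have "prob {\<omega> \<in> space M. ennreal \<epsilon> < ennreal \<bar>a * ((Z t \<omega>)\<^sup>2 / v t - 1)\<bar>} \<le> (2 * \<bar>a\<bar>) / \<epsilon>"
  proof (rule prob_Markov)
    have "(\<integral>\<^sup>+\<omega>. ennreal \<bar>a * ((Z t \<omega>)\<^sup>2 / v t - 1)\<bar> \<partial>M)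
        \<le> (\<integral>\<^sup>+\<omega>. ennreal (\<bar>a\<bar> * ((Z t \<omega>)\<^sup>2 / v t + 1)) \<partial>M)"
    proof (intro nn_integral_mono ennreal_leI)
      fix \<omega>
      have "0 \<le> (Z t \<omega>)\<^sup>2 / v t" using vt by simp
      then have "\<bar>(Z t \<omega>)\<^sup>2 / v t - 1\<bar> \<le> (Z t \<omega>)\<^sup>2 / v t + 1" by linarith
      then show "\<bar>a * ((Z t \<omega>)\<^sup>2 / v t - 1)\<bar> \<le> \<bar>a\<bar> * ((Z t \<omega>)\<^sup>2 / v t + 1)"
        unfolding abs_mult by (intro mult_left_mono) auto
    qed
    also have "\<dots> = ennreal (expectation (\<lambda>\<omega>. \<bar>a\<bar> * ((Z t \<omega>)\<^sup>2 / v t + 1)))"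
      using Z_second_moment(1)[OF t(1)] vt by (intro nn_integral_eq_integral) auto
    also have "expectation (\<lambda>\<omega>. \<bar>a\<bar> * ((Z t \<omega>)\<^sup>2 / v t + 1)) = 2 * \<bar>a\<bar>"
      using Z_second_moment[OF t(1)] vt by (simp add: prob_space)
    finally show "(\<integral>\<^sup>+\<omega>. ennreal \<bar>a * ((Z t \<omega>)\<^sup>2 / v t - 1)\<bar> \<partial>M) \<le> ennreal (2 * \<bar>a\<bar>)" .
  qed (use \<epsilon> in auto)
  then show ?thesis using \<epsilon> by (simp add: ennreal_less_iff)
qed

text \<open>
  The substitution \<open>r = v s / v t\<close> identifies the functional with the corresponding one of the time-changed
  process, which is a Wiener process on the unit interval.
\<close>

lemma quadratic_functional_law:
  assumes t: "t \<in> I" "0 < t" and W: "wiener_process N {0..1} W"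
  shows "(\<lambda>\<omega>. a * ((Z t \<omega>)\<^sup>2 / v t) + y * (integral {0..t} (\<lambda>s. (g s * Z s \<omega>)\<^sup>2) / (v t)\<^sup>2)) \<in> borel_measurable M"
    and "distr M borel (\<lambda>\<omega>. a * ((Z t \<omega>)\<^sup>2 / v t) + y * (integral {0..t} (\<lambda>s. (g s * Z s \<omega>)\<^sup>2) / (v t)\<^sup>2))
    = distr N borel (\<lambda>\<omega>. a * (W 1 \<omega>)\<^sup>2 + y * integral {0..1} (\<lambda>s. (W s \<omega>)\<^sup>2))"
proof -
  have sub: "{0..t} \<subseteq> I" by (rule interval_subset[OF t(1)])
  have "\<exists>\<kappa>. (\<forall>s\<in>{0..t}. \<kappa> (v s / v t) = s) \<and> wiener_process M {0..1} (\<lambda>r \<omega>. Z (\<kappa> r) \<omega> / sqrt (v t))"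
  proof (rule time_changed_wiener_integral[OF t g_cont'[OF t(1)], of Z, folded v_def])
    fix \<kappa>
    assume "\<And>s. s \<in> {0..t} \<Longrightarrow> \<kappa> (v s / v t) = s"
      "wiener_process M {0..1} (\<lambda>r \<omega>. Z (\<kappa> r) \<omega> / sqrt (v t))"
    then show ?thesis by blast
  qed (use sub in \<open>auto intro: g_pos Z_integral Z_adapted Z_cont' t\<close>)
  then obtain \<kappa> where \<kappa>: "\<And>s. s \<in> {0..t} \<Longrightarrow> \<kappa> (v s / v t) = s"
    and V: "wiener_process M {0..1} (\<lambda>r \<omega>. Z (\<kappa> r) \<omega> / sqrt (v t))" by blast
  define V where "V r \<omega> = Z (\<kappa> r) \<omega> / sqrt (v t)" for r \<omega>
  have V': "wiener_process M {0..1} V" using V by (simp add: V_def[abs_def])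
  have vt: "0 < v t" by (rule v_pos[OF t])
  have V1: "(V 1 \<omega>)\<^sup>2 = (Z t \<omega>)\<^sup>2 / v t" for \<omega>
    using \<kappa>[of t] t vt by (simp add: V_def power_divide)
  have Vint: "integral {0..1} (\<lambda>r. (V r \<omega>)\<^sup>2) = integral {0..t} (\<lambda>s. (g s * Z s \<omega>)\<^sup>2) / (v t)\<^sup>2"
    if \<omega>: "\<omega> \<in> space M" for \<omega>
  proof -
    have Vc: "continuous_on {0..1} (\<lambda>r. (V r \<omega>)\<^sup>2)"
      using V' \<omega> by (intro continuous_intros) (auto simp: wiener_process_def)
    have mono: "v s \<le> v t" if "s \<in> {0..t}" for s
    proof -
      have "v s \<le> v t"
        unfolding v_def using that g_cont'[OF t(1)]
        by (intro integral_subset_le integrable_continuous_real continuous_intros continuous_on_subset[OF g_cont'[OF t(1)]]) auto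
      then show ?thesis .
    qed
    have "((\<lambda>s. ((g s)\<^sup>2 / v t) *\<^sub>R (V (v s / v t) \<omega>)\<^sup>2) has_integral
        (integral {v 0 / v t..v t / v t} (\<lambda>r. (V r \<omega>)\<^sup>2))) {0..t}"
    proof (rule has_integral_substitution)
      show "(\<lambda>s. v s / v t) ` {0..t} \<subseteq> {0..1}"
        using mono v_nonneg sub vt by auto
      show "((\<lambda>s. v s / v t) has_real_derivative (g s)\<^sup>2 / v t) (at s within {0..t})" if "s \<in> {0..t}" for s
        by (rule DERIV_cdivide[OF v_deriv[OF t(1) that]])
    qed (use t vt v_0 Vc in auto)
    then have "((\<lambda>s. (g s * Z s \<omega>)\<^sup>2 / (v t)\<^sup>2) has_integral (integral {0..1} (\<lambda>r. (V r \<omega>)\<^sup>2))) {0..t}"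
      using vt v_0 \<kappa>
      by (subst has_integral_cong[where g = "\<lambda>s. ((g s)\<^sup>2 / v t) *\<^sub>R (V (v s / v t) \<omega>)\<^sup>2"])
         (auto simp: V_def power_divide power_mult_distrib power2_eq_square)
    then have "integral {0..1} (\<lambda>r. (V r \<omega>)\<^sup>2) = integral {0..t} (\<lambda>s. (g s * Z s \<omega>)\<^sup>2 / (v t)\<^sup>2)"
      by (rule integral_unique[symmetric])
    then show ?thesis by simp
  qed
  let ?L = "\<lambda>\<omega>. a * ((Z t \<omega>)\<^sup>2 / v t) + y * (integral {0..t} (\<lambda>s. (g s * Z s \<omega>)\<^sup>2) / (v t)\<^sup>2)"
  let ?V = "\<lambda>\<omega>. a * (V 1 \<omega>)\<^sup>2 + y * integral {0..1} (\<lambda>s. (V s \<omega>)\<^sup>2)"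
  have eq: "?L \<omega> = ?V \<omega>" if "\<omega> \<in> space M" for \<omega>
    using V1 Vint[OF that] by simp
  show "?L \<in> borel_measurable M"
    using wiener_quadratic_functional_measurable(1)[OF V'] measurable_cong[of M ?L ?V borel] eq by simp
  have "distr M borel ?L = distr M borel ?V" by (rule distr_cong) (use eq in auto)
  then show "distr M borel ?L = distr N borel (\<lambda>\<omega>. a * (W 1 \<omega>)\<^sup>2 + y * integral {0..1} (\<lambda>s. (W s \<omega>)\<^sup>2))"
    using wiener_quadratic_functional_law[OF V' W] by simp
qed

end

section \<open>Limits at the horizon\<close>

lemma eventually_up_to:
  assumes "0 < T"
  shows "eventually P (up_to T) \<longleftrightarrow> (\<exists>s\<in>time_interval T. \<forall>t. s < t \<longrightarrow> ereal t < T \<longrightarrow> P t)"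
proof (cases T)
  case (real r)
  then have r: "0 < r" using assms by simp
  have "eventually P (up_to T) \<longleftrightarrow> (\<exists>b<r. \<forall>y>b. y < r \<longrightarrow> P y)"
    unfolding real up_to_ereal using r by (subst eventually_at_left[of 0]) auto
  also have "\<dots> \<longleftrightarrow> (\<exists>s\<in>time_interval T. \<forall>t. s < t \<longrightarrow> ereal t < T \<longrightarrow> P t)"
  proof
    assume "\<exists>b<r. \<forall>y>b. y < r \<longrightarrow> P y"
    then obtain b where "b < r" "\<And>y. b < y \<Longrightarrow> y < r \<Longrightarrow> P y" by blast
    then show "\<exists>s\<in>time_interval T. \<forall>t. s < t \<longrightarrow> ereal t < T \<longrightarrow> P t"
      using r by (intro bexI[of _ "max 0 b"]) (auto simp: time_interval_def real)
  qed (auto simp: time_interval_def real)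
  finally show ?thesis .
next
  case PInf
  have "eventually P (up_to T) \<longleftrightarrow> (\<exists>N. \<forall>n>N. P n)"
    unfolding PInf up_to_PInf by (rule eventually_at_top_dense)
  also have "\<dots> \<longleftrightarrow> (\<exists>s\<in>time_interval T. \<forall>t. s < t \<longrightarrow> ereal t < T \<longrightarrow> P t)"
  proof
    assume "\<exists>N. \<forall>n>N. P n"
    then obtain b where "\<And>y. b < y \<Longrightarrow> P y" by blast
    then show "\<exists>s\<in>time_interval T. \<forall>t. s < t \<longrightarrow> ereal t < T \<longrightarrow> P t"
      by (intro bexI[of _ "max 0 b"]) (auto simp: time_interval_def PInf)
  qed (auto simp: time_interval_def PInf)
  finally show ?thesis .
qed (use assms in simp)

lemma time_interval_down: "t \<in> time_interval T \<Longrightarrow> 0 \<le> s \<Longrightarrow> s \<le> t \<Longrightarrow> s \<in> time_interval T"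
  using le_less_trans[of "ereal s" "ereal t" T] by (auto simp: time_interval_def)

lemma time_interval_subset: "t \<in> time_interval T \<Longrightarrow> {0..t} \<subseteq> time_interval T"
  using time_interval_down by auto

lemma eventually_up_to_gt:
  assumes "s \<in> time_interval T" "0 < T"
  shows "\<forall>\<^sub>F t in up_to T. s < t \<and> t \<in> time_interval T"
  unfolding eventually_up_to[OF assms(2)] using assms(1)
  by (intro bexI[of _ s]) (auto simp: time_interval_def)

text \<open>
  As \<open>w\<close> is the derivative of \<open>v\<close>, the integral of \<open>v w\<close> is \<open>v\<^sup>2 / 2\<close>. The weights
  \<open>2 v w / (v t)\<^sup>2\<close> have total mass one, and the mass of each fixed initial interval vanishes because \<open>v\<close> tends to infinity.
\<close>

lemma weighted_average_tendsto:
  fixes q w :: "real \<Rightarrow> real"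
  defines "v \<equiv> \<lambda>t. integral {0..t} w"
  assumes T: "0 < T" and w: "continuous_on (time_interval T) w"
    and w_nonneg: "\<And>s. s \<in> time_interval T \<Longrightarrow> 0 \<le> w s"
    and q: "continuous_on (time_interval T) q" and lim: "(q \<longlongrightarrow> L) (up_to T)"
    and v_top: "filterlim v at_top (up_to T)"
  shows "((\<lambda>t. integral {0..t} (\<lambda>s. q s * v s * w s) / (v t)\<^sup>2) \<longlongrightarrow> L / 2) (up_to T)"
proof (rule tendstoI)
  fix \<epsilon> :: real assume \<epsilon>: "0 < \<epsilon>"
  have wc: "continuous_on {0..t} w" and qc: "continuous_on {0..t} q" if "t \<in> time_interval T" for t
    using continuous_on_subset[OF w] continuous_on_subset[OF q] time_interval_subset[OF that] by auto
  have vd: "(v has_real_derivative w s) (at s within {0..t})" if "t \<in> time_interval T" "s \<in> {0..t}" for s t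
    unfolding v_def using wc[OF that(1)] that(2) by (rule integral_has_real_derivative)
  have vc: "continuous_on {0..t} v" if "t \<in> time_interval T" for t
    using vd[OF that] by (intro DERIV_continuous_on) auto
  have v_nonneg: "0 \<le> v t" if t: "t \<in> time_interval T" for t
    unfolding v_def using wc[OF t] w_nonneg time_interval_subset[OF t]
    by (intro integral_nonneg integrable_continuous_real) auto
  have vw: "integral {0..t} (\<lambda>s. v s * w s) = (v t)\<^sup>2 / 2" if t: "t \<in> time_interval T" for t
  proof -
    have "((\<lambda>s. v s * w s) has_integral (v t)\<^sup>2 / 2 - (v 0)\<^sup>2 / 2) {0..t}"
    proof (rule fundamental_theorem_of_calculus)
      show "0 \<le> t" using t by (simp add: time_interval_def)
      fix s assume "s \<in> {0..t}"
      from vd[OF t this] have "((\<lambda>s. (v s)\<^sup>2 / 2) has_real_derivative v s * w s) (at s within {0..t})"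
        by (auto intro!: derivative_eq_intros)
      then show "((\<lambda>s. (v s)\<^sup>2 / 2) has_vector_derivative v s * w s) (at s within {0..t})"
        by (simp add: has_real_derivative_iff_has_vector_derivative)
    qed
    then show ?thesis by (simp add: integral_unique v_def)
  qed
  have "\<forall>\<^sub>F t in up_to T. dist (q t) L < \<epsilon>" using lim \<epsilon> by (rule tendstoD)
  then obtain s' where s': "s' \<in> time_interval T" "\<And>u. s' < u \<Longrightarrow> ereal u < T \<Longrightarrow> dist (q u) L < \<epsilon>"
    unfolding eventually_up_to[OF T] by blast
  obtain s where "s' < s" "ereal s < T"
    using ereal_dense2[of s' T] s'(1) by (auto simp: time_interval_def)
  then have s: "s \<in> time_interval T" "\<And>u. s \<le> u \<Longrightarrow> ereal u < T \<Longrightarrow> dist (q u) L < \<epsilon>"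
    using s' by (auto simp: time_interval_def)
  define A where "A = \<bar>integral {0..s} (\<lambda>u. (q u - L) * (v u * w u))\<bar>"
  have "((\<lambda>t. A / (v t)\<^sup>2) \<longlongrightarrow> 0) (up_to T)"
  proof -
    have "filterlim (\<lambda>t. (v t)\<^sup>2) at_infinity (up_to T)"
      using filterlim_pow_at_top[OF _ v_top, of 2] by (auto intro: filterlim_at_top_imp_at_infinity)
    then show ?thesis by (intro tendsto_divide_0[OF tendsto_const])
  qed
  then have "\<forall>\<^sub>F t in up_to T. A / (v t)\<^sup>2 < \<epsilon> / 2"
    using \<epsilon> by (intro order_tendstoD(2)) auto
  moreover have "\<forall>\<^sub>F t in up_to T. 0 < v t"
    using v_top by (auto simp: filterlim_at_top_dense)
  ultimately show "\<forall>\<^sub>F t in up_to T. dist (integral {0..t} (\<lambda>s. q s * v s * w s) / (v t)\<^sup>2) (L / 2) < \<epsilon>"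
    using eventually_up_to_gt[OF s(1) T]
  proof eventually_elim
    case (elim t)
    then have t: "t \<in> time_interval T" "s < t" "0 < v t" by auto
    have s0: "0 \<le> s" using s(1) by (simp add: time_interval_def)
    note c = wc[OF t(1)] qc[OF t(1)] vc[OF t(1)]
    have sub: "{s..t} \<subseteq> {0..t}" using s0 by auto
    note c' = continuous_on_subset[OF c(1) sub] continuous_on_subset[OF c(2) sub] continuous_on_subset[OF c(3) sub]
    let ?d = "\<lambda>u. (q u - L) * (v u * w u)"
    have "integral {0..t} (\<lambda>s. q s * v s * w s) - L * integral {0..t} (\<lambda>s. v s * w s) = integral {0..t} (\<lambda>u. q u * v u * w u - L * (v u * w u))"
      using c by (subst Henstock_Kurzweil_Integration.integral_diff)
        (auto intro!: integrable_continuous_real continuous_intros)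
    also have "\<dots> = integral {0..t} ?d"
      by (rule arg_cong[where f = "integral _"]) (auto simp: algebra_simps)
    also have "\<dots> = integral {0..s} ?d + integral {s..t} ?d"
      using s0 t c by (intro Henstock_Kurzweil_Integration.integral_combine[symmetric])
        (auto intro!: integrable_continuous_real continuous_intros)
    finally have 1: "integral {0..t} (\<lambda>s. q s * v s * w s) - L * (v t)\<^sup>2 / 2 = integral {0..s} ?d + integral {s..t} ?d"
      using vw[OF t(1)] by simp
    have nn: "0 \<le> v u * w u" if "u \<in> {0..t}" for u
      using v_nonneg w_nonneg time_interval_subset[OF t(1)] that by auto
    have "norm (integral {s..t} ?d) \<le> integral {s..t} (\<lambda>u. \<epsilon> * (v u * w u))"
    proof (rule integral_norm_bound_integral)
      show "?d integrable_on {s..t}" "(\<lambda>u. \<epsilon> * (v u * w u)) integrable_on {s..t}"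
        using c' by (intro integrable_continuous_real continuous_intros; simp)+
      fix u assume u: "u \<in> {s..t}"
      show "norm (?d u) \<le> \<epsilon> * (v u * w u)"
      proof -
        have "\<bar>q u - L\<bar> \<le> \<epsilon>"
          using s(2)[of u] u time_interval_down[OF t(1), of u] s0
          by (auto simp: dist_real_def time_interval_def)
        then show ?thesis using nn[of u] u s0
          by (simp add: abs_mult[of "q u - L" "v u * w u"] mult_right_mono)
      qed
    qed
    also have "\<dots> = \<epsilon> * integral {s..t} (\<lambda>u. v u * w u)" by simp
    also have "\<dots> \<le> \<epsilon> * integral {0..t} (\<lambda>u. v u * w u)"
      using \<epsilon> c c' nn sub by (intro mult_left_mono integral_subset_le)
        (auto intro!: integrable_continuous_real continuous_intros)
    finally have 2: "\<bar>integral {s..t} ?d\<bar> \<le> \<epsilon> * (v t)\<^sup>2 / 2" using vw[OF t(1)] by simp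
    have "\<bar>integral {0..t} (\<lambda>s. q s * v s * w s) - L * (v t)\<^sup>2 / 2\<bar> \<le> A + \<epsilon> * (v t)\<^sup>2 / 2"
      unfolding 1 A_def using 2 by linarith
    also have "\<dots> < \<epsilon> * (v t)\<^sup>2"
      using elim(1) t(3) by (simp add: pos_divide_less_eq)
    finally have 3: "\<bar>integral {0..t} (\<lambda>s. q s * v s * w s) - L * (v t)\<^sup>2 / 2\<bar> < \<epsilon> * (v t)\<^sup>2" .
    have "integral {0..t} (\<lambda>s. q s * v s * w s) / (v t)\<^sup>2 - L / 2
        = (integral {0..t} (\<lambda>s. q s * v s * w s) - L * (v t)\<^sup>2 / 2) / (v t)\<^sup>2"
      using t(3) by (simp add: field_simps)
    then show ?case using 3 t(3) by (simp add: dist_real_def abs_divide pos_divide_less_eq)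
  qed
qed

text \<open>
  The variables \<open>Z t\<close> have a fixed law without an atom at 0, so that a perturbation
  that vanishes in probability does not change the limit of the distribution function at 0.
\<close>

lemma (in prob_space) tendsto_prob_le_zero:
  fixes U Z :: "real \<Rightarrow> 'a \<Rightarrow> real" and \<mu> :: "real measure"
  assumes \<mu>: "real_distribution \<mu>" and \<mu>0: "measure \<mu> {0} = 0"
    and ev: "\<forall>\<^sub>F t in G. U t \<in> borel_measurable M \<and> Z t \<in> borel_measurable M \<and> distr M borel (Z t) = \<mu>"
    and close: "\<And>\<eta>. 0 < \<eta> \<Longrightarrow> ((\<lambda>t. prob {\<omega> \<in> space M. \<eta> < \<bar>U t \<omega> - Z t \<omega>\<bar>}) \<longlongrightarrow> 0) G"
  shows "((\<lambda>t. prob {\<omega> \<in> space M. U t \<omega> \<le> 0}) \<longlongrightarrow> measure \<mu> {..0}) G"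
proof (rule tendstoI)
  fix r :: real assume r: "0 < r"
  interpret \<mu>: real_distribution \<mu> by (rule \<mu>)
  have "isCont (cdf \<mu>) 0" using \<mu>0 by (simp add: \<mu>.isCont_cdf)
  then obtain d where d: "0 < d" "\<And>y. dist y 0 < d \<Longrightarrow> dist (cdf \<mu> y) (cdf \<mu> 0) < r / 2"
    using r unfolding isCont_def by (metis continuous_at_eps_delta[unfolded isCont_def continuous_within] half_gt_zero)
  have d2: "0 < d / 2" using d(1) by simp
  have "\<forall>\<^sub>F t in G. prob {\<omega> \<in> space M. d / 2 < \<bar>U t \<omega> - Z t \<omega>\<bar>} < r / 2"
    using order_tendstoD(2)[OF close[OF d2], of "r / 2"] r by simp
  with ev show "\<forall>\<^sub>F t in G. dist (prob {\<omega> \<in> space M. U t \<omega> \<le> 0}) (measure \<mu> {..0}) < r"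
  proof eventually_elim
    case (elim t)
    then have [measurable]: "U t \<in> borel_measurable M" "Z t \<in> borel_measurable M" by auto
    have Z: "prob {\<omega> \<in> space M. Z t \<omega> \<le> y} = cdf \<mu> y" for y
    proof -
      have "cdf \<mu> y = measure (distr M borel (Z t)) {..y}" using elim by (simp add: cdf_def)
      also have "\<dots> = prob {\<omega> \<in> space M. Z t \<omega> \<le> y}"
        by (subst measure_distr) (auto intro!: arg_cong[where f = prob])
      finally show ?thesis by simp
    qed
    have "prob {\<omega> \<in> space M. U t \<omega> \<le> 0} \<le> prob {\<omega> \<in> space M. Z t \<omega> \<le> d / 2} + prob {\<omega> \<in> space M. d / 2 < \<bar>U t \<omega> - Z t \<omega>\<bar>}"
      by (rule prob_le_union) (auto simp: abs_if split: if_splits)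
    moreover have "prob {\<omega> \<in> space M. Z t \<omega> \<le> - (d / 2)} \<le> prob {\<omega> \<in> space M. U t \<omega> \<le> 0} + prob {\<omega> \<in> space M. d / 2 < \<bar>U t \<omega> - Z t \<omega>\<bar>}"
      by (rule prob_le_union) (auto simp: abs_if split: if_splits)
    moreover have "dist (cdf \<mu> (d / 2)) (cdf \<mu> 0) < r / 2" "dist (cdf \<mu> (- (d / 2))) (cdf \<mu> 0) < r / 2"
      using d by (auto simp: dist_real_def)
    ultimately show ?case
      using elim unfolding Z dist_real_def cdf_def by (auto simp: abs_if split: if_splits)
  qed
qed

section \<open>The maximum likelihood estimator\<close>

lemma is_arg_max_quadratic:
  fixes S A x :: real
  assumes A: "0 < A" and x: "is_arg_max (\<lambda>\<theta>. \<theta> * S - \<theta>\<^sup>2 / 2 * A) (\<lambda>_. True) x"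
  shows "x = S / A"
proof -
  have "(S / A) * S - (S / A)\<^sup>2 / 2 * A - (x * S - x\<^sup>2 / 2 * A) = A / 2 * (x - S / A)\<^sup>2"
    using A by (simp add: field_simps power2_eq_square)
  moreover have "(S / A) * S - (S / A)\<^sup>2 / 2 * A \<le> x * S - x\<^sup>2 / 2 * A"
    using x unfolding is_arg_max_def not_less by (metis (no_types, lifting) linorder_not_less)
  ultimately have "A / 2 * (x - S / A)\<^sup>2 \<le> 0" by linarith
  then show ?thesis using A by (simp add: mult_le_0_iff)
qed

lemma tendsto_zeroI_real:
  fixes f :: "'i \<Rightarrow> real"
  assumes "\<And>t. 0 \<le> f t" "\<And>r. 0 < r \<Longrightarrow> \<forall>\<^sub>F t in G. f t < r"
  shows "(f \<longlongrightarrow> 0) G"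
  by (rule tendstoI) (use assms in \<open>auto simp: dist_real_def\<close>)

section \<open>Asymptotics of the score and of the observed information\<close>

context gaussian_martingale
begin

lemma weighted_square_integral:
  assumes t: "t \<in> I" and c: "continuous_on {0..t} c"
  shows "(\<lambda>\<omega>. integral {0..t} (\<lambda>s. (c s)\<^sup>2 * (g s * Z s \<omega>)\<^sup>2)) \<in> borel_measurable M"
    and "0 < t \<Longrightarrow> c t \<noteq> 0 \<Longrightarrow>
      AE \<omega> in M. 0 < integral {0..t} (\<lambda>s. (c s)\<^sup>2 * (g s * Z s \<omega>)\<^sup>2)"
proof -
  let ?A = "\<lambda>\<omega>. integral {0..t} (\<lambda>s. (c s)\<^sup>2 * (g s * Z s \<omega>)\<^sup>2)"
  have cont: "continuous_on {0..t} (\<lambda>s. (c s)\<^sup>2 * (g s * Z s \<omega>)\<^sup>2)" if "\<omega> \<in> space M" for \<omega>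
    using c g_cont'[OF t] Z_cont'[OF t that] by (intro continuous_intros)
  have nonneg: "0 \<le> ?A \<omega>" if "\<omega> \<in> space M" for \<omega>
    by (intro integral_nonneg integrable_continuous_real cont[OF that]) simp
  have cg: "continuous_on {0..t} (\<lambda>s. c s * g s)"
    using c g_cont'[OF t] by (intro continuous_intros)
  have eq: "?A \<omega> = enn2real (energy t (\<lambda>s \<omega>. (c s * g s) * Z s \<omega>) \<omega>)" if \<omega>: "\<omega> \<in> space M" for \<omega>
  proof -
    have "energy t (\<lambda>s \<omega>. (c s * g s) * Z s \<omega>) \<omega> = (\<integral>\<^sup>+s\<in>{0..t}. ennreal ((c s)\<^sup>2 * (g s * Z s \<omega>)\<^sup>2) \<partial>lborel)"
      unfolding energy_def by (simp add: power_mult_distrib mult.assoc)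
    also have "\<dots> = ennreal (?A \<omega>)"
      by (rule nn_integral_continuous_interval[OF cont[OF \<omega>]]) simp
    finally show ?thesis using nonneg[OF \<omega>] by simp
  qed
  note [measurable] = energy_measurable[OF jointly_measurable_Z[OF t cg]]
  have "(\<lambda>\<omega>. enn2real (energy t (\<lambda>s \<omega>. (c s * g s) * Z s \<omega>) \<omega>)) \<in> borel_measurable M" by measurable
  then show "?A \<in> borel_measurable M" by (subst measurable_cong[OF eq]) auto
  show "AE \<omega> in M. 0 < ?A \<omega>" if t0: "0 < t" and ct: "c t \<noteq> 0"
    using Z_neq_0[OF t t0] AE_space
  proof eventually_elim
    case (elim \<omega>)
    have "?A \<omega> \<noteq> 0"
      using integral_eq_0_iff[OF cont[OF elim(2)]] elim(1) t0 ct g_pos[OF t] by (auto intro!: bexI[of _ t])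
    then show ?case using nonneg[OF elim(2)] by simp
  qed
qed

text \<open>
  The difference between the combination of score and information and its counterpart with \<open>C\<close> in place of \<open>c\<close>
  and the limit in place of \<open>\<rho>\<close> has three parts, due to the score, to \<open>\<rho>\<close> and to the information. Each is
  small in probability. The counterpart has the law \<open>\<mu>\<close> for every \<open>t\<close>.
\<close>

lemma normalized_score_tendsto:
  fixes T :: ereal and c \<rho> :: "real \<Rightarrow> real" and C x :: real
    and N :: "'n measure" and W :: "real \<Rightarrow> 'n \<Rightarrow> real"
  defines "a \<equiv> \<bar>C\<bar> / sqrt 2 * C / 2"
  defines "A \<equiv> \<lambda>t \<omega>. integral {0..t} (\<lambda>s. (c s)\<^sup>2 * (g s * Z s \<omega>)\<^sup>2)"
  defines "\<mu> \<equiv> distr N borel (\<lambda>\<omega>. (a * (W 1 \<omega>)\<^sup>2 + (- (x * C\<^sup>2)) * integral {0..1} (\<lambda>s. (W s \<omega>)\<^sup>2)) - a)"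
  assumes I: "I = time_interval T" and T_pos: "0 < T"
    and c_cont: "continuous_on I c" and c_lim: "(c \<longlongrightarrow> C) (up_to T)"
    and v_top: "filterlim v at_top (up_to T)"
    and \<rho>_nonneg: "\<And>t. t \<in> I \<Longrightarrow> 0 \<le> \<rho> t" and \<rho>_lim: "(\<rho> \<longlongrightarrow> \<bar>C\<bar> / sqrt 2) (up_to T)"
    and N_ito: "\<And>t. t \<in> I \<Longrightarrow> ito_lim (\<lambda>s \<omega>. c s * (g s * Z s \<omega>)) t (Nm t)"
    and W: "wiener_process N {0..1} W" and \<mu>_0: "measure \<mu> {0} = 0"
  shows "((\<lambda>t. prob {\<omega> \<in> space M. \<rho> t * (Nm t \<omega> / v t) - x * (A t \<omega> / (v t)\<^sup>2) \<le> 0})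
    \<longlongrightarrow> measure \<mu> {..0}) (up_to T)"
proof -
  have zero_I: "0 \<in> time_interval T" using zero_in I by simp
  have gt: "\<forall>\<^sub>F t in up_to T. 0 < t \<and> t \<in> I"
    using eventually_up_to_gt[OF zero_I T_pos] by (simp add: I)
  have cont0: "continuous_on {0..t} f" if "continuous_on I f" "t \<in> I" for f :: "real \<Rightarrow> real" and t
    by (rule continuous_on_subset[OF that(1) interval_subset[OF that(2)]])
  have v_eq: "v = (\<lambda>s. integral {0..s} (\<lambda>u. (g u)\<^sup>2))" by (simp add: v_def fun_eq_iff)
  have avg: "((\<lambda>t. integral {0..t} (\<lambda>s. q s * v s * (g s)\<^sup>2) / (v t)\<^sup>2) \<longlongrightarrow> L / 2) (up_to T)"
    if "continuous_on I q" "(q \<longlongrightarrow> L) (up_to T)" for q L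
    unfolding v_eq
    by (rule weighted_average_tendsto[OF T_pos _ _ that[unfolded I] v_top[unfolded v_eq]])
       (use g_cont in \<open>auto intro!: continuous_intros simp: I\<close>)
  define \<rho>0 where "\<rho>0 = \<bar>C\<bar> / sqrt 2"
  note \<rho>_lim = \<rho>_lim[folded \<rho>0_def] and a_def = a_def[folded \<rho>0_def]
  define Q where "Q t \<omega> = integral {0..t} (\<lambda>s. (g s * Z s \<omega>)\<^sup>2)" for t \<omega>
  define R1 where "R1 t = integral {0..t} (\<lambda>s. (c s - C)\<^sup>2 * v s * (g s)\<^sup>2) / (v t)\<^sup>2" for t
  define R2 where "R2 t = integral {0..t} (\<lambda>s. \<bar>(c s)\<^sup>2 - C\<^sup>2\<bar> * v s * (g s)\<^sup>2) / (v t)\<^sup>2" for t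
  have R1: "(R1 \<longlongrightarrow> 0) (up_to T)"
  proof -
    have "((\<lambda>t. (c t - C)\<^sup>2) \<longlongrightarrow> (C - C)\<^sup>2) (up_to T)" using c_lim by (intro tendsto_intros)
    moreover have "continuous_on I (\<lambda>t. (c t - C)\<^sup>2)" using c_cont by (intro continuous_intros)
    ultimately show ?thesis unfolding R1_def[abs_def] using avg by fastforce
  qed
  have R2: "(R2 \<longlongrightarrow> 0) (up_to T)"
  proof -
    have "((\<lambda>t. \<bar>(c t)\<^sup>2 - C\<^sup>2\<bar>) \<longlongrightarrow> \<bar>C\<^sup>2 - C\<^sup>2\<bar>) (up_to T)" using c_lim by (intro tendsto_intros)
    moreover have "continuous_on I (\<lambda>t. \<bar>(c t)\<^sup>2 - C\<^sup>2\<bar>)" using c_cont by (intro continuous_intros)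
    ultimately show ?thesis unfolding R2_def[abs_def] using avg by fastforce
  qed
  have A_meas: "A t \<in> borel_measurable M" if "t \<in> I" for t
    unfolding A_def using weighted_square_integral(1)[OF that cont0[OF c_cont that]] .
  have Nm_meas: "Nm t \<in> borel_measurable M" if "t \<in> I" for t
    by (rule ito_lim_measurable[OF N_ito[OF that]])
  let ?H = "\<lambda>\<omega>. a * (W 1 \<omega>)\<^sup>2 + (- (x * C\<^sup>2)) * integral {0..1} (\<lambda>s. (W s \<omega>)\<^sup>2)"
  have H_meas: "?H \<in> borel_measurable N"
    by (rule wiener_quadratic_functional_measurable(1)[OF W])
  interpret N: prob_space N using W by (simp add: wiener_process_def)
  have \<mu>_dist: "real_distribution \<mu>"
    unfolding \<mu>_def using H_meas by (intro N.real_distribution_distr borel_measurable_diff) auto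
  define U where "U t \<omega> = \<rho> t * (Nm t \<omega> / v t) - x * (A t \<omega> / (v t)\<^sup>2)" for t \<omega>
  define V where "V t \<omega> = (a * ((Z t \<omega>)\<^sup>2 / v t) + (- (x * C\<^sup>2)) * (Q t \<omega> / (v t)\<^sup>2)) - a" for t \<omega>
  have V_law: "V t \<in> borel_measurable M \<and> distr M borel (V t) = \<mu>" if t: "t \<in> I" "0 < t" for t
  proof -
    note * = quadratic_functional_law[OF t W, of a "- (x * C\<^sup>2)", folded Q_def]
    define h where "h = (\<lambda>\<omega>. a * ((Z t \<omega>)\<^sup>2 / v t) + (- (x * C\<^sup>2)) * (Q t \<omega> / (v t)\<^sup>2))"
    have [measurable]: "h \<in> borel_measurable M" unfolding h_def by (rule *(1))
    have V_h: "V t = (\<lambda>\<omega>. h \<omega> - a)" by (simp add: V_def h_def fun_eq_iff)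
    have "distr M borel (V t) = distr (distr M borel h) borel (\<lambda>z. z - a)"
      unfolding V_h by (subst distr_distr) (auto simp: comp_def)
    also have "\<dots> = distr (distr N borel ?H) borel (\<lambda>z. z - a)" unfolding h_def *(2) ..
    also have "\<dots> = \<mu>" unfolding \<mu>_def using H_meas by (subst distr_distr) (simp_all add: comp_def)
    finally show ?thesis unfolding V_h by simp
  qed
  have U_meas: "U t \<in> borel_measurable M" if t: "t \<in> I" for t
    unfolding U_def[abs_def] using Nm_meas[OF t] A_meas[OF t] by measurable
  have close: "((\<lambda>t. prob {\<omega> \<in> space M. \<eta> < \<bar>U t \<omega> - V t \<omega>\<bar>}) \<longlongrightarrow> 0) (up_to T)" if \<eta>: "0 < \<eta>" for \<eta>
  proof (rule tendsto_zeroI_real)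
    fix r :: real assume r: "0 < r"
    define \<epsilon> where "\<epsilon> = \<eta> / 3 / (\<rho>0 + 1)"
    have \<rho>0: "0 \<le> \<rho>0" by (simp add: \<rho>0_def)
    have \<eta>3: "0 < \<eta> / 3" using \<eta> by simp
    have \<epsilon>: "0 < \<epsilon>" using \<eta> \<rho>0 by (simp add: \<epsilon>_def)
    \<comment> \<open>makes the second term of the bound for the score equal to \<open>r / 4\<close>\<close>
    define \<delta> where "\<delta> = r * \<epsilon>\<^sup>2 / 64"
    have \<delta>: "0 < \<delta>" "16 * \<delta> / \<epsilon>\<^sup>2 = r / 4" using r \<epsilon> by (auto simp: \<delta>_def)
    have "((\<lambda>t. R1 t / \<delta>) \<longlongrightarrow> 0 / \<delta>) (up_to T)" using R1 \<delta> by (intro tendsto_intros) auto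
    then have e1: "\<forall>\<^sub>F t in up_to T. R1 t / \<delta> < r / 4" using r by (intro order_tendstoD(2)) auto
    have "((\<lambda>t. 2 * \<bar>(\<rho> t - \<rho>0) * C / 2\<bar> / (\<eta> / 3)) \<longlongrightarrow> 2 * \<bar>(\<rho>0 - \<rho>0) * C / 2\<bar> / (\<eta> / 3)) (up_to T)"
      using \<eta> by (intro tendsto_intros \<rho>_lim) auto
    then have e2: "\<forall>\<^sub>F t in up_to T. 2 * \<bar>(\<rho> t - \<rho>0) * C / 2\<bar> / (\<eta> / 3) < r / 4"
      using r by (intro order_tendstoD(2)) auto
    have "((\<lambda>t. \<bar>x\<bar> * R2 t / (\<eta> / 3)) \<longlongrightarrow> \<bar>x\<bar> * 0 / (\<eta> / 3)) (up_to T)"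
      using \<eta> by (intro tendsto_intros R2) auto
    then have e3: "\<forall>\<^sub>F t in up_to T. \<bar>x\<bar> * R2 t / (\<eta> / 3) < r / 4"
      using r by (intro order_tendstoD(2)) auto
    have e4: "\<forall>\<^sub>F t in up_to T. \<rho> t < \<rho>0 + 1" using \<rho>_lim by (rule order_tendstoD(2)) simp
    show "\<forall>\<^sub>F t in up_to T. prob {\<omega> \<in> space M. \<eta> < \<bar>U t \<omega> - V t \<omega>\<bar>} < r"
      using e1 e2 e3 e4 gt
    proof eventually_elim
      case (elim t)
      then have t: "t \<in> I" "0 < t" by auto
      have vt: "0 < v t" by (rule v_pos[OF t])
      have \<rho>t: "0 \<le> \<rho> t" by (rule \<rho>_nonneg[OF t(1)])
      let ?d1 = "\<lambda>\<omega>. Nm t \<omega> / v t - C * ((Z t \<omega>)\<^sup>2 / v t - 1) / 2"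
      let ?d2 = "\<lambda>\<omega>. ((\<rho> t - \<rho>0) * C / 2) * ((Z t \<omega>)\<^sup>2 / v t - 1)"
      let ?d3 = "\<lambda>\<omega>. x * (A t \<omega> / (v t)\<^sup>2 - C\<^sup>2 * (Q t \<omega> / (v t)\<^sup>2))"
      have Q_meas: "Q t \<in> borel_measurable M"
      proof -
        have "(\<lambda>\<omega>. 0 * ((Z t \<omega>)\<^sup>2 / v t) + (v t)\<^sup>2 * (Q t \<omega> / (v t)\<^sup>2)) \<in> borel_measurable M"
          by (rule quadratic_functional_law(1)[OF t W, of 0 "(v t)\<^sup>2", folded Q_def])
        then show ?thesis using vt by simp
      qed
      note [measurable] = Nm_meas[OF t(1)] A_meas[OF t(1)] Q_meas Z_measurable[OF t(1)]
      have dec: "U t \<omega> - V t \<omega> = \<rho> t * ?d1 \<omega> + ?d2 \<omega> - ?d3 \<omega>" for \<omega>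
        by (simp add: U_def V_def a_def algebra_simps diff_divide_distrib)
      have "prob {\<omega> \<in> space M. \<eta> < \<bar>U t \<omega> - V t \<omega>\<bar>} \<le> prob {\<omega> \<in> space M. \<epsilon> < \<bar>?d1 \<omega>\<bar>}
          + prob {\<omega> \<in> space M. \<eta> / 3 < \<bar>?d2 \<omega>\<bar>} + prob {\<omega> \<in> space M. \<eta> / 3 < \<bar>?d3 \<omega>\<bar>}"
      proof (rule prob_le_union3)
        show "{\<omega> \<in> space M. \<eta> < \<bar>U t \<omega> - V t \<omega>\<bar>} \<subseteq> {\<omega> \<in> space M. \<epsilon> < \<bar>?d1 \<omega>\<bar>}
          \<union> {\<omega> \<in> space M. \<eta> / 3 < \<bar>?d2 \<omega>\<bar>} \<union> {\<omega> \<in> space M. \<eta> / 3 < \<bar>?d3 \<omega>\<bar>}"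
        proof (intro subsetI, rule ccontr)
          fix \<omega> assume *: "\<omega> \<in> {\<omega> \<in> space M. \<eta> < \<bar>U t \<omega> - V t \<omega>\<bar>}"
            and "\<omega> \<notin> {\<omega> \<in> space M. \<epsilon> < \<bar>?d1 \<omega>\<bar>} \<union> {\<omega> \<in> space M. \<eta> / 3 < \<bar>?d2 \<omega>\<bar>} \<union> {\<omega> \<in> space M. \<eta> / 3 < \<bar>?d3 \<omega>\<bar>}"
          then have d: "\<bar>?d1 \<omega>\<bar> \<le> \<epsilon>" "\<bar>?d2 \<omega>\<bar> \<le> \<eta> / 3" "\<bar>?d3 \<omega>\<bar> \<le> \<eta> / 3" by auto
          have "\<bar>\<rho> t * ?d1 \<omega>\<bar> \<le> (\<rho>0 + 1) * \<epsilon>"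
            unfolding abs_mult using d(1) elim(4) \<rho>t \<rho>0 by (intro mult_mono) auto
          also have "\<dots> = \<eta> / 3" unfolding \<epsilon>_def
          proof -
            have "q * (y / q) = y" if "q \<noteq> 0" for q y :: real using that by simp
            then show "(\<rho>0 + 1) * (\<eta> / 3 / (\<rho>0 + 1)) = \<eta> / 3" using \<rho>0 by (metis add_nonneg_eq_0_iff zero_le_one zero_neq_one)
          qed
          finally have d1: "\<bar>\<rho> t * ?d1 \<omega>\<bar> \<le> \<eta> / 3" .
          have "\<bar>p + q - s\<bar> \<le> h" if "\<bar>p\<bar> \<le> h / 3" "\<bar>q\<bar> \<le> h / 3" "\<bar>s\<bar> \<le> h / 3" for p q s h :: real
            using that by linarith
          from this[OF d1 d(2,3)] have "\<bar>U t \<omega> - V t \<omega>\<bar> \<le> \<eta>" unfolding dec .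
          then show False using * by simp
        qed
      qed measurable
      moreover have "prob {\<omega> \<in> space M. \<epsilon> < \<bar>?d1 \<omega>\<bar>} \<le> R1 t / \<delta> + 16 * \<delta> / \<epsilon>\<^sup>2"
        using numerator_tail[OF t cont0[OF c_cont t(1)] N_ito[OF t(1)] \<delta>(1) \<epsilon>, of C]
        by (simp add: R1_def)
      moreover have "prob {\<omega> \<in> space M. \<eta> / 3 < \<bar>?d2 \<omega>\<bar>} \<le> 2 * \<bar>(\<rho> t - \<rho>0) * C / 2\<bar> / (\<eta> / 3)"
        using square_tail[OF t \<eta>3, of "(\<rho> t - \<rho>0) * C / 2"] by simp
      moreover have "prob {\<omega> \<in> space M. \<eta> / 3 < \<bar>?d3 \<omega>\<bar>} \<le> \<bar>x\<bar> * R2 t / (\<eta> / 3)"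
        using denominator_tail[OF t cont0[OF c_cont t(1)] \<eta>3, of x C]
        by (simp only: R2_def A_def Q_def)
      ultimately show ?case using elim(1,2,3) \<delta>(2) by linarith
    qed
  qed simp
  have "((\<lambda>t. prob {\<omega> \<in> space M. U t \<omega> \<le> 0}) \<longlongrightarrow> measure \<mu> {..0}) (up_to T)"
  proof (rule tendsto_prob_le_zero[OF \<mu>_dist \<mu>_0 _ close])
    show "\<forall>\<^sub>F t in up_to T. U t \<in> borel_measurable M \<and> V t \<in> borel_measurable M \<and> distr M borel (V t) = \<mu>"
      using gt by eventually_elim (use U_meas V_law in auto)
  qed
  then show ?thesis unfolding U_def .
qed

end

text \<open>
  \<open>L = C\<^sup>2 (\<integral> W\<^sup>2) (Rl - x)\<close> almost surely, with a positive factor in front of \<open>Rl - x\<close>. This uses \<open>C\<^sup>2 sgn C = \<bar>C\<bar> C\<close>.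
\<close>

lemma wiener_ratio_level:
  fixes C x :: real and N :: "'n measure" and W :: "real \<Rightarrow> 'n \<Rightarrow> real" and J :: "'n \<Rightarrow> real"
  defines "a \<equiv> \<bar>C\<bar> / sqrt 2 * C / 2"
  assumes W: "wiener_process N {0..1} W"
    and J: "has_ito_integral N (augmented_filtration N {0..1} W) W W 1 J" and C: "C \<noteq> 0"
  defines "Rl \<equiv> \<lambda>\<omega>. sgn C / sqrt 2 * (J \<omega> / (LBINT s:{0..1}. (W s \<omega>)\<^sup>2))"
    and "L \<equiv> \<lambda>\<omega>. (a * (W 1 \<omega>)\<^sup>2 + (- (x * C\<^sup>2)) * integral {0..1} (\<lambda>s. (W s \<omega>)\<^sup>2)) - a"
  shows "Rl \<in> borel_measurable N"
    and "isCont (cdf (distr N borel Rl)) x \<Longrightarrow> measure (distr N borel L) {0} = 0"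
    and "measure (distr N borel L) {..0} = cdf (distr N borel Rl) x"
proof -
  interpret N: prob_space N using W by (simp add: wiener_process_def)
  let ?q = "\<lambda>\<omega>. integral {0..1} (\<lambda>s. (W s \<omega>)\<^sup>2)"
  have W_int: "(LBINT s:{0..1}. (W s \<omega>)\<^sup>2) = ?q \<omega>" if "\<omega> \<in> space N" for \<omega>
    using W that by (intro LBINT_continuous_interval continuous_intros) (simp add: wiener_process_def)
  have J_meas [measurable]: "J \<in> borel_measurable N"
    using J by (auto simp: has_ito_integral_def tendsto_in_prob_def)
  have q_meas [measurable]: "?q \<in> borel_measurable N"
    using wiener_quadratic_functional_measurable(1)[OF W, of 0 1] by simp
  show Rl_meas [measurable]: "Rl \<in> borel_measurable N"
  proof -
    have "(\<lambda>\<omega>. sgn C / sqrt 2 * (J \<omega> / ?q \<omega>)) \<in> borel_measurable N" by measurable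
    moreover have "Rl \<omega> = sgn C / sqrt 2 * (J \<omega> / ?q \<omega>)" if "\<omega> \<in> space N" for \<omega>
      unfolding Rl_def W_int[OF that] ..
    ultimately show ?thesis by (subst measurable_cong)
  qed
  let ?H = "\<lambda>\<omega>. a * (W 1 \<omega>)\<^sup>2 + (- (x * C\<^sup>2)) * ?q \<omega>"
  have H_meas [measurable]: "?H \<in> borel_measurable N"
    by (rule wiener_quadratic_functional_measurable(1)[OF W])
  have L_meas [measurable]: "L \<in> borel_measurable N"
    unfolding L_def using H_meas by (rule borel_measurable_diff) simp
  have L_eq: "AE \<omega> in N. L \<omega> = C\<^sup>2 * ?q \<omega> * (Rl \<omega> - x) \<and> 0 < C\<^sup>2 * ?q \<omega>"
    using wiener_ito_self[OF W J] AE_space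
  proof eventually_elim
    case (elim \<omega>)
    have sgn: "C\<^sup>2 * sgn C = \<bar>C\<bar> * C" by (simp add: sgn_real_def power2_eq_square abs_if)
    have "C\<^sup>2 * (sgn C / sqrt 2 * J \<omega>) = (C\<^sup>2 * sgn C) / sqrt 2 * J \<omega>" by simp
    also have "\<dots> = a * ((W 1 \<omega>)\<^sup>2 - 1)"
      unfolding sgn elim(1) by (simp add: a_def)
    finally have "C\<^sup>2 * (sgn C / sqrt 2 * J \<omega>) = a * ((W 1 \<omega>)\<^sup>2 - 1)" .
    moreover have "C\<^sup>2 * ?q \<omega> * (Rl \<omega> - x) = C\<^sup>2 * (sgn C / sqrt 2 * J \<omega>) - x * C\<^sup>2 * ?q \<omega>"
      using elim(2) W_int[OF elim(3)] by (simp add: Rl_def field_simps)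
    ultimately show ?case using elim(2) C by (simp add: L_def algebra_simps)
  qed
  interpret R: real_distribution "distr N borel Rl" by (rule N.real_distribution_distr) measurable
  show "measure (distr N borel L) {0} = 0" if x: "isCont (cdf (distr N borel Rl)) x"
  proof -
    have "measure (distr N borel L) {0} = measure N {\<omega> \<in> space N. L \<omega> = 0}"
      by (subst measure_distr) (auto intro!: arg_cong[where f = "measure N"])
    also have "\<dots> = measure N {\<omega> \<in> space N. Rl \<omega> = x}"
    proof (rule measure_eq_AE)
      show "AE \<omega> in N. \<omega> \<in> {\<omega> \<in> space N. L \<omega> = 0} \<longleftrightarrow> \<omega> \<in> {\<omega> \<in> space N. Rl \<omega> = x}"
        using L_eq by eventually_elim auto
    qed measurable
    also have "\<dots> = measure (distr N borel Rl) {x}"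
      by (subst measure_distr) (auto intro!: arg_cong[where f = "measure N"])
    also have "\<dots> = 0" using x by (simp add: R.isCont_cdf)
    finally show ?thesis .
  qed
  show "measure (distr N borel L) {..0} = cdf (distr N borel Rl) x"
  proof -
    have "measure (distr N borel L) {..0} = measure N {\<omega> \<in> space N. L \<omega> \<le> 0}"
      by (subst measure_distr) (auto intro!: arg_cong[where f = "measure N"])
    also have "\<dots> = measure N {\<omega> \<in> space N. Rl \<omega> \<le> x}"
    proof (rule measure_eq_AE)
      show "AE \<omega> in N. \<omega> \<in> {\<omega> \<in> space N. L \<omega> \<le> 0} \<longleftrightarrow> \<omega> \<in> {\<omega> \<in> space N. Rl \<omega> \<le> x}"
        using L_eq
      proof eventually_elim
        case (elim \<omega>)
        then have "L \<omega> \<le> 0 \<longleftrightarrow> Rl \<omega> - x \<le> 0"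
          by (metis mult_le_0_iff not_less order_less_imp_le)
        then show ?case by simp
      qed
    qed measurable
    also have "\<dots> = measure (distr N borel Rl) {..x}"
      by (subst measure_distr) (auto intro!: arg_cong[where f = "measure N"])
    finally show ?thesis by (simp add: cdf_def)
  qed
qed

theorem theorem2p5:
  fixes T :: ereal and t0 \<alpha> C :: real and b \<sigma> :: "real \<Rightarrow> real"
    and M :: "'a measure" and F :: "real \<Rightarrow> 'a measure"
    and B X S \<alpha>hat :: "real \<Rightarrow> 'a \<Rightarrow> real"
    and N :: "'b measure" and W :: "real \<Rightarrow> 'b \<Rightarrow> real" and J :: "'b \<Rightarrow> real"
  assumes T_pos: "0 < T"
    and b_cont: "continuous_on (time_interval T) b"
    and \<sigma>_cont: "continuous_on (time_interval T) \<sigma>"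
    and \<sigma>_pos: "\<And>t. t \<in> time_interval T \<Longrightarrow> \<sigma> t > 0"
    and t0: "0 < t0" "ereal t0 < T"
    and b_nonzero: "\<And>t. t0 \<le> t \<Longrightarrow> ereal t < T \<Longrightarrow> b t \<noteq> 0"
    and space: "wiener_filtered_space M (time_interval T) F B"
    and X: "sde_solution M F B (time_interval T) (\<lambda>t x. \<alpha> * b t * x) (\<lambda>t x. \<sigma> t) 0 X"
    and S: "\<And>t. t \<in> time_interval T \<Longrightarrow>
              has_ito_process_integral M F B (\<lambda>s \<omega>. \<alpha> * b s * X s \<omega>) (\<lambda>s \<omega>. \<sigma> s) X
                (\<lambda>s \<omega>. b s * X s \<omega> / (\<sigma> s)\<^sup>2) t (S t)"
    and mle: "\<And>t. t0 \<le> t \<Longrightarrow> ereal t < T \<Longrightarrow> is_mle M b \<sigma> X S t (\<alpha>hat t)"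
    and information: "filterlim (fisher_information M b \<sigma> X) at_top (up_to T)"
    and limit: "((\<lambda>t. b t / (\<sigma> t)\<^sup>2 * exp (2 * \<alpha> * (LBINT w:{0..t}. b w))) \<longlongrightarrow> C) (up_to T)"
    and C: "C \<noteq> 0"
    and W: "wiener_process N {0..1} W"
    and J: "has_ito_integral N (augmented_filtration N {0..1} W) W W 1 J"
  shows "tendsto_in_distr
           M (\<lambda>t \<omega>. sqrt (fisher_information M b \<sigma> X t) * (\<alpha>hat t \<omega> - \<alpha>))
           N (\<lambda>\<omega>. sgn C / sqrt 2 * (J \<omega> / (LBINT s:{0..1}. (W s \<omega>)\<^sup>2)))
           (up_to T)"
proof -
  let ?I = "time_interval T"
  have W_M: "wiener_process M ?I B" and F_eq: "F = augmented_filtration M ?I B"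
    and complete: "complete_measure M"
    using space by (auto simp: wiener_filtered_space_def usual_conditions_def)
  interpret prob_space M using W_M by (simp add: wiener_process_def)
  interpret complete_measure M by (rule complete)
  have zero_I: "0 \<in> ?I" using T_pos by (simp add: time_interval_def zero_ereal_def)
  interpret bm: brownian M ?I B
    by unfold_locales (use W_M zero_I time_interval_down in \<open>auto simp: time_interval_def\<close>)
  note sub = time_interval_subset
  have cont0: "continuous_on {0..t} f" if "continuous_on ?I f" "t \<in> ?I" for f :: "real \<Rightarrow> real" and t
    by (rule continuous_on_subset[OF that(1) sub[OF that(2)]])
  define \<beta> where "\<beta> t = integral {0..t} b" for t
  define e where "e t = exp (- \<alpha> * \<beta> t)" for t
  have \<beta>_eq: "(LBINT w:{0..t}. b w) = \<beta> t" if "t \<in> ?I" for t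
    unfolding \<beta>_def by (rule LBINT_continuous_interval[OF cont0[OF b_cont that]])
  have \<beta>_deriv: "(\<beta> has_real_derivative b s) (at s within {0..t})" if "t \<in> ?I" "s \<in> {0..t}" for s t
    unfolding \<beta>_def using cont0[OF b_cont that(1)] that(2) by (rule integral_has_real_derivative)
  have e_deriv: "(e has_real_derivative - (\<alpha> * b s * e s)) (at s within {0..t})" if "t \<in> ?I" "s \<in> {0..t}" for s t
    unfolding e_def using \<beta>_deriv[OF that] by (auto intro!: derivative_eq_intros)
  have "continuous_on ?I \<beta>"
    unfolding continuous_on_eq_continuous_within
  proof
    fix s assume s: "s \<in> ?I"
    obtain t where t: "s < t" "ereal t < T"
      using ereal_dense2[of s T] s by (auto simp: time_interval_def)
    then have tI: "t \<in> ?I" "s \<in> {0..t}" using s by (auto simp: time_interval_def)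
    have "continuous (at s within {0..t}) \<beta>"
      using \<beta>_deriv[OF tI] by (rule DERIV_continuous)
    moreover have "at s within ?I = at s within {0..t}"
    proof (rule at_within_nhd[of s "{..<t}"])
      show "?I \<inter> {..<t} - {s} = {0..t} \<inter> {..<t} - {s}"
        using sub[OF tI(1)] by (auto simp: time_interval_def)
    qed (use t in auto)
    ultimately show "continuous (at s within ?I) \<beta>" by (simp add: continuous_within)
  qed
  note \<beta>_cont = this
  have e_cont: "continuous_on ?I e" unfolding e_def by (intro continuous_intros \<beta>_cont)
  have e_pos: "0 < e t" for t by (simp add: e_def)
  have e_diff: "e d - e a = - integral {a..d} (\<lambda>u. \<alpha> * b u * e u)"
    if "0 \<le> a" "a \<le> d" "d \<le> t" "t \<in> ?I" for a d t
  proof -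
    have "((\<lambda>u. - (\<alpha> * b u * e u)) has_integral e d - e a) {a..d}"
    proof (rule fundamental_theorem_of_calculus[OF that(2)])
      fix u assume "u \<in> {a..d}"
      then have "(e has_real_derivative - (\<alpha> * b u * e u)) (at u within {a..d})"
        using that by (intro DERIV_subset[OF e_deriv[OF that(4)]]) auto
      then show "(e has_vector_derivative - (\<alpha> * b u * e u)) (at u within {a..d})"
        by (simp add: has_real_derivative_iff_has_vector_derivative)
    qed
    from integral_unique[OF this] show ?thesis by simp
  qed
  have X_F: "X t \<in> borel_measurable (bm.F t)" if "t \<in> ?I" for t
    using X that F_eq by (auto simp: sde_solution_def ito_process_def)
  have X_M [measurable]: "X t \<in> borel_measurable M" if "t \<in> ?I" for t
    using X_F[OF that] by (rule bm.measurable_F_M)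
  have X_cont: "continuous_on ?I (\<lambda>t. X t \<omega>)" if "\<omega> \<in> space M" for \<omega>
    using X that by (auto simp: sde_solution_def ito_process_def)
  note X_cont0 = cont0[OF X_cont]
  have X_0: "AE \<omega> in M. X 0 \<omega> = 0" using X by (simp add: sde_solution_def)
  have X_ito: "bm.ito_lim (\<lambda>u _. \<sigma> u) s (\<lambda>\<omega>. X s \<omega> - X 0 \<omega> - integral {0..s} (\<lambda>u. \<alpha> * b u * X u \<omega>))"
    if s: "s \<in> ?I" for s
  proof -
    let ?Y = "\<lambda>\<omega>. X s \<omega> - X 0 \<omega> - (LBINT u:{0..s}. \<alpha> * b u * X u \<omega>)"
    let ?Y' = "\<lambda>\<omega>. X s \<omega> - X 0 \<omega> - integral {0..s} (\<lambda>u. \<alpha> * b u * X u \<omega>)"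
    have "has_ito_integral M bm.F B (\<lambda>u _. \<sigma> u) s ?Y"
      using X s F_eq by (auto simp: sde_solution_def ito_process_def)
    then have 1: "bm.ito_lim (\<lambda>u _. \<sigma> u) s ?Y" using s by (rule bm.has_ito_integral_imp_ito_lim)
    have eq: "?Y \<omega> = ?Y' \<omega>" if "\<omega> \<in> space M" for \<omega>
      using cont0[OF b_cont s] X_cont0[OF that s]
      by (subst LBINT_continuous_interval) (auto intro!: continuous_intros)
    have "?Y' \<in> borel_measurable M"
      using bm.ito_lim_measurable[OF 1] measurable_cong[of M ?Y ?Y' borel] eq by simp
    then show ?thesis
      by (rule bm.ito_lim_cong'[OF 1, rotated]) (auto simp: eq intro: AE_I2)
  qed
  define g where "g u = \<sigma> u * e u" for u
  define Z where "Z s \<omega> = e s * X s \<omega>" for s \<omega>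
  have g_cont: "continuous_on ?I g" unfolding g_def by (intro continuous_intros \<sigma>_cont e_cont)
  have Z_ito: "bm.ito_lim (\<lambda>u _. g u) s (Z s)" if s: "s \<in> ?I" for s
  proof (cases "s = 0")
    case True
    have z: "bm.ito_lim (\<lambda>u _. \<sigma> u) 0 (\<lambda>\<omega>. X 0 \<omega> - X 0 \<omega> - integral {0..0} (\<lambda>u. \<alpha> * b u * X u \<omega>))"
      using X_ito[OF zero_I] .
    show ?thesis
      unfolding True
    proof (rule bm.ito_lim_cong[OF z])
      show "bm.jointly_measurable 0 (\<lambda>u _. g u)"
        by (intro bm.jointly_measurable_continuous) auto
      show "Z 0 \<in> borel_measurable M" unfolding Z_def using X_M[OF zero_I] by measurable
      show "AE \<omega> in M. X 0 \<omega> - X 0 \<omega> - integral {0..0} (\<lambda>u. \<alpha> * b u * X u \<omega>) = Z 0 \<omega>"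
        using X_0 by eventually_elim (simp add: Z_def)
    qed (rule energy_at_0)
  next
    case False
    then have s0: "0 < s" using s by (simp add: time_interval_def)
    have "bm.ito_lim (\<lambda>u _. \<sigma> u * e u) s (\<lambda>\<omega>. e s * X s \<omega>)"
    proof (rule bm.ornstein_uhlenbeck_wiener_integral[where k = "\<lambda>u. \<alpha> * b u"])
      show "continuous_on {0..s} (\<lambda>u. \<alpha> * b u)" by (intro continuous_intros cont0[OF b_cont s])
      show "\<And>a d. 0 \<le> a \<Longrightarrow> a \<le> d \<Longrightarrow> d \<le> s \<Longrightarrow> e d - e a = - integral {a..d} (\<lambda>u. \<alpha> * b u * e u)"
        using e_diff[OF _ _ _ s] .
    qed (use s s0 sub[OF s] cont0[OF \<sigma>_cont s] cont0[OF e_cont s] X_cont0[OF _ s] X_0 X_ito X_M in auto)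
    then show ?thesis by (simp add: g_def[abs_def] Z_def[abs_def])
  qed
  interpret gm: gaussian_martingale M ?I B g Z
  proof unfold_locales
    show "Z s \<in> borel_measurable (bm.F s)" if "s \<in> ?I" for s
      unfolding Z_def using X_F[OF that] by measurable
    show "continuous_on ?I (\<lambda>s. Z s \<omega>)" if "\<omega> \<in> space M" for \<omega>
      unfolding Z_def by (intro continuous_intros e_cont X_cont that)
  qed (use g_cont Z_ito \<sigma>_pos e_pos in \<open>auto simp: g_def\<close>)
  define v where "v = gm.v"
  have v_eq: "v = (\<lambda>s. integral {0..s} (\<lambda>u. (g u)\<^sup>2))" by (simp add: v_def gm.v_def fun_eq_iff)
  define c where "c s = b s / (\<sigma> s)\<^sup>2 * exp (2 * \<alpha> * \<beta> s)" for s
  \<comment> \<open>in this form, \<open>c g Z = b X / \<sigma>\<close> and \<open>c\<^sup>2 g\<^sup>2 Z\<^sup>2 = b\<^sup>2 X\<^sup>2 / \<sigma>\<^sup>2\<close> become visible\<close>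
  have c_e: "c s = b s / ((\<sigma> s)\<^sup>2 * (e s)\<^sup>2)" for s
    unfolding c_def e_def by (simp add: exp_double[symmetric] exp_minus field_simps)
  have c_cont: "continuous_on ?I c"
    unfolding c_def using \<sigma>_pos by (intro continuous_intros b_cont \<sigma>_cont \<beta>_cont) (auto simp: less_imp_neq[symmetric])
  have c_lim: "(c \<longlongrightarrow> C) (up_to T)"
  proof (rule Lim_transform_eventually[OF limit])
    show "\<forall>\<^sub>F t in up_to T. b t / (\<sigma> t)\<^sup>2 * exp (2 * \<alpha> * (LBINT w:{0..t}. b w)) = c t"
      using eventually_up_to_gt[OF zero_I T_pos] by eventually_elim (simp add: c_def \<beta>_eq)
  qed
  have info: "fisher_information M b \<sigma> X t = integral {0..t} (\<lambda>s. (c s)\<^sup>2 * v s * (g s)\<^sup>2)" if t: "t \<in> ?I" for t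
  proof -
    have "fisher_information M b \<sigma> X t = (LBINT s:{0..t}. (c s)\<^sup>2 * v s * (g s)\<^sup>2)"
      unfolding fisher_information_def
    proof (rule set_lebesgue_integral_cong)
      show "\<forall>s. s \<in> {0..t} \<longrightarrow> (b s)\<^sup>2 * (\<integral>\<omega>. (X s \<omega>)\<^sup>2 \<partial>M) / (\<sigma> s)\<^sup>2 = (c s)\<^sup>2 * v s * (g s)\<^sup>2"
      proof (intro allI impI)
        fix s assume "s \<in> {0..t}"
        then have s: "s \<in> ?I" using sub[OF t] by auto
        have "v s = (\<integral>\<omega>. (e s)\<^sup>2 * (X s \<omega>)\<^sup>2 \<partial>M)"
          using gm.Z_second_moment(2)[OF s] by (simp add: Z_def v_def power_mult_distrib)
        also have "\<dots> = (e s)\<^sup>2 * (\<integral>\<omega>. (X s \<omega>)\<^sup>2 \<partial>M)" by simp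
        finally show "(b s)\<^sup>2 * (\<integral>\<omega>. (X s \<omega>)\<^sup>2 \<partial>M) / (\<sigma> s)\<^sup>2 = (c s)\<^sup>2 * v s * (g s)\<^sup>2"
          using e_pos[of s] \<sigma>_pos[OF s] by (simp add: c_e g_def field_simps power2_eq_square)
      qed
    qed simp
    also have "\<dots> = integral {0..t} (\<lambda>s. (c s)\<^sup>2 * v s * (g s)\<^sup>2)"
      unfolding v_def using cont0[OF c_cont t] cont0[OF g_cont t] gm.v_cont[OF t]
      by (intro LBINT_continuous_interval continuous_intros)
    finally show ?thesis .
  qed
  have v_mono: "v s \<le> v t" if "t \<in> ?I" "s \<in> {0..t}" for s t
    unfolding v_eq using that cont0[OF g_cont that(1)] continuous_on_subset[OF cont0[OF g_cont that(1)], of "{0..s}"]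
    by (intro integral_subset_le integrable_continuous_real continuous_intros) auto
  have v_pos: "0 < v t" if "t \<in> ?I" "0 < t" for t using gm.v_pos[OF that] by (simp add: v_def)
  have v_nonneg: "0 \<le> v t" if "t \<in> ?I" for t using gm.v_nonneg[OF that] by (simp add: v_def)
  have v_cont: "continuous_on {0..t} v" if "t \<in> ?I" for t using gm.v_cont[OF that] by (simp add: v_def)
  obtain K where K: "0 < K" "\<And>t. t \<in> ?I \<Longrightarrow> (c t)\<^sup>2 \<le> K"
  proof -
    have "\<forall>\<^sub>F t in up_to T. dist (c t) C < 1" using c_lim by (rule tendstoD) simp
    then obtain s where s: "s \<in> ?I" "\<And>u. s < u \<Longrightarrow> ereal u < T \<Longrightarrow> dist (c u) C < 1"
      unfolding eventually_up_to[OF T_pos] by blast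
    obtain K1 where K1: "1 \<le> K1" "\<And>u. u \<in> {0..s} \<Longrightarrow> \<bar>c u\<bar> \<le> K1"
      by (rule bm.continuous_bounded[OF cont0[OF c_cont s(1)]]) blast
    have "\<bar>c t\<bar> \<le> K1 + \<bar>C\<bar> + 1" if t: "t \<in> ?I" for t
    proof (cases "t \<le> s")
      case True
      then show ?thesis using K1(2)[of t] t by (simp add: time_interval_def)
    next
      case False
      then show ?thesis using s(2)[of t] t K1(1) by (simp add: time_interval_def dist_real_def)
    qed
    then have "(c t)\<^sup>2 \<le> (K1 + \<bar>C\<bar> + 1)\<^sup>2" if "t \<in> ?I" for t
      using that by (metis abs_ge_zero power2_abs power_mono)
    moreover have "0 < (K1 + \<bar>C\<bar> + 1)\<^sup>2" using K1(1) by simp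
    ultimately show ?thesis using that by blast
  qed
  have info_le: "fisher_information M b \<sigma> X t \<le> K * (v t)\<^sup>2" if t: "t \<in> ?I" for t
  proof -
    have "fisher_information M b \<sigma> X t \<le> integral {0..t} (\<lambda>s. (K * v t) * (g s)\<^sup>2)"
      unfolding info[OF t]
    proof (rule integral_le)
      fix s assume s: "s \<in> {0..t}"
      then have sI: "s \<in> ?I" using sub[OF t] by auto
      show "(c s)\<^sup>2 * v s * (g s)\<^sup>2 \<le> K * v t * (g s)\<^sup>2"
        using K(1) K(2)[OF sI] v_mono[OF t s] v_nonneg[OF sI] by (intro mult_right_mono mult_mono) auto
    qed (use cont0[OF c_cont t] cont0[OF g_cont t] v_cont[OF t] in
        \<open>auto intro!: integrable_continuous_real continuous_intros\<close>)
    also have "\<dots> = K * (v t)\<^sup>2" by (simp add: v_eq power2_eq_square)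
    finally show ?thesis .
  qed
  have v_top: "filterlim v at_top (up_to T)"
  proof (rule filterlim_at_top_mono)
    have "filterlim (\<lambda>t. (1 / K) * fisher_information M b \<sigma> X t) at_top (up_to T)"
      by (rule filterlim_tendsto_pos_mult_at_top[OF tendsto_const _ information]) (use K in simp)
    then show "filterlim (\<lambda>t. sqrt ((1 / K) * fisher_information M b \<sigma> X t)) at_top (up_to T)"
      by (rule filterlim_compose[OF sqrt_at_top])
    show "\<forall>\<^sub>F t in up_to T. sqrt ((1 / K) * fisher_information M b \<sigma> X t) \<le> v t"
      using eventually_up_to_gt[OF zero_I T_pos]
    proof eventually_elim
      case (elim t)
      have "(1 / K) * fisher_information M b \<sigma> X t \<le> (v t)\<^sup>2"
        using info_le[of t] elim K(1) by (simp add: pos_divide_le_eq mult.commute)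
      then show ?case using v_nonneg[of t] elim by (intro real_le_lsqrt) auto
    qed
  qed
  have avg: "((\<lambda>t. integral {0..t} (\<lambda>s. q s * v s * (g s)\<^sup>2) / (v t)\<^sup>2) \<longlongrightarrow> L / 2) (up_to T)"
    if "continuous_on ?I q" "(q \<longlongrightarrow> L) (up_to T)" for q L
    unfolding v_eq
    by (rule weighted_average_tendsto[OF T_pos _ _ that v_top[unfolded v_eq]])
       (use g_cont in \<open>auto intro!: continuous_intros\<close>)
  define \<rho> where "\<rho> t = sqrt (fisher_information M b \<sigma> X t) / v t" for t
  define \<rho>0 where "\<rho>0 = \<bar>C\<bar> / sqrt 2"
  have \<rho>_lim: "(\<rho> \<longlongrightarrow> \<rho>0) (up_to T)"
  proof -
    have "((\<lambda>t. (c t)\<^sup>2) \<longlongrightarrow> C\<^sup>2) (up_to T)" using c_lim by (intro tendsto_intros)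
    moreover have "continuous_on ?I (\<lambda>t. (c t)\<^sup>2)" using c_cont by (intro continuous_intros)
    ultimately have "((\<lambda>t. sqrt (integral {0..t} (\<lambda>s. (c s)\<^sup>2 * v s * (g s)\<^sup>2) / (v t)\<^sup>2)) \<longlongrightarrow> sqrt (C\<^sup>2 / 2)) (up_to T)"
      by (intro tendsto_real_sqrt avg)
    moreover have "sqrt (C\<^sup>2 / 2) = \<rho>0" by (simp add: \<rho>0_def real_sqrt_divide)
    moreover have "\<forall>\<^sub>F t in up_to T. sqrt (integral {0..t} (\<lambda>s. (c s)\<^sup>2 * v s * (g s)\<^sup>2) / (v t)\<^sup>2) = \<rho> t"
      using eventually_up_to_gt[OF zero_I T_pos]
    proof eventually_elim
      case (elim t)
      then show ?case using info[of t] v_nonneg[of t] by (simp add: \<rho>_def real_sqrt_divide)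
    qed
    ultimately show ?thesis using Lim_transform_eventually by fastforce
  qed
  have \<rho>_nonneg: "0 \<le> \<rho> t" if t: "t \<in> ?I" for t
  proof -
    have "0 \<le> fisher_information M b \<sigma> X t"
      unfolding info[OF t]
      using cont0[OF c_cont t] cont0[OF g_cont t] v_cont[OF t] v_nonneg sub[OF t]
      by (intro integral_nonneg integrable_continuous_real continuous_intros) auto
    then show ?thesis using v_nonneg[OF t] by (simp add: \<rho>_def)
  qed
  define A where "A t \<omega> = integral {0..t} (\<lambda>s. (c s)\<^sup>2 * (g s * Z s \<omega>)\<^sup>2)" for t \<omega>
  define Nm where "Nm t \<omega> = S t \<omega> - \<alpha> * A t \<omega>" for t \<omega>
  have cgZ: "b s * X s \<omega> / (\<sigma> s)\<^sup>2 * \<sigma> s = c s * (g s * Z s \<omega>)" if "s \<in> ?I" for s \<omega>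
    using e_pos[of s] \<sigma>_pos[OF that] by (simp add: c_e g_def Z_def field_simps power2_eq_square)
  have Z_cont0: "continuous_on {0..t} (\<lambda>s. Z s \<omega>)" if "t \<in> ?I" "\<omega> \<in> space M" for t \<omega>
    by (rule gm.Z_cont'[OF that])
  have cgZ_cont: "continuous_on {0..t} (\<lambda>s. (c s)\<^sup>2 * (g s * Z s \<omega>)\<^sup>2)" if "t \<in> ?I" "\<omega> \<in> space M" for t \<omega>
    using cont0[OF c_cont that(1)] cont0[OF g_cont that(1)] Z_cont0[OF that] by (intro continuous_intros)
  have A_eq: "(LBINT s:{0..t}. (b s)\<^sup>2 * (X s \<omega>)\<^sup>2 / (\<sigma> s)\<^sup>2) = A t \<omega>"
    "(LBINT s:{0..t}. b s * X s \<omega> / (\<sigma> s)\<^sup>2 * (\<alpha> * b s * X s \<omega>)) = \<alpha> * A t \<omega>"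
    if t: "t \<in> ?I" and \<omega>: "\<omega> \<in> space M" for t \<omega>
  proof -
    have *: "(c s)\<^sup>2 * (g s * Z s \<omega>)\<^sup>2 = (b s)\<^sup>2 * (X s \<omega>)\<^sup>2 / (\<sigma> s)\<^sup>2" if "s \<in> {0..t}" for s
    proof -
      have s: "s \<in> ?I" using sub[OF t] that by auto
      show ?thesis using e_pos[of s] \<sigma>_pos[OF s] by (simp add: c_e g_def Z_def field_simps power2_eq_square)
    qed
    have "(LBINT s:{0..t}. (b s)\<^sup>2 * (X s \<omega>)\<^sup>2 / (\<sigma> s)\<^sup>2) = (LBINT s:{0..t}. (c s)\<^sup>2 * (g s * Z s \<omega>)\<^sup>2)"
      by (rule set_lebesgue_integral_cong) (use * in auto)
    also have "\<dots> = A t \<omega>" unfolding A_def by (rule LBINT_continuous_interval[OF cgZ_cont[OF t \<omega>]])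
    finally show 1: "(LBINT s:{0..t}. (b s)\<^sup>2 * (X s \<omega>)\<^sup>2 / (\<sigma> s)\<^sup>2) = A t \<omega>" .
    have "(LBINT s:{0..t}. b s * X s \<omega> / (\<sigma> s)\<^sup>2 * (\<alpha> * b s * X s \<omega>))
        = (LBINT s:{0..t}. \<alpha> * ((b s)\<^sup>2 * (X s \<omega>)\<^sup>2 / (\<sigma> s)\<^sup>2))"
      by (rule set_lebesgue_integral_cong) (auto simp: power2_eq_square)
    also have "\<dots> = \<alpha> * A t \<omega>" unfolding 1[symmetric] by (rule set_integral_mult_right)
    finally show "(LBINT s:{0..t}. b s * X s \<omega> / (\<sigma> s)\<^sup>2 * (\<alpha> * b s * X s \<omega>)) = \<alpha> * A t \<omega>" .
  qed
  have A_meas [measurable]: "A t \<in> borel_measurable M" if "t \<in> ?I" for t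
    unfolding A_def using gm.weighted_square_integral(1)[OF that cont0[OF c_cont that]] .
  have N_ito: "bm.ito_lim (\<lambda>s \<omega>. c s * (g s * Z s \<omega>)) t (Nm t)" if t: "t \<in> ?I" for t
  proof -
    let ?Y = "\<lambda>\<omega>. S t \<omega> - (LBINT s:{0..t}. b s * X s \<omega> / (\<sigma> s)\<^sup>2 * (\<alpha> * b s * X s \<omega>))"
    have "has_ito_integral M bm.F B (\<lambda>s \<omega>. b s * X s \<omega> / (\<sigma> s)\<^sup>2 * \<sigma> s) t ?Y"
      using S[OF t] F_eq by (simp add: has_ito_process_integral_def)
    then have 1: "bm.ito_lim (\<lambda>s \<omega>. b s * X s \<omega> / (\<sigma> s)\<^sup>2 * \<sigma> s) t ?Y"
      using t by (rule bm.has_ito_integral_imp_ito_lim)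
    have eq: "?Y \<omega> = Nm t \<omega>" if "\<omega> \<in> space M" for \<omega>
      using A_eq(2)[OF t that] by (simp add: Nm_def)
    have m: "Nm t \<in> borel_measurable M"
      using bm.ito_lim_measurable[OF 1] measurable_cong[of M ?Y "Nm t" borel] eq by simp
    show ?thesis
    proof (rule bm.ito_lim_cong'[OF 1])
      show "b s * X s \<omega> / (\<sigma> s)\<^sup>2 * \<sigma> s = c s * (g s * Z s \<omega>)" if "0 \<le> s" "s \<le> t" for s \<omega>
        using cgZ[OF time_interval_down[OF t that]] .
      show "AE \<omega> in M. ?Y \<omega> = Nm t \<omega>" by (rule AE_I2) (rule eq)
    qed (rule m)
  qed
  have Nm_meas [measurable]: "Nm t \<in> borel_measurable M" if "t \<in> ?I" for t
    by (rule bm.ito_lim_measurable[OF N_ito[OF that]])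
  have late: "t \<in> ?I \<and> 0 < t" if "t0 \<le> t" "ereal t < T" for t
    using that t0 by (simp add: time_interval_def)
  have A_pos: "AE \<omega> in M. 0 < A t \<omega>" if t: "t0 \<le> t" "ereal t < T" for t
  proof -
    have tI: "t \<in> ?I" "0 < t" using late[OF t] by auto
    have "c t \<noteq> 0" using b_nonzero[OF t] \<sigma>_pos[OF tI(1)] by (simp add: c_def)
    then show ?thesis
      unfolding A_def using gm.weighted_square_integral(2)[OF tI(1) cont0[OF c_cont tI(1)] tI(2)] by simp
  qed
  have \<alpha>hat: "AE \<omega> in M. 0 < A t \<omega> \<and> \<alpha>hat t \<omega> - \<alpha> = Nm t \<omega> / A t \<omega>" if t: "t0 \<le> t" "ereal t < T" for t
    using mle[OF t, unfolded is_mle_def] A_pos[OF t] AE_space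
  proof eventually_elim
    case (elim \<omega>)
    have "t \<in> ?I" using late[OF t] by simp
    then have "is_arg_max (\<lambda>\<theta>. \<theta> * S t \<omega> - \<theta>\<^sup>2 / 2 * A t \<omega>) (\<lambda>_. True) (\<alpha>hat t \<omega>)"
      using elim(1) A_eq(1)[of t \<omega>] elim(3) by (simp add: log_likelihood_def[abs_def])
    from is_arg_max_quadratic[OF elim(2) this] show ?case
      using elim(2) by (simp add: Nm_def field_simps)
  qed
  let ?E = "\<lambda>t \<omega>. sqrt (fisher_information M b \<sigma> X t) * (\<alpha>hat t \<omega> - \<alpha>)"
  \<comment> \<open>the estimator is only determined almost surely, hence completeness of \<open>M\<close> is used\<close>
  have E_meas: "?E t \<in> borel_measurable M" if t: "t0 \<le> t" "ereal t < T" for t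
  proof (rule measurableI)
    fix G :: "real set" assume G: "G \<in> sets borel"
    have tI: "t \<in> ?I" using late[OF t] by simp
    let ?E' = "\<lambda>\<omega>. sqrt (fisher_information M b \<sigma> X t) * (Nm t \<omega> / A t \<omega>)"
    have "?E' \<in> borel_measurable M" using Nm_meas[OF tI] A_meas[OF tI] by measurable
    then have s': "?E' -` G \<inter> space M \<in> sets M" using G by (rule measurable_sets)
    have ae: "AE \<omega> in M. \<omega> \<in> ?E' -` G \<inter> space M \<longleftrightarrow> \<omega> \<in> ?E t -` G \<inter> space M"
      using \<alpha>hat[OF t] by eventually_elim simp
    show "?E t -` G \<inter> space M \<in> sets M" by (rule in_sets_AE[OF ae s']) simp
  qed simp
  let ?Rl = "\<lambda>\<omega>. sgn C / sqrt 2 * (J \<omega> / (LBINT s:{0..1}. (W s \<omega>)\<^sup>2))"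
  have conv: "((\<lambda>t. cdf (distr M borel (?E t)) x) \<longlongrightarrow> cdf (distr N borel ?Rl) x) (up_to T)"
    if x: "isCont (cdf (distr N borel ?Rl)) x" for x
  proof -
    define U where "U t \<omega> = \<rho> t * (Nm t \<omega> / v t) - x * (A t \<omega> / (v t)\<^sup>2)" for t \<omega>
    have U_meas: "U t \<in> borel_measurable M" if t: "t \<in> ?I" for t
      unfolding U_def[abs_def] using Nm_meas[OF t] A_meas[OF t] by measurable
    have "((\<lambda>t. prob {\<omega> \<in> space M. U t \<omega> \<le> 0}) \<longlongrightarrow> cdf (distr N borel ?Rl) x) (up_to T)"
      unfolding U_def A_def v_def wiener_ratio_level(3)[OF W J C, symmetric]
      by (rule gm.normalized_score_tendsto[OF refl T_pos c_cont c_lim v_top[unfolded v_def] \<rho>_nonneg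
            \<rho>_lim[unfolded \<rho>0_def] N_ito W wiener_ratio_level(2)[OF W J C x]])
    then show ?thesis
    proof (rule Lim_transform_eventually)
      have t0_I: "t0 \<in> ?I" using t0 by (simp add: time_interval_def)
      show "\<forall>\<^sub>F t in up_to T. prob {\<omega> \<in> space M. U t \<omega> \<le> 0} = cdf (distr M borel (?E t)) x"
        using eventually_up_to_gt[OF t0_I T_pos]
      proof eventually_elim
        case (elim t)
        then have t: "t0 \<le> t" "ereal t < T" and tI: "t \<in> ?I" by (auto simp: time_interval_def)
        have vt: "0 < v t" using v_pos[OF tI] late[OF t] by simp
        note [measurable] = E_meas[OF t] U_meas[OF tI]
        have "cdf (distr M borel (?E t)) x = prob {\<omega> \<in> space M. ?E t \<omega> \<le> x}"
          unfolding cdf_def by (subst measure_distr) (auto intro!: arg_cong[where f = prob])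
        also have "\<dots> = prob {\<omega> \<in> space M. U t \<omega> \<le> 0}"
        proof (rule measure_eq_AE)
          show "AE \<omega> in M. \<omega> \<in> {\<omega> \<in> space M. ?E t \<omega> \<le> x} \<longleftrightarrow> \<omega> \<in> {\<omega> \<in> space M. U t \<omega> \<le> 0}"
            using \<alpha>hat[OF t]
          proof eventually_elim
            case (elim \<omega>)
            have U_eq: "U t \<omega> = (A t \<omega> / (v t)\<^sup>2) * (?E t \<omega> - x)"
              using elim vt by (simp add: U_def \<rho>_def field_simps power2_eq_square)
            moreover have "0 < A t \<omega> / (v t)\<^sup>2" using elim vt by simp
            ultimately have "U t \<omega> \<le> 0 \<longleftrightarrow> ?E t \<omega> - x \<le> 0"
              by (metis mult_le_0_iff not_less order_less_imp_le)
            then show ?case by simp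
          qed
        qed measurable
        finally show ?case by simp
      qed
    qed
  qed
  show ?thesis
    unfolding tendsto_in_distr_def weak_conv_filter_def
  proof (intro conjI allI impI conv wiener_ratio_level(1)[OF W J C])
    have t0_I: "t0 \<in> ?I" using t0 by (simp add: time_interval_def)
    show "\<forall>\<^sub>F t in up_to T. ?E t \<in> borel_measurable M"
      using eventually_up_to_gt[OF t0_I T_pos]
      by eventually_elim (rule E_meas; simp add: time_interval_def)
  qed
qed

end
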